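(* Let $T$ be a complete first-order theory. Let $M\models T$ and let $M^{Sh}$ be the Shelah expansion of $M$. If $Th(M^{Sh})$ is distal, then $T$ is distal.
   Context: Structures may be many-sorted. Shelah expansion. Let $M$ be an $L$-structure and $M\prec M'$ a sufficiently saturated elementary extension ($|M|+|L|$-saturated in the sense of $(|M|+|L|)^+$-saturation suffices). An externally definable set of $M$ is a set of the form $X\cap M^{\bar x}$, where $\bar x$ is a finite tuple of variables, $M^{\bar x}$ is the corresponding finite cartesian power of sorts of $M$, and $X\subseteq M'^{\bar x}$ is definable in $M'$ with parameters from $M'$ (this does not depend on the choice of $M'$). The Shelah expansion $M^{Sh}$ is the structure with the same underlying set(s) as $M$ whose language $L(M^{Sh})$ has one predicate for each externally definable set of $M$, each predicate being interpreted as that set. Distality. Let $T$ be a complete theory and let $U$ be a sufficiently saturated (saturated and strongly homogeneous up to some large cardinal $\kappa$) model of $T$; small means of cardinality less than $\kappa$. $T$ is distal if it has NIP and, for any small indiscernible sequence in $U$ of the form $I+\{b\}+J$, where $\{b\}$ is a singleton and $I$ and $J$ are infinite without endpoints, and any small $D\subseteq U$, if $I+J$ is indiscernible over $D$ then $I+\{b\}+J$ is indiscernible over $D$. Elements of the sequences may be finite tuples of elements of $U$. Here $+$ denotes concatenation of disjoint ordered sets (everything in the left set placed below everything in the right set). *)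

theory Defs
  imports Main
begin

unbundle cardinal_syntax

section \<open>Many-sorted first-order logic\<close>

text \<open>
  The sorts of a language are all elements of the type \<open>'s\<close>; its function and relation symbols
  are those elements of \<open>'f\<close> and \<open>'p\<close> that are given an arity. Constants are function symbols
  with an empty list of argument sorts. A variable is a pair of a sort and an index.
\<close>

record ('s, 'f, 'p) lang =
  fun_ar :: "'f \<Rightarrow> ('s list \<times> 's) option"
  rel_ar :: "'p \<Rightarrow> 's list option"

type_synonym 's var = "'s \<times> nat"

datatype ('s, 'f) tm = Var "'s var" | Fn 'f "('s, 'f) tm list"

datatype ('s, 'f, 'p) fm =
    Eq "('s, 'f) tm" "('s, 'f) tm"
  | Rel 'p "('s, 'f) tm list"
  | Neg "('s, 'f, 'p) fm"
  | And "('s, 'f, 'p) fm" "('s, 'f, 'p) fm"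
  | Ex "'s var" "('s, 'f, 'p) fm"

inductive has_sort :: "('s, 'f, 'p) lang \<Rightarrow> ('s, 'f) tm \<Rightarrow> 's \<Rightarrow> bool" for L where
  "has_sort L (Var v) (fst v)"
| "fun_ar L f = Some (\<sigma>, s) \<Longrightarrow> list_all2 (has_sort L) ts \<sigma> \<Longrightarrow> has_sort L (Fn f ts) s"

primrec wf_fm :: "('s, 'f, 'p) lang \<Rightarrow> ('s, 'f, 'p) fm \<Rightarrow> bool" where
  "wf_fm L (Eq t u) \<longleftrightarrow> (\<exists>s. has_sort L t s \<and> has_sort L u s)"
| "wf_fm L (Rel p ts) \<longleftrightarrow> (\<exists>\<sigma>. rel_ar L p = Some \<sigma> \<and> list_all2 (has_sort L) ts \<sigma>)"
| "wf_fm L (Neg \<phi>) \<longleftrightarrow> wf_fm L \<phi>"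
| "wf_fm L (And \<phi> \<psi>) \<longleftrightarrow> wf_fm L \<phi> \<and> wf_fm L \<psi>"
| "wf_fm L (Ex v \<phi>) \<longleftrightarrow> wf_fm L \<phi>"

primrec fv_tm :: "('s, 'f) tm \<Rightarrow> 's var set" where
  "fv_tm (Var v) = {v}"
| "fv_tm (Fn f ts) = \<Union> (set (map fv_tm ts))"

primrec fv :: "('s, 'f, 'p) fm \<Rightarrow> 's var set" where
  "fv (Eq t u) = fv_tm t \<union> fv_tm u"
| "fv (Rel p ts) = \<Union> (set (map fv_tm ts))"
| "fv (Neg \<phi>) = fv \<phi>"
| "fv (And \<phi> \<psi>) = fv \<phi> \<union> fv \<psi>"
| "fv (Ex v \<phi>) = fv \<phi> - {v}"

definition formulas :: "('s, 'f, 'p) lang \<Rightarrow> ('s, 'f, 'p) fm set" where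
  "formulas L = {\<phi>. wf_fm L \<phi>}"

definition sentences :: "('s, 'f, 'p) lang \<Rightarrow> ('s, 'f, 'p) fm set" where
  "sentences L = {\<phi> \<in> formulas L. fv \<phi> = {}}"

text \<open>
  A structure has a universe in which every element carries its sort, so distinct sorts have
  disjoint domains. Only the values of \<open>fun_int\<close> and \<open>rel_int\<close> at well-sorted tuples matter.
\<close>

record ('s, 'f, 'p, 'a) struc =
  univ :: "'a set"
  srt :: "'a \<Rightarrow> 's"
  fun_int :: "'f \<Rightarrow> 'a list \<Rightarrow> 'a"
  rel_int :: "'p \<Rightarrow> 'a list set"

definition dom_of :: "('s, 'f, 'p, 'a) struc \<Rightarrow> 's \<Rightarrow> 'a set" where
  "dom_of M s = {a \<in> univ M. srt M a = s}"

definition tuples :: "('s, 'f, 'p, 'a) struc \<Rightarrow> 's list \<Rightarrow> 'a list set" where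
  "tuples M \<sigma> = {as. list_all2 (\<lambda>a s. a \<in> dom_of M s) as \<sigma>}"

definition is_struc :: "('s, 'f, 'p) lang \<Rightarrow> ('s, 'f, 'p, 'a) struc \<Rightarrow> bool" where
  "is_struc L M \<longleftrightarrow>
     (\<forall>s. dom_of M s \<noteq> {}) \<and>
     (\<forall>f \<sigma> s. fun_ar L f = Some (\<sigma>, s) \<longrightarrow> (\<forall>as \<in> tuples M \<sigma>. fun_int M f as \<in> dom_of M s))"

primrec eval :: "('s, 'f, 'p, 'a) struc \<Rightarrow> ('s var \<Rightarrow> 'a) \<Rightarrow> ('s, 'f) tm \<Rightarrow> 'a" where
  "eval M e (Var v) = e v"
| "eval M e (Fn f ts) = fun_int M f (map (eval M e) ts)"

primrec sat :: "('s, 'f, 'p, 'a) struc \<Rightarrow> ('s var \<Rightarrow> 'a) \<Rightarrow> ('s, 'f, 'p) fm \<Rightarrow> bool" where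
  "sat M e (Eq t u) \<longleftrightarrow> eval M e t = eval M e u"
| "sat M e (Rel p ts) \<longleftrightarrow> map (eval M e) ts \<in> rel_int M p"
| "sat M e (Neg \<phi>) \<longleftrightarrow> \<not> sat M e \<phi>"
| "sat M e (And \<phi> \<psi>) \<longleftrightarrow> sat M e \<phi> \<and> sat M e \<psi>"
| "sat M e (Ex v \<phi>) \<longleftrightarrow> (\<exists>a \<in> dom_of M (fst v). sat M (e(v := a)) \<phi>)"

text \<open>
  A formula with parameters from \<open>A\<close> is represented by a formula \<open>\<phi>\<close> together with an assignment
  \<open>e\<close> giving (well-sorted) values in \<open>A\<close> to those free variables of \<open>\<phi>\<close>
  that are not among the variables of interest; \<open>params\<close> says that \<open>e\<close> does so on \<open>V\<close>.
  Values of \<open>e\<close> elsewhere are irrelevant.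
\<close>

definition params :: "('s, 'f, 'p, 'a) struc \<Rightarrow> 'a set \<Rightarrow> 's var set \<Rightarrow> ('s var \<Rightarrow> 'a) \<Rightarrow> bool" where
  "params M A V e \<longleftrightarrow> (\<forall>v \<in> V. e v \<in> A \<inter> dom_of M (fst v))"

definition assign :: "('s var \<Rightarrow> 'a) \<Rightarrow> 's var list \<Rightarrow> 'a list \<Rightarrow> 's var \<Rightarrow> 'a" where
  "assign e xs as v = (case map_of (zip xs as) v of None \<Rightarrow> e v | Some a \<Rightarrow> a)"

definition models :: "('s, 'f, 'p) lang \<Rightarrow> ('s, 'f, 'p, 'a) struc \<Rightarrow> ('s, 'f, 'p) fm set \<Rightarrow> bool" where
  "models L M T \<longleftrightarrow> is_struc L M \<and> (\<forall>\<phi> \<in> T. \<forall>e. sat M e \<phi>)"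

text \<open>
  Theories are taken to be deductively closed. A set \<open>T\<close> of sentences having a model is a complete
  theory iff it contains exactly one of \<open>\<phi>\<close> and \<open>\<not>\<phi>\<close> for every sentence \<open>\<phi>\<close>.
  (Consistency of \<open>T\<close> is not part of this definition.)
\<close>

definition complete_theory :: "('s, 'f, 'p) lang \<Rightarrow> ('s, 'f, 'p) fm set \<Rightarrow> bool" where
  "complete_theory L T \<longleftrightarrow> T \<subseteq> sentences L \<and> (\<forall>\<phi> \<in> sentences L. Neg \<phi> \<in> T \<longleftrightarrow> \<phi> \<notin> T)"

definition Th :: "('s, 'f, 'p) lang \<Rightarrow> ('s, 'f, 'p, 'a) struc \<Rightarrow> ('s, 'f, 'p) fm set" where
  "Th L M = {\<phi> \<in> sentences L. \<forall>e. sat M e \<phi>}"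

definition elem_sub ::
    "('s, 'f, 'p) lang \<Rightarrow> ('s, 'f, 'p, 'a) struc \<Rightarrow> ('s, 'f, 'p, 'a) struc \<Rightarrow> bool" where
  "elem_sub L M N \<longleftrightarrow>
     is_struc L M \<and> is_struc L N \<and> univ M \<subseteq> univ N \<and> (\<forall>a \<in> univ M. srt N a = srt M a) \<and>
     (\<forall>\<phi> \<in> formulas L. \<forall>e. params M (univ M) (fv \<phi>) e \<longrightarrow> (sat M e \<phi> \<longleftrightarrow> sat N e \<phi>))"


section \<open>Saturation and homogeneity\<close>

text \<open>
  Cardinals are initial well-orders as in the HOL cardinals library. The cardinality \<open>|L|\<close> of a
  language is, as usual, that of its set of formulas (the number of sorts and symbols, or
  \<open>\<aleph>\<^sub>0\<close> if that is larger).
\<close>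

definition saturated ::
    "('s, 'f, 'p) lang \<Rightarrow> 'k rel \<Rightarrow> ('s, 'f, 'p, 'a) struc \<Rightarrow> bool" where
  "saturated L \<kappa> M \<longleftrightarrow>
     (\<forall>A p x.
        A \<subseteq> univ M \<and> |A| <o \<kappa> \<and>
        (\<forall>(\<phi>, e) \<in> p. \<phi> \<in> formulas L \<and> params M A (fv \<phi> - {x}) e) \<and>
        (\<forall>q \<subseteq> p. finite q \<longrightarrow> (\<exists>a \<in> dom_of M (fst x). \<forall>(\<phi>, e) \<in> q. sat M (e(x := a)) \<phi>))
        \<longrightarrow> (\<exists>a \<in> dom_of M (fst x). \<forall>(\<phi>, e) \<in> p. sat M (e(x := a)) \<phi>))"

definition partial_elementary ::
    "('s, 'f, 'p) lang \<Rightarrow> ('s, 'f, 'p, 'a) struc \<Rightarrow> 'a set \<Rightarrow> ('a \<Rightarrow> 'a) \<Rightarrow> bool" where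
  "partial_elementary L M A h \<longleftrightarrow>
     (\<forall>a \<in> A. h a \<in> dom_of M (srt M a)) \<and>
     (\<forall>\<phi> \<in> formulas L. \<forall>e. params M A (fv \<phi>) e \<longrightarrow> (sat M e \<phi> \<longleftrightarrow> sat M (h \<circ> e) \<phi>))"

definition automorphism ::
    "('s, 'f, 'p) lang \<Rightarrow> ('s, 'f, 'p, 'a) struc \<Rightarrow> ('a \<Rightarrow> 'a) \<Rightarrow> bool" where
  "automorphism L M g \<longleftrightarrow>
     bij_betw g (univ M) (univ M) \<and>
     (\<forall>a \<in> univ M. srt M (g a) = srt M a) \<and>
     (\<forall>f \<sigma> s. fun_ar L f = Some (\<sigma>, s) \<longrightarrow>
        (\<forall>as \<in> tuples M \<sigma>. g (fun_int M f as) = fun_int M f (map g as))) \<and>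
     (\<forall>p \<sigma>. rel_ar L p = Some \<sigma> \<longrightarrow>
        (\<forall>as \<in> tuples M \<sigma>. as \<in> rel_int M p \<longleftrightarrow> map g as \<in> rel_int M p))"

definition strongly_homogeneous ::
    "('s, 'f, 'p) lang \<Rightarrow> 'k rel \<Rightarrow> ('s, 'f, 'p, 'a) struc \<Rightarrow> bool" where
  "strongly_homogeneous L \<kappa> M \<longleftrightarrow>
     (\<forall>A h. A \<subseteq> univ M \<and> |A| <o \<kappa> \<and> partial_elementary L M A h \<longrightarrow>
        (\<exists>g. automorphism L M g \<and> (\<forall>a \<in> A. g a = h a)))"

text \<open>
  The only largeness required of the cardinal \<open>\<kappa>\<close> is \<open>\<kappa> > |L|\<close>; in particular it is uncountable.
\<close>

definition monster ::
    "('s, 'f, 'p) lang \<Rightarrow> ('s, 'f, 'p) fm set \<Rightarrow> 'k rel \<Rightarrow> ('s, 'f, 'p, 'u) struc \<Rightarrow> bool" where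
  "monster L T \<kappa> U \<longleftrightarrow>
     Card_order \<kappa> \<and> |formulas L| <o \<kappa> \<and>
     models L U T \<and> saturated L \<kappa> U \<and> strongly_homogeneous L \<kappa> U"


section \<open>The Shelah expansion\<close>

definition definable ::
    "('s, 'f, 'p) lang \<Rightarrow> ('s, 'f, 'p, 'a) struc \<Rightarrow> 's list \<Rightarrow> 'a list set \<Rightarrow> bool" where
  "definable L M \<sigma> X \<longleftrightarrow>
     (\<exists>\<phi> \<in> formulas L. \<exists>xs e.
        distinct xs \<and> map fst xs = \<sigma> \<and> params M (univ M) (fv \<phi> - set xs) e \<and>
        X = {as \<in> tuples M \<sigma>. sat M (assign e xs as) \<phi>})"

definition ext_definable ::
    "('s, 'f, 'p) lang \<Rightarrow> ('s, 'f, 'p, 'a) struc \<Rightarrow> ('s, 'f, 'p, 'a) struc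
      \<Rightarrow> 's list \<Rightarrow> 'a list set \<Rightarrow> bool" where
  "ext_definable L M M' \<sigma> Y \<longleftrightarrow> (\<exists>X. definable L M' \<sigma> X \<and> Y = X \<inter> tuples M \<sigma>)"

text \<open>
  The predicate symbols of \<open>L(M\<^sup>S\<^sup>h)\<close> are the externally definable sets themselves, tagged with
  their sorts (so that the empty set gives one predicate for each finite tuple of sorts). There are no
  function symbols; the type \<open>unit\<close> is a mere placeholder.
\<close>

definition shelah_lang ::
    "('s, 'f, 'p) lang \<Rightarrow> ('s, 'f, 'p, 'a) struc \<Rightarrow> ('s, 'f, 'p, 'a) struc
      \<Rightarrow> ('s, unit, 's list \<times> 'a list set) lang" where
  "shelah_lang L M M' =
     \<lparr>fun_ar = (\<lambda>_. None),
      rel_ar = (\<lambda>(\<sigma>, Y). if ext_definable L M M' \<sigma> Y then Some \<sigma> else None)\<rparr>"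

definition shelah_expansion ::
    "('s, 'f, 'p, 'a) struc \<Rightarrow> ('s, unit, 's list \<times> 'a list set, 'a) struc" where
  "shelah_expansion M =
     \<lparr>univ = univ M, srt = srt M, fun_int = (\<lambda>_ _. undefined), rel_int = (\<lambda>(\<sigma>, Y). Y)\<rparr>"


section \<open>NIP and distality\<close>

text \<open>
  \<open>T\<close> has NIP if for no formula \<open>\<phi>(x; y)\<close> is there an infinite set \<open>A\<close> of \<open>x\<close>-tuples of the monster
  model all of whose subsets \<open>S\<close> are cut out of \<open>A\<close> by some \<open>\<phi>(x; b\<^sub>S)\<close>.
\<close>

definition NIP :: "('s, 'f, 'p) lang \<Rightarrow> ('s, 'f, 'p, 'u) struc \<Rightarrow> bool" where
  "NIP L U \<longleftrightarrow>
     \<not> (\<exists>\<phi> \<in> formulas L. \<exists>xs ys A.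
          distinct (xs @ ys) \<and> fv \<phi> \<subseteq> set (xs @ ys) \<and>
          infinite A \<and> A \<subseteq> tuples U (map fst xs) \<and>
          (\<forall>S \<subseteq> A. \<exists>b \<in> tuples U (map fst ys).
             \<forall>a \<in> A. sat U (assign undefined (xs @ ys) (a @ b)) \<phi> \<longleftrightarrow> a \<in> S))"

definition increasing :: "'k rel \<Rightarrow> 'k list \<Rightarrow> bool" where
  "increasing r is \<longleftrightarrow> sorted_wrt (\<lambda>i j. (i, j) \<in> r \<and> i \<noteq> j) is"

text \<open>
  Indiscernibility over \<open>D\<close> of the sequence \<open>(a i)\<^sub>i\<^sub>\<in>\<^sub>K\<close> of tuples of sorts \<open>\<sigma>\<close>, where \<open>K\<close> is linearly
  ordered by (the restriction to \<open>K\<close> of) the reflexive relation \<open>r\<close>.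
\<close>

definition indiscernible ::
    "('s, 'f, 'p) lang \<Rightarrow> ('s, 'f, 'p, 'u) struc \<Rightarrow> 'u set
      \<Rightarrow> 's list \<Rightarrow> 'k rel \<Rightarrow> 'k set \<Rightarrow> ('k \<Rightarrow> 'u list) \<Rightarrow> bool" where
  "indiscernible L U D \<sigma> r K a \<longleftrightarrow>
     (\<forall>i \<in> K. a i \<in> tuples U \<sigma>) \<and>
     (\<forall>\<phi> \<in> formulas L. \<forall>n xs e is js.
        distinct xs \<and> map fst xs = concat (replicate n \<sigma>) \<and>
        params U D (fv \<phi> - set xs) e \<and>
        set is \<subseteq> K \<and> increasing r is \<and> length is = n \<and>
        set js \<subseteq> K \<and> increasing r js \<and> length js = n
        \<longrightarrow> (sat U (assign e xs (concat (map a is))) \<phi> \<longleftrightarrow>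
             sat U (assign e xs (concat (map a js))) \<phi>))"

definition without_endpoints :: "'k rel \<Rightarrow> 'k set \<Rightarrow> bool" where
  "without_endpoints r I \<longleftrightarrow>
     (\<forall>i \<in> I. (\<exists>j \<in> I. j \<noteq> i \<and> (j, i) \<in> r) \<and> (\<exists>j \<in> I. j \<noteq> i \<and> (i, j) \<in> r))"

text \<open>
  \<open>T\<close> is distal, as seen in its monster model \<open>U\<close>. The sequence \<open>I + {b} + J\<close> is indexed by
  the order \<open>r\<close> on \<open>I \<union> {c} \<union> J\<close>, with \<open>b = a c\<close>. Taking the indices from the type \<open>'k\<close> underlying
  \<open>\<kappa>\<close> is no restriction: every linear order of cardinality less than \<open>\<kappa>\<close> has an isomorphic copy
  on a subset of \<open>'k\<close>.
\<close>

definition distal ::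
    "('s, 'f, 'p) lang \<Rightarrow> ('s, 'f, 'p) fm set \<Rightarrow> 'k rel \<Rightarrow> ('s, 'f, 'p, 'u) struc \<Rightarrow> bool" where
  "distal L T \<kappa> U \<longleftrightarrow>
     monster L T \<kappa> U \<and> NIP L U \<and>
     (\<forall>(I :: 'k set) c J r \<sigma> a D.
        c \<notin> I \<union> J \<and> I \<inter> J = {} \<and> |I \<union> {c} \<union> J| <o \<kappa> \<and>
        linear_order_on (I \<union> {c} \<union> J) r \<and>
        (\<forall>i \<in> I. (i, c) \<in> r) \<and> (\<forall>j \<in> J. (c, j) \<in> r) \<and>
        infinite I \<and> infinite J \<and> without_endpoints r I \<and> without_endpoints r J \<and>
        D \<subseteq> univ U \<and> |D| <o \<kappa> \<and>
        indiscernible L U {} \<sigma> r (I \<union> {c} \<union> J) a \<and>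
        indiscernible L U D \<sigma> r (I \<union> J) a
        \<longrightarrow> indiscernible L U D \<sigma> r (I \<union> {c} \<union> J) a)"

end

theory Submission
  imports Defs "HOL-Library.Ramsey" "HOL-Library.Countable_Set"
begin

text \<open>
  NIP passes to \<open>T\<close> because \<open>M\<close> is a model of \<open>T\<close> and every \<open>L\<close>-definable set of \<open>M\<close> is named in the Shelah expansion.
  Given NIP, distality of \<open>T\<close> follows from a statement without parameters: (*) if a sequence indexed by a cofinite set
  \<open>A\<close> of rationals is indiscernible when \<open>p\<close> is omitted and when \<open>q\<close> is omitted, then it is indiscernible. Indeed, if
  \<open>\<phi>(x, e)\<close> singles out \<open>b\<close> in \<open>I + {b} + J\<close>, put copies of \<open>b\<close> into \<open>N\<close> cuts of one sequence indiscernible over \<open>e\<close>. By (*)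
  and induction the result is indiscernible, although \<open>\<phi>(x, e)\<close> singles out \<open>N\<close> of its elements; moving each of these
  to a neighbour or not gives all patterns, against NIP.

  For (*), suppose that an \<open>L\<close>-formula distinguishes two increasing tuples, and copy finite parts of the sequence into the
  monster model \<open>U1\<close> of the theory of the Shelah expansion. By Ramsey's theorem the part far from \<open>p\<close> and \<open>q\<close> can be made
  indiscernible for finitely many formulas of the expanded language. The remaining two elements can be inserted, in cuts
  of this sequence, while keeping the \<open>L\<close>-type; if they always spoiled the indiscernibility, then tuples of the same \<open>L\<close>-type
  would follow all patterns with respect to an externally definable set, since by Shelah's theorem every formula of the expansion
  defines one, and this contradicts NIP of \<open>L\<close>. By compactness, \<open>U1\<close> contains a sequence as in (*) for the expanded
  language, but with the same \<open>L\<close>-formula distinguishing the two tuples; this contradicts distality of \<open>U1\<close>, with the elements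
  up to \<open>p\<close> as parameters.
\<close>

subsection \<open>Formulas on standard variables\<close>

text \<open>Distality does not pass to reducts in general: the theory of dense linear orders without
  endpoints is distal, that of an infinite pure set is not. So the argument must use that the new
  predicates are traces of \<open>L\<close>-formulas: an arrangement of tuples relative to such a
  predicate is an arrangement relative to instances of one \<open>L\<close>-formula, and NIP of
  \<open>L\<close> limits those.

  \<open>U\<close> is not a reduct of \<open>U1\<close>; the two are linked only through
  \<open>M\<close>. Types over the empty set can be copied from one to the other, while sets of
  parameters are not carried along. This forces the detour through a statement without parameters,
  in which two removable points stand for the parameter set and the element in the cut.

  Applying Ramsey's theorem to the sequence with \<open>p\<close> and \<open>q\<close> in it would
  destroy the tuples that the \<open>L\<close>-formula distinguishes. So the sequence is made
  homogeneous first and the two points are inserted afterwards; the price is that an insertion may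
  fail, and failures have to be shown to be bounded in number.\<close>

lemma finite_fv_tm: "finite (fv_tm t)"
  by (induction t) auto

lemma finite_fv: "finite (fv \<phi>)"
  by (induction \<phi>) (auto simp: finite_fv_tm)

lemma eval_cong: "(\<And>v. v \<in> fv_tm t \<Longrightarrow> e v = e' v) \<Longrightarrow> eval N e t = eval N e' t"
proof (induction t)
  case (Fn f ts)
  then have "map (eval N e) ts = map (eval N e') ts" by auto
  then show ?case by (simp only: eval.simps)
qed simp

lemma sat_cong: "(\<And>v. v \<in> fv \<phi> \<Longrightarrow> e v = e' v) \<Longrightarrow> sat N e \<phi> \<longleftrightarrow> sat N e' \<phi>"
proof (induction \<phi> arbitrary: e e')
  case (Eq t u)
  then show ?case using eval_cong[of t e e' N] eval_cong[of u e e' N] by simp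
next
  case (Rel p ts)
  then have "map (eval N e) ts = map (eval N e') ts"
    by (auto intro!: eval_cong)
  then show ?case by (simp only: sat.simps)
next
  case (Neg \<phi>)
  have "sat N e \<phi> = sat N e' \<phi>" by (rule Neg.IH) (use Neg.prems in auto)
  then show ?case by simp
next
  case (And \<phi>1 \<phi>2)
  have "sat N e \<phi>1 = sat N e' \<phi>1" by (rule And.IH) (use And.prems in auto)
  moreover have "sat N e \<phi>2 = sat N e' \<phi>2" by (rule And.IH) (use And.prems in auto)
  ultimately show ?case by simp
next
  case (Ex v \<phi>)
  have "sat N (e(v := a)) \<phi> = sat N (e'(v := a)) \<phi>" for a
    by (rule Ex.IH) (use Ex.prems in auto)
  then show ?case by simp
qed

section \<open>Renaming of variables\<close>

primrec rename_tm :: "('s var \<Rightarrow> 's var) \<Rightarrow> ('s, 'f) tm \<Rightarrow> ('s, 'f) tm" where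
  "rename_tm \<pi> (Var v) = Var (\<pi> v)"
| "rename_tm \<pi> (Fn f ts) = Fn f (map (rename_tm \<pi>) ts)"

text \<open>Bound variables are renamed together with the free ones. For a sort-preserving
  permutation no variable can be captured, so no freshness conditions arise.\<close>

primrec rename :: "('s var \<Rightarrow> 's var) \<Rightarrow> ('s, 'f, 'p) fm \<Rightarrow> ('s, 'f, 'p) fm" where
  "rename \<pi> (Eq t u) = Eq (rename_tm \<pi> t) (rename_tm \<pi> u)"
| "rename \<pi> (Rel p ts) = Rel p (map (rename_tm \<pi>) ts)"
| "rename \<pi> (Neg \<phi>) = Neg (rename \<pi> \<phi>)"
| "rename \<pi> (And \<phi> \<psi>) = And (rename \<pi> \<phi>) (rename \<pi> \<psi>)"
| "rename \<pi> (Ex v \<phi>) = Ex (\<pi> v) (rename \<pi> \<phi>)"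

definition var_perm :: "('s var \<Rightarrow> 's var) \<Rightarrow> bool" where
  "var_perm \<pi> \<longleftrightarrow> bij \<pi> \<and> (\<forall>v. fst (\<pi> v) = fst v)"

lemma eval_rename_tm: "eval N e (rename_tm \<pi> t) = eval N (e \<circ> \<pi>) t"
proof (induction t)
  case (Fn f ts)
  have "map (eval N e) (map (rename_tm \<pi>) ts) = map (eval N (e \<circ> \<pi>)) ts"
    unfolding map_map by (rule map_cong[OF refl]) (simp only: comp_apply[of "eval N e"] Fn.IH)
  then show ?case by (simp only: rename_tm.simps eval.simps)
qed simp

lemma sat_rename:
  assumes "var_perm \<pi>"
  shows "sat N e (rename \<pi> \<phi>) \<longleftrightarrow> sat N (e \<circ> \<pi>) \<phi>"
proof (induction \<phi> arbitrary: e)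
  case (Rel p ts)
  have "map (eval N e \<circ> rename_tm \<pi>) ts = map (eval N (e \<circ> \<pi>)) ts"
    using eval_rename_tm[of N e \<pi>] by simp
  then show ?case by (simp only: rename.simps sat.simps map_map)
next
  case (Ex v \<phi>)
  have "(e(\<pi> v := a)) \<circ> \<pi> = (e \<circ> \<pi>)(v := a)" for a
    using assms by (auto simp: var_perm_def fun_eq_iff bij_def inj_eq)
  moreover have "fst (\<pi> v) = fst v" using assms unfolding var_perm_def by blast
  ultimately show ?case by (simp only: rename.simps sat.simps Ex.IH)
qed (auto simp: eval_rename_tm)

lemma fv_tm_rename: "fv_tm (rename_tm \<pi> t) = \<pi> ` fv_tm t"
  by (induction t) auto

lemma fv_rename: "var_perm \<pi> \<Longrightarrow> fv (rename \<pi> \<phi>) = \<pi> ` fv \<phi>"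
  by (induction \<phi>) (auto simp: fv_tm_rename var_perm_def bij_def inj_eq)

lemma has_sort_rename_tm:
  assumes "var_perm \<pi>"
  shows "has_sort L t s \<Longrightarrow> has_sort L (rename_tm \<pi> t) s"
proof (induction rule: has_sort.induct)
  case (1 v)
  have "fst (\<pi> v) = fst v" using assms unfolding var_perm_def by blast
  then show ?case using has_sort.intros(1)[of L "\<pi> v"] by simp
next
  case (2 f \<sigma> s ts)
  then show ?case
    by (auto intro!: has_sort.intros(2) simp: list_all2_conv_all_nth)
qed

lemma wf_rename: "var_perm \<pi> \<Longrightarrow> wf_fm L \<phi> \<Longrightarrow> wf_fm L (rename \<pi> \<phi>)"
proof (induction \<phi>)
  case (Rel p ts)
  then show ?case
    by (auto simp: list_all2_conv_all_nth intro: has_sort_rename_tm)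
qed (auto intro: has_sort_rename_tm)

text \<open>Since \<open>rename\<close> is meant for permutations, a matching of two lists of
  variables has to be extended to all variables. The permutation found for the tail is corrected at
  the new entry by a transposition.\<close>

lemma ex_var_perm:
  assumes "distinct xs" "distinct ys" "map fst xs = map fst ys"
  shows "\<exists>\<pi>. var_perm \<pi> \<and> map \<pi> xs = ys"
  using assms
proof (induction xs arbitrary: ys)
  case Nil
  then show ?case by (intro exI[of _ id]) (auto simp: var_perm_def bij_id[unfolded id_def])
next
  case (Cons x xs)
  then obtain y ys' where ys: "ys = y # ys'" by (cases ys) auto
  with Cons.prems have "distinct xs" "distinct ys'" "map fst xs = map fst ys'" by auto
  from Cons.IH[OF this] obtain \<pi> where \<pi>: "var_perm \<pi>" "map \<pi> xs = ys'" by auto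
  have inj: "inj \<pi>" using \<pi> by (auto simp: var_perm_def bij_def)
  \<comment> \<open>The transposition of \<open>y\<close> and \<open>\<pi> x\<close>. It fixes every
    entry of \<open>ys'\<close>, because neither of the two occurs there.\<close>
  define t where "t = (\<lambda>z. if z = \<pi> x then y else if z = y then \<pi> x else z)"
  have "bij t" by (rule o_bij[of t]) (auto simp: t_def)
  have "\<pi> x \<notin> set ys'" using Cons.prems(1) \<pi>(2) inj by (auto simp: inj_eq)
  moreover have "y \<notin> set ys'" using Cons.prems ys by auto
  ultimately have "t z = z" if "z \<in> set ys'" for z using that by (auto simp: t_def)
  then have "map t ys' = ys'" by (simp add: map_idI)
  then have "map (t \<circ> \<pi>) (x # xs) = ys"
    using \<pi>(2) ys by (simp flip: map_map) (simp add: t_def)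
  moreover have "fst y = fst x" using Cons.prems ys by auto
  moreover have "fst (\<pi> v) = fst v" for v using \<pi>(1) unfolding var_perm_def by blast
  ultimately have "fst ((t \<circ> \<pi>) v) = fst v" for v by (metis comp_apply t_def)
  moreover have "bij (t \<circ> \<pi>)" using \<pi>(1) \<open>bij t\<close> unfolding var_perm_def by (blast intro: bij_comp)
  ultimately have "var_perm (t \<circ> \<pi>)" unfolding var_perm_def by blast
  with \<open>map (t \<circ> \<pi>) (x # xs) = ys\<close> show ?case by blast
qed

definition move :: "'s var list \<Rightarrow> 's var list \<Rightarrow> 's var \<Rightarrow> 's var" where
  "move xs ys = (SOME \<pi>. var_perm \<pi> \<and> map \<pi> xs = ys)"

lemma move:
  assumes "distinct xs" "distinct ys" "map fst xs = map fst ys"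
  shows "var_perm (move xs ys)" "map (move xs ys) xs = ys"
  using someI_ex[OF ex_var_perm[OF assms]] by (auto simp: move_def)

definition std_vars :: "'s list \<Rightarrow> 's var list" where
  "std_vars \<tau> = map (\<lambda>j. (\<tau> ! j, j)) [0..<length \<tau>]"

text \<open>The sort of the variable is ignored: in a formula of \<open>fms\<close> each index
  occurs free with one sort only.\<close>

definition std_env :: "'a list \<Rightarrow> 's var \<Rightarrow> 'a" where
  "std_env as v = as ! snd v"

text \<open>Only the variables \<open>(\<tau> ! j, j)\<close> are used below; \<open>\<tau> @ \<tau>'\<close> separates variables from parameters.\<close>

definition fms :: "('s, 'f, 'p) lang \<Rightarrow> 's list \<Rightarrow> ('s, 'f, 'p) fm set" where
  "fms L \<tau> = {\<phi> \<in> formulas L. fv \<phi> \<subseteq> set (std_vars \<tau>)}"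

definition ext :: "('s, 'f, 'p, 'a) struc \<Rightarrow> 's list \<Rightarrow> ('s, 'f, 'p) fm \<Rightarrow> 'a list set" where
  "ext N \<tau> \<phi> = {as \<in> tuples N \<tau>. sat N (std_env as) \<phi>}"

lemma in_std_vars: "v \<in> set (std_vars \<tau>) \<longleftrightarrow> snd v < length \<tau> \<and> fst v = \<tau> ! snd v"
  by (cases v) (auto simp: std_vars_def)

lemma length_std_vars [simp]: "length (std_vars \<tau>) = length \<tau>"
  and distinct_std_vars [simp]: "distinct (std_vars \<tau>)"
  and nth_std_vars [simp]: "j < length \<tau> \<Longrightarrow> std_vars \<tau> ! j = (\<tau> ! j, j)"
  and map_fst_std_vars [simp]: "map fst (std_vars \<tau>) = \<tau>"
  by (auto simp: std_vars_def distinct_map inj_on_def comp_def map_nth)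

lemma tuples_iff: "as \<in> tuples N \<tau> \<longleftrightarrow> length as = length \<tau> \<and> (\<forall>j<length \<tau>. as ! j \<in> dom_of N (\<tau> ! j))"
  by (auto simp: tuples_def list_all2_conv_all_nth)

lemma tuples_length: "as \<in> tuples N \<tau> \<Longrightarrow> length as = length \<tau>"
  by (simp add: tuples_iff)

lemma tuples_Nil [simp]: "tuples N [] = {[]}"
  by (auto simp: tuples_def)

lemma tuples_append: "length as = length \<tau> \<Longrightarrow> as @ bs \<in> tuples N (\<tau> @ \<tau>') \<longleftrightarrow> as \<in> tuples N \<tau> \<and> bs \<in> tuples N \<tau>'"
  by (auto simp: tuples_def list_all2_append)

lemma tuples_appendI: "as \<in> tuples N \<tau> \<Longrightarrow> bs \<in> tuples N \<tau>' \<Longrightarrow> as @ bs \<in> tuples N (\<tau> @ \<tau>')"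
  by (simp add: tuples_append tuples_length)

lemma tuples_appendE:
  assumes "as \<in> tuples N (\<tau> @ \<tau>')"
  obtains bs cs where "as = bs @ cs" "bs \<in> tuples N \<tau>" "cs \<in> tuples N \<tau>'"
  using assms by (auto simp: tuples_def list_all2_append2)

lemma tuples_single [simp]: "[a] \<in> tuples N [s] \<longleftrightarrow> a \<in> dom_of N s"
  by (auto simp: tuples_def)

lemma tuples_concat: "(\<And>x. x \<in> set xs \<Longrightarrow> f x \<in> tuples N \<sigma>) \<Longrightarrow>
    concat (map f xs) \<in> tuples N (concat (replicate (length xs) \<sigma>))"
  by (induction xs) (auto intro: tuples_appendI)

lemma ext_tuples: "ext N \<tau> \<phi> \<subseteq> tuples N \<tau>"
  by (auto simp: ext_def)

lemma fms_Neg: "\<phi> \<in> fms L \<tau> \<Longrightarrow> Neg \<phi> \<in> fms L \<tau>"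
  and fms_And: "\<phi> \<in> fms L \<tau> \<Longrightarrow> \<psi> \<in> fms L \<tau> \<Longrightarrow> And \<phi> \<psi> \<in> fms L \<tau>"
  by (auto simp: fms_def formulas_def)

lemma ext_Neg: "ext N \<tau> (Neg \<phi>) = tuples N \<tau> - ext N \<tau> \<phi>"
  and ext_And: "ext N \<tau> (And \<phi> \<psi>) = ext N \<tau> \<phi> \<inter> ext N \<tau> \<psi>"
  by (auto simp: ext_def)

text \<open>There is no symbol for truth. This sentence holds in every structure because all sorts
  are inhabited.\<close>

definition Tru :: "('s, 'f, 'p) fm" where
  "Tru = Ex (undefined, 0) (Eq (Var (undefined, 0)) (Var (undefined, 0)))"

lemma fms_Tru: "Tru \<in> fms L \<tau>"
  by (auto simp: fms_def formulas_def Tru_def intro: has_sort.intros)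

lemma ext_Tru: "is_struc L N \<Longrightarrow> ext N \<tau> Tru = tuples N \<tau>"
  by (auto simp: ext_def Tru_def is_struc_def)

primrec conj :: "('s, 'f, 'p) fm list \<Rightarrow> ('s, 'f, 'p) fm" where
  "conj [] = Tru"
| "conj (\<phi> # \<phi>s) = And \<phi> (conj \<phi>s)"

lemma fms_conj: "(\<And>\<phi>. \<phi> \<in> set \<phi>s \<Longrightarrow> \<phi> \<in> fms L \<tau>) \<Longrightarrow> conj \<phi>s \<in> fms L \<tau>"
  by (induction \<phi>s) (auto intro: fms_Tru fms_And)

lemma ext_conj: "is_struc L N \<Longrightarrow> ext N \<tau> (conj \<phi>s) = {as \<in> tuples N \<tau>. \<forall>\<phi>\<in>set \<phi>s. as \<in> ext N \<tau> \<phi>}"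
  by (induction \<phi>s) (auto simp: ext_Tru ext_And ext_tuples[THEN subsetD])

text \<open>The block that is quantified away is the last one, so the remaining variables keep their
  indices.\<close>

fun exs :: "'s list \<Rightarrow> 's list \<Rightarrow> ('s, 'f, 'p) fm \<Rightarrow> ('s, 'f, 'p) fm" where
  exs_Nil: "exs \<tau> [] \<phi> = \<phi>"
| exs_Cons: "exs \<tau> (s # \<tau>') \<phi> = Ex (s, length \<tau>) (exs (\<tau> @ [s]) \<tau>' \<phi>)"

lemma std_env_update: "length as = length \<tau> \<Longrightarrow> v \<in> set (std_vars (\<tau> @ [s])) \<Longrightarrow>
    ((std_env as)((s, length \<tau>) := b)) v = std_env (as @ [b]) v"
  unfolding in_std_vars std_env_def
  by (cases "snd v = length \<tau>") (auto simp: nth_append prod_eq_iff)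

lemma ext_Ex:
  assumes "\<phi> \<in> fms L (\<tau> @ [s])"
  shows "ext N \<tau> (Ex (s, length \<tau>) \<phi>) = {as \<in> tuples N \<tau>. \<exists>b \<in> dom_of N s. as @ [b] \<in> ext N (\<tau> @ [s]) \<phi>}"
proof -
  have "sat N ((std_env as)((s, length \<tau>) := b)) \<phi> = sat N (std_env (as @ [b])) \<phi>"
    if "as \<in> tuples N \<tau>" for as b
    by (rule sat_cong, rule std_env_update) (use assms that in \<open>auto simp: fms_def tuples_length\<close>)
  then show ?thesis by (auto simp: ext_def tuples_appendI)
qed

lemma fms_Ex: "\<phi> \<in> fms L (\<tau> @ [s]) \<Longrightarrow> Ex (s, length \<tau>) \<phi> \<in> fms L \<tau>"
  by (fastforce simp: fms_def formulas_def in_std_vars nth_append less_Suc_eq split: if_splits)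

lemma fms_exs: "\<phi> \<in> fms L (\<tau> @ \<tau>') \<Longrightarrow> exs \<tau> \<tau>' \<phi> \<in> fms L \<tau>"
  by (induction \<tau> \<tau>' \<phi> rule: exs.induct) (auto intro: fms_Ex)

lemma ext_exs: "\<phi> \<in> fms L (\<tau> @ \<tau>') \<Longrightarrow>
    ext N \<tau> (exs \<tau> \<tau>' \<phi>) = {as \<in> tuples N \<tau>. \<exists>bs \<in> tuples N \<tau>'. as @ bs \<in> ext N (\<tau> @ \<tau>') \<phi>}"
proof (induction \<tau> \<tau>' \<phi> rule: exs.induct)
  case (1 \<tau> \<phi>)
  then show ?case by (auto simp: ext_def)
next
  case (2 \<tau> s \<tau>' \<phi>)
  then have *: "exs (\<tau> @ [s]) \<tau>' \<phi> \<in> fms L (\<tau> @ [s])" by (intro fms_exs) simp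
  have "(\<exists>b\<in>dom_of N s. as @ [b] \<in> ext N (\<tau> @ [s]) (exs (\<tau> @ [s]) \<tau>' \<phi>)) \<longleftrightarrow>
      (\<exists>bs\<in>tuples N (s # \<tau>'). as @ bs \<in> ext N (\<tau> @ s # \<tau>') \<phi>)" (is "?l \<longleftrightarrow> ?r")
    if "as \<in> tuples N \<tau>" for as
  proof
    assume ?l
    then obtain b bs where "b \<in> dom_of N s" "bs \<in> tuples N \<tau>'" "as @ b # bs \<in> ext N (\<tau> @ s # \<tau>') \<phi>"
      using 2 by auto
    then show ?r by (intro bexI[of _ "b # bs"]) (auto simp: tuples_def)
  next
    assume ?r
    then obtain b bs where "b \<in> dom_of N s" "bs \<in> tuples N \<tau>'" "as @ b # bs \<in> ext N (\<tau> @ s # \<tau>') \<phi>"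
      by (auto simp: tuples_def list_all2_Cons2)
    moreover from this that have "as @ [b] \<in> tuples N (\<tau> @ [s])" by (intro tuples_appendI) auto
    ultimately show ?l using 2 by auto
  qed
  then show ?case by (auto simp: ext_Ex[OF *])
qed

section \<open>Substitution of variables by reindexing\<close>

definition pick :: "nat list \<Rightarrow> 'a list \<Rightarrow> 'a list" where
  "pick hs as = map (nth as) hs"

text \<open>A map of positions that respects sorts but may repeat or omit positions of
  \<open>\<tau>'\<close>: the substitution of \<open>\<tau>'\<close>-variables for the
  \<open>\<tau>\<close>-variables.\<close>

definition reidx :: "'s list \<Rightarrow> 's list \<Rightarrow> nat list \<Rightarrow> bool" where
  "reidx \<tau> \<tau>' hs \<longleftrightarrow> set hs \<subseteq> {..<length \<tau>'} \<and> pick hs \<tau>' = \<tau>"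

lemma reidx_length: "reidx \<tau> \<tau>' hs \<Longrightarrow> length hs = length \<tau>"
  by (auto simp: reidx_def pick_def)

lemma reidx_nth: "reidx \<tau> \<tau>' hs \<Longrightarrow> j < length \<tau> \<Longrightarrow> hs ! j < length \<tau>' \<and> \<tau>' ! (hs ! j) = \<tau> ! j"
  by (auto simp: reidx_def pick_def subset_iff)

lemma pick_tuples: "reidx \<tau> \<tau>' hs \<Longrightarrow> as \<in> tuples N \<tau>' \<Longrightarrow> pick hs as \<in> tuples N \<tau>"
  using reidx_nth[of \<tau> \<tau>' hs] reidx_length[of \<tau> \<tau>' hs] by (fastforce simp: tuples_iff pick_def)

text \<open>Substitution without a substitution operation: the variables of \<open>\<phi>\<close>
  are moved past \<open>\<tau>'\<close> by a permutation, equated with the variables that they stand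
  for, and quantified away. A mere renaming would not do, because \<open>hs\<close> may identify
  variables.\<close>

definition reindex :: "'s list \<Rightarrow> 's list \<Rightarrow> nat list \<Rightarrow> ('s, 'f, 'p) fm \<Rightarrow> ('s, 'f, 'p) fm" where
  "reindex \<tau> \<tau>' hs \<phi> = exs \<tau>' \<tau>
     (conj (rename (move (std_vars \<tau>) (drop (length \<tau>') (std_vars (\<tau>' @ \<tau>)))) \<phi> #
       map (\<lambda>j. Eq (Var (\<tau> ! j, hs ! j)) (Var (\<tau> ! j, length \<tau>' + j))) [0..<length \<tau>]))"

lemma
  fixes L :: "('s, 'f, 'p) lang"
  assumes h: "reidx \<tau> \<tau>' hs" and \<phi>: "\<phi> \<in> fms L \<tau>"
  shows fms_reindex: "reindex \<tau> \<tau>' hs \<phi> \<in> fms L \<tau>'"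
    and ext_reindex: "is_struc L N \<Longrightarrow> ext N \<tau>' (reindex \<tau> \<tau>' hs \<phi>) = {as \<in> tuples N \<tau>'. pick hs as \<in> ext N \<tau> \<phi>}"
proof -
  define zs where "zs = drop (length \<tau>') (std_vars (\<tau>' @ \<tau>))"
  define \<pi> where "\<pi> = move (std_vars \<tau>) zs"
  have "map fst zs = drop (length \<tau>') (map fst (std_vars (\<tau>' @ \<tau>)))"
    unfolding zs_def drop_map ..
  then have "map fst (std_vars \<tau>) = map fst zs" by simp
  with move[of "std_vars \<tau>" zs] have \<pi>: "var_perm \<pi>" "map \<pi> (std_vars \<tau>) = zs"
    by (auto simp: \<pi>_def zs_def)
  have \<pi>j: "\<pi> (\<tau> ! j, j) = (\<tau> ! j, length \<tau>' + j)" if "j < length \<tau>" for j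
  proof -
    have "\<pi> (\<tau> ! j, j) = map \<pi> (std_vars \<tau>) ! j" using that by simp
    also have "\<dots> = zs ! j" by (simp add: \<pi>)
    finally show ?thesis using that by (simp add: zs_def nth_append)
  qed
  define \<phi>' where "\<phi>' = rename \<pi> \<phi>"
  define es :: "('s, 'f, 'p) fm list" where "es = map (\<lambda>j. Eq (Var (\<tau> ! j, hs ! j)) (Var (\<tau> ! j, length \<tau>' + j))) [0..<length \<tau>]"
  have "fv \<phi>' \<subseteq> set (std_vars (\<tau>' @ \<tau>))"
  proof -
    have "\<pi> ` fv \<phi> \<subseteq> \<pi> ` set (std_vars \<tau>)" using \<phi> by (auto simp: fms_def)
    also have "\<dots> = set zs" using \<pi>(2) by (metis set_map)
    also have "\<dots> \<subseteq> set (std_vars (\<tau>' @ \<tau>))" by (simp add: zs_def set_drop_subset)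
    finally show ?thesis by (simp only: fv_rename[OF \<pi>(1)] \<phi>'_def)
  qed
  then have 1: "\<phi>' \<in> fms L (\<tau>' @ \<tau>)"
    using wf_rename[OF \<pi>(1), of L \<phi>] \<phi> by (auto simp: \<phi>'_def fms_def formulas_def)
  have hsrt: "has_sort L (Var (s, k)) s" for s k using has_sort.intros(1)[of L "(s, k)"] by simp
  have 2: "\<psi> \<in> fms L (\<tau>' @ \<tau>)" if "\<psi> \<in> set es" for \<psi>
    using that reidx_nth[OF h]
    by (auto simp: es_def fms_def formulas_def in_std_vars nth_append intro!: exI hsrt)
  have 3: "conj (\<phi>' # es) \<in> fms L (\<tau>' @ \<tau>)" by (rule fms_conj) (use 1 2 in auto)
  have r: "reindex \<tau> \<tau>' hs \<phi> = exs \<tau>' \<tau> (conj (\<phi>' # es))"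
    by (simp add: reindex_def \<phi>'_def \<pi>_def zs_def es_def)
  show "reindex \<tau> \<tau>' hs \<phi> \<in> fms L \<tau>'" unfolding r by (rule fms_exs[OF 3])
  assume N: "is_struc L N"
  have *: "as @ bs \<in> ext N (\<tau>' @ \<tau>) (conj (\<phi>' # es)) \<longleftrightarrow> bs = pick hs as \<and> bs \<in> ext N \<tau> \<phi>"
    if as: "as \<in> tuples N \<tau>'" and bs: "bs \<in> tuples N \<tau>" for as bs
  proof -
    have l: "length as = length \<tau>'" "length bs = length \<tau>" using as bs by (auto simp: tuples_length)
    have ab: "as @ bs \<in> tuples N (\<tau>' @ \<tau>)" using as bs by (rule tuples_appendI)
    have "sat N (std_env (as @ bs)) \<phi>' = sat N (std_env bs) \<phi>"
      unfolding \<phi>'_def sat_rename[OF \<pi>(1)]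
    proof (rule sat_cong)
      fix v assume "v \<in> fv \<phi>"
      then have "v \<in> set (std_vars \<tau>)" using \<phi> by (auto simp: fms_def)
      then obtain j where "v = (\<tau> ! j, j)" "j < length \<tau>" unfolding in_std_vars by (metis prod.collapse)
      then show "(std_env (as @ bs) \<circ> \<pi>) v = std_env bs v" using \<pi>j[of j] l by (simp add: std_env_def nth_append)
    qed
    moreover have "(\<forall>\<psi>\<in>set es. sat N (std_env (as @ bs)) \<psi>) \<longleftrightarrow> bs = pick hs as"
    proof -
      have "sat N (std_env (as @ bs)) (Eq (Var (\<tau> ! j, hs ! j)) (Var (\<tau> ! j, length \<tau>' + j))) \<longleftrightarrow> bs ! j = pick hs as ! j"
        if "j < length \<tau>" for j
        using that l reidx_nth[OF h that] reidx_length[OF h] by (auto simp: std_env_def nth_append pick_def)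
      then have "(\<forall>\<psi>\<in>set es. sat N (std_env (as @ bs)) \<psi>) \<longleftrightarrow> (\<forall>j<length \<tau>. bs ! j = pick hs as ! j)"
        by (auto simp: es_def simp del: sat.simps)
      then show ?thesis using l reidx_length[OF h] by (simp add: list_eq_iff_nth_eq pick_def)
    qed
    ultimately show ?thesis unfolding ext_conj[OF N] using ab bs by (auto simp: ext_def simp del: sat.simps)
  qed
  show "ext N \<tau>' (reindex \<tau> \<tau>' hs \<phi>) = {as \<in> tuples N \<tau>'. pick hs as \<in> ext N \<tau> \<phi>}"
    unfolding r ext_exs[OF 3] using * pick_tuples[OF h, of _ N] by auto
qed

definition canon :: "'s var list \<Rightarrow> ('s, 'f, 'p) fm \<Rightarrow> ('s, 'f, 'p) fm" where
  "canon xs \<phi> = rename (move xs (std_vars (map fst xs))) \<phi>"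

lemma assign_nth: "distinct xs \<Longrightarrow> length as = length xs \<Longrightarrow> j < length xs \<Longrightarrow> assign e xs as (xs ! j) = as ! j"
  by (simp add: assign_def map_of_zip_nth)

lemma assign_notin: "v \<notin> set xs \<Longrightarrow> assign e xs as v = e v"
  by (cases "map_of (zip xs as) v") (auto simp: assign_def dest!: map_of_SomeD set_zip_leftD)

lemma
  assumes xs: "distinct xs" and \<phi>: "\<phi> \<in> formulas L" "fv \<phi> \<subseteq> set xs"
  shows fms_canon: "canon xs \<phi> \<in> fms L (map fst xs)"
    and sat_canon: "(\<And>j. j < length xs \<Longrightarrow> e (xs ! j) = as ! j) \<Longrightarrow> sat N (std_env as) (canon xs \<phi>) \<longleftrightarrow> sat N e \<phi>"
proof -
  define \<pi> where "\<pi> = move xs (std_vars (map fst xs))"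
  have \<pi>: "var_perm \<pi>" "map \<pi> xs = std_vars (map fst xs)"
    unfolding \<pi>_def by (rule move; use xs in simp)+
  have "\<pi> ` fv \<phi> \<subseteq> \<pi> ` set xs" using \<phi> by auto
  also have "\<dots> = set (std_vars (map fst xs))" using \<pi>(2) by (metis set_map)
  finally have "fv (canon xs \<phi>) \<subseteq> set (std_vars (map fst xs))"
    using fv_rename[OF \<pi>(1), of \<phi>] by (simp add: canon_def \<pi>_def)
  then show "canon xs \<phi> \<in> fms L (map fst xs)"
    using wf_rename[OF \<pi>(1), of L \<phi>] \<phi> by (simp add: canon_def fms_def formulas_def \<pi>_def)
  assume e: "\<And>j. j < length xs \<Longrightarrow> e (xs ! j) = as ! j"
  have "sat N (std_env as \<circ> \<pi>) \<phi> = sat N e \<phi>"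
  proof (rule sat_cong)
    fix v assume "v \<in> fv \<phi>"
    then obtain j where j: "j < length xs" "v = xs ! j" using \<phi> by (metis in_set_conv_nth subsetD)
    have "\<pi> (xs ! j) = map \<pi> xs ! j" using j by simp
    then have "\<pi> (xs ! j) = (fst (xs ! j), j)" unfolding \<pi>(2) using j by simp
    then show "(std_env as \<circ> \<pi>) v = e v" using j e by (simp add: std_env_def)
  qed
  then show "sat N (std_env as) (canon xs \<phi>) \<longleftrightarrow> sat N e \<phi>"
    unfolding canon_def \<pi>_def[symmetric] sat_rename[OF \<pi>(1)] .
qed

subsection \<open>Picking coordinates\<close>

lemma pick_append: "pick (hs @ hs') as = pick hs as @ pick hs' as"
  by (simp add: pick_def)

lemma reidx_append: "reidx \<tau> \<mu> hs \<Longrightarrow> reidx \<tau>' \<mu> hs' \<Longrightarrow> reidx (\<tau> @ \<tau>') \<mu> (hs @ hs')"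
  by (auto simp: reidx_def pick_append)

lemma pick_block: "length xs = k \<Longrightarrow> length as = n \<Longrightarrow> pick [k..<k + n] (xs @ as @ ys) = as"
  by (auto simp: pick_def list_eq_iff_nth_eq nth_append)

lemma reidx_block: "length \<tau>1 = k \<Longrightarrow> length \<tau> = n \<Longrightarrow> reidx \<tau> (\<tau>1 @ \<tau> @ \<tau>2) [k..<k + n]"
  by (auto simp: reidx_def pick_block)

lemma ex_reidx_append:
  shows "\<exists>hs. reidx \<tau> (\<tau>1 @ \<tau> @ \<tau>2) hs \<and>
    (\<forall>xs as ys. length xs = length \<tau>1 \<longrightarrow> length as = length \<tau> \<longrightarrow> pick hs (xs @ as @ ys) = as)"
  by (rule exI[of _ "[length \<tau>1..<length \<tau>1 + length \<tau>]"]) (auto simp: reidx_block pick_block)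

definition pos :: "'i list \<Rightarrow> 'i \<Rightarrow> nat" where
  "pos bs x = (LEAST k. k < length bs \<and> bs ! k = x)"

lemma pos: "x \<in> set bs \<Longrightarrow> pos bs x < length bs \<and> bs ! pos bs x = x"
  unfolding pos_def by (rule LeastI_ex) (auto simp: in_set_conv_nth)

abbreviation pow :: "'s list \<Rightarrow> nat \<Rightarrow> 's list" where
  "pow \<sigma> n \<equiv> concat (replicate n \<sigma>)"

abbreviation cat :: "('i \<Rightarrow> 'a list) \<Rightarrow> 'i list \<Rightarrow> 'a list" where
  "cat f is \<equiv> concat (map f is)"

text \<open>All entries are blocks of \<open>n\<close> elements, so the block of \<open>x\<close>
  starts at \<open>n\<close> times its position. \<open>pos\<close> takes the first occurrence,
  which makes repetitions in \<open>bs\<close> harmless.\<close>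

definition cpick :: "nat \<Rightarrow> 'i list \<Rightarrow> 'i list \<Rightarrow> nat list" where
  "cpick n bs is = cat (\<lambda>x. [pos bs x * n..<pos bs x * n + n]) is"

lemma concat_take_drop:
  assumes "\<And>x. x \<in> set bs \<Longrightarrow> length (f x) = n" "k < length bs"
  shows "length (cat f (take k bs)) = k * n" "cat f bs = cat f (take k bs) @ f (bs ! k) @ cat f (drop (Suc k) bs)"
proof -
  have "length (cat f xs) = length xs * n" if "set xs \<subseteq> set bs" for xs
    using that by (induction xs) (auto simp: assms)
  from this[of "take k bs"] show "length (cat f (take k bs)) = k * n"
    using assms(2) by (simp add: set_take_subset)
  show "cat f bs = cat f (take k bs) @ f (bs ! k) @ cat f (drop (Suc k) bs)"
    using id_take_nth_drop[OF assms(2)] by (metis concat.simps(2) concat_append list.simps(9) map_append)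
qed

lemma pick_cpick:
  assumes "\<And>x. x \<in> set bs \<Longrightarrow> length (f x) = n" "set is \<subseteq> set bs"
  shows "pick (cpick n bs is) (cat f bs) = cat f is"
  using assms(2)
proof (induction "is")
  case (Cons x "is")
  have "pos bs x < length bs" "bs ! pos bs x = x" using pos[of x bs] Cons.prems by auto
  moreover have "length (f x) = n" using Cons.prems assms(1) by auto
  ultimately have "pick [pos bs x * n..<pos bs x * n + n] (cat f bs) = f x"
    using concat_take_drop[of bs f n "pos bs x"] assms(1) pick_block by (metis)
  with Cons show ?case by (simp add: cpick_def pick_append)
qed (simp add: cpick_def pick_def)

lemma pow_cat: "pow \<sigma> (length bs) = cat (\<lambda>_. \<sigma>) bs"
  by (induction bs) auto

lemma length_pow [simp]: "length (pow \<sigma> n) = n * length \<sigma>"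
  by (induction n) auto

lemma pow_add: "pow \<sigma> (m + n) = pow \<sigma> m @ pow \<sigma> n"
  by (simp add: replicate_add)

lemma reidx_cpick:
  assumes "set is \<subseteq> set bs"
  shows "reidx (pow \<sigma> (length is)) (pow \<sigma> (length bs)) (cpick (length \<sigma>) bs is)"
  unfolding reidx_def
proof
  have "pos bs x * length \<sigma> + length \<sigma> \<le> length bs * length \<sigma>" if "x \<in> set is" for x
  proof -
    have "Suc (pos bs x) * length \<sigma> \<le> length bs * length \<sigma>"
      using pos[of x bs] assms that by (intro mult_le_mono1) auto
    then show ?thesis by simp
  qed
  then show "set (cpick (length \<sigma>) bs is) \<subseteq> {..<length (pow \<sigma> (length bs))}"
    by (fastforce simp: cpick_def)
  show "pick (cpick (length \<sigma>) bs is) (pow \<sigma> (length bs)) = pow \<sigma> (length is)"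
    unfolding pow_cat by (rule pick_cpick) (use assms in auto)
qed

lemma reidx_mono: "reidx \<tau> \<mu> hs \<Longrightarrow> reidx \<tau> (\<mu> @ \<mu>') hs"
  by (auto simp: reidx_def pick_def nth_append)

lemma pick_mono: "reidx \<tau> \<mu> hs \<Longrightarrow> length as = length \<mu> \<Longrightarrow> pick hs (as @ bs) = pick hs as"
  by (auto simp: reidx_def pick_def nth_append)

lemma cat_tuples: "(\<And>x. x \<in> set is \<Longrightarrow> f x \<in> tuples N \<sigma>) \<Longrightarrow> cat f is \<in> tuples N (pow \<sigma> (length is))"
  by (rule tuples_concat)

lemma length_cat: "(\<And>x. x \<in> set is \<Longrightarrow> length (f x) = n) \<Longrightarrow> length (cat f is) = length is * n"
  by (induction "is") auto

text \<open>The indices \<open>is\<close> may repeat those of \<open>bs\<close> in any order and multiplicity; the second block is kept.\<close>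

definition refam :: "'s list \<Rightarrow> 's list \<Rightarrow> 'i list \<Rightarrow> 'i list \<Rightarrow> ('s, 'f, 'p) fm \<Rightarrow> ('s, 'f, 'p) fm" where
  "refam \<sigma> \<epsilon> bs is = reindex (pow \<sigma> (length is) @ \<epsilon>) (pow \<sigma> (length bs) @ \<epsilon>)
     (cpick (length \<sigma>) bs is @ [length bs * length \<sigma>..<length bs * length \<sigma> + length \<epsilon>])"

lemma
  assumes "set is \<subseteq> set bs" "\<phi> \<in> fms L (pow \<sigma> (length is) @ \<epsilon>)"
  shows fms_refam: "refam \<sigma> \<epsilon> bs is \<phi> \<in> fms L (pow \<sigma> (length bs) @ \<epsilon>)"
    and ext_refam: "is_struc L N \<Longrightarrow> (\<And>x. x \<in> set bs \<Longrightarrow> f x \<in> tuples N \<sigma>) \<Longrightarrow> e \<in> tuples N \<epsilon> \<Longrightarrow>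
      cat f bs @ e \<in> ext N (pow \<sigma> (length bs) @ \<epsilon>) (refam \<sigma> \<epsilon> bs is \<phi>) \<longleftrightarrow>
      cat f is @ e \<in> ext N (pow \<sigma> (length is) @ \<epsilon>) \<phi>"
proof -
  let ?hs = "cpick (length \<sigma>) bs is @ [length bs * length \<sigma>..<length bs * length \<sigma> + length \<epsilon>]"
  have "reidx \<epsilon> (pow \<sigma> (length bs) @ \<epsilon> @ []) [length bs * length \<sigma>..<length bs * length \<sigma> + length \<epsilon>]"
    by (rule reidx_block) auto
  then have h: "reidx (pow \<sigma> (length is) @ \<epsilon>) (pow \<sigma> (length bs) @ \<epsilon>) ?hs"
    by (intro reidx_append[OF reidx_mono] reidx_cpick assms) simp
  show "refam \<sigma> \<epsilon> bs is \<phi> \<in> fms L (pow \<sigma> (length bs) @ \<epsilon>)"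
    unfolding refam_def by (rule fms_reindex[OF h assms(2)])
  assume N: "is_struc L N" and f: "\<And>x. x \<in> set bs \<Longrightarrow> f x \<in> tuples N \<sigma>" and e: "e \<in> tuples N \<epsilon>"
  have l: "length (f x) = length \<sigma>" if "x \<in> set bs" for x using f[OF that] by (rule tuples_length)
  have c: "length (cat f bs) = length bs * length \<sigma>" by (rule length_cat) (rule l)
  have "pick (cpick (length \<sigma>) bs is) (cat f bs @ e) = pick (cpick (length \<sigma>) bs is) (cat f bs)"
    by (rule pick_mono[OF reidx_cpick[OF assms(1)]]) (simp add: c)
  also have "\<dots> = cat f is" by (rule pick_cpick[OF l assms(1)])
  finally have "pick ?hs (cat f bs @ e) = cat f is @ e"
    unfolding pick_append using pick_block[of "cat f bs" "length bs * length \<sigma>" e "length \<epsilon>" "[]"] c tuples_length[OF e] by simp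
  moreover have "cat f bs @ e \<in> tuples N (pow \<sigma> (length bs) @ \<epsilon>)"
    by (intro tuples_appendI cat_tuples f e)
  ultimately show "cat f bs @ e \<in> ext N (pow \<sigma> (length bs) @ \<epsilon>) (refam \<sigma> \<epsilon> bs is \<phi>) \<longleftrightarrow>
      cat f is @ e \<in> ext N (pow \<sigma> (length is) @ \<epsilon>) \<phi>"
    unfolding refam_def ext_reindex[OF h assms(2) N] by simp
qed

subsection \<open>Realizing types of tuples and of countable families\<close>

lemma finite_ordLess_Card_order:
  assumes "Card_order \<kappa>" "infinite (Field \<kappa>)" "finite A"
  shows "|A| <o \<kappa>"
proof -
  have "|A| <o |Field \<kappa>|" using assms(2,3)
    by (meson finite_iff_ordLess_natLeq infinite_iff_natLeq_ordLeq ordLess_ordLeq_trans)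
  then show ?thesis using card_of_Field_ordIso[OF assms(1)] ordLess_ordIso_trans by blast
qed

lemma Un_ordLess:
  assumes "Card_order \<kappa>" "infinite (Field \<kappa>)" "|A| <o \<kappa>" "|B| <o \<kappa>"
  shows "|A \<union> B| <o \<kappa>"
  using card_of_Un_ordLess_infinite_Field[OF assms(2,1,3,4)] .

text \<open>A condition carries its own parameter tuple and the sorts of that tuple. Types are sets
  of conditions, so the language never has to be extended by constants.\<close>

definition conds :: "('s, 'f, 'p) lang \<Rightarrow> ('s, 'f, 'p, 'a) struc \<Rightarrow> 'a set \<Rightarrow> 's list \<Rightarrow> (('s, 'f, 'p) fm \<times> 's list \<times> 'a list) set" where
  "conds L N A \<tau> = {(\<phi>, \<tau>', e). \<phi> \<in> fms L (\<tau> @ \<tau>') \<and> e \<in> tuples N \<tau>' \<and> set e \<subseteq> A}"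

text \<open>Compactness arguments meet finitely many conditions whose parameter tuples differ in
  length and sorts. Concatenating these tuples and reindexing each formula to its own block turns
  them into one formula with one parameter tuple.\<close>

lemma merge:
  fixes N :: "('s, 'f, 'p, 'a) struc"
  assumes N: "is_struc L N" and "finite q"
    and "q \<subseteq> conds L N A \<tau>"
  shows "\<exists>\<mu> m \<chi>. m \<in> tuples N \<mu> \<and> set m \<subseteq> A \<and> \<chi> \<in> fms L (\<tau> @ \<mu>) \<and>
    (\<forall>as \<in> tuples N \<tau>. as @ m \<in> ext N (\<tau> @ \<mu>) \<chi> \<longleftrightarrow> (\<forall>(\<phi>, \<tau>', e) \<in> q. as @ e \<in> ext N (\<tau> @ \<tau>') \<phi>))"
  using assms(2,3)
proof (induction q rule: finite_induct)
  case empty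
  show ?case
    by (rule exI[of _ "[]"], rule exI[of _ "[]"], rule exI[of _ Tru]) (auto simp: fms_Tru ext_Tru[OF N])
next
  case (insert t q)
  obtain \<phi> \<tau>' e where t: "t = (\<phi>, \<tau>', e)" by (cases t)
  have \<phi>: "\<phi> \<in> fms L (\<tau> @ \<tau>')" and e: "e \<in> tuples N \<tau>'" "set e \<subseteq> A" using insert.prems t by (auto simp: conds_def)
  have "q \<subseteq> conds L N A \<tau>" using insert.prems by simp
  from insert.IH[OF this] obtain \<mu> m \<chi> where m: "m \<in> tuples N \<mu>" "set m \<subseteq> A" and \<chi>: "\<chi> \<in> fms L (\<tau> @ \<mu>)"
    and *: "\<And>as. as \<in> tuples N \<tau> \<Longrightarrow> as @ m \<in> ext N (\<tau> @ \<mu>) \<chi> \<longleftrightarrow> (\<forall>(\<phi>, \<tau>', e) \<in> q. as @ e \<in> ext N (\<tau> @ \<tau>') \<phi>)"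
    by (elim exE conjE) blast
  obtain h0 where h0: "reidx \<tau> ([] @ \<tau> @ (\<tau>' @ \<mu>)) h0"
    "\<And>as ys. length as = length \<tau> \<Longrightarrow> pick h0 ([] @ as @ ys) = (as :: 'a list)"
    using ex_reidx_append[of \<tau> "[]" "\<tau>' @ \<mu>"] by auto
  obtain h1 where h1: "reidx \<tau>' (\<tau> @ \<tau>' @ \<mu>) h1"
    "\<And>xs as ys. length xs = length \<tau> \<Longrightarrow> length as = length \<tau>' \<Longrightarrow> pick h1 (xs @ as @ ys) = (as :: 'a list)"
    using ex_reidx_append by blast
  obtain h2 where h2: "reidx \<mu> ((\<tau> @ \<tau>') @ \<mu> @ []) h2"
    "\<And>xs as ys. length xs = length (\<tau> @ \<tau>') \<Longrightarrow> length as = length \<mu> \<Longrightarrow> pick h2 (xs @ as @ ys) = (as :: 'a list)"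
    using ex_reidx_append by blast
  let ?\<mu> = "\<tau>' @ \<mu>" and ?m = "e @ m"
  have r1: "reidx (\<tau> @ \<tau>') (\<tau> @ ?\<mu>) (h0 @ h1)" using reidx_append h0(1) h1(1) by fastforce
  have r2: "reidx (\<tau> @ \<mu>) (\<tau> @ ?\<mu>) (h0 @ h2)" using reidx_append h0(1) h2(1) by fastforce
  let ?\<chi> = "And (reindex (\<tau> @ \<tau>') (\<tau> @ ?\<mu>) (h0 @ h1) \<phi>) (reindex (\<tau> @ \<mu>) (\<tau> @ ?\<mu>) (h0 @ h2) \<chi>)"
  have "as @ ?m \<in> ext N (\<tau> @ ?\<mu>) ?\<chi> \<longleftrightarrow> as @ e \<in> ext N (\<tau> @ \<tau>') \<phi> \<and> as @ m \<in> ext N (\<tau> @ \<mu>) \<chi>"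
    if as: "as \<in> tuples N \<tau>" for as
  proof -
    have "as @ ?m \<in> tuples N (\<tau> @ ?\<mu>)" using as m e by (auto intro: tuples_appendI)
    moreover have "pick h0 (as @ ?m) = as" "pick h1 (as @ ?m) = e" "pick h2 (as @ ?m) = m"
      using h0(2)[of as ?m] h1(2)[of as e m] h2(2)[of "as @ e" m "[]"] as m(1) e(1) by (auto simp: tuples_length)
    ultimately show ?thesis
      unfolding ext_And ext_reindex[OF r1 \<phi> N] ext_reindex[OF r2 \<chi> N] by (simp add: pick_append)
  qed
  moreover have "?m \<in> tuples N ?\<mu>" "set ?m \<subseteq> A" using m e by (auto intro: tuples_appendI)
  moreover have "?\<chi> \<in> fms L (\<tau> @ ?\<mu>)" by (intro fms_And fms_reindex r1 r2 \<phi> \<chi>)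
  ultimately show ?case using * t by (intro exI[of _ ?\<mu>] exI[of _ ?m] exI[of _ ?\<chi>]) auto
qed

definition fin_sat :: "('s, 'f, 'p, 'a) struc \<Rightarrow> 's list \<Rightarrow> (('s, 'f, 'p) fm \<times> 's list \<times> 'a list) set \<Rightarrow> bool" where
  "fin_sat N \<tau> C \<longleftrightarrow> (\<forall>q \<subseteq> C. finite q \<longrightarrow>
     (\<exists>as \<in> tuples N \<tau>. \<forall>(\<phi>, \<tau>', e) \<in> q. as @ e \<in> ext N (\<tau> @ \<tau>') \<phi>))"

lemma realize1:
  fixes N :: "('s, 'f, 'p, 'a) struc"
  assumes "saturated L \<kappa> N" "A \<subseteq> univ N" "|A| <o \<kappa>" and C: "C \<subseteq> conds L N A [s]" and sat: "fin_sat N [s] C"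
  shows "\<exists>a \<in> dom_of N s. \<forall>(\<phi>, \<tau>', e) \<in> C. [a] @ e \<in> ext N ([s] @ \<tau>') \<phi>"
proof -
  \<comment> \<open>Variable 0 is the one to be realized, so the parameters start at index
    1.\<close>
  define ev where "ev e v = e ! (snd v - 1)" for e :: "'a list" and v :: "'s var"
  have key: "sat N ((ev e)((s, 0) := a)) \<phi> \<longleftrightarrow> [a] @ e \<in> ext N ([s] @ \<tau>') \<phi>"
    if "(\<phi>, \<tau>', e) \<in> C" "a \<in> dom_of N s" for \<phi> \<tau>' e a
  proof -
    have 1: "\<phi> \<in> fms L ([s] @ \<tau>')" "e \<in> tuples N \<tau>'" using that C by (auto simp: conds_def)
    have "sat N ((ev e)((s, 0) := a)) \<phi> = sat N (std_env ([a] @ e)) \<phi>"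
    proof (rule sat_cong)
      fix v assume "v \<in> fv \<phi>"
      then have "snd v < length ([s] @ \<tau>') \<and> fst v = ([s] @ \<tau>') ! snd v"
        using 1 by (auto simp: fms_def in_std_vars)
      then show "((ev e)((s, 0) := a)) v = std_env ([a] @ e) v"
        by (cases v; cases "snd v") (auto simp: ev_def std_env_def)
    qed
    moreover have "[a] @ e \<in> tuples N ([s] @ \<tau>')" using that 1 by (intro tuples_appendI) auto
    ultimately show ?thesis by (simp add: ext_def)
  qed
  define p where "p = (\<lambda>(\<phi>, \<tau>', e). (\<phi>, ev e)) ` C"
  have "\<exists>a \<in> dom_of N (fst (s, 0::nat)). \<forall>(\<phi>, e) \<in> p. sat N (e((s, 0) := a)) \<phi>"
  proof (rule assms(1)[unfolded saturated_def, rule_format, of A p "(s, 0)"], intro conjI allI impI)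
    show "\<forall>(\<phi>, e) \<in> p. \<phi> \<in> formulas L \<and> params N A (fv \<phi> - {(s, 0)}) e"
    proof clarify
      fix \<phi> e' assume "(\<phi>, e') \<in> p"
      then obtain \<tau>' e where *: "(\<phi>, \<tau>', e) \<in> C" "e' = ev e" by (auto simp: p_def)
      then have 1: "\<phi> \<in> fms L ([s] @ \<tau>')" "e \<in> tuples N \<tau>'" "set e \<subseteq> A" using C by (auto simp: conds_def)
      have "ev e v \<in> A \<inter> dom_of N (fst v)" if "v \<in> fv \<phi> - {(s, 0)}" for v
      proof -
        have v: "snd v < length ([s] @ \<tau>') \<and> fst v = ([s] @ \<tau>') ! snd v"
          using that 1 by (auto simp: fms_def in_std_vars)
        with that obtain j where "snd v = Suc j" by (cases v; cases "snd v") auto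
        with v 1 show ?thesis by (auto simp: ev_def tuples_iff)
      qed
      with 1 * show "\<phi> \<in> formulas L \<and> params N A (fv \<phi> - {(s, 0)}) e'" by (auto simp: fms_def params_def)
    qed
    fix q assume "q \<subseteq> p" "finite q"
    then obtain q' where q': "q' \<subseteq> C" "finite q'" "q = (\<lambda>(\<phi>, \<tau>', e). (\<phi>, ev e)) ` q'"
      using finite_subset_image[OF \<open>finite q\<close>] unfolding p_def by blast
    with sat obtain as where as: "as \<in> tuples N [s]" "\<forall>(\<phi>, \<tau>', e) \<in> q'. as @ e \<in> ext N ([s] @ \<tau>') \<phi>"
      unfolding fin_sat_def by blast
    then obtain a where "as = [a]" "a \<in> dom_of N s" by (auto simp: tuples_def list_all2_Cons2)
    have "sat N ((snd t)((s, 0) := a)) (fst t)" if t: "t \<in> q" for t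
    proof -
      from t q'(3) obtain \<phi> \<tau>' e where 1: "(\<phi>, \<tau>', e) \<in> q'" "t = (\<phi>, ev e)" by auto
      with q'(1) have "(\<phi>, \<tau>', e) \<in> C" by blast
      moreover from as(2) 1(1) have "[a] @ e \<in> ext N ([s] @ \<tau>') \<phi>" using \<open>as = [a]\<close> by auto
      ultimately show ?thesis using key \<open>a \<in> dom_of N s\<close> 1(2) by simp
    qed
    with \<open>a \<in> dom_of N s\<close> show "\<exists>a \<in> dom_of N (fst (s, 0::nat)). \<forall>(\<phi>, e) \<in> q. sat N (e((s, 0) := a)) \<phi>"
      by (intro bexI[of _ a]) auto
  qed (use assms in auto)
  then obtain a where a: "a \<in> dom_of N s" "\<forall>(\<phi>, e) \<in> p. sat N (e((s, 0) := a)) \<phi>" by auto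
  have "[a] @ e \<in> ext N ([s] @ \<tau>') \<phi>" if "(\<phi>, \<tau>', e) \<in> C" for \<phi> \<tau>' e
  proof -
    have "(\<phi>, ev e) \<in> p" using that by (force simp: p_def)
    with a(2) key[OF that a(1)] show ?thesis by auto
  qed
  with a(1) show ?thesis by blast
qed

text \<open>\<open>saturated\<close> concerns a single variable. For a tuple, the first coordinate
  is chosen so that every finite part of \<open>C\<close> stays solvable in the other coordinates;
  this is itself a type in one variable over the same parameters. The chosen element then joins the
  parameters.\<close>

lemma realize:
  fixes N :: "('s, 'f, 'p, 'a) struc"
  assumes sat: "saturated L \<kappa> N" and N: "is_struc L N" and \<kappa>: "Card_order \<kappa>" "infinite (Field \<kappa>)"
  shows "A \<subseteq> univ N \<Longrightarrow> |A| <o \<kappa> \<Longrightarrow> C \<subseteq> conds L N A \<tau> \<Longrightarrow> fin_sat N \<tau> C \<Longrightarrow>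
    \<exists>as \<in> tuples N \<tau>. \<forall>(\<phi>, \<tau>', e) \<in> C. as @ e \<in> ext N (\<tau> @ \<tau>') \<phi>"
proof (induction \<tau> arbitrary: A C)
  case Nil
  have "[] @ e \<in> ext N ([] @ \<tau>') \<phi>" if "(\<phi>, \<tau>', e) \<in> C" for \<phi> \<tau>' e
    using Nil.prems(4)[unfolded fin_sat_def, rule_format, of "{(\<phi>, \<tau>', e)}"] that by auto
  then show ?case by auto
next
  case (Cons s \<tau>)
  define holds where "holds q a \<longleftrightarrow> (\<exists>as \<in> tuples N \<tau>. \<forall>(\<phi>, \<tau>', e) \<in> q. (a # as) @ e \<in> ext N ((s # \<tau>) @ \<tau>') \<phi>)" for q a
  \<comment> \<open>\<open>D\<close> collects, for all finite parts \<open>q\<close> of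
    \<open>C\<close>, the formulas equivalent to solvability of \<open>q\<close> once the first
    coordinate is given.\<close>
  define D where "D = {(\<psi>, \<mu>, m). \<psi> \<in> fms L ([s] @ \<mu>) \<and> m \<in> tuples N \<mu> \<and> set m \<subseteq> A \<and>
    (\<exists>q \<subseteq> C. finite q \<and> (\<forall>a \<in> dom_of N s. [a] @ m \<in> ext N ([s] @ \<mu>) \<psi> \<longleftrightarrow> holds q a))}"
  have ex: "\<exists>\<psi> \<mu> m. (\<psi>, \<mu>, m) \<in> D \<and> (\<forall>a \<in> dom_of N s. [a] @ m \<in> ext N ([s] @ \<mu>) \<psi> \<longleftrightarrow> holds q a)"
    if q: "q \<subseteq> C" "finite q" for q
  proof -
    have "q \<subseteq> conds L N A (s # \<tau>)" using q(1) Cons.prems(3) by blast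
    from merge[OF N q(2) this] obtain \<mu> m \<chi> where m: "m \<in> tuples N \<mu>" "set m \<subseteq> A"
      and \<chi>: "\<chi> \<in> fms L ((s # \<tau>) @ \<mu>)"
      and *: "\<And>as. as \<in> tuples N (s # \<tau>) \<Longrightarrow> as @ m \<in> ext N ((s # \<tau>) @ \<mu>) \<chi> \<longleftrightarrow>
        (\<forall>(\<phi>, \<tau>', e) \<in> q. as @ e \<in> ext N ((s # \<tau>) @ \<tau>') \<phi>)" by metis
    obtain h0 where h0: "reidx [s] ([] @ [s] @ (\<mu> @ \<tau>)) h0"
      "\<And>as ys. length as = length [s] \<Longrightarrow> pick h0 ([] @ as @ ys) = (as :: 'a list)"
      using ex_reidx_append[of "[s]" "[]" "\<mu> @ \<tau>"] by auto
    obtain h1 where h1: "reidx \<tau> (([s] @ \<mu>) @ \<tau> @ []) h1"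
      "\<And>xs as ys. length xs = length ([s] @ \<mu>) \<Longrightarrow> length as = length \<tau> \<Longrightarrow> pick h1 (xs @ as @ ys) = (as :: 'a list)"
      using ex_reidx_append by blast
    obtain h2 where h2: "reidx \<mu> ([s] @ \<mu> @ \<tau>) h2"
      "\<And>xs as ys. length xs = length [s] \<Longrightarrow> length as = length \<mu> \<Longrightarrow> pick h2 (xs @ as @ ys) = (as :: 'a list)"
      using ex_reidx_append by blast
    have r: "reidx ((s # \<tau>) @ \<mu>) (([s] @ \<mu>) @ \<tau>) (h0 @ h1 @ h2)"
      using reidx_append[of "[s]" _ h0 "\<tau> @ \<mu>" "h1 @ h2"] reidx_append[of \<tau> _ h1 \<mu> h2] h0(1) h1(1) h2(1) by simp
    define \<psi>0 where "\<psi>0 = reindex ((s # \<tau>) @ \<mu>) (([s] @ \<mu>) @ \<tau>) (h0 @ h1 @ h2) \<chi>"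
    have \<psi>0: "\<psi>0 \<in> fms L (([s] @ \<mu>) @ \<tau>)" unfolding \<psi>0_def by (rule fms_reindex[OF r \<chi>])
    define \<psi> where "\<psi> = exs ([s] @ \<mu>) \<tau> \<psi>0"
    have \<psi>: "\<psi> \<in> fms L ([s] @ \<mu>)" unfolding \<psi>_def by (rule fms_exs[OF \<psi>0])
    have "[a] @ m \<in> ext N ([s] @ \<mu>) \<psi> \<longleftrightarrow> holds q a" if a: "a \<in> dom_of N s" for a
    proof -
      have "([a] @ m) @ as \<in> ext N (([s] @ \<mu>) @ \<tau>) \<psi>0 \<longleftrightarrow> (\<forall>(\<phi>, \<tau>', e) \<in> q. (a # as) @ e \<in> ext N ((s # \<tau>) @ \<tau>') \<phi>)"
        if as: "as \<in> tuples N \<tau>" for as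
      proof -
        have "([a] @ m) @ as \<in> tuples N (([s] @ \<mu>) @ \<tau>)" using a as m by (intro tuples_appendI) auto
        moreover have "pick (h0 @ h1 @ h2) (([a] @ m) @ as) = (a # as) @ m"
          using h0(2)[of "[a]" "m @ as"] h1(2)[of "[a] @ m" as "[]"] h2(2)[of "[a]" m as] as m(1)
          by (simp add: pick_append tuples_length)
        ultimately show ?thesis
          using *[of "a # as"] a as tuples_appendI[of "[a]" N "[s]" as \<tau>]
          unfolding \<psi>0_def ext_reindex[OF r \<chi> N] by simp
      qed
      moreover have "[a] @ m \<in> tuples N ([s] @ \<mu>)" using a m by (intro tuples_appendI) auto
      ultimately show ?thesis unfolding \<psi>_def ext_exs[OF \<psi>0] holds_def by blast
    qed
    then show ?thesis using \<psi> m q unfolding D_def by blast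
  qed
  have DC: "D \<subseteq> conds L N A [s]" by (auto simp: D_def conds_def)
  have "fin_sat N [s] D"
    unfolding fin_sat_def
  proof (intro allI impI)
    fix d assume d: "d \<subseteq> D" "finite d"
    have "\<forall>t \<in> d. \<exists>q \<subseteq> C. finite q \<and> (\<forall>a \<in> dom_of N s. [a] @ snd (snd t) \<in> ext N ([s] @ fst (snd t)) (fst t) \<longleftrightarrow> holds q a)"
      using d(1) by (auto simp: D_def)
    then obtain Q where Q: "\<And>t. t \<in> d \<Longrightarrow> Q t \<subseteq> C \<and> finite (Q t) \<and>
        (\<forall>a \<in> dom_of N s. [a] @ snd (snd t) \<in> ext N ([s] @ fst (snd t)) (fst t) \<longleftrightarrow> holds (Q t) a)"
      by metis
    define q where "q = \<Union> (Q ` d)"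
    have "q \<subseteq> C" "finite q" using Q d(2) unfolding q_def by blast+
    with Cons.prems(4) obtain as where as: "as \<in> tuples N (s # \<tau>)" "\<forall>(\<phi>, \<tau>', e) \<in> q. as @ e \<in> ext N ((s # \<tau>) @ \<tau>') \<phi>"
      unfolding fin_sat_def by blast
    then obtain a as' where a: "as = a # as'" "a \<in> dom_of N s" "as' \<in> tuples N \<tau>"
      by (auto simp: tuples_def list_all2_Cons2)
    have "holds (Q t) a" if "t \<in> d" for t
      unfolding holds_def by (rule bexI[of _ as']) (use as a that in \<open>auto simp: q_def\<close>)
    then show "\<exists>as \<in> tuples N [s]. \<forall>(\<phi>, \<tau>', e) \<in> d. as @ e \<in> ext N ([s] @ \<tau>') \<phi>"
      using a Q by (intro bexI[of _ "[a]"]) (auto simp: split_beta)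
  qed
  from realize1[OF sat Cons.prems(1,2) DC this]
  obtain a where a: "a \<in> dom_of N s" "\<And>t. t \<in> D \<Longrightarrow> [a] @ snd (snd t) \<in> ext N ([s] @ fst (snd t)) (fst t)"
    by (auto simp: split_beta)
  have holds: "holds q a" if "q \<subseteq> C" "finite q" for q
    using ex[OF that] a(1) a(2) by (metis fst_conv snd_conv)
  have "\<exists>hs. reidx ((s # \<tau>) @ \<tau>') (\<tau> @ (s # \<tau>')) hs \<and> (\<forall>as a e. length as = length \<tau> \<longrightarrow>
    length e = length \<tau>' \<longrightarrow> pick hs (as @ a # e) = ((a :: 'a) # as) @ e)" for \<tau>'
  proof -
    obtain h0 where h0: "reidx \<tau> ([] @ \<tau> @ (s # \<tau>')) h0"
      "\<And>as ys. length as = length \<tau> \<Longrightarrow> pick h0 ([] @ as @ ys) = (as :: 'a list)"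
      using ex_reidx_append[of \<tau> "[]" "s # \<tau>'"] by auto
    obtain h1 where h1: "reidx [s] (\<tau> @ [s] @ \<tau>') h1"
      "\<And>xs as ys. length xs = length \<tau> \<Longrightarrow> length as = length [s] \<Longrightarrow> pick h1 (xs @ as @ ys) = (as :: 'a list)"
      using ex_reidx_append by blast
    obtain h2 where h2: "reidx \<tau>' ((\<tau> @ [s]) @ \<tau>' @ []) h2"
      "\<And>xs as ys. length xs = length (\<tau> @ [s]) \<Longrightarrow> length as = length \<tau>' \<Longrightarrow> pick h2 (xs @ as @ ys) = (as :: 'a list)"
      using ex_reidx_append by blast
    have "reidx ([s] @ \<tau> @ \<tau>') (\<tau> @ (s # \<tau>')) (h1 @ h0 @ h2)"
      by (intro reidx_append) (use h0(1) h1(1) h2(1) in auto)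
    moreover have "pick (h1 @ h0 @ h2) (as @ a # e) = (a # as) @ e" if "length as = length \<tau>" "length e = length \<tau>'" for as e and a :: 'a
      using h0(2)[of as "a # e"] h1(2)[of as "[a]" e] h2(2)[of "as @ [a]" e "[]"] that by (simp add: pick_append)
    ultimately show ?thesis by (intro exI[of _ "h1 @ h0 @ h2"]) auto
  qed
  then obtain H where r: "\<And>\<tau>'. reidx ((s # \<tau>) @ \<tau>') (\<tau> @ (s # \<tau>')) (H \<tau>')"
    and H: "\<And>\<tau>' as a e. length as = length \<tau> \<Longrightarrow> length e = length \<tau>' \<Longrightarrow> pick (H \<tau>') (as @ a # e) = ((a :: 'a) # as) @ e"
    by metis
  \<comment> \<open>The first coordinate has a value now and moves from the variables to the head of
    the parameter tuple.\<close>
  define \<Phi> :: "('s, 'f, 'p) fm \<times> 's list \<times> 'a list \<Rightarrow> ('s, 'f, 'p) fm \<times> 's list \<times> 'a list" where "\<Phi> = (\<lambda>(\<phi>, \<tau>', e). (reindex ((s # \<tau>) @ \<tau>') (\<tau> @ (s # \<tau>')) (H \<tau>') \<phi>, s # \<tau>', a # e))"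
  have key: "as @ a # e \<in> ext N (\<tau> @ s # \<tau>') (fst (\<Phi> (\<phi>, \<tau>', e))) \<longleftrightarrow> (a # as) @ e \<in> ext N ((s # \<tau>) @ \<tau>') \<phi>"
    if "(\<phi>, \<tau>', e) \<in> C" "as \<in> tuples N \<tau>" for as \<phi> \<tau>' e
  proof -
    have 1: "\<phi> \<in> fms L ((s # \<tau>) @ \<tau>')" "e \<in> tuples N \<tau>'" using that Cons.prems(3) by (auto simp: conds_def)
    have "pick (H \<tau>') (as @ a # e) = (a # as) @ e"
      by (rule H) (use that(2) 1(2) in \<open>auto simp: tuples_length\<close>)
    moreover have "as @ a # e \<in> tuples N (\<tau> @ s # \<tau>')" using that 1 a
      using tuples_appendI[of as N \<tau> "a # e" "s # \<tau>'"] tuples_appendI[of "[a]" N "[s]" e \<tau>'] by simp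
    ultimately show ?thesis unfolding \<Phi>_def using ext_reindex[OF r 1(1) N] by simp
  qed
  have c1: "\<Phi> ` C \<subseteq> conds L N (A \<union> {a}) \<tau>"
  proof (intro image_subsetI, unfold split_paired_all)
    fix \<phi> \<tau>' e assume "(\<phi>, \<tau>', e) \<in> C"
    then have 1: "\<phi> \<in> fms L ((s # \<tau>) @ \<tau>')" "e \<in> tuples N \<tau>'" "set e \<subseteq> A" using Cons.prems(3) by (auto simp: conds_def)
    with a tuples_appendI[of "[a]" N "[s]" e \<tau>'] fms_reindex[OF r 1(1)]
    show "\<Phi> (\<phi>, \<tau>', e) \<in> conds L N (A \<union> {a}) \<tau>" by (auto simp: \<Phi>_def conds_def)
  qed
  have c2: "fin_sat N \<tau> (\<Phi> ` C)"
    unfolding fin_sat_def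
  proof (intro allI impI)
    fix q' assume "q' \<subseteq> \<Phi> ` C" "finite q'"
    then obtain q where q: "q \<subseteq> C" "finite q" "q' = \<Phi> ` q"
      using finite_subset_image[OF \<open>finite q'\<close>] by blast
    from holds[OF q(1,2)] obtain as where as: "as \<in> tuples N \<tau>" "\<forall>(\<phi>, \<tau>', e) \<in> q. (a # as) @ e \<in> ext N ((s # \<tau>) @ \<tau>') \<phi>"
      unfolding holds_def by blast
    have "as @ a # e \<in> ext N (\<tau> @ s # \<tau>') (fst (\<Phi> (\<phi>, \<tau>', e)))" if t: "(\<phi>, \<tau>', e) \<in> q" for \<phi> \<tau>' e
    proof -
      have "(\<phi>, \<tau>', e) \<in> C" using t q(1) by blast
      moreover have "(a # as) @ e \<in> ext N ((s # \<tau>) @ \<tau>') \<phi>" using as(2) t by blast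
      ultimately show ?thesis using key as(1) by blast
    qed
    with as(1) show "\<exists>as \<in> tuples N \<tau>. \<forall>(\<phi>, \<tau>', e) \<in> q'. as @ e \<in> ext N (\<tau> @ \<tau>') \<phi>"
      unfolding q(3) by (intro bexI[of _ as]) (auto simp: \<Phi>_def)
  qed
  have c3: "|A \<union> {a}| <o \<kappa>"
    by (rule Un_ordLess[OF \<kappa> Cons.prems(2) finite_ordLess_Card_order[OF \<kappa>]]) simp
  have "A \<union> {a} \<subseteq> univ N" using Cons.prems(1) a(1) by (auto simp: dom_of_def)
  from Cons.IH[OF this c3 c1 c2]
  obtain as where as: "as \<in> tuples N \<tau>" "\<forall>(\<phi>, \<tau>', e) \<in> \<Phi> ` C. as @ e \<in> ext N (\<tau> @ \<tau>') \<phi>"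
    by blast
  then have "(a # as) @ e \<in> ext N ((s # \<tau>) @ \<tau>') \<phi>" if "(\<phi>, \<tau>', e) \<in> C" for \<phi> \<tau>' e
  proof -
    have "\<Phi> (\<phi>, \<tau>', e) \<in> \<Phi> ` C" using that by (rule imageI)
    with as(2) have "as @ a # e \<in> ext N (\<tau> @ s # \<tau>') (fst (\<Phi> (\<phi>, \<tau>', e)))" by (auto simp: \<Phi>_def)
    with key[OF that as(1)] show ?thesis by simp
  qed
  moreover have "a # as \<in> tuples N (s # \<tau>)" using tuples_appendI[of "[a]" N "[s]" as \<tau>] a as by simp
  ultimately show ?case by blast
qed

section \<open>Families of tuples and their types\<close>

definition famsat :: "('s, 'f, 'p, 'a) struc \<Rightarrow> 's list \<Rightarrow> 's list \<Rightarrow> 'a list \<Rightarrow> ('i \<Rightarrow> 'a list) \<Rightarrow> 'i list \<times> ('s, 'f, 'p) fm \<Rightarrow> bool" where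
  "famsat N \<sigma> \<epsilon> e f = (\<lambda>(is, \<phi>). cat f is @ e \<in> ext N (pow \<sigma> (length is) @ \<epsilon>) \<phi>)"

text \<open>The blocks of \<open>b\<close> prescribe the values at the entries of \<open>js\<close>;
  distinctness keeps these prescriptions from conflicting.\<close>

lemma ex_cat_eq:
  assumes "distinct js" "b \<in> tuples N (pow \<sigma> (length js))" "\<And>j. f j \<in> tuples N \<sigma>"
  shows "\<exists>g. (\<forall>j. g j \<in> tuples N \<sigma>) \<and> (\<forall>j. j \<notin> set js \<longrightarrow> g j = f j) \<and> cat g js = b"
  using assms(1,2)
proof (induction js arbitrary: b)
  case Nil
  then show ?case using assms(3) by (intro exI[of _ f]) auto
next
  case (Cons i js)
  then obtain y z where b: "b = y @ z" "y \<in> tuples N \<sigma>" "z \<in> tuples N (pow \<sigma> (length js))"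
    by (auto elim: tuples_appendE)
  with Cons obtain g where g: "\<forall>j. g j \<in> tuples N \<sigma>" "\<forall>j. j \<notin> set js \<longrightarrow> g j = f j" "cat g js = z"
    by auto
  define g' where "g' = g(i := y)"
  have "map g' js = map g js" using Cons.prems(1) by (auto simp: g'_def)
  then have "cat g' js = cat g js" by (simp only:)
  moreover have "g' i = y" by (simp add: g'_def)
  ultimately have "cat g' (i # js) = b" using b g(3) by simp
  moreover have "\<forall>j. g' j \<in> tuples N \<sigma>" "\<forall>j. j \<notin> set (i # js) \<longrightarrow> g' j = f j" using g(1,2) b(2) by (auto simp: g'_def)
  ultimately show ?case by blast
qed

text \<open>The values of the family outside \<open>i\<close> and \<open>ds\<close> are quantified away.\<close>

lemma famsat_formula:
  fixes N :: "('s, 'f, 'p, 'a) struc" and i :: 'i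
  assumes N: "is_struc L N" and e: "e \<in> tuples N \<epsilon>" and "finite q"
    and q: "\<And>is \<phi>. (is, \<phi>) \<in> q \<Longrightarrow> \<phi> \<in> fms L (pow \<sigma> (length is) @ \<epsilon>)"
    and f: "\<And>i. f i \<in> tuples N \<sigma>" and i: "i \<notin> set ds"
  shows "\<exists>\<psi> \<in> fms L (\<sigma> @ (pow \<sigma> (length ds) @ \<epsilon>)). \<forall>a \<in> tuples N \<sigma>.
    a @ (cat f ds @ e) \<in> ext N (\<sigma> @ (pow \<sigma> (length ds) @ \<epsilon>)) \<psi> \<longleftrightarrow>
    (\<exists>g. (\<forall>j. g j \<in> tuples N \<sigma>) \<and> g i = a \<and> (\<forall>j\<in>set ds. g j = f j) \<and> (\<forall>c\<in>q. famsat N \<sigma> \<epsilon> e g c))"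
proof -
  have "finite (\<Union>(set ` fst ` q) - {i} - set ds)" using \<open>finite q\<close> by auto
  from finite_distinct_list[OF this]
  obtain js where js: "set js = \<Union>(set ` fst ` q) - {i} - set ds" "distinct js" by (elim exE conjE)
  let ?bs = "(i # ds) @ js"
  obtain cs where cs: "set cs = q" using finite_list[OF \<open>finite q\<close>] by (elim exE)
  define \<chi> where "\<chi> = conj (map (\<lambda>(is, \<phi>). refam \<sigma> \<epsilon> ?bs is \<phi>) cs)"
  have sub: "set is \<subseteq> set ?bs" if "(is, \<phi>) \<in> q" for "is" \<phi>
  proof -
    have "set is \<in> set ` fst ` q" using imageI[OF imageI[OF that, of fst], of set] by simp
    then show ?thesis using js(1) by auto
  qed
  have fr: "refam \<sigma> \<epsilon> ?bs is \<phi> \<in> fms L (pow \<sigma> (length ?bs) @ \<epsilon>)" if "(is, \<phi>) \<in> q" for "is" \<phi>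
    using fms_refam[OF sub q] that by blast
  have \<chi>: "\<chi> \<in> fms L (pow \<sigma> (length ?bs) @ \<epsilon>)" unfolding \<chi>_def
    by (rule fms_conj) (use cs fr in auto)
  have ext\<chi>: "cat g ?bs @ e \<in> ext N (pow \<sigma> (length ?bs) @ \<epsilon>) \<chi> \<longleftrightarrow> (\<forall>c\<in>q. famsat N \<sigma> \<epsilon> e g c)"
    if g: "\<And>j. g j \<in> tuples N \<sigma>" for g
  proof -
    have "cat g ?bs @ e \<in> tuples N (pow \<sigma> (length ?bs) @ \<epsilon>)" by (intro tuples_appendI cat_tuples g e)
    moreover have "cat g ?bs @ e \<in> ext N (pow \<sigma> (length ?bs) @ \<epsilon>) (refam \<sigma> \<epsilon> ?bs is \<phi>) \<longleftrightarrow> famsat N \<sigma> \<epsilon> e g (is, \<phi>)"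
      if "(is, \<phi>) \<in> q" for "is" \<phi>
      unfolding famsat_def prod.case by (rule ext_refam[OF sub[OF that] q[OF that] N _ e]) (rule g)
    ultimately show ?thesis unfolding \<chi>_def ext_conj[OF N] using cs by fastforce
  qed
  let ?P = "pow \<sigma> (length ds)" and ?J = "pow \<sigma> (length js)"
  have bs: "pow \<sigma> (length ?bs) = \<sigma> @ ?P @ ?J" using pow_add[of "Suc (length ds)" "length js" \<sigma>] by simp
  obtain h1 where h1: "reidx (\<sigma> @ ?P) ([] @ (\<sigma> @ ?P) @ (\<epsilon> @ ?J)) h1"
    "\<And>as ys. length as = length (\<sigma> @ ?P) \<Longrightarrow> pick h1 ([] @ as @ ys) = (as :: 'a list)"
    using ex_reidx_append[of "\<sigma> @ ?P" "[]" "\<epsilon> @ ?J"] by auto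
  obtain h2 where h2: "reidx ?J ((\<sigma> @ ?P @ \<epsilon>) @ ?J @ []) h2"
    "\<And>xs as ys. length xs = length (\<sigma> @ ?P @ \<epsilon>) \<Longrightarrow> length as = length ?J \<Longrightarrow> pick h2 (xs @ as @ ys) = (as :: 'a list)"
    using ex_reidx_append by blast
  obtain h3 where h3: "reidx \<epsilon> ((\<sigma> @ ?P) @ \<epsilon> @ ?J) h3"
    "\<And>xs as ys. length xs = length (\<sigma> @ ?P) \<Longrightarrow> length as = length \<epsilon> \<Longrightarrow> pick h3 (xs @ as @ ys) = (as :: 'a list)"
    using ex_reidx_append by blast
  have r: "reidx (pow \<sigma> (length ?bs) @ \<epsilon>) ((\<sigma> @ (?P @ \<epsilon>)) @ ?J) ((h1 @ h2) @ h3)"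
    unfolding bs using reidx_append[of "\<sigma> @ ?P" "(\<sigma> @ (?P @ \<epsilon>)) @ ?J" h1 "?J @ \<epsilon>" "h2 @ h3"]
      reidx_append[of ?J "(\<sigma> @ (?P @ \<epsilon>)) @ ?J" h2 \<epsilon> h3] h1(1) h2(1) h3(1) by simp
  define \<chi>' where "\<chi>' = reindex (pow \<sigma> (length ?bs) @ \<epsilon>) ((\<sigma> @ (?P @ \<epsilon>)) @ ?J) ((h1 @ h2) @ h3) \<chi>"
  have \<chi>': "\<chi>' \<in> fms L ((\<sigma> @ (?P @ \<epsilon>)) @ ?J)" unfolding \<chi>'_def by (rule fms_reindex[OF r \<chi>])
  have lf: "length (cat f ds) = length ds * length \<sigma>" by (rule length_cat) (use f tuples_length in blast)
  have "a @ (cat f ds @ e) \<in> ext N (\<sigma> @ (?P @ \<epsilon>)) (exs (\<sigma> @ (?P @ \<epsilon>)) ?J \<chi>') \<longleftrightarrow>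
    (\<exists>g. (\<forall>j. g j \<in> tuples N \<sigma>) \<and> g i = a \<and> (\<forall>j\<in>set ds. g j = f j) \<and> (\<forall>c\<in>q. famsat N \<sigma> \<epsilon> e g c))"
    (is "?l \<longleftrightarrow> ?r") if a: "a \<in> tuples N \<sigma>" for a
  proof -
    have t: "a @ (cat f ds @ e) \<in> tuples N (\<sigma> @ (?P @ \<epsilon>))" by (intro tuples_appendI a e cat_tuples f)
    have x: "(a @ (cat f ds @ e)) @ b \<in> ext N ((\<sigma> @ (?P @ \<epsilon>)) @ ?J) \<chi>' \<longleftrightarrow>
        ((a @ cat f ds) @ b) @ e \<in> ext N (pow \<sigma> (length ?bs) @ \<epsilon>) \<chi>" if b: "b \<in> tuples N ?J" for b
    proof -
      have "pick ((h1 @ h2) @ h3) ((a @ (cat f ds @ e)) @ b) = ((a @ cat f ds) @ b) @ e"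
        using h1(2)[of "a @ cat f ds" "e @ b"] h2(2)[of "a @ (cat f ds @ e)" b "[]"] h3(2)[of "a @ cat f ds" e b]
          lf tuples_length[OF a] tuples_length[OF e] tuples_length[OF b] by (simp add: pick_append)
      then show ?thesis unfolding \<chi>'_def ext_reindex[OF r \<chi> N] using t b by (simp add: tuples_appendI del: append_assoc)
    qed
    show ?thesis
    proof
      assume ?l
      then obtain b where b: "b \<in> tuples N ?J" "((a @ cat f ds) @ b) @ e \<in> ext N (pow \<sigma> (length ?bs) @ \<epsilon>) \<chi>"
        unfolding ext_exs[OF \<chi>'] using x by blast
      define f' where "f' = f(i := a)"
      have f': "f' j \<in> tuples N \<sigma>" for j using f a by (simp add: f'_def)
      from ex_cat_eq[of js b N \<sigma> f', OF js(2) b(1) f'] obtain g where gt': "\<forall>j. g j \<in> tuples N \<sigma>"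
        and g: "\<forall>j. j \<notin> set js \<longrightarrow> g j = f' j" and catg: "cat g js = b" by (elim exE conjE)
      then have gt: "g j \<in> tuples N \<sigma>" for j by simp
      have gd: "g j = f j" if "j \<in> set ds" for j using that i js g by (auto simp: f'_def)
      then have "cat g ds = cat f ds" by (metis (mono_tags, lifting) map_eq_conv)
      moreover have gi: "g i = a" using js g by (simp add: f'_def)
      ultimately have gb: "cat g ?bs = (a @ cat f ds) @ b" using catg by simp
      have "\<forall>c\<in>q. famsat N \<sigma> \<epsilon> e g c" using ext\<chi>[of g, OF gt, unfolded gb] b(2) by (rule iffD1)
      then show ?r using gt gd gi by (intro exI[of _ g] conjI allI ballI) auto
    next
      assume ?r
      then obtain g where g: "\<And>j. g j \<in> tuples N \<sigma>" "g i = a" "\<And>j. j\<in>set ds \<Longrightarrow> g j = f j" "\<forall>c\<in>q. famsat N \<sigma> \<epsilon> e g c"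
        by blast
      have "cat g ds = cat f ds" using g(3) by (metis (mono_tags, lifting) map_eq_conv)
      then have gb: "cat g ?bs = (a @ cat f ds) @ cat g js" using g(2) by simp
      have "((a @ cat f ds) @ cat g js) @ e \<in> ext N (pow \<sigma> (length ?bs) @ \<epsilon>) \<chi>"
        using ext\<chi>[of g, OF g(1), unfolded gb] g(4) by (rule iffD2)
      moreover have "cat g js \<in> tuples N ?J" by (rule cat_tuples) (rule g)
      ultimately show ?l unfolding ext_exs[OF \<chi>'] using x t by blast
    qed
  qed
  moreover have "exs (\<sigma> @ (?P @ \<epsilon>)) ?J \<chi>' \<in> fms L (\<sigma> @ (?P @ \<epsilon>))" by (rule fms_exs[OF \<chi>'])
  ultimately show ?thesis by blast
qed

lemma tuples_set: "as \<in> tuples N \<tau> \<Longrightarrow> set as \<subseteq> univ N"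
  by (auto simp: tuples_iff dom_of_def in_set_conv_nth)

text \<open>The values are chosen one after the other along an enumeration of the countable index
  type. Each choice has finitely many parameters, namely the earlier values and \<open>e\<close>, so
  \<open>realize\<close> applies. What has to be preserved is that every finite part of
  \<open>C\<close> is still satisfied by some family with the values chosen so far.\<close>

lemma realize_family:
  fixes N :: "('s, 'f, 'p, 'a) struc" and C :: "('i :: countable list \<times> ('s, 'f, 'p) fm) set"
  assumes sat: "saturated L \<kappa> N" and N: "is_struc L N" and \<kappa>: "Card_order \<kappa>" "infinite (Field \<kappa>)"
    and e: "e \<in> tuples N \<epsilon>"
    and C': "\<forall>(is, \<phi>) \<in> C. \<phi> \<in> fms L (pow \<sigma> (length is) @ \<epsilon>)"
    and fin': "\<forall>q. q \<subseteq> C \<longrightarrow> finite q \<longrightarrow> (\<exists>f. (\<forall>i. f i \<in> tuples N \<sigma>) \<and> (\<forall>c\<in>q. famsat N \<sigma> \<epsilon> e f c))"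
  shows "\<exists>f. (\<forall>i. f i \<in> tuples N \<sigma>) \<and> (\<forall>c\<in>C. famsat N \<sigma> \<epsilon> e f c)"
proof -
  have C: "\<phi> \<in> fms L (pow \<sigma> (length is) @ \<epsilon>)" if "(is, \<phi>) \<in> C" for "is" \<phi> using C' that by blast
  have fin: "\<exists>f. (\<forall>i. f i \<in> tuples N \<sigma>) \<and> (\<forall>c\<in>q. famsat N \<sigma> \<epsilon> e f c)" if "q \<subseteq> C" "finite q" for q
    using fin' that by blast
  define \<iota> :: "nat \<Rightarrow> 'i" where "\<iota> = from_nat"
  define I where "I n f \<longleftrightarrow> (\<forall>i. f i \<in> tuples N \<sigma>) \<and> (\<forall>q. q \<subseteq> C \<longrightarrow> finite q \<longrightarrow>
    (\<exists>g. (\<forall>i. g i \<in> tuples N \<sigma>) \<and> (\<forall>i\<in>\<iota> ` {..<n}. g i = f i) \<and> (\<forall>c\<in>q. famsat N \<sigma> \<epsilon> e g c)))" for n f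
  have "\<exists>f. I 0 f" using fin[of "{}"] fin by (auto simp: I_def)
  moreover have "\<exists>f'. I (Suc n) f' \<and> (\<forall>i\<in>\<iota> ` {..<n}. f' i = f i)" if I: "I n f" for n f
  proof (cases "\<iota> n \<in> \<iota> ` {..<n}")
    \<comment> \<open>The enumeration may repeat an index; its value has then been chosen
      before.\<close>
    case True
    then have "\<iota> ` {..<Suc n} = \<iota> ` {..<n}" by (auto simp: lessThan_Suc)
    with I show ?thesis unfolding I_def by auto
  next
    case False
    define ds where "ds = map \<iota> [0..<n]"
    have ds: "set ds = \<iota> ` {..<n}" by (auto simp: ds_def)
    let ?\<mu> = "pow \<sigma> (length ds) @ \<epsilon>" and ?m = "cat f ds @ e"
    have f: "\<And>i. f i \<in> tuples N \<sigma>" using I by (auto simp: I_def)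
    have m: "?m \<in> tuples N ?\<mu>" by (intro tuples_appendI cat_tuples f e)
    define holds where "holds q a \<longleftrightarrow> (\<exists>g. (\<forall>j. g j \<in> tuples N \<sigma>) \<and> g (\<iota> n) = a \<and> (\<forall>j\<in>set ds. g j = f j) \<and> (\<forall>c\<in>q. famsat N \<sigma> \<epsilon> e g c))" for q a
    \<comment> \<open>Solvability of a finite part of \<open>C\<close>, given the values chosen so
      far, becomes a formula about the next value alone.\<close>
    have ex: "\<exists>\<psi> \<in> fms L (\<sigma> @ ?\<mu>). \<forall>a \<in> tuples N \<sigma>. a @ ?m \<in> ext N (\<sigma> @ ?\<mu>) \<psi> \<longleftrightarrow> holds q a"
      if "q \<subseteq> C" "finite q" for q
      unfolding holds_def by (rule famsat_formula[OF N e that(2)]) (use that C f False ds in auto)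
    define D where "D = {(\<psi>, ?\<mu>, ?m) | \<psi>. \<psi> \<in> fms L (\<sigma> @ ?\<mu>) \<and>
      (\<exists>q \<subseteq> C. finite q \<and> (\<forall>a \<in> tuples N \<sigma>. a @ ?m \<in> ext N (\<sigma> @ ?\<mu>) \<psi> \<longleftrightarrow> holds q a))}"
    have "\<exists>as \<in> tuples N \<sigma>. \<forall>(\<phi>, \<tau>', e) \<in> D. as @ e \<in> ext N (\<sigma> @ \<tau>') \<phi>"
    proof (rule realize[OF sat N \<kappa>])
      show "D \<subseteq> conds L N (set ?m) \<sigma>" using m by (auto simp: D_def conds_def)
      show "set ?m \<subseteq> univ N" by (rule tuples_set[OF m])
      show "|set ?m| <o \<kappa>" by (rule finite_ordLess_Card_order[OF \<kappa>]) simp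
      show "fin_sat N \<sigma> D"
        unfolding fin_sat_def
      proof (intro allI impI)
        fix d assume d: "d \<subseteq> D" "finite d"
        have "\<forall>t \<in> d. \<exists>q \<subseteq> C. finite q \<and> (\<forall>a \<in> tuples N \<sigma>. a @ ?m \<in> ext N (\<sigma> @ ?\<mu>) (fst t) \<longleftrightarrow> holds q a)"
        proof
          fix t assume "t \<in> d"
          with d(1) have "t \<in> D" by blast
          then show "\<exists>q \<subseteq> C. finite q \<and> (\<forall>a \<in> tuples N \<sigma>. a @ ?m \<in> ext N (\<sigma> @ ?\<mu>) (fst t) \<longleftrightarrow> holds q a)"
            unfolding D_def by auto
        qed
        then obtain Q where Q: "\<And>t. t \<in> d \<Longrightarrow> Q t \<subseteq> C \<and> finite (Q t) \<and>
            (\<forall>a \<in> tuples N \<sigma>. a @ ?m \<in> ext N (\<sigma> @ ?\<mu>) (fst t) \<longleftrightarrow> holds (Q t) a)"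
          by metis
        define q where "q = \<Union> (Q ` d)"
        have "q \<subseteq> C" "finite q" using Q d(2) unfolding q_def by blast+
        then obtain g where g: "\<And>i. g i \<in> tuples N \<sigma>" "\<And>i. i\<in>set ds \<Longrightarrow> g i = f i" "\<And>c. c\<in>q \<Longrightarrow> famsat N \<sigma> \<epsilon> e g c"
          using I unfolding I_def ds by metis
        have "holds (Q t) (g (\<iota> n))" if "t \<in> d" for t
          unfolding holds_def by (rule exI[of _ g]) (use g that in \<open>fastforce simp: q_def\<close>)
        then have "g (\<iota> n) @ snd (snd t) \<in> ext N (\<sigma> @ fst (snd t)) (fst t)" if "t \<in> d" for t
          using Q[OF that] that d(1) g(1) by (auto simp: D_def)
        then show "\<exists>as\<in>tuples N \<sigma>. \<forall>(\<phi>, \<tau>', e)\<in>d. as @ e \<in> ext N (\<sigma> @ \<tau>') \<phi>"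
          using g(1) by (intro bexI[of _ "g (\<iota> n)"]) (auto simp: split_beta)
      qed
    qed
    then obtain a where a: "a \<in> tuples N \<sigma>" "\<forall>(\<phi>, \<tau>', e) \<in> D. a @ e \<in> ext N (\<sigma> @ \<tau>') \<phi>" by blast
    have "holds q a" if q: "q \<subseteq> C" "finite q" for q
    proof -
      from ex[OF q] obtain \<psi> where "\<psi> \<in> fms L (\<sigma> @ ?\<mu>)" "\<forall>a \<in> tuples N \<sigma>. a @ ?m \<in> ext N (\<sigma> @ ?\<mu>) \<psi> \<longleftrightarrow> holds q a" by blast
      moreover from this have "(\<psi>, ?\<mu>, ?m) \<in> D" using q unfolding D_def by blast
      ultimately show ?thesis using a by blast
    qed
    have "I (Suc n) (f(\<iota> n := a))"
      unfolding I_def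
    proof (intro conjI allI impI)
      fix q assume "q \<subseteq> C" "finite q"
      with \<open>\<And>q. q \<subseteq> C \<Longrightarrow> finite q \<Longrightarrow> holds q a\<close> have "holds q a" by blast
      then obtain g where g: "\<forall>j. g j \<in> tuples N \<sigma>" "g (\<iota> n) = a" "\<forall>j\<in>set ds. g j = f j" "\<forall>c\<in>q. famsat N \<sigma> \<epsilon> e g c"
        unfolding holds_def by (elim exE conjE)
      have "\<forall>i\<in>\<iota> ` {..<Suc n}. g i = (f(\<iota> n := a)) i"
      proof
        fix i assume "i \<in> \<iota> ` {..<Suc n}"
        then have "i = \<iota> n \<or> i \<in> set ds" using ds by (auto simp: lessThan_Suc)
        then show "g i = (f(\<iota> n := a)) i" using g(2,3) False ds by auto
      qed
      with g show "\<exists>g. (\<forall>i. g i \<in> tuples N \<sigma>) \<and> (\<forall>i\<in>\<iota> ` {..<Suc n}. g i = (f(\<iota> n := a)) i) \<and> (\<forall>c\<in>q. famsat N \<sigma> \<epsilon> e g c)"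
        by (intro exI[of _ g] conjI)
    qed (use f a(1) in auto)
    moreover have "\<forall>i\<in>\<iota> ` {..<n}. (f(\<iota> n := a)) i = f i" using False by (metis fun_upd_other)
    ultimately show ?thesis by blast
  qed
  ultimately obtain F where F: "\<And>n. I n (F n)" "\<And>n i. i \<in> \<iota> ` {..<n} \<Longrightarrow> F (Suc n) i = F n i"
    using dependent_nat_choice[of I "\<lambda>n f f'. \<forall>i\<in>\<iota> ` {..<n}. f' i = f i"] by metis
  have stab: "F m i = F n i" if "n \<le> m" "i \<in> \<iota> ` {..<n}" for m n i
    using that by (induction m rule: dec_induct) (auto simp: F(2) subset_iff)
  \<comment> \<open>The value at \<open>i\<close> is final as soon as \<open>i\<close> has been
    enumerated.\<close>
  define h where "h i = F (Suc (to_nat i)) i" for i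
  have hF: "h i = F n i" if "i \<in> \<iota> ` {..<n}" for n i
  proof -
    have "\<iota> (to_nat i) = i" by (simp add: \<iota>_def)
    then have "i \<in> \<iota> ` {..<Suc (to_nat i)}" by (metis image_eqI lessI lessThan_iff)
    then show ?thesis unfolding h_def using stab[of n "Suc (to_nat i)" i] stab[of "Suc (to_nat i)" n i] that
      by (cases "n \<le> Suc (to_nat i)") auto
  qed
  have "famsat N \<sigma> \<epsilon> e h (is, \<phi>)" if c: "(is, \<phi>) \<in> C" for "is" \<phi>
  proof -
    define n where "n = Suc (Max (insert 0 (to_nat ` set is)))"
    have n: "set is \<subseteq> \<iota> ` {..<n}"
    proof
      fix i assume "i \<in> set is"
      then have "to_nat i < n" unfolding n_def by (simp add: le_imp_less_Suc)
      then show "i \<in> \<iota> ` {..<n}" by (intro image_eqI[of _ _ "to_nat i"]) (auto simp: \<iota>_def)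
    qed
    from F(1)[of n] c obtain g where g: "\<forall>i\<in>\<iota> ` {..<n}. g i = F n i" "famsat N \<sigma> \<epsilon> e g (is, \<phi>)"
      unfolding I_def by (metis empty_subsetI finite.emptyI finite_insert insert_subset singletonI)
    have "map h is = map g is" using n g(1) hF by auto
    with g(2) show ?thesis by (simp only: famsat_def prod.case)
  qed
  moreover have "h i \<in> tuples N \<sigma>" for i using F(1) by (simp add: h_def I_def)
  ultimately show ?thesis by (intro exI[of _ h]) auto
qed

subsection \<open>The notions of the statement in terms of standard variables\<close>

text \<open>The remaining free variables are listed after \<open>xs\<close>, so that a formula with
  parameters takes the shape used everywhere below: a formula on \<open>\<tau> @ \<tau>'\<close>
  together with a tuple of parameters.\<close>

lemma to_std_vars:
  fixes \<phi> :: "('s, 'f, 'p) fm" and xs :: "'s var list"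
  assumes "\<phi> \<in> formulas L" "distinct xs"
  obtains zs where "distinct (xs @ zs)" "set zs = fv \<phi> - set xs"
    "canon (xs @ zs) \<phi> \<in> fms L (map fst xs @ map fst zs)"
    "\<And>(N :: ('s, 'f, 'p, 'a) struc) e as. length as = length xs \<Longrightarrow>
      sat N (assign e xs as) \<phi> \<longleftrightarrow> sat N (std_env (as @ map e zs)) (canon (xs @ zs) \<phi>)"
proof -
  have "finite (fv \<phi> - set xs)" by (simp add: finite_fv)
  from finite_distinct_list[OF this] obtain zs where zs: "set zs = fv \<phi> - set xs" "distinct zs" by (elim exE conjE)
  have d: "distinct (xs @ zs)" using zs assms by auto
  have f: "fv \<phi> \<subseteq> set (xs @ zs)" using zs by auto
  have "sat N (assign e xs as) \<phi> \<longleftrightarrow> sat N (std_env (as @ map e zs)) (canon (xs @ zs) \<phi>)"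
    if "length as = length xs" for N :: "('s, 'f, 'p, 'a) struc" and e as
  proof (rule sat_canon[OF d assms(1) f, symmetric])
    fix j assume j: "j < length (xs @ zs)"
    show "assign e xs as ((xs @ zs) ! j) = (as @ map e zs) ! j"
    proof (cases "j < length xs")
      case True
      then show ?thesis using assms(2) that by (simp add: assign_nth nth_append)
    next
      case False
      then have "zs ! (j - length xs) \<in> set zs" using j by simp
      then have "zs ! (j - length xs) \<notin> set xs" using zs by auto
      then show ?thesis using False j that by (simp add: assign_notin nth_append)
    qed
  qed
  with that[OF d zs(1)] fms_canon[OF d assms(1) f] show thesis by simp
qed

lemma params_list:
  assumes "params N A (set zs) e"
  shows "map e zs \<in> tuples N (map fst zs)" "set (map e zs) \<subseteq> A"
  using assms by (auto simp: params_def tuples_iff)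

lemma sat_assign_std:
  assumes "\<phi> \<in> fms L (\<tau> @ \<tau>')" "length as = length \<tau>" "length e = length \<tau>'"
  shows "sat N (assign (\<lambda>v. e ! (snd v - length \<tau>)) (std_vars \<tau>) as) \<phi> \<longleftrightarrow> sat N (std_env (as @ e)) \<phi>"
proof (rule sat_cong)
  fix v assume "v \<in> fv \<phi>"
  then have v: "snd v < length (\<tau> @ \<tau>')" "fst v = (\<tau> @ \<tau>') ! snd v" using assms by (auto simp: fms_def in_std_vars)
  show "assign (\<lambda>v. e ! (snd v - length \<tau>)) (std_vars \<tau>) as v = std_env (as @ e) v"
  proof (cases "snd v < length \<tau>")
    case True
    then have "v = std_vars \<tau> ! snd v" using v by (auto simp: nth_append prod_eq_iff)
    then have "assign (\<lambda>v. e ! (snd v - length \<tau>)) (std_vars \<tau>) as v = as ! snd v"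
      using assign_nth[of "std_vars \<tau>" as "snd v"] True assms(2) by simp
    then show ?thesis using True assms(2) by (simp add: std_env_def nth_append)
  next
    case False
    then have "v \<notin> set (std_vars \<tau>)" by (simp add: in_std_vars)
    then show ?thesis using False assms by (simp add: assign_notin std_env_def nth_append)
  qed
qed

lemma params_std:
  assumes "\<phi> \<in> fms L (\<tau> @ \<tau>')" "e \<in> tuples N \<tau>'" "set e \<subseteq> A"
  shows "params N A (fv \<phi> - set (std_vars \<tau>)) (\<lambda>v. e ! (snd v - length \<tau>))"
  unfolding params_def
proof
  fix v assume v: "v \<in> fv \<phi> - set (std_vars \<tau>)"
  then have "snd v < length (\<tau> @ \<tau>')" "fst v = (\<tau> @ \<tau>') ! snd v" using assms by (auto simp: fms_def in_std_vars)
  moreover from v this have "\<not> snd v < length \<tau>" by (auto simp: in_std_vars nth_append)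
  ultimately show "e ! (snd v - length \<tau>) \<in> A \<inter> dom_of N (fst v)"
    using assms(2,3) by (auto simp: tuples_iff nth_append)
qed

text \<open>\<open>indiscernible\<close>, with the assignment of parameters replaced by a tuple
  \<open>e\<close> of them; the two agree by \<open>indiscernible_iff\<close>.\<close>

definition indisc :: "('s, 'f, 'p) lang \<Rightarrow> ('s, 'f, 'p, 'u) struc \<Rightarrow> 'u set
      \<Rightarrow> 's list \<Rightarrow> 'k rel \<Rightarrow> 'k set \<Rightarrow> ('k \<Rightarrow> 'u list) \<Rightarrow> bool" where
  "indisc L U D \<sigma> r K a \<longleftrightarrow> (\<forall>i \<in> K. a i \<in> tuples U \<sigma>) \<and>
     (\<forall>n \<tau> \<phi> e is js. \<phi> \<in> fms L (pow \<sigma> n @ \<tau>) \<and> e \<in> tuples U \<tau> \<and> set e \<subseteq> D \<and>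
        set is \<subseteq> K \<and> increasing r is \<and> length is = n \<and> set js \<subseteq> K \<and> increasing r js \<and> length js = n \<longrightarrow>
        (cat a is @ e \<in> ext U (pow \<sigma> n @ \<tau>) \<phi> \<longleftrightarrow> cat a js @ e \<in> ext U (pow \<sigma> n @ \<tau>) \<phi>))"

lemma indiscernible_iff: "indiscernible L U D \<sigma> r K a \<longleftrightarrow> indisc L U D \<sigma> r K a"
proof
  assume ind: "indiscernible L U D \<sigma> r K a"
  then have a: "\<And>i. i \<in> K \<Longrightarrow> a i \<in> tuples U \<sigma>" by (auto simp: indiscernible_def)
  have "cat a is @ e \<in> ext U (pow \<sigma> n @ \<tau>) \<phi> \<longleftrightarrow> cat a js @ e \<in> ext U (pow \<sigma> n @ \<tau>) \<phi>"
    if *: "\<phi> \<in> fms L (pow \<sigma> n @ \<tau>)" "e \<in> tuples U \<tau>" "set e \<subseteq> D"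
      "set is \<subseteq> K" "increasing r is" "length is = n" "set js \<subseteq> K" "increasing r js" "length js = n" for n \<tau> \<phi> e "is" js
  proof -
    have t: "cat a ks \<in> tuples U (pow \<sigma> n)" if "set ks \<subseteq> K" "length ks = n" for ks
      using cat_tuples[of ks a U \<sigma>] a that by auto
    have "sat U (assign (\<lambda>v. e ! (snd v - length (pow \<sigma> n))) (std_vars (pow \<sigma> n)) (cat a is)) \<phi> \<longleftrightarrow>
        sat U (assign (\<lambda>v. e ! (snd v - length (pow \<sigma> n))) (std_vars (pow \<sigma> n)) (cat a js)) \<phi>"
      using ind[unfolded indiscernible_def, THEN conjunct2, rule_format, of \<phi> "std_vars (pow \<sigma> n)" n _ "is" js]
        * params_std[OF *(1-3)] by (simp add: fms_def)
    then have "sat U (std_env (cat a is @ e)) \<phi> \<longleftrightarrow> sat U (std_env (cat a js @ e)) \<phi>"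
      unfolding sat_assign_std[OF *(1) tuples_length[OF t[OF *(4,6)]] tuples_length[OF *(2)]]
        sat_assign_std[OF *(1) tuples_length[OF t[OF *(7,9)]] tuples_length[OF *(2)]] .
    then show ?thesis using t *(2,4,6,7,9) by (auto simp: ext_def intro: tuples_appendI)
  qed
  with a show "indisc L U D \<sigma> r K a" by (auto simp: indisc_def)
next
  assume ind: "indisc L U D \<sigma> r K a"
  then have a: "\<And>i. i \<in> K \<Longrightarrow> a i \<in> tuples U \<sigma>" by (auto simp: indisc_def)
  have "sat U (assign e xs (cat a is)) \<phi> \<longleftrightarrow> sat U (assign e xs (cat a js)) \<phi>"
    if *: "\<phi> \<in> formulas L" "distinct xs" "map fst xs = pow \<sigma> n" "params U D (fv \<phi> - set xs) e"
      "set is \<subseteq> K" "increasing r is" "length is = n" "set js \<subseteq> K" "increasing r js" "length js = n" for \<phi> n xs e "is" js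
  proof -
    from to_std_vars[OF *(1,2)] obtain zs where zs: "set zs = fv \<phi> - set xs"
      "canon (xs @ zs) \<phi> \<in> fms L (map fst xs @ map fst zs)"
      and s: "\<And>as. length as = length xs \<Longrightarrow>
      sat U (assign e xs as) \<phi> \<longleftrightarrow> sat U (std_env (as @ map e zs)) (canon (xs @ zs) \<phi>)" by metis
    have p: "map e zs \<in> tuples U (map fst zs)" "set (map e zs) \<subseteq> D" using params_list[of U D zs e] *(4) zs by auto
    have t: "cat a ks \<in> tuples U (pow \<sigma> n)" if "set ks \<subseteq> K" "length ks = n" for ks
      using cat_tuples[of ks a U \<sigma>] a that by auto
    have l: "length xs = length (pow \<sigma> n)" using *(3) by (metis length_map)
    let ?\<psi> = "canon (xs @ zs) \<phi>" and ?\<tau> = "map fst zs"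
    have \<psi>: "?\<psi> \<in> fms L (pow \<sigma> n @ ?\<tau>)" using zs *(3) by simp
    have "cat a is @ map e zs \<in> ext U (pow \<sigma> n @ ?\<tau>) ?\<psi> \<longleftrightarrow> cat a js @ map e zs \<in> ext U (pow \<sigma> n @ ?\<tau>) ?\<psi>"
      using ind[unfolded indisc_def, THEN conjunct2, rule_format, of ?\<psi> n ?\<tau> "map e zs" "is" js] \<psi> p *(5-10) by simp
    moreover have "cat a ks @ map e zs \<in> ext U (pow \<sigma> n @ ?\<tau>) ?\<psi> \<longleftrightarrow> sat U (assign e xs (cat a ks)) \<phi>"
      if "set ks \<subseteq> K" "length ks = n" for ks
      using t[OF that] p s[of "cat a ks"] l by (simp add: ext_def tuples_appendI tuples_length)
    ultimately show ?thesis using *(5,7,8,10) by simp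
  qed
  with a show "indiscernible L U D \<sigma> r K a" by (auto simp: indiscernible_def)
qed

section \<open>Externally definable sets\<close>

lemma elem_sub_tuples: "elem_sub L M M' \<Longrightarrow> as \<in> tuples M \<tau> \<Longrightarrow> as \<in> tuples M' \<tau>"
  by (auto simp: elem_sub_def tuples_iff dom_of_def subset_iff)

lemma elem_sub_ext:
  assumes "elem_sub L M M'" "\<phi> \<in> fms L \<tau>" "as \<in> tuples M \<tau>"
  shows "as \<in> ext M \<tau> \<phi> \<longleftrightarrow> as \<in> ext M' \<tau> \<phi>"
proof -
  have "params M (univ M) (fv \<phi>) (std_env as)"
    using assms(2,3) by (auto simp: params_def fms_def std_env_def tuples_iff in_std_vars dom_of_def subset_iff)
  then have "sat M (std_env as) \<phi> \<longleftrightarrow> sat M' (std_env as) \<phi>"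
    using assms(1,2) by (auto simp: elem_sub_def fms_def)
  then show ?thesis using assms elem_sub_tuples by (auto simp: ext_def)
qed

lemma elem_sub_refl: "is_struc L M \<Longrightarrow> elem_sub L M M"
  by (auto simp: elem_sub_def)

lemma ext_definable_iff:
  assumes "elem_sub L M M'"
  shows "ext_definable L M M' \<tau> Y \<longleftrightarrow>
    (\<exists>\<tau>' \<phi> e. \<phi> \<in> fms L (\<tau> @ \<tau>') \<and> e \<in> tuples M' \<tau>' \<and> Y = {as \<in> tuples M \<tau>. as @ e \<in> ext M' (\<tau> @ \<tau>') \<phi>})"
    (is "?l \<longleftrightarrow> ?r")
proof
  assume ?l
  then obtain \<phi> xs e where *: "\<phi> \<in> formulas L" "distinct xs" "map fst xs = \<tau>"
    "params M' (univ M') (fv \<phi> - set xs) e" and Y: "Y = {as \<in> tuples M' \<tau>. sat M' (assign e xs as) \<phi>} \<inter> tuples M \<tau>"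
    by (auto simp: ext_definable_def definable_def)
  from to_std_vars[OF *(1,2)] obtain zs where zs: "set zs = fv \<phi> - set xs"
    "canon (xs @ zs) \<phi> \<in> fms L (map fst xs @ map fst zs)"
    and s: "\<And>as. length as = length xs \<Longrightarrow>
    sat M' (assign e xs as) \<phi> \<longleftrightarrow> sat M' (std_env (as @ map e zs)) (canon (xs @ zs) \<phi>)" by metis
  have p: "map e zs \<in> tuples M' (map fst zs)" using params_list[of M' _ zs e] *(4) zs by auto
  have l: "length xs = length \<tau>" using *(3) by auto
  have "Y = {as \<in> tuples M \<tau>. as @ map e zs \<in> ext M' (\<tau> @ map fst zs) (canon (xs @ zs) \<phi>)}"
    unfolding Y using s l p elem_sub_tuples[OF assms] by (auto simp: ext_def tuples_appendI tuples_length)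
  with p zs *(3) show ?r by blast
next
  assume ?r
  then obtain \<tau>' \<phi> e where *: "\<phi> \<in> fms L (\<tau> @ \<tau>')" "e \<in> tuples M' \<tau>'" and Y: "Y = {as \<in> tuples M \<tau>. as @ e \<in> ext M' (\<tau> @ \<tau>') \<phi>}"
    by blast
  let ?e = "\<lambda>v. e ! (snd v - length \<tau>)"
  have "params M' (univ M') (fv \<phi> - set (std_vars \<tau>)) ?e"
    by (rule params_std[OF *]) (rule tuples_set[OF *(2)])
  then have "definable L M' \<tau> {as \<in> tuples M' \<tau>. sat M' (assign ?e (std_vars \<tau>) as) \<phi>}"
    unfolding definable_def using *(1)
    by (intro bexI[of _ \<phi>] exI[of _ "std_vars \<tau>"] exI[of _ ?e]) (auto simp: fms_def)
  moreover have "Y = {as \<in> tuples M' \<tau>. sat M' (assign ?e (std_vars \<tau>) as) \<phi>} \<inter> tuples M \<tau>"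
    unfolding Y using sat_assign_std[OF *(1) tuples_length tuples_length[OF *(2)]] *(2) elem_sub_tuples[OF assms]
    by (auto simp: ext_def tuples_appendI)
  ultimately show ?l by (auto simp: ext_definable_def)
qed

context
  fixes L :: "('s, 'f, 'p) lang" and M M' :: "('s, 'f, 'p, 'a) struc"
  assumes elem: "elem_sub L M M'"
begin

lemma ED_sub: "ext_definable L M M' \<tau> Y \<Longrightarrow> Y \<subseteq> tuples M \<tau>"
  by (auto simp: ext_definable_def)

lemma ED_ext: "\<phi> \<in> fms L \<tau> \<Longrightarrow> ext_definable L M M' \<tau> (ext M \<tau> \<phi>)"
  unfolding ext_definable_iff[OF elem]
  by (rule exI[of _ "[]"], rule exI[of _ \<phi>], rule exI[of _ "[]"])
    (use elem_sub_ext[OF elem] ext_tuples in fastforce)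

lemma ED_compl:
  assumes "ext_definable L M M' \<tau> Y"
  shows "ext_definable L M M' \<tau> (tuples M \<tau> - Y)"
proof -
  from assms obtain \<tau>' \<phi> e where *: "\<phi> \<in> fms L (\<tau> @ \<tau>')" "e \<in> tuples M' \<tau>'"
    and Y: "Y = {as \<in> tuples M \<tau>. as @ e \<in> ext M' (\<tau> @ \<tau>') \<phi>}"
    unfolding ext_definable_iff[OF elem] by blast
  have "tuples M \<tau> - Y = {as \<in> tuples M \<tau>. as @ e \<in> ext M' (\<tau> @ \<tau>') (Neg \<phi>)}"
    unfolding Y ext_Neg using *(2) elem_sub_tuples[OF elem] by (auto intro: tuples_appendI)
  with fms_Neg[OF *(1)] *(2) show ?thesis unfolding ext_definable_iff[OF elem] by blast
qed

lemma ED_inter: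
  assumes "ext_definable L M M' \<tau> Y" "ext_definable L M M' \<tau> Z"
  shows "ext_definable L M M' \<tau> (Y \<inter> Z)"
proof -
  from assms(1) obtain \<tau>' \<phi> e where *: "\<phi> \<in> fms L (\<tau> @ \<tau>')" "e \<in> tuples M' \<tau>'"
    and Y: "Y = {as \<in> tuples M \<tau>. as @ e \<in> ext M' (\<tau> @ \<tau>') \<phi>}"
    unfolding ext_definable_iff[OF elem] by blast
  from assms(2) obtain \<tau>'' \<psi> d where **: "\<psi> \<in> fms L (\<tau> @ \<tau>'')" "d \<in> tuples M' \<tau>''"
    and Z: "Z = {as \<in> tuples M \<tau>. as @ d \<in> ext M' (\<tau> @ \<tau>'') \<psi>}"
    unfolding ext_definable_iff[OF elem] by blast
  have N: "is_struc L M'" using elem by (simp add: elem_sub_def)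
  \<comment> \<open>The two sets may have different external parameters; \<open>merge\<close> joins
    these into one tuple of \<open>M'\<close>.\<close>
  let ?q = "{(\<phi>, \<tau>', e), (\<psi>, \<tau>'', d)}"
  have q: "?q \<subseteq> conds L M' UNIV \<tau>" "finite ?q" using * ** by (auto simp: conds_def)
  from merge[OF N q(2,1)] obtain \<mu> m \<chi> where m: "m \<in> tuples M' \<mu>" and \<chi>: "\<chi> \<in> fms L (\<tau> @ \<mu>)"
    and eq': "\<forall>as \<in> tuples M' \<tau>. as @ m \<in> ext M' (\<tau> @ \<mu>) \<chi> \<longleftrightarrow> (\<forall>(\<phi>, \<tau>', e) \<in> ?q. as @ e \<in> ext M' (\<tau> @ \<tau>') \<phi>)"
    by (elim exE conjE) blast
  then have eq: "as @ m \<in> ext M' (\<tau> @ \<mu>) \<chi> \<longleftrightarrow>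
      as @ e \<in> ext M' (\<tau> @ \<tau>') \<phi> \<and> as @ d \<in> ext M' (\<tau> @ \<tau>'') \<psi>" if "as \<in> tuples M' \<tau>" for as
    using that by simp
  have "Y \<inter> Z = {as \<in> tuples M \<tau>. as @ m \<in> ext M' (\<tau> @ \<mu>) \<chi>}"
    unfolding Y Z using eq elem_sub_tuples[OF elem] by auto
  with m \<chi> show ?thesis unfolding ext_definable_iff[OF elem] by blast
qed

lemma ED_diff:
  assumes "ext_definable L M M' \<tau> Y" "ext_definable L M M' \<tau> Z"
  shows "ext_definable L M M' \<tau> (Y - Z)"
proof -
  have "Y - Z = Y \<inter> (tuples M \<tau> - Z)" using ED_sub[OF assms(1)] by auto
  then show ?thesis using ED_inter[OF assms(1) ED_compl[OF assms(2)]] by simp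
qed

lemma ED_Un:
  assumes "ext_definable L M M' \<tau> Y" "ext_definable L M M' \<tau> Z"
  shows "ext_definable L M M' \<tau> (Y \<union> Z)"
proof -
  have "Y \<union> Z = tuples M \<tau> - ((tuples M \<tau> - Y) - Z)" using ED_sub[OF assms(1)] ED_sub[OF assms(2)] by auto
  then show ?thesis using ED_compl[OF ED_diff[OF ED_compl[OF assms(1)] assms(2)]] by simp
qed

lemma ED_tuples: "ext_definable L M M' \<tau> (tuples M \<tau>)"
  using ED_ext[OF fms_Tru, of \<tau>] ext_Tru[of L M \<tau>] elem by (simp add: elem_sub_def)

lemma ED_reidx:
  assumes h: "reidx \<tau> \<tau>' hs" and Y: "ext_definable L M M' \<tau> Y"
  shows "ext_definable L M M' \<tau>' {as \<in> tuples M \<tau>'. pick hs as \<in> Y}"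
proof -
  from Y obtain \<mu> \<phi> e where *: "\<phi> \<in> fms L (\<tau> @ \<mu>)" "e \<in> tuples M' \<mu>"
    and Y: "Y = {as \<in> tuples M \<tau>. as @ e \<in> ext M' (\<tau> @ \<mu>) \<phi>}"
    unfolding ext_definable_iff[OF elem] by blast
  obtain h1 where h1: "reidx \<mu> (\<tau>' @ \<mu> @ []) h1"
    "\<And>xs as ys. length xs = length \<tau>' \<Longrightarrow> length as = length \<mu> \<Longrightarrow> pick h1 (xs @ as @ ys) = (as :: 'a list)"
    using ex_reidx_append by blast
  have r: "reidx (\<tau> @ \<mu>) (\<tau>' @ \<mu>) (hs @ h1)" using reidx_append[OF reidx_mono[OF h]] h1(1) by simp
  have N: "is_struc L M'" using elem by (simp add: elem_sub_def)
  have "pick (hs @ h1) (as @ e) = pick hs as @ e" if "as \<in> tuples M \<tau>'" for as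
    using pick_mono[OF h, of as e] h1(2)[of as e "[]"] tuples_length[OF that] tuples_length[OF *(2)] by (simp add: pick_append)
  then have "{as \<in> tuples M \<tau>'. pick hs as \<in> Y} = {as \<in> tuples M \<tau>'. as @ e \<in> ext M' (\<tau>' @ \<mu>) (reindex (\<tau> @ \<mu>) (\<tau>' @ \<mu>) (hs @ h1) \<phi>)}"
    unfolding Y ext_reindex[OF r *(1) N] using *(2) elem_sub_tuples[OF elem] pick_tuples[OF h]
    by (auto intro: tuples_appendI)
  then show ?thesis using fms_reindex[OF r *(1)] *(2) unfolding ext_definable_iff[OF elem] by blast
qed

lemma ED_slice:
  assumes Y: "ext_definable L M M' (\<tau> @ \<tau>') Y" and m: "m \<in> tuples M \<tau>'"
  shows "ext_definable L M M' \<tau> {as \<in> tuples M \<tau>. as @ m \<in> Y}"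
proof -
  from Y obtain \<mu> \<phi> e where *: "\<phi> \<in> fms L ((\<tau> @ \<tau>') @ \<mu>)" "e \<in> tuples M' \<mu>"
    and Y: "Y = {as \<in> tuples M (\<tau> @ \<tau>'). as @ e \<in> ext M' ((\<tau> @ \<tau>') @ \<mu>) \<phi>}"
    unfolding ext_definable_iff[OF elem] by blast
  have "{as \<in> tuples M \<tau>. as @ m \<in> Y} = {as \<in> tuples M \<tau>. as @ (m @ e) \<in> ext M' (\<tau> @ (\<tau>' @ \<mu>)) \<phi>}"
    unfolding Y using m by (auto intro: tuples_appendI)
  moreover have "m @ e \<in> tuples M' (\<tau>' @ \<mu>)" using m *(2) elem_sub_tuples[OF elem] by (auto intro: tuples_appendI)
  moreover have "\<phi> \<in> fms L (\<tau> @ (\<tau>' @ \<mu>))" using *(1) by simp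
  ultimately show ?thesis unfolding ext_definable_iff[OF elem] by blast
qed

end

lemma ED_of_definable:
  assumes elem: "elem_sub L M M'" and Y: "ext_definable L M M \<tau> Y"
  shows "ext_definable L M M' \<tau> Y"
proof -
  have "is_struc L M" using elem by (simp add: elem_sub_def)
  from Y obtain \<mu> \<phi> e where *: "\<phi> \<in> fms L (\<tau> @ \<mu>)" "e \<in> tuples M \<mu>"
    and Y: "Y = {as \<in> tuples M \<tau>. as @ e \<in> ext M (\<tau> @ \<mu>) \<phi>}"
    unfolding ext_definable_iff[OF elem_sub_refl[OF \<open>is_struc L M\<close>]] by blast
  have "Y = {as \<in> tuples M \<tau>. as @ e \<in> ext M' (\<tau> @ \<mu>) \<phi>}"
    unfolding Y using elem_sub_ext[OF elem *(1)] *(2) by (auto intro: tuples_appendI)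
  with * elem_sub_tuples[OF elem] show ?thesis unfolding ext_definable_iff[OF elem] by blast
qed

subsection \<open>Shattering\<close>

text \<open>The formula saying that pattern \<open>S\<close> has a witness: some \<open>z\<close>
  satisfies \<open>\<phi>\<close> together with exactly those picked tuples whose number is in
  \<open>S\<close>. The picked tuples may share entries, as they do in
  \<open>interleaved_patterns\<close>.\<close>

definition patt :: "'s list \<Rightarrow> 's list \<Rightarrow> 's list \<Rightarrow> (nat \<Rightarrow> nat list) \<Rightarrow> nat \<Rightarrow> nat set \<Rightarrow> ('s, 'f, 'p) fm \<Rightarrow> ('s, 'f, 'p) fm" where
  "patt \<tau> \<sigma> \<epsilon> hs n S \<phi> = exs \<tau> \<epsilon> (conj (map (\<lambda>k.
     (if k \<in> S then (\<lambda>\<psi>. \<psi>) else Neg) (reindex (\<sigma> @ \<epsilon>) (\<tau> @ \<epsilon>) (hs k @ [length \<tau>..<length \<tau> + length \<epsilon>]) \<phi>)) [0..<n]))"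

lemma
  assumes h0: "\<forall>k<n. reidx \<sigma> \<tau> (hs k)" and \<phi>: "\<phi> \<in> fms L (\<sigma> @ \<epsilon>)"
  shows fms_patt: "patt \<tau> \<sigma> \<epsilon> hs n S \<phi> \<in> fms L \<tau>"
    and ext_patt: "is_struc L N \<Longrightarrow> x \<in> tuples N \<tau> \<Longrightarrow> x \<in> ext N \<tau> (patt \<tau> \<sigma> \<epsilon> hs n S \<phi>) \<longleftrightarrow>
      (\<exists>z \<in> tuples N \<epsilon>. \<forall>k<n. pick (hs k) x @ z \<in> ext N (\<sigma> @ \<epsilon>) \<phi> \<longleftrightarrow> k \<in> S)"
proof -
  have h: "reidx \<sigma> \<tau> (hs k)" if "k < n" for k using h0 that by blast
  let ?h = "\<lambda>k. hs k @ [length \<tau>..<length \<tau> + length \<epsilon>]"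
  have r: "reidx (\<sigma> @ \<epsilon>) (\<tau> @ \<epsilon>) (?h k)" if "k < n" for k
    using reidx_append[OF reidx_mono[OF h[OF that]]] reidx_block[of \<tau> "length \<tau>" \<epsilon> "length \<epsilon>" "[]"] by simp
  let ?f = "\<lambda>k. (if k \<in> S then (\<lambda>\<psi>. \<psi>) else Neg) (reindex (\<sigma> @ \<epsilon>) (\<tau> @ \<epsilon>) (?h k) \<phi>)"
  have c: "conj (map ?f [0..<n]) \<in> fms L (\<tau> @ \<epsilon>)"
  proof (rule fms_conj)
    have f: "reindex (\<sigma> @ \<epsilon>) (\<tau> @ \<epsilon>) (?h k) \<phi> \<in> fms L (\<tau> @ \<epsilon>)" if "k < n" for k
      by (rule fms_reindex[OF r[OF that] \<phi>])
    have "?f k \<in> fms L (\<tau> @ \<epsilon>)" if "k < n" for k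
      using f[OF that] fms_Neg[OF f[OF that]] by simp
    then show "\<psi> \<in> fms L (\<tau> @ \<epsilon>)" if "\<psi> \<in> set (map ?f [0..<n])" for \<psi>
      using that by (simp only: set_map) auto
  qed
  show "patt \<tau> \<sigma> \<epsilon> hs n S \<phi> \<in> fms L \<tau>" unfolding patt_def by (rule fms_exs[OF c])
  assume N: "is_struc L N" and x: "x \<in> tuples N \<tau>"
  have "x @ z \<in> ext N (\<tau> @ \<epsilon>) (?f k) \<longleftrightarrow> (pick (hs k) x @ z \<in> ext N (\<sigma> @ \<epsilon>) \<phi> \<longleftrightarrow> k \<in> S)"
    if z: "z \<in> tuples N \<epsilon>" and k: "k < n" for z k
  proof -
    have "pick (?h k) (x @ z) = pick (hs k) x @ z"
      using pick_mono[OF h[OF k], of x z] pick_block[of x "length \<tau>" z "length \<epsilon>" "[]"] tuples_length[OF x] tuples_length[OF z]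
      by (simp add: pick_append)
    then have "x @ z \<in> ext N (\<tau> @ \<epsilon>) (reindex (\<sigma> @ \<epsilon>) (\<tau> @ \<epsilon>) (?h k) \<phi>) \<longleftrightarrow> pick (hs k) x @ z \<in> ext N (\<sigma> @ \<epsilon>) \<phi>"
      unfolding ext_reindex[OF r[OF k] \<phi> N] using x z by (simp add: tuples_appendI)
    then show ?thesis using x z by (simp add: ext_Neg tuples_appendI)
  qed
  then have "x @ z \<in> ext N (\<tau> @ \<epsilon>) (conj (map ?f [0..<n])) \<longleftrightarrow> (\<forall>k<n. pick (hs k) x @ z \<in> ext N (\<sigma> @ \<epsilon>) \<phi> \<longleftrightarrow> k \<in> S)"
    if z: "z \<in> tuples N \<epsilon>" for z
    unfolding ext_conj[OF N] using x z by (auto simp: tuples_appendI)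
  then show "x \<in> ext N \<tau> (patt \<tau> \<sigma> \<epsilon> hs n S \<phi>) \<longleftrightarrow>
      (\<exists>z \<in> tuples N \<epsilon>. \<forall>k<n. pick (hs k) x @ z \<in> ext N (\<sigma> @ \<epsilon>) \<phi> \<longleftrightarrow> k \<in> S)"
    unfolding patt_def ext_exs[OF c] using x by blast
qed

text \<open>The finite form of the condition in \<open>NIP\<close>. For fixed \<open>n\<close> it is
  expressed by a sentence, so it can be transferred between models of a complete theory.\<close>

definition shatters :: "('s, 'f, 'p, 'a) struc \<Rightarrow> 's list \<Rightarrow> 's list \<Rightarrow> ('s, 'f, 'p) fm \<Rightarrow> nat \<Rightarrow> bool" where
  "shatters N \<sigma> \<epsilon> \<phi> n \<longleftrightarrow> (\<exists>w. (\<forall>k. w k \<in> tuples N \<sigma>) \<and>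
     (\<forall>S \<subseteq> {..<n}. \<exists>z \<in> tuples N \<epsilon>. \<forall>k<n. w k @ z \<in> ext N (\<sigma> @ \<epsilon>) \<phi> \<longleftrightarrow> k \<in> S))"

text \<open>The case of \<open>patt\<close> in which the tuples are consecutive disjoint
  blocks.\<close>

definition spatt :: "'s list \<Rightarrow> 's list \<Rightarrow> nat \<Rightarrow> nat set \<Rightarrow> ('s, 'f, 'p) fm \<Rightarrow> ('s, 'f, 'p) fm" where
  "spatt \<sigma> \<epsilon> n S \<phi> = patt (pow \<sigma> n) \<sigma> \<epsilon> (\<lambda>k. cpick (length \<sigma>) [0..<n] [k]) n S \<phi>"

lemma
  assumes \<phi>: "\<phi> \<in> fms L (\<sigma> @ \<epsilon>)"
  shows fms_spatt: "spatt \<sigma> \<epsilon> n S \<phi> \<in> fms L (pow \<sigma> n)"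
    and ext_spatt: "is_struc L N \<Longrightarrow> (\<And>k. w k \<in> tuples N \<sigma>) \<Longrightarrow> cat w [0..<n] \<in> ext N (pow \<sigma> n) (spatt \<sigma> \<epsilon> n S \<phi>) \<longleftrightarrow>
      (\<exists>z \<in> tuples N \<epsilon>. \<forall>k<n. w k @ z \<in> ext N (\<sigma> @ \<epsilon>) \<phi> \<longleftrightarrow> k \<in> S)"
proof -
  have r: "\<forall>k<n. reidx \<sigma> (pow \<sigma> n) (cpick (length \<sigma>) [0..<n] [k])"
  proof (intro allI impI)
    show "reidx \<sigma> (pow \<sigma> n) (cpick (length \<sigma>) [0..<n] [k])" if "k < n" for k
      using reidx_cpick[of "[k]" "[0..<n]" \<sigma>] that by simp
  qed
  show "spatt \<sigma> \<epsilon> n S \<phi> \<in> fms L (pow \<sigma> n)" unfolding spatt_def by (rule fms_patt[OF r \<phi>])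
  assume N: "is_struc L N" and w: "\<And>k. w k \<in> tuples N \<sigma>"
  have "pick (cpick (length \<sigma>) [0..<n] [k]) (cat w [0..<n]) = w k" if "k < n" for k
    using pick_cpick[of "[0..<n]" w "length \<sigma>" "[k]"] tuples_length[OF w] that by simp
  moreover have "cat w [0..<n] \<in> tuples N (pow \<sigma> n)" using cat_tuples[of "[0..<n]" w N \<sigma>] w by simp
  ultimately show "cat w [0..<n] \<in> ext N (pow \<sigma> n) (spatt \<sigma> \<epsilon> n S \<phi>) \<longleftrightarrow>
      (\<exists>z \<in> tuples N \<epsilon>. \<forall>k<n. w k @ z \<in> ext N (\<sigma> @ \<epsilon>) \<phi> \<longleftrightarrow> k \<in> S)"
    unfolding spatt_def using ext_patt[OF r \<phi> N] by simp
qed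

lemma shatters_iff:
  assumes \<phi>: "\<phi> \<in> fms L (\<sigma> @ \<epsilon>)" and N: "is_struc L N"
  shows "shatters N \<sigma> \<epsilon> \<phi> n \<longleftrightarrow> (\<exists>w. (\<forall>k. w k \<in> tuples N \<sigma>) \<and>
    (\<forall>c \<in> (\<lambda>S. ([0..<n], spatt \<sigma> \<epsilon> n S \<phi>)) ` Pow {..<n}. famsat N \<sigma> [] [] w c))"
proof -
  have "famsat N \<sigma> [] [] w ([0..<n], spatt \<sigma> \<epsilon> n S \<phi>) \<longleftrightarrow>
      (\<exists>z \<in> tuples N \<epsilon>. \<forall>k<n. w k @ z \<in> ext N (\<sigma> @ \<epsilon>) \<phi> \<longleftrightarrow> k \<in> S)"
    if "\<forall>k. w k \<in> tuples N \<sigma>" for S and w :: "nat \<Rightarrow> 'd list"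
    unfolding famsat_def using ext_spatt[OF \<phi> N, of w n S] that by simp
  then show ?thesis unfolding shatters_def by (simp add: Pow_def cong: conj_cong)
qed

text \<open>Finitely many conditions without parameters amount to one existential sentence, and
  sentences are assumed to transfer.\<close>

lemma family_transfer:
  fixes N :: "('s, 'f, 'p, 'a) struc" and N' :: "('s, 'f, 'p, 'b) struc" and q :: "('i list \<times> ('s, 'f, 'p) fm) set"
  assumes N: "is_struc L N" and N': "is_struc L N'"
    and tr: "\<And>\<phi>. \<phi> \<in> fms L [] \<Longrightarrow> ext N [] \<phi> \<noteq> {} \<Longrightarrow> ext N' [] \<phi> \<noteq> {}"
    and fin: "finite q" and q0: "\<forall>(is, \<phi>) \<in> q. \<phi> \<in> fms L (pow \<sigma> (length is))"
    and f0: "\<forall>i. f i \<in> tuples N \<sigma>" "\<forall>c \<in> q. famsat N \<sigma> [] [] f c"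
  shows "\<exists>g. (\<forall>i. g i \<in> tuples N' \<sigma>) \<and> (\<forall>c \<in> q. famsat N' \<sigma> [] [] g c)"
proof -
  have q: "\<phi> \<in> fms L (pow \<sigma> (length is))" if "(is, \<phi>) \<in> q" for "is" \<phi> using q0 that by blast
  have f: "f i \<in> tuples N \<sigma>" "c \<in> q \<Longrightarrow> famsat N \<sigma> [] [] f c" for i c using f0 by auto
  have "finite (\<Union>(set ` fst ` q))" using fin by auto
  from finite_distinct_list[OF this] obtain bs where bs: "set bs = \<Union>(set ` fst ` q)" "distinct bs" by (elim exE conjE)
  obtain cs where cs: "set cs = q" using finite_list[OF fin] by (elim exE)
  have sub: "set is \<subseteq> set bs" if "(is, \<phi>) \<in> q" for "is" \<phi>
  proof -
    have "set is \<in> set ` fst ` q" using imageI[OF imageI[OF that, of fst], of set] by simp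
    then show ?thesis using bs(1) by auto
  qed
  have q': "\<phi> \<in> fms L (pow \<sigma> (length is) @ [])" if "(is, \<phi>) \<in> q" for "is" \<phi> using q[OF that] by simp
  define \<chi> where "\<chi> = conj (map (\<lambda>(is, \<phi>). refam \<sigma> [] bs is \<phi>) cs)"
  have fr: "refam \<sigma> [] bs is \<phi> \<in> fms L (pow \<sigma> (length bs))" if "(is, \<phi>) \<in> q" for "is" \<phi>
    using fms_refam[OF sub[OF that] q'[OF that]] by simp
  have \<chi>: "\<chi> \<in> fms L ([] @ pow \<sigma> (length bs))" unfolding \<chi>_def append_Nil
    by (rule fms_conj) (use cs fr in auto)
  have ext\<chi>: "cat g bs \<in> ext N0 (pow \<sigma> (length bs)) \<chi> \<longleftrightarrow> (\<forall>c\<in>q. famsat N0 \<sigma> [] [] g c)"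
    if g: "\<And>j. g j \<in> tuples N0 \<sigma>" and N0: "is_struc L N0" for g and N0 :: "('s, 'f, 'p, 'c) struc"
  proof -
    have "cat g bs \<in> tuples N0 (pow \<sigma> (length bs))" by (intro cat_tuples g)
    moreover have "cat g bs \<in> ext N0 (pow \<sigma> (length bs)) (refam \<sigma> [] bs is \<phi>) \<longleftrightarrow> famsat N0 \<sigma> [] [] g (is, \<phi>)"
      if "(is, \<phi>) \<in> q" for "is" \<phi>
      unfolding famsat_def prod.case
      using ext_refam[OF sub[OF that] q'[OF that] N0, of g "[]"] g by simp
    ultimately show ?thesis unfolding \<chi>_def ext_conj[OF N0] using cs by fastforce
  qed
  have e: "ext N0 [] (exs [] (pow \<sigma> (length bs)) \<chi>) \<noteq> {} \<longleftrightarrow> (\<exists>b \<in> tuples N0 (pow \<sigma> (length bs)). b \<in> ext N0 (pow \<sigma> (length bs)) \<chi>)"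
    for N0 :: "('s, 'f, 'p, 'c) struc"
    unfolding ext_exs[OF \<chi>] by auto
  have "cat f bs \<in> ext N (pow \<sigma> (length bs)) \<chi>" using ext\<chi>[of f N, OF f(1) N] f(2) by blast
  moreover from this have "cat f bs \<in> tuples N (pow \<sigma> (length bs))" using ext_tuples by blast
  ultimately have "ext N [] (exs [] (pow \<sigma> (length bs)) \<chi>) \<noteq> {}" using e[of N] by blast
  from tr[OF fms_exs[OF \<chi>] this] obtain b where b: "b \<in> tuples N' (pow \<sigma> (length bs))" "b \<in> ext N' (pow \<sigma> (length bs)) \<chi>"
    using e[of N'] by blast
  have "\<exists>d. d \<in> tuples N' \<sigma>"
  proof -
    have "\<exists>d. \<forall>s. d s \<in> dom_of N' s" using N' unfolding is_struc_def by (intro choice) blast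
    then obtain d where "\<And>s. d s \<in> dom_of N' s" by blast
    then have "map d \<sigma> \<in> tuples N' \<sigma>" by (simp add: tuples_iff)
    then show ?thesis ..
  qed
  then obtain d where "d \<in> tuples N' \<sigma>" ..
  with ex_cat_eq[OF bs(2) b(1), of "\<lambda>_. d"] obtain g where g: "\<forall>j. g j \<in> tuples N' \<sigma>" "cat g bs = b" by blast
  have "\<forall>c\<in>q. famsat N' \<sigma> [] [] g c" using ext\<chi>[of g N', OF _ N'] g b(2) by simp
  with g(1) show ?thesis by blast
qed

subsection \<open>Monster models\<close>

lemma infinite_formulas: "infinite (formulas L)"
proof
  assume "finite (formulas L)"
  moreover have "(\<lambda>n. Eq (Var (undefined, n)) (Var (undefined, n))) ` UNIV \<subseteq> formulas L"
    using has_sort.intros(1)[of L] by (auto simp: formulas_def intro!: exI[of _ undefined])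
  ultimately have "finite (range (\<lambda>n. Eq (Var (undefined, n)) (Var (undefined, n)) :: ('a, 'b, 'c) fm))"
    using finite_subset by blast
  then have "finite (UNIV :: nat set)" by (rule finite_imageD) (simp add: inj_on_def)
  then show False by simp
qed

lemma countable_ordLess:
  fixes L :: "('s, 'f, 'p) lang" and A :: "'b set"
  assumes "countable A" "|formulas L| <o \<kappa>"
  shows "|A| <o \<kappa>"
proof -
  have "|A| \<le>o |UNIV :: nat set|" using assms(1) by (metis card_of_ordLeq countable_def top_greatest)
  also have "|UNIV :: nat set| \<le>o |formulas L|"
    using infinite_formulas[of L] by (metis infinite_iff_card_of_nat)
  finally show ?thesis using assms(2) ordLeq_ordLess_trans by blast
qed

lemma monsterD:
  assumes "monster L T \<kappa> U"
  shows "Card_order \<kappa>" "infinite (Field \<kappa>)" "is_struc L U" "saturated L \<kappa> U" "|formulas L| <o \<kappa>"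
proof -
  show *: "Card_order \<kappa>" "is_struc L U" "saturated L \<kappa> U" "|formulas L| <o \<kappa>"
    using assms by (auto simp: monster_def models_def)
  have "|formulas L| <o |Field \<kappa>|" using *(4) card_of_Field_ordIso[OF *(1)] ordIso_symmetric ordLess_ordIso_trans by blast
  then have "|formulas L| \<le>o |Field \<kappa>|" by (rule ordLess_imp_ordLeq)
  then show "infinite (Field \<kappa>)" using card_of_ordLeq_infinite infinite_formulas by blast
qed

text \<open>The empty tuple is the only possible element, so nonemptiness is truth of the sentence.
  Transfer between models is expressed in this form.\<close>

lemma ext_Nil: "\<phi> \<in> fms L [] \<Longrightarrow> ext N [] \<phi> \<noteq> {} \<longleftrightarrow> sat N e \<phi>"
  using sat_cong[of \<phi> "std_env []" e N] by (auto simp: ext_def fms_def std_vars_def)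

lemma fms_Nil: "fms L [] = sentences L"
  by (auto simp: fms_def sentences_def std_vars_def)

lemma complete_theory_transfer:
  assumes "complete_theory L T" "models L N T" "models L N' T" "\<phi> \<in> fms L []" "ext N [] \<phi> \<noteq> {}"
  shows "ext N' [] \<phi> \<noteq> {}"
proof -
  have "\<phi> \<in> sentences L" using assms(4) by (simp add: fms_Nil)
  have "\<phi> \<in> T"
  proof (rule ccontr)
    assume "\<phi> \<notin> T"
    then have "Neg \<phi> \<in> T" using assms(1) \<open>\<phi> \<in> sentences L\<close> by (auto simp: complete_theory_def)
    then have "sat N e (Neg \<phi>)" for e using assms(2) by (auto simp: models_def)
    then show False using ext_Nil[OF assms(4), of N] assms(5) by simp
  qed
  then have "sat N' e \<phi>" for e using assms(3) by (auto simp: models_def)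
  then show ?thesis using ext_Nil[OF assms(4), of N'] by simp
qed

lemma sat_assign_all:
  assumes "\<phi> \<in> fms L \<tau>" "length as = length \<tau>"
  shows "sat N (assign u (std_vars \<tau>) as) \<phi> \<longleftrightarrow> sat N (std_env as) \<phi>"
proof (rule sat_cong)
  fix v assume "v \<in> fv \<phi>"
  then have v: "snd v < length \<tau>" "fst v = \<tau> ! snd v" using assms by (auto simp: fms_def in_std_vars)
  then have "v = std_vars \<tau> ! snd v" by (auto simp: prod_eq_iff)
  then show "assign u (std_vars \<tau>) as v = std_env as v"
    using assign_nth[of "std_vars \<tau>" as "snd v" u] v assms(2) by (simp add: std_env_def)
qed

text \<open>By saturation a formula that shatters sets of every finite size would shatter an infinite set.\<close>

lemma NIP_bound:
  fixes L :: "('s, 'f, 'p) lang" and U :: "('s, 'f, 'p, 'u) struc"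
  assumes U: "monster L T \<kappa> U" and "NIP L U" and \<phi>: "\<phi> \<in> fms L (\<sigma> @ \<epsilon>)"
  shows "\<exists>n. \<not> shatters U \<sigma> \<epsilon> \<phi> n"
proof (rule ccontr)
  note [simp] = monsterD(3)[OF U]
  assume "\<not> ?thesis"
  then have sh: "shatters U \<sigma> \<epsilon> \<phi> n" for n by blast
  \<comment> \<open>The requirement that for every \<open>n\<close> the first \<open>n\<close> terms
    be shattered.\<close>
  define C where "C = (\<Union>n. (\<lambda>S. ([0..<n], spatt \<sigma> \<epsilon> n S \<phi>)) ` Pow {..<n})"
  have C1: "\<forall>(is, \<psi>) \<in> C. \<psi> \<in> fms L (pow \<sigma> (length is) @ [])"
    using fms_spatt[OF \<phi>] by (auto simp: C_def)
  have "\<exists>f. (\<forall>i. f i \<in> tuples U \<sigma>) \<and> (\<forall>c\<in>q. famsat U \<sigma> [] [] f c)" if q: "q \<subseteq> C" "finite q" for q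
  proof -
    have "\<forall>c \<in> q. \<exists>n S. S \<subseteq> {..<n} \<and> c = ([0..<n], spatt \<sigma> \<epsilon> n S \<phi>)"
      using q(1) unfolding C_def by blast
    then obtain nn SS where nS: "\<And>c. c \<in> q \<Longrightarrow> SS c \<subseteq> {..<nn c} \<and> c = ([0..<nn c], spatt \<sigma> \<epsilon> (nn c) (SS c) \<phi>)" by metis
    \<comment> \<open>A shattered sequence of the largest length occurring in \<open>q\<close>
      serves all conditions of \<open>q\<close>: a pattern on fewer terms is also a pattern on all
      of them.\<close>
    define n where "n = Max (insert 0 (nn ` q))"
    have n: "nn c \<le> n" if "c \<in> q" for c unfolding n_def using q(2) that by (intro Max_ge) auto
    from sh[of n] obtain w where w: "\<And>k. w k \<in> tuples U \<sigma>"
      and w': "\<And>S. S \<subseteq> {..<n} \<Longrightarrow> \<exists>z \<in> tuples U \<epsilon>. \<forall>k<n. w k @ z \<in> ext U (\<sigma> @ \<epsilon>) \<phi> \<longleftrightarrow> k \<in> S"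
      unfolding shatters_def by blast
    have "famsat U \<sigma> [] [] w c" if c: "c \<in> q" for c
    proof -
      have "SS c \<subseteq> {..<n}" using nS[OF c] n[OF c] by auto
      then have "\<exists>z \<in> tuples U \<epsilon>. \<forall>k<nn c. w k @ z \<in> ext U (\<sigma> @ \<epsilon>) \<phi> \<longleftrightarrow> k \<in> SS c"
        using w' n[OF c] by (meson order_less_le_trans)
      then have "cat w [0..<nn c] \<in> ext U (pow \<sigma> (nn c)) (spatt \<sigma> \<epsilon> (nn c) (SS c) \<phi>)"
        using ext_spatt[OF \<phi>, of U w "nn c" "SS c"] w by simp
      moreover have "c = ([0..<nn c], spatt \<sigma> \<epsilon> (nn c) (SS c) \<phi>)" using nS[OF c] by simp
      ultimately show ?thesis unfolding famsat_def by (metis (no_types, lifting) append_Nil2 case_prod_conv diff_zero length_upt)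
    qed
    with w show ?thesis by blast
  qed
  then have "\<forall>q. q \<subseteq> C \<longrightarrow> finite q \<longrightarrow> (\<exists>f. (\<forall>i. f i \<in> tuples U \<sigma>) \<and> (\<forall>c\<in>q. famsat U \<sigma> [] [] f c))" by blast
  from realize_family[OF monsterD(4,3,1,2)[OF U] _ C1 this]
  obtain w where w: "\<And>i. w i \<in> tuples U \<sigma>" and "\<And>c. c \<in> C \<Longrightarrow> famsat U \<sigma> [] [] w c"
    by auto
  moreover have "([0..<n], spatt \<sigma> \<epsilon> n S \<phi>) \<in> C" if "S \<subseteq> {..<n}" for n S
    using that unfolding C_def by blast
  ultimately have "famsat U \<sigma> [] [] w ([0..<n], spatt \<sigma> \<epsilon> n S \<phi>)" if "S \<subseteq> {..<n}" for n S
    using that by blast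
  then have w': "\<exists>z \<in> tuples U \<epsilon>. \<forall>k<n. w k @ z \<in> ext U (\<sigma> @ \<epsilon>) \<phi> \<longleftrightarrow> k \<in> S" if "S \<subseteq> {..<n}" for n S
    using ext_spatt[OF \<phi>, of U w n S] w that unfolding famsat_def by simp
  \<comment> \<open>The pattern that contains only \<open>i\<close> separates the two terms. So the
    terms are distinct and form an infinite set, as the definition of NIP requires.\<close>
  have "w i \<noteq> w j" if "i < j" for i j
  proof
    assume eq: "w i = w j"
    have "{i} \<subseteq> {..<Suc j}" using that by auto
    from w'[OF this] obtain z where z: "\<forall>k<Suc j. w k @ z \<in> ext U (\<sigma> @ \<epsilon>) \<phi> \<longleftrightarrow> k \<in> {i}" by blast
    from z[rule_format, of i] z[rule_format, of j] eq that show False by simp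
  qed
  then have inj: "inj w" by (metis injI linorder_neqE_nat)
  \<comment> \<open>Arbitrary subsets of the infinite set need a second compactness argument, this
    time for the parameter. As \<open>realize\<close> puts the unknown tuple first, the two blocks
    of \<open>\<phi>\<close> are exchanged.\<close>
  have "\<exists>b \<in> tuples U \<epsilon>. \<forall>k. w k @ b \<in> ext U (\<sigma> @ \<epsilon>) \<phi> \<longleftrightarrow> k \<in> S" for S
  proof -
    obtain h1 where h1: "reidx \<sigma> (\<epsilon> @ \<sigma> @ []) h1"
      "\<And>xs as ys. length xs = length \<epsilon> \<Longrightarrow> length as = length \<sigma> \<Longrightarrow> pick h1 (xs @ as @ ys) = (as :: 'u list)"
      using ex_reidx_append by blast
    obtain h2 where h2: "reidx \<epsilon> ([] @ \<epsilon> @ \<sigma>) h2"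
      "\<And>as ys. length as = length \<epsilon> \<Longrightarrow> pick h2 ([] @ as @ ys) = (as :: 'u list)"
      using ex_reidx_append[of \<epsilon> "[]" \<sigma>] by auto
    have r: "reidx (\<sigma> @ \<epsilon>) (\<epsilon> @ \<sigma>) (h1 @ h2)" using reidx_append[OF _ h2(1)[simplified]] h1(1) by simp
    define \<phi>' where "\<phi>' = reindex (\<sigma> @ \<epsilon>) (\<epsilon> @ \<sigma>) (h1 @ h2) \<phi>"
    have \<phi>': "\<phi>' \<in> fms L (\<epsilon> @ \<sigma>)" unfolding \<phi>'_def by (rule fms_reindex[OF r \<phi>])
    have e: "b @ a \<in> ext U (\<epsilon> @ \<sigma>) \<phi>' \<longleftrightarrow> a @ b \<in> ext U (\<sigma> @ \<epsilon>) \<phi>" if a: "a \<in> tuples U \<sigma>" and b: "b \<in> tuples U \<epsilon>" for a b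
    proof -
      have "pick (h1 @ h2) (b @ a) = a @ b"
        using h1(2)[of b a "[]"] h2(2)[of b a] tuples_length[OF a] tuples_length[OF b] by (simp add: pick_append)
      then show ?thesis unfolding \<phi>'_def using ext_reindex[OF r \<phi>, of U] a b by (simp add: tuples_appendI)
    qed
    define D where "D = range (\<lambda>k. (if k \<in> S then \<phi>' else Neg \<phi>', \<sigma>, w k))"
    define A where "A = (\<Union>k. set (w k))"
    have "\<exists>as \<in> tuples U \<epsilon>. \<forall>(\<phi>, \<tau>', e) \<in> D. as @ e \<in> ext U (\<epsilon> @ \<tau>') \<phi>"
    proof (rule realize[OF monsterD(4,3,1,2)[OF U]])
      show "A \<subseteq> univ U" using tuples_set[OF w] by (auto simp: A_def)
      show "|A| <o \<kappa>" by (rule countable_ordLess[OF _ monsterD(5)[OF U]]) (auto simp: A_def countable_finite)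
      show "D \<subseteq> conds L U A \<epsilon>" using \<phi>' fms_Neg[OF \<phi>'] w by (auto simp: D_def conds_def A_def)
      show "fin_sat U \<epsilon> D" unfolding fin_sat_def
      proof (intro allI impI)
        fix q assume q: "q \<subseteq> D" "finite q"
        from finite_subset_image[OF q(2) q(1)[unfolded D_def]] obtain K where K: "finite K"
          "q = (\<lambda>k. (if k \<in> S then \<phi>' else Neg \<phi>', \<sigma>, w k)) ` K" by blast
        define n where "n = Suc (Max (insert 0 K))"
        have n: "k < n" if "k \<in> K" for k unfolding n_def using K that by (simp add: le_imp_less_Suc)
        from w'[of "S \<inter> {..<n}" n] obtain z where z: "z \<in> tuples U \<epsilon>"
          "\<And>k. k < n \<Longrightarrow> w k @ z \<in> ext U (\<sigma> @ \<epsilon>) \<phi> \<longleftrightarrow> k \<in> S" by auto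
        then show "\<exists>as\<in>tuples U \<epsilon>. \<forall>(\<phi>, \<tau>', e)\<in>q. as @ e \<in> ext U (\<epsilon> @ \<tau>') \<phi>"
          using K(2) e[OF w z(1)] n w by (intro bexI[of _ z]) (auto simp: ext_Neg tuples_appendI)
      qed
    qed
    then obtain b where b: "b \<in> tuples U \<epsilon>" "\<And>k. b @ w k \<in> ext U (\<epsilon> @ \<sigma>) (if k \<in> S then \<phi>' else Neg \<phi>')"
      by (auto simp: D_def)
    have "w k @ b \<in> ext U (\<sigma> @ \<epsilon>) \<phi> \<longleftrightarrow> k \<in> S" for k
      using b(2)[of k] e[OF w[of k] b(1)] by (auto simp: ext_Neg split: if_splits)
    with b(1) show ?thesis by blast
  qed
  note b = this
  let ?xs = "std_vars \<sigma>" and ?ys = "drop (length \<sigma>) (std_vars (\<sigma> @ \<epsilon>))"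
  have xy: "?xs @ ?ys = std_vars (\<sigma> @ \<epsilon>)"
    by (rule nth_equalityI) (auto simp: nth_append)
  have "map fst ?ys = drop (length \<sigma>) (map fst (std_vars (\<sigma> @ \<epsilon>)))" unfolding drop_map ..
  then have ys: "map fst ?ys = \<epsilon>" by simp
  have "\<exists>b\<in>tuples U (map fst ?ys). \<forall>a\<in>range w. sat U (assign undefined (?xs @ ?ys) (a @ b)) \<phi> \<longleftrightarrow> a \<in> S"
    if "S \<subseteq> range w" for S
  proof -
    from b[of "w -` S"] obtain z where z: "z \<in> tuples U \<epsilon>" "\<And>k. w k @ z \<in> ext U (\<sigma> @ \<epsilon>) \<phi> \<longleftrightarrow> w k \<in> S" by auto
    have "sat U (assign undefined (?xs @ ?ys) (w k @ z)) \<phi> \<longleftrightarrow> w k \<in> S" for k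
      unfolding xy using z(2)[of k] sat_assign_all[OF \<phi>, of "w k @ z" U undefined] tuples_appendI[OF w[of k] z(1)]
      by (simp add: ext_def tuples_length[OF w[of k]] tuples_length[OF z(1)])
    with z(1) ys show ?thesis by (intro bexI[of _ z]) auto
  qed
  moreover have "infinite (range w)" using inj by (simp add: finite_image_iff)
  moreover have "distinct (?xs @ ?ys)" unfolding xy by simp
  moreover have "fv \<phi> \<subseteq> set (?xs @ ?ys)" unfolding xy using \<phi> by (simp add: fms_def)
  moreover have "range w \<subseteq> tuples U (map fst ?xs)" using w by auto
  moreover have "\<phi> \<in> formulas L" using \<phi> by (simp add: fms_def)
  ultimately show False using assms(2) unfolding NIP_def by metis
qed

text \<open>An infinite set all of whose subsets are cut out by instances contains shattered sets of
  every finite size.\<close>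

lemma NIP_if_bound:
  fixes L :: "('s, 'f, 'p) lang" and U :: "('s, 'f, 'p, 'u) struc"
  assumes "\<And>\<phi> \<sigma> \<epsilon>. \<phi> \<in> fms L (\<sigma> @ \<epsilon>) \<Longrightarrow> \<exists>n. \<not> shatters U \<sigma> \<epsilon> \<phi> n"
  shows "NIP L U"
  unfolding NIP_def
proof (intro notI, elim bexE exE conjE)
  fix \<phi> :: "('s, 'f, 'p) fm" and xs ys and A :: "'u list set"
  assume *: "\<phi> \<in> formulas L" "distinct (xs @ ys)" "fv \<phi> \<subseteq> set (xs @ ys)" "infinite A" "A \<subseteq> tuples U (map fst xs)"
    "\<forall>S\<subseteq>A. \<exists>b\<in>tuples U (map fst ys). \<forall>a\<in>A. sat U (assign undefined (xs @ ys) (a @ b)) \<phi> \<longleftrightarrow> a \<in> S"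
  let ?\<phi> = "canon (xs @ ys) \<phi>" and ?\<sigma> = "map fst xs" and ?\<epsilon> = "map fst ys"
  have \<phi>: "?\<phi> \<in> fms L (?\<sigma> @ ?\<epsilon>)" using fms_canon[OF *(2,1,3)] by simp
  have e: "sat U (assign undefined (xs @ ys) as) \<phi> \<longleftrightarrow> as \<in> ext U (?\<sigma> @ ?\<epsilon>) ?\<phi>" if "as \<in> tuples U (?\<sigma> @ ?\<epsilon>)" for as
    using sat_canon[OF *(2,1,3), of "assign undefined (xs @ ys) as" as U] assign_nth[OF *(2), of as] tuples_length[OF that] that
    by (simp add: ext_def)
  from infinite_countable_subset[OF *(4)] obtain w :: "nat \<Rightarrow> 'u list" where w: "inj w" "range w \<subseteq> A" by blast
  have "shatters U ?\<sigma> ?\<epsilon> ?\<phi> n" for n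
    unfolding shatters_def
  proof (intro exI[of _ w] conjI allI impI)
    show wt: "w k \<in> tuples U ?\<sigma>" for k using w *(5) by auto
    fix S assume "S \<subseteq> {..<n}"
    have "w ` S \<subseteq> A" using w by auto
    with *(6) obtain b where b: "b \<in> tuples U ?\<epsilon>" "\<And>a. a \<in> A \<Longrightarrow> sat U (assign undefined (xs @ ys) (a @ b)) \<phi> \<longleftrightarrow> a \<in> w ` S"
      by metis
    have "w k @ b \<in> ext U (?\<sigma> @ ?\<epsilon>) ?\<phi> \<longleftrightarrow> k \<in> S" for k
      using e[OF tuples_appendI[OF wt b(1)], of k] b(2)[of "w k"] w by (auto simp: inj_image_mem_iff)
    with b(1) show "\<exists>z\<in>tuples U ?\<epsilon>. \<forall>k<n. w k @ z \<in> ext U (?\<sigma> @ ?\<epsilon>) ?\<phi> \<longleftrightarrow> k \<in> S" by blast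
  qed
  with assms[OF \<phi>] show False by blast
qed

lemma fms_conj_map: "(\<And>x. x \<in> set xs \<Longrightarrow> f x \<in> fms L \<tau>) \<Longrightarrow> conj (map f xs) \<in> fms L \<tau>"
  by (rule fms_conj) auto

lemma ext_conj_map: "is_struc L N \<Longrightarrow> as \<in> tuples N \<tau> \<Longrightarrow>
    as \<in> ext N \<tau> (conj (map f xs)) \<longleftrightarrow> (\<forall>x\<in>set xs. as \<in> ext N \<tau> (f x))"
  by (simp add: ext_conj)

subsection \<open>The Shelah expansion and its monster model\<close>

text \<open>\<open>M'\<close> supplies the parameters of the externally definable sets,
  \<open>U1\<close> is a monster model of the theory of the expansion. No embedding between the two
  is given; facts pass between them through \<open>M\<close>.\<close>

locale shelah =
  fixes L :: "('s, 'f, 'p) lang" and M M' :: "('s, 'f, 'p, 'a) struc"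
    and \<kappa>1 :: "'k rel" and U1 :: "('s, unit, 's list \<times> 'a list set, 'v) struc"
  assumes elem: "elem_sub L M M'"
    and sat_M': "saturated L (cardSuc ( |univ M| +c |formulas L| )) M'"
    and dist: "distal (shelah_lang L M M') (Th (shelah_lang L M M') (shelah_expansion M)) \<kappa>1 U1"
begin

abbreviation ED :: "'s list \<Rightarrow> 'a list set \<Rightarrow> bool" where
  "ED \<equiv> ext_definable L M M'"

abbreviation "L1 \<equiv> shelah_lang L M M'"
abbreviation "S \<equiv> shelah_expansion M"

lemma monster_U1: "monster L1 (Th L1 S) \<kappa>1 U1"
  and NIP_U1: "NIP L1 U1"
  using dist by (simp_all add: distal_def)

lemma is_struc_M: "is_struc L M" and is_struc_M': "is_struc L M'"
  using elem by (simp_all add: elem_sub_def)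

lemmas is_struc_U1 = monsterD(3)[OF monster_U1]

lemma dom_of_S: "dom_of S s = dom_of M s"
  by (simp add: dom_of_def shelah_expansion_def)

lemma tuples_S [simp]: "tuples S \<tau> = tuples M \<tau>"
  by (simp add: tuples_def dom_of_S)

lemma is_struc_S: "is_struc L1 S"
  using is_struc_M by (simp add: is_struc_def dom_of_S shelah_lang_def)

lemma models_S: "models L1 S (Th L1 S)" and models_U1: "models L1 U1 (Th L1 S)"
  using is_struc_S monster_U1 by (simp_all add: models_def Th_def monster_def)

lemma complete_Th: "complete_theory L1 (Th L1 S)"
proof -
  have "Neg \<phi> \<in> Th L1 S \<longleftrightarrow> \<phi> \<notin> Th L1 S" if "\<phi> \<in> sentences L1" for \<phi>
  proof -
    have "sat S e \<phi> \<longleftrightarrow> sat S e' \<phi>" for e e' by (rule sat_cong) (use that in \<open>auto simp: sentences_def\<close>)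
    then show ?thesis using that by (auto simp: Th_def sentences_def formulas_def)
  qed
  then show ?thesis by (auto simp: complete_theory_def Th_def)
qed

lemmas transfer_S_U1 = complete_theory_transfer[OF complete_Th models_S models_U1]
lemmas transfer_U1_S = complete_theory_transfer[OF complete_Th models_U1 models_S]

lemma transfer_ne:
  assumes "\<beta> \<in> fms L1 \<tau>"
  shows "ext S \<tau> \<beta> \<noteq> {} \<longleftrightarrow> ext U1 \<tau> \<beta> \<noteq> {}"
proof -
  have \<beta>: "\<beta> \<in> fms L1 ([] @ \<tau>)" using assms by simp
  have "ext N [] (exs [] \<tau> \<beta>) \<noteq> {} \<longleftrightarrow> ext N \<tau> \<beta> \<noteq> {}" for N :: "('s, unit, 's list \<times> 'a list set, 'b) struc"
    unfolding ext_exs[OF \<beta>] using ext_tuples by fastforce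
  then show ?thesis using transfer_S_U1[OF fms_exs[OF \<beta>]] transfer_U1_S[OF fms_exs[OF \<beta>]] by metis
qed

lemma transfer_sub:
  assumes "\<beta> \<in> fms L1 \<tau>" "\<gamma> \<in> fms L1 \<tau>" "ext S \<tau> \<beta> \<subseteq> ext S \<tau> \<gamma>"
  shows "ext U1 \<tau> \<beta> \<subseteq> ext U1 \<tau> \<gamma>"
proof -
  have "ext S \<tau> (And \<beta> (Neg \<gamma>)) = {}" using assms(3) by (auto simp: ext_And ext_Neg)
  then have "ext U1 \<tau> (And \<beta> (Neg \<gamma>)) = {}"
    using transfer_ne[OF fms_And[OF assms(1) fms_Neg[OF assms(2)]]] by simp
  then show ?thesis using ext_tuples[of U1 \<tau> \<beta>] by (auto simp: ext_And ext_Neg)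
qed

lemma transfer_eq:
  assumes "\<beta> \<in> fms L1 \<tau>" "\<gamma> \<in> fms L1 \<tau>" "ext S \<tau> \<beta> = ext S \<tau> \<gamma>"
  shows "ext U1 \<tau> \<beta> = ext U1 \<tau> \<gamma>"
  using transfer_sub[of \<beta> \<tau> \<gamma>] transfer_sub[of \<gamma> \<tau> \<beta>] assms by auto

text \<open>The extension of \<open>Y\<close> to \<open>U1\<close> that its predicate provides. It
  is of interest for externally definable \<open>Y\<close>; by transfer it then commutes with
  Boolean operations and reindexing.\<close>

definition star :: "'s list \<Rightarrow> 'a list set \<Rightarrow> 'v list set" where
  "star \<tau> Y = {as \<in> tuples U1 \<tau>. as \<in> rel_int U1 (\<tau>, Y)}"

definition rf :: "'s list \<Rightarrow> 'a list set \<Rightarrow> ('s, unit, 's list \<times> 'a list set) fm" where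
  "rf \<tau> Y = Rel (\<tau>, Y) (map Var (std_vars \<tau>))"

lemma fms_rf: "ED \<tau> Y \<Longrightarrow> rf \<tau> Y \<in> fms L1 \<tau>"
proof -
  have *: "has_sort L1 (Var v) (fst v)" for v by (rule has_sort.intros)
  have "has_sort L1 (map Var (std_vars \<tau>) ! j) (\<tau> ! j)" if "j < length \<tau>" for j
    using *[of "(\<tau> ! j, j)"] that by simp
  then have "list_all2 (has_sort L1) (map Var (std_vars \<tau>)) \<tau>"
    unfolding list_all2_conv_all_nth by simp
  moreover assume "ED \<tau> Y"
  ultimately show "rf \<tau> Y \<in> fms L1 \<tau>" by (auto simp: rf_def fms_def formulas_def shelah_lang_def)
qed

lemma ext_rf_aux: "ext N \<tau> (rf \<tau> Y) = {as \<in> tuples N \<tau>. as \<in> rel_int N (\<tau>, Y)}"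
proof -
  have "map (eval N (std_env as)) (map Var (std_vars \<tau>)) = as" if "as \<in> tuples N \<tau>" for as
    using tuples_length[OF that] by (intro nth_equalityI) (auto simp: std_env_def)
  then show ?thesis by (auto simp: ext_def rf_def)
qed

lemma rel_int_S: "rel_int S (\<tau>, Y) = Y"
  by (simp add: shelah_expansion_def)

lemma ext_rf_U1: "ext U1 \<tau> (rf \<tau> Y) = star \<tau> Y"
  unfolding ext_rf_aux star_def ..

lemma ext_rf_S: "ED \<tau> Y \<Longrightarrow> ext S \<tau> (rf \<tau> Y) = Y"
  unfolding ext_rf_aux using ED_sub[OF elem] rel_int_S by auto

lemma star_tuples: "as \<in> star \<tau> Y \<Longrightarrow> as \<in> tuples U1 \<tau>"
  by (simp add: star_def)

lemma star_mono: "ED \<tau> Y \<Longrightarrow> ED \<tau> Z \<Longrightarrow> Y \<subseteq> Z \<Longrightarrow> star \<tau> Y \<subseteq> star \<tau> Z"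
  using transfer_sub[OF fms_rf fms_rf] ext_rf_S ext_rf_U1 by metis

lemma star_all: "star \<tau> (tuples M \<tau>) = tuples U1 \<tau>"
  using transfer_eq[OF fms_rf[OF ED_tuples[OF elem]] fms_Tru] ext_rf_U1 ext_rf_S[OF ED_tuples[OF elem]]
    ext_Tru[OF is_struc_S] ext_Tru[OF is_struc_U1] by (metis tuples_S)

lemma star_compl: "ED \<tau> Y \<Longrightarrow> star \<tau> (tuples M \<tau> - Y) = tuples U1 \<tau> - star \<tau> Y"
  using transfer_eq[OF fms_rf[OF ED_compl[OF elem]] fms_Neg[OF fms_rf]] ext_rf_U1 ext_rf_S[OF ED_compl[OF elem]]
    ext_rf_S by (metis ext_Neg tuples_S)

lemma star_inter: "ED \<tau> Y \<Longrightarrow> ED \<tau> Z \<Longrightarrow> star \<tau> (Y \<inter> Z) = star \<tau> Y \<inter> star \<tau> Z"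
  using transfer_eq[OF fms_rf[OF ED_inter[OF elem]] fms_And[OF fms_rf fms_rf]] ext_rf_U1 ext_rf_S[OF ED_inter[OF elem]]
    ext_rf_S by (metis ext_And)

lemma star_ne: "ED \<tau> Y \<Longrightarrow> star \<tau> Y \<noteq> {} \<longleftrightarrow> Y \<noteq> {}"
  using transfer_ne[OF fms_rf] ext_rf_U1 ext_rf_S by metis

lemma star_reidx:
  assumes "reidx \<tau> \<tau>' hs" "ED \<tau> Y"
  shows "star \<tau>' {as \<in> tuples M \<tau>'. pick hs as \<in> Y} = {as \<in> tuples U1 \<tau>'. pick hs as \<in> star \<tau> Y}"
  using transfer_eq[OF fms_rf[OF ED_reidx[OF elem assms]] fms_reindex[OF assms(1) fms_rf[OF assms(2)]]]
  unfolding ext_reindex[OF assms(1) fms_rf[OF assms(2)] is_struc_S] ext_reindex[OF assms(1) fms_rf[OF assms(2)] is_struc_U1]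
    ext_rf_U1 ext_rf_S[OF ED_reidx[OF elem assms]] ext_rf_S[OF assms(2)] by simp

text \<open>The assumption on \<open>Y\<close> and \<open>Z\<close> is a sentence of the expanded
  language about two predicates, so it transfers to \<open>U1\<close>.\<close>

lemma star_ex:
  assumes Y: "ED \<tau> Y" and Z: "ED (\<tau> @ \<tau>') Z" and sub: "\<And>as. as \<in> Y \<Longrightarrow> \<exists>bs \<in> tuples M \<tau>'. as @ bs \<in> Z" and as: "as \<in> star \<tau> Y"
  shows "\<exists>bs \<in> tuples U1 \<tau>'. as @ bs \<in> star (\<tau> @ \<tau>') Z"
proof -
  have "ext S \<tau> (rf \<tau> Y) \<subseteq> ext S \<tau> (exs \<tau> \<tau>' (rf (\<tau> @ \<tau>') Z))"
    unfolding ext_exs[OF fms_rf[OF Z]] ext_rf_S[OF Z] ext_rf_S[OF Y] using sub ED_sub[OF elem Y] by auto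
  from transfer_sub[OF fms_rf[OF Y] fms_exs[OF fms_rf[OF Z]] this] as show ?thesis
    unfolding ext_exs[OF fms_rf[OF Z]] ext_rf_U1 by auto
qed

lemma tuples_ne: "is_struc L' N \<Longrightarrow> \<exists>as. as \<in> tuples N \<tau>"
proof -
  assume "is_struc L' N"
  then have "\<exists>d. \<forall>s. d s \<in> dom_of N s" unfolding is_struc_def by (intro choice) blast
  then obtain d where "\<And>s. d s \<in> dom_of N s" by blast
  then have "map d \<tau> \<in> tuples N \<tau>" by (simp add: tuples_iff)
  then show ?thesis ..
qed

text \<open>In \<open>M\<close> the formula is equivalent to the predicate naming its extension. If
  it shattered sets of every finite size in \<open>M\<close>, the predicate would do so in
  \<open>U1\<close>, against NIP of the expansion.\<close>

lemma shatter_bound: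
  assumes \<phi>: "\<phi> \<in> fms L (\<sigma> @ \<epsilon>)"
  shows "\<exists>n. \<not> shatters M \<sigma> \<epsilon> \<phi> n"
proof -
  let ?X = "ext M (\<sigma> @ \<epsilon>) \<phi>" let ?R = "rf (\<sigma> @ \<epsilon>) ?X"
  have X: "ED (\<sigma> @ \<epsilon>) ?X" by (rule ED_ext[OF elem \<phi>])
  from NIP_bound[OF monster_U1 NIP_U1 fms_rf[OF X]] obtain n where n: "\<not> shatters U1 \<sigma> \<epsilon> ?R n" by blast
  have "\<not> shatters M \<sigma> \<epsilon> \<phi> n"
  proof
    assume "shatters M \<sigma> \<epsilon> \<phi> n"
    then have sh: "shatters S \<sigma> \<epsilon> ?R n" unfolding shatters_def ext_rf_S[OF X] by simp
    let ?q = "(\<lambda>A. ([0..<n], spatt \<sigma> \<epsilon> n A ?R)) ` Pow {..<n}"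
    from sh obtain w where w: "\<forall>k. w k \<in> tuples S \<sigma>" "\<forall>c\<in>?q. famsat S \<sigma> [] [] w c"
      unfolding shatters_iff[OF fms_rf[OF X] is_struc_S] by blast
    have "\<forall>(is, \<phi>) \<in> ?q. \<phi> \<in> fms L1 (pow \<sigma> (length is))" using fms_spatt[OF fms_rf[OF X]] by auto
    from family_transfer[OF is_struc_S is_struc_U1 transfer_S_U1 _ this w] n
    show False unfolding shatters_iff[OF fms_rf[OF X] is_struc_U1] by simp
  qed
  then show ?thesis ..
qed

text \<open>Tuples of the same \<open>L\<close>-type cannot follow all patterns with respect to an externally definable set:
  the external parameter of that set witnesses each pattern, and \<open>L\<close> has NIP.\<close>

lemma no_patterns:
  assumes X: "ED \<sigma> X"
  shows "\<exists>n :: nat. \<forall>\<tau> hs b. (\<forall>k<n. reidx \<sigma> \<tau> (hs k)) \<longrightarrow> (\<forall>A. b A \<in> tuples U1 \<tau>) \<longrightarrow>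
    (\<forall>A. \<forall>\<alpha> \<in> fms L \<tau>. b A \<in> star \<tau> (ext M \<tau> \<alpha>) \<longrightarrow> b {} \<in> star \<tau> (ext M \<tau> \<alpha>)) \<longrightarrow>
    \<not> (\<forall>A. \<forall>k<n. pick (hs k) (b A) \<in> star \<sigma> X \<longleftrightarrow> k \<in> A)"
proof -
  from X obtain \<epsilon> \<phi> e where \<phi>: "\<phi> \<in> fms L (\<sigma> @ \<epsilon>)" and e: "e \<in> tuples M' \<epsilon>"
    and Xe: "X = {as \<in> tuples M \<sigma>. as @ e \<in> ext M' (\<sigma> @ \<epsilon>) \<phi>}"
    unfolding ext_definable_iff[OF elem] by blast
  from shatter_bound[OF \<phi>] obtain n where n: "\<not> shatters M \<sigma> \<epsilon> \<phi> n" by blast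
  have no: False
    if h: "\<forall>k<n. reidx \<sigma> \<tau> (hs k)" and b: "\<forall>A. b A \<in> tuples U1 \<tau>"
      and tp: "\<forall>A. \<forall>\<alpha> \<in> fms L \<tau>. b A \<in> star \<tau> (ext M \<tau> \<alpha>) \<longrightarrow> b {} \<in> star \<tau> (ext M \<tau> \<alpha>)"
      and pat: "\<forall>A. \<forall>k<n. pick (hs k) (b A) \<in> star \<sigma> X \<longleftrightarrow> k \<in> A" for \<tau> hs b
  proof -
    let ?\<alpha> = "\<lambda>A. patt \<tau> \<sigma> \<epsilon> hs n A \<phi>"
    have h': "k < n \<Longrightarrow> reidx \<sigma> \<tau> (hs k)" for k using h by blast
    have \<alpha>: "?\<alpha> A \<in> fms L \<tau>" for A by (rule fms_patt[OF h \<phi>])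
    have ED\<alpha>: "ED \<tau> (ext M \<tau> (?\<alpha> A))" for A by (rule ED_ext[OF elem \<alpha>])
    have "b A \<in> star \<tau> (ext M \<tau> (?\<alpha> A))" for A
    proof -
      let ?f = "\<lambda>k. if k \<in> A then reindex \<sigma> \<tau> (hs k) (rf \<sigma> X) else Neg (reindex \<sigma> \<tau> (hs k) (rf \<sigma> X))"
      let ?\<gamma> = "conj (map ?f [0..<n])"
      have f: "?f k \<in> fms L1 \<tau>" if "k < n" for k
        using fms_reindex[OF h'[OF that] fms_rf[OF X]] fms_Neg by auto
      have \<gamma>: "?\<gamma> \<in> fms L1 \<tau>" by (rule fms_conj_map, rule f) simp
      have fS: "x \<in> ext S \<tau> (?f k) \<longleftrightarrow> (pick (hs k) x \<in> X \<longleftrightarrow> k \<in> A)" if "k < n" "x \<in> tuples M \<tau>" for k x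
        using ext_reindex[OF h'[OF that(1)] fms_rf[OF X] is_struc_S] that(2) by (simp add: ext_rf_S[OF X] ext_Neg)
      have fU: "x \<in> ext U1 \<tau> (?f k) \<longleftrightarrow> (pick (hs k) x \<in> star \<sigma> X \<longleftrightarrow> k \<in> A)" if "k < n" "x \<in> tuples U1 \<tau>" for k x
        using ext_reindex[OF h'[OF that(1)] fms_rf[OF X] is_struc_U1] that(2) by (simp add: ext_rf_U1 ext_Neg)
      \<comment> \<open>For a tuple of \<open>M\<close> with pattern \<open>A\<close> relative to
        \<open>X\<close>, the external parameter \<open>e\<close> is a witness in \<open>M'\<close>.
        That a witness exists is an \<open>L\<close>-formula about this tuple alone, so elementarity
        brings it down to \<open>M\<close>.\<close>
      have "ext S \<tau> ?\<gamma> \<subseteq> ext S \<tau> (rf \<tau> (ext M \<tau> (?\<alpha> A)))"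
      proof
        fix x assume x: "x \<in> ext S \<tau> ?\<gamma>"
        then have xt: "x \<in> tuples M \<tau>" using ext_tuples by fastforce
        have p: "pick (hs k) x \<in> X \<longleftrightarrow> k \<in> A" if "k < n" for k
          using x fS[OF that xt] that unfolding ext_conj[OF is_struc_S] by auto
        have "x \<in> ext M' \<tau> (?\<alpha> A)"
          unfolding ext_patt[OF h \<phi> is_struc_M' elem_sub_tuples[OF elem xt]]
          by (rule bexI[OF _ e]) (use p pick_tuples[OF h' xt] in \<open>auto simp: Xe\<close>)
        then show "x \<in> ext S \<tau> (rf \<tau> (ext M \<tau> (?\<alpha> A)))"
          unfolding ext_rf_S[OF ED\<alpha>] elem_sub_ext[OF elem \<alpha> xt] .
      qed
      from transfer_sub[OF \<gamma> fms_rf[OF ED\<alpha>] this] have "ext U1 \<tau> ?\<gamma> \<subseteq> star \<tau> (ext M \<tau> (?\<alpha> A))"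
        unfolding ext_rf_U1 .
      moreover have bt: "b A \<in> tuples U1 \<tau>" using b by blast
      have "b A \<in> ext U1 \<tau> ?\<gamma>"
      proof (rule ext_conj_map[OF is_struc_U1 bt, THEN iffD2], intro ballI)
        show "b A \<in> ext U1 \<tau> (?f k)" if "k \<in> set [0..<n]" for k using fU[OF _ bt] pat that by simp
      qed
      ultimately show ?thesis by blast
    qed
    \<comment> \<open>\<open>b {}\<close> serves as the reference tuple. It satisfies the
      \<open>L\<close>-formulas that hold of any \<open>b A\<close>, hence for every
      \<open>A\<close> it admits a witness of pattern \<open>A\<close>.\<close>
    then have b0: "b {} \<in> star \<tau> (ext M \<tau> (?\<alpha> A))" for A using tp \<alpha> by blast
    obtain As where As: "set As = Pow {..<n}" using finite_list[of "Pow {..<n}"] by auto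
    \<comment> \<open>All finitely many patterns are put into one formula before the return to
      \<open>M\<close>, where a single tuple \<open>x\<close> then yields a shattered set.\<close>
    let ?\<delta> = "conj (map (\<lambda>A. rf \<tau> (ext M \<tau> (?\<alpha> A))) As)"
    have \<delta>: "?\<delta> \<in> fms L1 \<tau>" by (rule fms_conj) (use fms_rf[OF ED\<alpha>] in auto)
    have "b {} \<in> ext U1 \<tau> ?\<delta>" unfolding ext_conj[OF is_struc_U1] using b b0 by (auto simp: ext_rf_U1)
    then obtain x where x: "x \<in> ext S \<tau> ?\<delta>" using transfer_ne[OF \<delta>] by blast
    then have xt: "x \<in> tuples M \<tau>" using ext_tuples by fastforce
    have xA: "x \<in> ext M \<tau> (?\<alpha> A)" if "A \<subseteq> {..<n}" for A
      using x As that unfolding ext_conj[OF is_struc_S] by (auto simp: ext_rf_S[OF ED\<alpha>])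
    obtain d where d: "d \<in> tuples M \<sigma>" using tuples_ne[OF is_struc_M] by blast
    have "shatters M \<sigma> \<epsilon> \<phi> n"
      unfolding shatters_def
    proof (intro exI[of _ "\<lambda>k. if k < n then pick (hs k) x else d"] conjI allI impI)
      show "(if k < n then pick (hs k) x else d) \<in> tuples M \<sigma>" for k using d pick_tuples[OF h' xt] by auto
      fix A assume "A \<subseteq> {..<n}"
      from xA[OF this] show "\<exists>z\<in>tuples M \<epsilon>. \<forall>k<n. (if k < n then pick (hs k) x else d) @ z \<in> ext M (\<sigma> @ \<epsilon>) \<phi> \<longleftrightarrow> k \<in> A"
        unfolding ext_patt[OF h \<phi> is_struc_M xt] by auto
    qed
    with n show False by blast
  qed
  show ?thesis by (intro exI[of _ n] allI impI notI) (rule no)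
qed

end

text \<open>\<open>realize\<close> treats the first block as the unknown one, while
  \<open>exs\<close> and \<open>star_ex\<close> quantify the last one. Exchanging blocks mediates
  between the two conventions.\<close>

lemma block_swap:
  fixes L :: "('s, 'f, 'p) lang"
  assumes \<phi>: "\<phi> \<in> fms L (\<alpha> @ \<beta> @ \<gamma> @ \<delta>)"
  shows "\<exists>\<phi>' \<in> fms L (\<alpha> @ \<gamma> @ \<beta> @ \<delta>). \<forall>N :: ('s, 'f, 'p, 'a) struc. is_struc L N \<longrightarrow>
    (\<forall>a\<in>tuples N \<alpha>. \<forall>b\<in>tuples N \<beta>. \<forall>c\<in>tuples N \<gamma>. \<forall>d\<in>tuples N \<delta>.
      a @ c @ b @ d \<in> ext N (\<alpha> @ \<gamma> @ \<beta> @ \<delta>) \<phi>' \<longleftrightarrow> a @ b @ c @ d \<in> ext N (\<alpha> @ \<beta> @ \<gamma> @ \<delta>) \<phi>)"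
proof -
  obtain h1 where h1: "reidx \<alpha> ([] @ \<alpha> @ (\<gamma> @ \<beta> @ \<delta>)) h1"
    "\<And>as ys. length as = length \<alpha> \<Longrightarrow> pick h1 ([] @ as @ ys) = (as :: 'a list)"
    using ex_reidx_append[of \<alpha> "[]" "\<gamma> @ \<beta> @ \<delta>"] by auto
  obtain h2 where h2: "reidx \<beta> ((\<alpha> @ \<gamma>) @ \<beta> @ \<delta>) h2"
    "\<And>xs as ys. length xs = length (\<alpha> @ \<gamma>) \<Longrightarrow> length as = length \<beta> \<Longrightarrow> pick h2 (xs @ as @ ys) = (as :: 'a list)"
    using ex_reidx_append by blast
  obtain h3 where h3: "reidx \<gamma> (\<alpha> @ \<gamma> @ (\<beta> @ \<delta>)) h3"
    "\<And>xs as ys. length xs = length \<alpha> \<Longrightarrow> length as = length \<gamma> \<Longrightarrow> pick h3 (xs @ as @ ys) = (as :: 'a list)"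
    using ex_reidx_append by blast
  obtain h4 where h4: "reidx \<delta> ((\<alpha> @ \<gamma> @ \<beta>) @ \<delta> @ []) h4"
    "\<And>xs as ys. length xs = length (\<alpha> @ \<gamma> @ \<beta>) \<Longrightarrow> length as = length \<delta> \<Longrightarrow> pick h4 (xs @ as @ ys) = (as :: 'a list)"
    using ex_reidx_append by blast
  have r: "reidx (\<alpha> @ \<beta> @ \<gamma> @ \<delta>) (\<alpha> @ \<gamma> @ \<beta> @ \<delta>) (h1 @ h2 @ h3 @ h4)"
    by (intro reidx_append) (use h1(1) h2(1) h3(1) h4(1) in auto)
  have "a @ c @ b @ d \<in> ext N (\<alpha> @ \<gamma> @ \<beta> @ \<delta>) (reindex (\<alpha> @ \<beta> @ \<gamma> @ \<delta>) (\<alpha> @ \<gamma> @ \<beta> @ \<delta>) (h1 @ h2 @ h3 @ h4) \<phi>) \<longleftrightarrow>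
      a @ b @ c @ d \<in> ext N (\<alpha> @ \<beta> @ \<gamma> @ \<delta>) \<phi>"
    if N: "is_struc L N" and a: "a \<in> tuples N \<alpha>" and b: "b \<in> tuples N \<beta>" and c: "c \<in> tuples N \<gamma>" and d: "d \<in> tuples N \<delta>"
    for N :: "('s, 'f, 'p, 'a) struc" and a b c d
  proof -
    have "pick (h1 @ h2 @ h3 @ h4) (a @ c @ b @ d) = a @ b @ c @ d"
      using h1(2)[of a "c @ b @ d"] h2(2)[of "a @ c" b d] h3(2)[of a c "b @ d"] h4(2)[of "a @ c @ b" d "[]"]
        tuples_length[OF a] tuples_length[OF b] tuples_length[OF c] tuples_length[OF d] by (simp add: pick_append)
    then show ?thesis unfolding ext_reindex[OF r \<phi> N] using a b c d by (simp add: tuples_appendI)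
  qed
  then show ?thesis using fms_reindex[OF r \<phi>] by blast
qed

lemma block_swap2:
  fixes L :: "('s, 'f, 'p) lang"
  assumes \<phi>: "\<phi> \<in> fms L (\<beta> @ \<gamma> @ \<delta>)"
  obtains \<phi>' where "\<phi>' \<in> fms L (\<gamma> @ \<beta> @ \<delta>)"
    "\<And>(N :: ('s, 'f, 'p, 'a) struc) b c d. is_struc L N \<Longrightarrow> b \<in> tuples N \<beta> \<Longrightarrow> c \<in> tuples N \<gamma> \<Longrightarrow> d \<in> tuples N \<delta> \<Longrightarrow>
      c @ b @ d \<in> ext N (\<gamma> @ \<beta> @ \<delta>) \<phi>' \<longleftrightarrow> b @ c @ d \<in> ext N (\<beta> @ \<gamma> @ \<delta>) \<phi>"
  using block_swap[of \<phi> L "[]" \<beta> \<gamma> \<delta>, where 'a = 'a] \<phi> by auto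

lemma ED_param:
  assumes elem: "elem_sub L M M'" and \<phi>: "\<phi> \<in> fms L (\<beta> @ (\<tau> @ \<mu>))" and b: "b \<in> tuples M' \<beta>" and m: "m \<in> tuples M' \<mu>"
  shows "ext_definable L M M' \<tau> {u \<in> tuples M \<tau>. b @ (u @ m) \<in> ext M' (\<beta> @ (\<tau> @ \<mu>)) \<phi>}"
proof -
  have N: "is_struc L M'" using elem by (simp add: elem_sub_def)
  obtain \<phi>' where \<phi>': "\<phi>' \<in> fms L (\<tau> @ \<beta> @ \<mu>)"
    and e: "\<And>u. u \<in> tuples M' \<tau> \<Longrightarrow> u @ b @ m \<in> ext M' (\<tau> @ \<beta> @ \<mu>) \<phi>' \<longleftrightarrow> b @ u @ m \<in> ext M' (\<beta> @ \<tau> @ \<mu>) \<phi>"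
    using block_swap2[OF \<phi>] N b m by metis
  have "{u \<in> tuples M \<tau>. b @ (u @ m) \<in> ext M' (\<beta> @ (\<tau> @ \<mu>)) \<phi>} = {u \<in> tuples M \<tau>. u @ (b @ m) \<in> ext M' (\<tau> @ (\<beta> @ \<mu>)) \<phi>'}"
    using e elem_sub_tuples[OF elem] by auto
  then show ?thesis unfolding ext_definable_iff[OF elem] using \<phi>' tuples_appendI[OF b m] by blast
qed

context shelah
begin

lemma star_finite_inter:
  assumes "finite q" "\<forall>t\<in>q. ED \<tau> (F t)"
  shows "ED \<tau> {y \<in> tuples M \<tau>. \<forall>t\<in>q. y \<in> F t} \<and>
    star \<tau> {y \<in> tuples M \<tau>. \<forall>t\<in>q. y \<in> F t} = {b \<in> tuples U1 \<tau>. \<forall>t\<in>q. b \<in> star \<tau> (F t)}"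
  using assms
proof (induction q rule: finite_induct)
  case empty
  then show ?case using ED_tuples[OF elem] star_all by simp
next
  case (insert t q)
  have eq: "{y \<in> tuples M \<tau>. \<forall>t\<in>insert t q. y \<in> F t} = F t \<inter> {y \<in> tuples M \<tau>. \<forall>t\<in>q. y \<in> F t}"
    using ED_sub[OF elem, of \<tau> "F t"] insert.prems by auto
  from insert have IH: "ED \<tau> {y \<in> tuples M \<tau>. \<forall>t\<in>q. y \<in> F t}"
    "star \<tau> {y \<in> tuples M \<tau>. \<forall>t\<in>q. y \<in> F t} = {b \<in> tuples U1 \<tau>. \<forall>t\<in>q. b \<in> star \<tau> (F t)}" by auto
  have t: "ED \<tau> (F t)" using insert.prems by simp
  show ?case unfolding eq using ED_inter[OF elem t IH(1)] star_inter[OF t IH(1)] IH(2) star_tuples by auto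
qed

lemma cardM: "Card_order (cardSuc ( |univ M| +c |formulas L| ))" "infinite (Field (cardSuc ( |univ M| +c |formulas L| )))"
  "|univ M| <o cardSuc ( |univ M| +c |formulas L| )"
proof -
  have c: "Card_order ( |univ M| +c |formulas L| )" by (rule Card_order_csum)
  show c': "Card_order (cardSuc ( |univ M| +c |formulas L| ))" by (rule cardSuc_Card_order[OF c])
  have g: "( |univ M| +c |formulas L| ) <o cardSuc ( |univ M| +c |formulas L| )" by (rule cardSuc_greater[OF c])
  have "|univ M| \<le>o |univ M| +c |formulas L|" by (rule ordLeq_csum1) (rule card_of_Card_order)
  then show "|univ M| <o cardSuc ( |univ M| +c |formulas L| )" using g ordLeq_ordLess_trans by blast
  have "|formulas L| \<le>o |univ M| +c |formulas L|" by (rule ordLeq_csum2) (rule card_of_Card_order)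
  then have "|formulas L| <o cardSuc ( |univ M| +c |formulas L| )" using g ordLeq_ordLess_trans by blast
  then have "|formulas L| <o |Field (cardSuc ( |univ M| +c |formulas L| ))|"
    using card_of_Field_ordIso[OF c'] ordIso_symmetric ordLess_ordIso_trans by blast
  then show "infinite (Field (cardSuc ( |univ M| +c |formulas L| )))"
    using ordLess_imp_ordLeq card_of_ordLeq_infinite infinite_formulas by blast
qed

lemma ED_formula:
  assumes "\<chi> \<in> fms L (\<beta> @ \<mu>)" "m \<in> tuples M \<mu>"
  shows "ED \<beta> {y \<in> tuples M \<beta>. y @ m \<in> ext M (\<beta> @ \<mu>) \<chi>}"
  by (rule ED_slice[OF elem ED_ext[OF elem assms(1)] assms(2)])

text \<open>The \<open>L\<close>-type of \<open>b\<close> over \<open>M\<close>, read off from the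
  predicates naming \<open>M\<close>-definable sets, is finitely satisfiable in \<open>M\<close>,
  because a predicate with a realization in \<open>U1\<close> names a nonempty set. Saturation of
  \<open>M'\<close> over \<open>M\<close> then gives a realization \<open>b'\<close>, which turns
  instances at \<open>b\<close> into external ones.\<close>

lemma realize_in_M':
  assumes b: "b \<in> tuples U1 \<beta>"
  shows "\<exists>b' \<in> tuples M' \<beta>. \<forall>\<mu>. \<forall>\<chi> \<in> fms L (\<beta> @ \<mu>). \<forall>m \<in> tuples M \<mu>.
    b' @ m \<in> ext M' (\<beta> @ \<mu>) \<chi> \<longleftrightarrow> b \<in> star \<beta> {y \<in> tuples M \<beta>. y @ m \<in> ext M (\<beta> @ \<mu>) \<chi>}"
proof -
  define F where "F t = {y \<in> tuples M \<beta>. y @ snd (snd t) \<in> ext M (\<beta> @ fst (snd t)) (fst t)}" for t :: "('s, 'f, 'p) fm \<times> 's list \<times> 'a list"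
  define C where "C = {(\<chi>, \<mu>, m). \<chi> \<in> fms L (\<beta> @ \<mu>) \<and> m \<in> tuples M \<mu> \<and> b \<in> star \<beta> (F (\<chi>, \<mu>, m))}"
  have EDF: "ED \<beta> (F t)" if "t \<in> C" for t
    using that ED_formula by (auto simp: C_def F_def)
  have "\<exists>as \<in> tuples M' \<beta>. \<forall>(\<phi>, \<tau>', e) \<in> C. as @ e \<in> ext M' (\<beta> @ \<tau>') \<phi>"
  proof (rule realize[OF sat_M' is_struc_M' cardM(1,2)])
    show "univ M \<subseteq> univ M'" using elem by (simp add: elem_sub_def)
    show "|univ M| <o cardSuc ( |univ M| +c |formulas L| )" by (rule cardM)
    show "C \<subseteq> conds L M' (univ M) \<beta>" using elem_sub_tuples[OF elem] tuples_set by (fastforce simp: C_def conds_def)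
    show "fin_sat M' \<beta> C" unfolding fin_sat_def
    proof (intro allI impI)
      fix q assume q: "q \<subseteq> C" "finite q"
      have "\<forall>t\<in>q. ED \<beta> (F t)" using EDF q(1) by blast
      note fi = star_finite_inter[OF q(2) this]
      have "\<forall>t\<in>q. b \<in> star \<beta> (F t)" using q(1) by (auto simp: C_def)
      with b fi have "b \<in> star \<beta> {y \<in> tuples M \<beta>. \<forall>t\<in>q. y \<in> F t}" by simp
      then have "{y \<in> tuples M \<beta>. \<forall>t\<in>q. y \<in> F t} \<noteq> {}" using star_ne fi by blast
      then obtain y where y: "y \<in> tuples M \<beta>" "\<And>t. t \<in> q \<Longrightarrow> y \<in> F t" by blast
      have "y @ m \<in> ext M' (\<beta> @ \<mu>) \<chi>" if t: "(\<chi>, \<mu>, m) \<in> q" for \<chi> \<mu> m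
      proof -
        have \<chi>: "\<chi> \<in> fms L (\<beta> @ \<mu>)" "m \<in> tuples M \<mu>" using t q(1) by (auto simp: C_def)
        have "y @ m \<in> ext M (\<beta> @ \<mu>) \<chi>" using y(2)[OF t] by (simp add: F_def)
        then show ?thesis using elem_sub_ext[OF elem \<chi>(1) tuples_appendI[OF y(1) \<chi>(2)]] by simp
      qed
      then show "\<exists>as\<in>tuples M' \<beta>. \<forall>(\<phi>, \<tau>', e)\<in>q. as @ e \<in> ext M' (\<beta> @ \<tau>') \<phi>"
        using elem_sub_tuples[OF elem y(1)] by (intro bexI[of _ y]) auto
    qed
  qed
  then obtain b' where b': "b' \<in> tuples M' \<beta>" and C: "\<And>\<chi> \<mu> m. (\<chi>, \<mu>, m) \<in> C \<Longrightarrow> b' @ m \<in> ext M' (\<beta> @ \<mu>) \<chi>" by blast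
  have "b' @ m \<in> ext M' (\<beta> @ \<mu>) \<chi> \<longleftrightarrow> b \<in> star \<beta> {y \<in> tuples M \<beta>. y @ m \<in> ext M (\<beta> @ \<mu>) \<chi>}"
    if \<chi>: "\<chi> \<in> fms L (\<beta> @ \<mu>)" and m: "m \<in> tuples M \<mu>" for \<mu> \<chi> m
  proof
    show "b' @ m \<in> ext M' (\<beta> @ \<mu>) \<chi>" if "b \<in> star \<beta> {y \<in> tuples M \<beta>. y @ m \<in> ext M (\<beta> @ \<mu>) \<chi>}"
      by (rule C) (use that \<chi> m in \<open>auto simp: C_def F_def\<close>)
    show "b \<in> star \<beta> {y \<in> tuples M \<beta>. y @ m \<in> ext M (\<beta> @ \<mu>) \<chi>}" if b2: "b' @ m \<in> ext M' (\<beta> @ \<mu>) \<chi>"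
    proof (rule ccontr)
      assume "b \<notin> star \<beta> {y \<in> tuples M \<beta>. y @ m \<in> ext M (\<beta> @ \<mu>) \<chi>}"
      moreover have "tuples M \<beta> - {y \<in> tuples M \<beta>. y @ m \<in> ext M (\<beta> @ \<mu>) \<chi>} = {y \<in> tuples M \<beta>. y @ m \<in> ext M (\<beta> @ \<mu>) (Neg \<chi>)}"
        using m by (auto simp: ext_Neg tuples_appendI)
      ultimately have "b \<in> star \<beta> {y \<in> tuples M \<beta>. y @ m \<in> ext M (\<beta> @ \<mu>) (Neg \<chi>)}"
        using star_compl[OF ED_formula[OF \<chi> m]] b by auto
      then have "b' @ m \<in> ext M' (\<beta> @ \<mu>) (Neg \<chi>)"
        by (intro C) (use fms_Neg[OF \<chi>] m in \<open>auto simp: C_def F_def\<close>)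
      with b2 show False by (simp add: ext_Neg)
    qed
  qed
  with b' show ?thesis by blast
qed

abbreviation DM :: "'s list \<Rightarrow> 'a list set \<Rightarrow> bool" where
  "DM \<equiv> ext_definable L M M"

lemmas elemM = elem_sub_refl[OF is_struc_M]
lemmas DM_ED = ED_of_definable[OF elem]

subsection \<open>Honest definitions\<close>

text \<open>The trace on \<open>M\<close> of the \<open>b\<close>-instance of the \<open>M\<close>-definable set \<open>W\<close>.\<close>

definition tr :: "'s list \<Rightarrow> 's list \<Rightarrow> 'v list \<Rightarrow> 'a list set \<Rightarrow> 'a list set" where
  "tr \<beta> \<sigma> b W = {x \<in> tuples M \<sigma>. b \<in> star \<beta> {y \<in> tuples M \<beta>. y @ x \<in> W}}"

lemma DM_slice: "DM (\<beta> @ \<sigma>) W \<Longrightarrow> x \<in> tuples M \<sigma> \<Longrightarrow> DM \<beta> {y \<in> tuples M \<beta>. y @ x \<in> W}"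
  by (rule ED_slice[OF elemM])

lemma ED_slice': "DM (\<beta> @ \<sigma>) W \<Longrightarrow> x \<in> tuples M \<sigma> \<Longrightarrow> ED \<beta> {y \<in> tuples M \<beta>. y @ x \<in> W}"
  by (rule DM_ED[OF DM_slice])

lemma DM_formula:
  assumes "DM (\<beta> @ \<sigma>) W"
  obtains \<mu> \<chi> m where "\<chi> \<in> fms L (\<beta> @ \<sigma> @ \<mu>)" "m \<in> tuples M \<mu>"
    "W = {z \<in> tuples M (\<beta> @ \<sigma>). z @ m \<in> ext M (\<beta> @ \<sigma> @ \<mu>) \<chi>}"
  using assms unfolding ext_definable_iff[OF elemM] append_assoc by (elim exE conjE) (rule that)

text \<open>The \<open>b\<close>-instance can be replaced by the \<open>b'\<close>-instance of the
  same formula, where \<open>b'\<close> in \<open>M'\<close> realizes the type of \<open>b\<close>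
  over \<open>M\<close>; the trace of the latter is external by definition.\<close>

lemma ED_tr:
  assumes b: "b \<in> tuples U1 \<beta>" and W: "DM (\<beta> @ \<sigma>) W"
  shows "ED \<sigma> (tr \<beta> \<sigma> b W)"
proof -
  from W obtain \<mu> \<chi> m where \<chi>: "\<chi> \<in> fms L (\<beta> @ \<sigma> @ \<mu>)" and m: "m \<in> tuples M \<mu>"
    and We: "W = {z \<in> tuples M (\<beta> @ \<sigma>). z @ m \<in> ext M (\<beta> @ \<sigma> @ \<mu>) \<chi>}" by (rule DM_formula)
  from realize_in_M'[OF b] obtain b' where b': "b' \<in> tuples M' \<beta>"
    and e': "\<forall>\<mu>. \<forall>\<chi> \<in> fms L (\<beta> @ \<mu>). \<forall>m \<in> tuples M \<mu>.
      b' @ m \<in> ext M' (\<beta> @ \<mu>) \<chi> \<longleftrightarrow> b \<in> star \<beta> {y \<in> tuples M \<beta>. y @ m \<in> ext M (\<beta> @ \<mu>) \<chi>}" by (elim bexE)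
  note e = e'[rule_format]
  have "x \<in> tr \<beta> \<sigma> b W \<longleftrightarrow> b' @ (x @ m) \<in> ext M' (\<beta> @ (\<sigma> @ \<mu>)) \<chi>" if x: "x \<in> tuples M \<sigma>" for x
  proof -
    have "{y \<in> tuples M \<beta>. y @ x \<in> W} = {y \<in> tuples M \<beta>. y @ (x @ m) \<in> ext M (\<beta> @ (\<sigma> @ \<mu>)) \<chi>}"
      using x by (auto simp: We tuples_appendI)
    then show ?thesis using e[OF \<chi>, of "x @ m"] x m by (simp add: tr_def tuples_appendI)
  qed
  then have "tr \<beta> \<sigma> b W = {x \<in> tuples M \<sigma>. b' @ (x @ m) \<in> ext M' (\<beta> @ (\<sigma> @ \<mu>)) \<chi>}"
    by (auto simp: tr_def)
  then show ?thesis using ED_param[OF elem \<chi> b' elem_sub_tuples[OF elem m]] by simp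
qed

lemma tr_inter:
  assumes "DM (\<beta> @ \<sigma>) W" "DM (\<beta> @ \<sigma>) W'"
  shows "tr \<beta> \<sigma> b (W \<inter> W') = tr \<beta> \<sigma> b W \<inter> tr \<beta> \<sigma> b W'"
proof -
  have "{y \<in> tuples M \<beta>. y @ x \<in> W \<inter> W'} = {y \<in> tuples M \<beta>. y @ x \<in> W} \<inter> {y \<in> tuples M \<beta>. y @ x \<in> W'}" for x by auto
  then show ?thesis using star_inter[OF ED_slice'[OF assms(1)] ED_slice'[OF assms(2)]] by (auto simp: tr_def)
qed

lemma tr_compl:
  assumes W: "DM (\<beta> @ \<sigma>) W" and b: "b \<in> tuples U1 \<beta>"
  shows "tr \<beta> \<sigma> b (tuples M (\<beta> @ \<sigma>) - W) = tuples M \<sigma> - tr \<beta> \<sigma> b W"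
proof -
  have "{y \<in> tuples M \<beta>. y @ x \<in> tuples M (\<beta> @ \<sigma>) - W} = tuples M \<beta> - {y \<in> tuples M \<beta>. y @ x \<in> W}" if "x \<in> tuples M \<sigma>" for x
    using that by (auto simp: tuples_appendI)
  then show ?thesis using star_compl[OF ED_slice'[OF W]] b by (auto simp: tr_def)
qed

text \<open>The sentence transferred here quantifies over all \<open>y\<close> in \<open>Y\<close>.
  Membership of \<open>b\<close> in the extension of \<open>Y\<close> is the only information about
  \<open>b\<close> that enters.\<close>

lemma star_witness:
  assumes b: "b \<in> star \<beta> Y" and Y: "ED \<beta> Y" and W: "ED (\<beta> @ \<sigma>) W" and X: "ED \<sigma> X"
    and sub: "\<And>y. y \<in> Y \<Longrightarrow> \<exists>x \<in> X. y @ x \<in> W"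
  shows "\<exists>x \<in> star \<sigma> X. b @ x \<in> star (\<beta> @ \<sigma>) W"
proof -
  have b': "b \<in> tuples U1 \<beta>" by (rule star_tuples[OF b])
  let ?h = "[length \<beta>..<length \<beta> + length \<sigma>]"
  have r: "reidx \<sigma> (\<beta> @ \<sigma>) ?h" using reidx_block[of \<beta> "length \<beta>" \<sigma> "length \<sigma>" "[]"] by simp
  let ?X = "{z \<in> tuples M (\<beta> @ \<sigma>). pick ?h z \<in> X}"
  have X': "ED (\<beta> @ \<sigma>) ?X" by (rule ED_reidx[OF elem r X])
  have "\<exists>x \<in> tuples U1 \<sigma>. b @ x \<in> star (\<beta> @ \<sigma>) (W \<inter> ?X)"
  proof (rule star_ex[OF Y ED_inter[OF elem W X'] _ b])
    fix y assume y: "y \<in> Y"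
    then have yt: "y \<in> tuples M \<beta>" using ED_sub[OF elem Y] by auto
    from sub[OF y] obtain x where x: "x \<in> X" "y @ x \<in> W" by blast
    then have xt: "x \<in> tuples M \<sigma>" using ED_sub[OF elem X] by auto
    show "\<exists>bs\<in>tuples M \<sigma>. y @ bs \<in> W \<inter> ?X"
      using x xt yt pick_block[of y "length \<beta>" x "length \<sigma>" "[]"] by (intro bexI[OF _ xt]) (auto simp: tuples_length tuples_appendI)
  qed
  then obtain x where x: "x \<in> tuples U1 \<sigma>" "b @ x \<in> star (\<beta> @ \<sigma>) (W \<inter> ?X)" by blast
  then have "b @ x \<in> star (\<beta> @ \<sigma>) W" "b @ x \<in> star (\<beta> @ \<sigma>) ?X" using star_inter[OF W X'] by auto
  moreover from this(2) have "pick ?h (b @ x) \<in> star \<sigma> X" unfolding star_reidx[OF r X] by simp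
  ultimately show ?thesis using pick_block[of b "length \<beta>" x "length \<sigma>" "[]"] x(1) b' by (auto simp: tuples_length)
qed

text \<open>An approximation of \<open>X\<close> from inside: every realization in \<open>U1\<close>
  of the \<open>b\<close>-instance of \<open>W\<close> lies in the extension of \<open>X\<close>. It
  is an honest definition of \<open>X\<close> if its trace also contains \<open>X\<close>, which is
  what \<open>ex_honest\<close> provides.\<close>

definition honest :: "'s list \<Rightarrow> 'a list set \<Rightarrow> 's list \<times> 'v list \<times> 'a list set \<Rightarrow> bool" where
  "honest \<sigma> X = (\<lambda>(\<beta>, b, W). b \<in> tuples U1 \<beta> \<and> DM (\<beta> @ \<sigma>) W \<and>
     (\<forall>x \<in> tuples U1 \<sigma>. b @ x \<in> star (\<beta> @ \<sigma>) W \<longrightarrow> x \<in> star \<sigma> X))"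

text \<open>Points of \<open>M\<close> are not given as points of \<open>U1\<close>, so a point of
  the trace outside \<open>X\<close> does not refute honesty directly. By transfer, however, it
  forces the \<open>b\<close>-instance in \<open>U1\<close> to have some point outside the extension
  of \<open>X\<close>.\<close>

lemma honest_sub:
  assumes X: "ED \<sigma> X" and h: "honest \<sigma> X (\<beta>, b, W)"
  shows "tr \<beta> \<sigma> b W \<subseteq> X"
proof
  fix x0 assume x0: "x0 \<in> tr \<beta> \<sigma> b W"
  have W: "DM (\<beta> @ \<sigma>) W" and hx: "\<And>x. x \<in> tuples U1 \<sigma> \<Longrightarrow> b @ x \<in> star (\<beta> @ \<sigma>) W \<Longrightarrow> x \<in> star \<sigma> X"
    using h by (auto simp: honest_def)
  have x0t: "x0 \<in> tuples M \<sigma>" and b: "b \<in> star \<beta> {y \<in> tuples M \<beta>. y @ x0 \<in> W}" using x0 by (auto simp: tr_def)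
  show "x0 \<in> X"
  proof (rule ccontr)
    assume "x0 \<notin> X"
    have "\<exists>x \<in> star \<sigma> (tuples M \<sigma> - X). b @ x \<in> star (\<beta> @ \<sigma>) W"
      by (rule star_witness[OF b ED_slice'[OF W x0t] DM_ED[OF W] ED_compl[OF elem X]]) (use x0t \<open>x0 \<notin> X\<close> in auto)
    then show False using star_compl[OF X] hx by auto
  qed
qed

lemma DM_Un_blocks:
  assumes W: "DM (\<beta> @ \<sigma>) W" and W': "DM (\<beta>' @ \<sigma>) W'"
    and h: "reidx (\<beta> @ \<sigma>) ((\<beta> @ \<beta>') @ \<sigma>) h" "reidx (\<beta>' @ \<sigma>) ((\<beta> @ \<beta>') @ \<sigma>) h'"
  defines "V \<equiv> {z \<in> tuples M ((\<beta> @ \<beta>') @ \<sigma>). pick h z \<in> W} \<union> {z \<in> tuples M ((\<beta> @ \<beta>') @ \<sigma>). pick h' z \<in> W'}"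
  shows "DM ((\<beta> @ \<beta>') @ \<sigma>) V"
    "star ((\<beta> @ \<beta>') @ \<sigma>) V = {z \<in> tuples U1 ((\<beta> @ \<beta>') @ \<sigma>). pick h z \<in> star (\<beta> @ \<sigma>) W \<or> pick h' z \<in> star (\<beta>' @ \<sigma>) W'}"
proof -
  let ?A = "{z \<in> tuples M ((\<beta> @ \<beta>') @ \<sigma>). pick h z \<in> W}" and ?B = "{z \<in> tuples M ((\<beta> @ \<beta>') @ \<sigma>). pick h' z \<in> W'}"
  let ?T = "(\<beta> @ \<beta>') @ \<sigma>"
  note A = ED_reidx[OF elemM h(1) W] and B = ED_reidx[OF elemM h(2) W']
  show "DM ?T V" unfolding V_def by (rule ED_Un[OF elemM A B])
  have V: "V = tuples M ?T - ((tuples M ?T - ?A) \<inter> (tuples M ?T - ?B))" by (auto simp: V_def)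
  show "star ?T V = {z \<in> tuples U1 ?T. pick h z \<in> star (\<beta> @ \<sigma>) W \<or> pick h' z \<in> star (\<beta>' @ \<sigma>) W'}"
    unfolding V star_compl[OF DM_ED[OF ED_inter[OF elemM ED_compl[OF elemM A] ED_compl[OF elemM B]]]]
      star_inter[OF DM_ED[OF ED_compl[OF elemM A]] DM_ED[OF ED_compl[OF elemM B]]]
      star_compl[OF DM_ED[OF A]] star_compl[OF DM_ED[OF B]] star_reidx[OF h(1) DM_ED[OF W]] star_reidx[OF h(2) DM_ED[OF W']]
    by auto
qed

text \<open>Two instances are united over a joint parameter. This makes the honest approximations
  directed, as the compactness argument in \<open>ex_coheir\<close> needs.\<close>

lemma honest_Un:
  assumes h1: "honest \<sigma> X (\<beta>, b, W)" and h2: "honest \<sigma> X (\<beta>', b', W')"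
  shows "\<exists>V. honest \<sigma> X (\<beta> @ \<beta>', b @ b', V) \<and> tr \<beta> \<sigma> b W \<subseteq> tr (\<beta> @ \<beta>') \<sigma> (b @ b') V \<and>
    tr \<beta>' \<sigma> b' W' \<subseteq> tr (\<beta> @ \<beta>') \<sigma> (b @ b') V"
proof -
  have b: "b \<in> tuples U1 \<beta>" "b' \<in> tuples U1 \<beta>'" and W: "DM (\<beta> @ \<sigma>) W" "DM (\<beta>' @ \<sigma>) W'"
    using h1 h2 by (auto simp: honest_def)
  define i1 where "i1 = [0..<length \<beta>]"
  define i2 where "i2 = [length \<beta>..<length \<beta> + length \<beta>']"
  define i3 where "i3 = [length (\<beta> @ \<beta>')..<length (\<beta> @ \<beta>') + length \<sigma>]"
  have r: "reidx \<beta> ((\<beta> @ \<beta>') @ \<sigma>) i1" "reidx \<beta>' ((\<beta> @ \<beta>') @ \<sigma>) i2" "reidx \<sigma> ((\<beta> @ \<beta>') @ \<sigma>) i3"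
    and r': "reidx \<beta> (\<beta> @ \<beta>') i1" "reidx \<beta>' (\<beta> @ \<beta>') i2"
    using reidx_block[of "[]" 0 \<beta> "length \<beta>" "\<beta>' @ \<sigma>"] reidx_block[of \<beta> "length \<beta>" \<beta>' "length \<beta>'" \<sigma>]
      reidx_block[of "\<beta> @ \<beta>'" "length (\<beta> @ \<beta>')" \<sigma> "length \<sigma>" "[]"]
      reidx_block[of "[]" 0 \<beta> "length \<beta>" "\<beta>'"] reidx_block[of \<beta> "length \<beta>" \<beta>' "length \<beta>'" "[]"]
    by (simp_all add: i1_def i2_def i3_def)
  have p: "pick i1 (x @ y @ z) = x" "pick i2 (x @ y @ z) = y" "pick i3 (x @ y @ z) = z"
    if "length x = length \<beta>" "length y = length \<beta>'" "length z = length \<sigma>" for x y z :: "'b list"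
    using pick_block[of "[]" 0 x "length \<beta>" "y @ z"] pick_block[of x "length \<beta>" y "length \<beta>'" z]
      pick_block[of "x @ y" "length (\<beta> @ \<beta>')" z "length \<sigma>" "[]"] that by (simp_all add: i1_def i2_def i3_def)
  have p': "pick i1 (x @ y) = x" "pick i2 (x @ y) = y"
    if "length x = length \<beta>" "length y = length \<beta>'" for x y :: "'b list"
    using pick_block[of "[]" 0 x "length \<beta>" y] pick_block[of x "length \<beta>" y "length \<beta>'" "[]"] that by (simp_all add: i1_def i2_def)
  note q = reidx_append[OF r(1) r(3)] reidx_append[OF r(2) r(3)]
  define V where "V = {z \<in> tuples M ((\<beta> @ \<beta>') @ \<sigma>). pick (i1 @ i3) z \<in> W} \<union> {z \<in> tuples M ((\<beta> @ \<beta>') @ \<sigma>). pick (i2 @ i3) z \<in> W'}"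
  note V = DM_Un_blocks[OF W q, folded V_def]
  have bb: "b @ b' \<in> tuples U1 (\<beta> @ \<beta>')" by (rule tuples_appendI[OF b])
  have "x \<in> star \<sigma> X" if x: "x \<in> tuples U1 \<sigma>" and "(b @ b') @ x \<in> star ((\<beta> @ \<beta>') @ \<sigma>) V" for x
  proof -
    from that have "b @ x \<in> star (\<beta> @ \<sigma>) W \<or> b' @ x \<in> star (\<beta>' @ \<sigma>) W'"
      unfolding V(2) using p[of b b' x] x b by (simp add: pick_append tuples_length)
    then show ?thesis using h1 h2 x by (auto simp: honest_def)
  qed
  then have "honest \<sigma> X (\<beta> @ \<beta>', b @ b', V)" using bb V(1) by (simp add: honest_def)
  moreover have "tr \<beta> \<sigma> b W \<subseteq> tr (\<beta> @ \<beta>') \<sigma> (b @ b') V"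
  proof
    fix x assume x: "x \<in> tr \<beta> \<sigma> b W"
    then have xt: "x \<in> tuples M \<sigma>" by (simp add: tr_def)
    note E = ED_slice'[OF W(1) xt]
    have "b @ b' \<in> star (\<beta> @ \<beta>') {z \<in> tuples M (\<beta> @ \<beta>'). pick i1 z \<in> {y \<in> tuples M \<beta>. y @ x \<in> W}}"
      unfolding star_reidx[OF r'(1) E] using x bb p'[of b b'] b by (simp add: tr_def tuples_length)
    moreover have "{z \<in> tuples M (\<beta> @ \<beta>'). pick i1 z \<in> {y \<in> tuples M \<beta>. y @ x \<in> W}} \<subseteq> {z \<in> tuples M (\<beta> @ \<beta>'). z @ x \<in> V}"
    proof clarify
      fix z assume z: "z \<in> tuples M (\<beta> @ \<beta>')" and "pick i1 z @ x \<in> W"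
      from z obtain y y' where zy: "z = y @ y'" "y \<in> tuples M \<beta>" "y' \<in> tuples M \<beta>'" by (rule tuples_appendE)
      have "z @ x \<in> tuples M ((\<beta> @ \<beta>') @ \<sigma>)" by (rule tuples_appendI[OF z xt])
      then show "z @ x \<in> V" using \<open>pick i1 z @ x \<in> W\<close> p[of y y' x] p'[of y y'] zy xt
        by (simp add: V_def pick_append tuples_length)
    qed
    ultimately show "x \<in> tr (\<beta> @ \<beta>') \<sigma> (b @ b') V"
      using star_mono[OF ED_reidx[OF elem r'(1) E] ED_slice'[OF V(1) xt]] xt by (auto simp: tr_def)
  qed
  moreover have "tr \<beta>' \<sigma> b' W' \<subseteq> tr (\<beta> @ \<beta>') \<sigma> (b @ b') V"
  proof
    fix x assume x: "x \<in> tr \<beta>' \<sigma> b' W'"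
    then have xt: "x \<in> tuples M \<sigma>" by (simp add: tr_def)
    note E = ED_slice'[OF W(2) xt]
    have "b @ b' \<in> star (\<beta> @ \<beta>') {z \<in> tuples M (\<beta> @ \<beta>'). pick i2 z \<in> {y \<in> tuples M \<beta>'. y @ x \<in> W'}}"
      unfolding star_reidx[OF r'(2) E] using x bb p'[of b b'] b by (simp add: tr_def tuples_length)
    moreover have "{z \<in> tuples M (\<beta> @ \<beta>'). pick i2 z \<in> {y \<in> tuples M \<beta>'. y @ x \<in> W'}} \<subseteq> {z \<in> tuples M (\<beta> @ \<beta>'). z @ x \<in> V}"
    proof clarify
      fix z assume z: "z \<in> tuples M (\<beta> @ \<beta>')" and "pick i2 z @ x \<in> W'"
      from z obtain y y' where zy: "z = y @ y'" "y \<in> tuples M \<beta>" "y' \<in> tuples M \<beta>'" by (rule tuples_appendE)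
      have "z @ x \<in> tuples M ((\<beta> @ \<beta>') @ \<sigma>)" by (rule tuples_appendI[OF z xt])
      then show "z @ x \<in> V" using \<open>pick i2 z @ x \<in> W'\<close> p[of y y' x] p'[of y y'] zy xt
        by (simp add: V_def pick_append tuples_length)
    qed
    ultimately show "x \<in> tr (\<beta> @ \<beta>') \<sigma> (b @ b') V"
      using star_mono[OF ED_reidx[OF elem r'(2) E] ED_slice'[OF V(1) xt]] xt by (auto simp: tr_def)
  qed
  ultimately show ?thesis by blast
qed

abbreviation "tr' \<sigma> t \<equiv> tr (fst t) \<sigma> (fst (snd t)) (snd (snd t))"

lemma honest_finite:
  assumes "finite q" "\<forall>t\<in>q. honest \<sigma> X t"
  shows "\<exists>t. honest \<sigma> X t \<and> (\<forall>s\<in>q. tr' \<sigma> s \<subseteq> tr' \<sigma> t)"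
  using assms
proof (induction q rule: finite_induct)
  case empty
  have "DM ([] @ \<sigma>) {}" using ED_compl[OF elemM ED_tuples[OF elemM], of \<sigma>] by simp
  moreover from this have "star \<sigma> {} = {}" using star_ne[OF DM_ED, of \<sigma> "{}"] by simp
  ultimately have "honest \<sigma> X ([], [], {})" by (simp add: honest_def)
  then show ?case by blast
next
  case (insert s q)
  then obtain t where t: "honest \<sigma> X t" "\<forall>s\<in>q. tr' \<sigma> s \<subseteq> tr' \<sigma> t" by auto
  obtain \<beta> b W \<beta>' b' W' where e: "s = (\<beta>, b, W)" "t = (\<beta>', b', W')" by (metis prod.collapse)
  have "honest \<sigma> X (\<beta>, b, W)" "honest \<sigma> X (\<beta>', b', W')" using insert.prems t e by auto
  from honest_Un[OF this] obtain V where "honest \<sigma> X (\<beta> @ \<beta>', b @ b', V)"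
    "tr \<beta> \<sigma> b W \<subseteq> tr (\<beta> @ \<beta>') \<sigma> (b @ b') V" "tr \<beta>' \<sigma> b' W' \<subseteq> tr (\<beta> @ \<beta>') \<sigma> (b @ b') V" by blast
  then show ?case using t(2) e by (intro exI[of _ "(\<beta> @ \<beta>', b @ b', V)"]) auto
qed

lemma ED_tr':
  assumes "honest \<sigma> X t"
  shows "ED \<sigma> (tr' \<sigma> t)"
  using assms ED_tr by (cases t) (auto simp: honest_def)

text \<open>If \<open>X\<close> has no honest definition, then the type of \<open>c\<close> over \<open>M\<close> will have a Morley sequence in which
  membership in \<open>X\<close> can be prescribed term by term, which contradicts NIP.\<close>

lemma ex_coheir:
  assumes X: "ED \<sigma> X" and no: "\<And>t. honest \<sigma> X t \<Longrightarrow> \<not> X \<subseteq> tr' \<sigma> t"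
  shows "\<exists>c \<in> star \<sigma> X. \<forall>t. honest \<sigma> X t \<longrightarrow> c \<notin> star \<sigma> (tr' \<sigma> t)"
proof -
  \<comment> \<open>Membership in \<open>X\<close> together with avoidance of all honest traces. By
    directedness finitely many traces lie in a single one, which by assumption does not cover
    \<open>X\<close>.\<close>
  let ?c0 = "(rf \<sigma> X, [], []) :: ('s, unit, 's list \<times> 'a list set) fm \<times> 's list \<times> 'v list"
  let ?G = "\<lambda>t. (Neg (rf \<sigma> (tr' \<sigma> t)), [], []) :: ('s, unit, 's list \<times> 'a list set) fm \<times> 's list \<times> 'v list"
  let ?C = "insert ?c0 (?G ` {t. honest \<sigma> X t})"
  have "\<exists>as \<in> tuples U1 \<sigma>. \<forall>(\<phi>, \<tau>', e) \<in> ?C. as @ e \<in> ext U1 (\<sigma> @ \<tau>') \<phi>"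
  proof (rule realize[OF monsterD(4,3,1,2)[OF monster_U1]])
    show "{} \<subseteq> univ U1" by simp
    show "|{} :: 'v set| <o \<kappa>1" by (rule finite_ordLess_Card_order[OF monsterD(1,2)[OF monster_U1]]) simp
    show "?C \<subseteq> conds L1 U1 {} \<sigma>" using fms_rf[OF X] fms_Neg[OF fms_rf[OF ED_tr']] by (auto simp: conds_def)
    show "fin_sat U1 \<sigma> ?C" unfolding fin_sat_def
    proof (intro allI impI)
      fix q assume q: "q \<subseteq> ?C" "finite q"
      then have "finite (q - {?c0})" "q - {?c0} \<subseteq> ?G ` {t. honest \<sigma> X t}" by auto
      from finite_subset_image[OF this] obtain Q where Q: "Q \<subseteq> {t. honest \<sigma> X t}" "finite Q" "q - {?c0} = ?G ` Q" by blast
      have "\<forall>t\<in>Q. honest \<sigma> X t" using Q(1) by blast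
      from honest_finite[OF Q(2) this] obtain t where t: "honest \<sigma> X t" "\<forall>s\<in>Q. tr' \<sigma> s \<subseteq> tr' \<sigma> t" by blast
      note Et = ED_tr'[OF t(1)]
      have "X - tr' \<sigma> t \<noteq> {}" using no[OF t(1)] by blast
      moreover have "X - tr' \<sigma> t = X \<inter> (tuples M \<sigma> - tr' \<sigma> t)" using ED_sub[OF elem X] by auto
      ultimately have "star \<sigma> (X \<inter> (tuples M \<sigma> - tr' \<sigma> t)) \<noteq> {}" using star_ne[OF ED_inter[OF elem X ED_compl[OF elem Et]]] by simp
      then obtain x where x: "x \<in> star \<sigma> X" "x \<notin> star \<sigma> (tr' \<sigma> t)"
        unfolding star_inter[OF X ED_compl[OF elem Et]] star_compl[OF Et] by blast
      have "x \<notin> star \<sigma> (tr' \<sigma> s)" if "s \<in> Q" for s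
        using star_mono[OF ED_tr' Et] t(2) that Q(1) x(2) by blast
      then have "x @ e \<in> ext U1 (\<sigma> @ \<tau>') \<phi>" if "(\<phi>, \<tau>', e) \<in> q - {?c0}" for \<phi> \<tau>' e
        using that star_tuples[OF x(1)] unfolding Q(3) by (auto simp: ext_Neg ext_rf_U1)
      moreover have "x @ e \<in> ext U1 (\<sigma> @ \<tau>') \<phi>" if "(\<phi>, \<tau>', e) = ?c0" for \<phi> \<tau>' e
        using that x(1) by (simp add: ext_rf_U1)
      ultimately have "\<forall>(\<phi>, \<tau>', e)\<in>q. x @ e \<in> ext U1 (\<sigma> @ \<tau>') \<phi>" by blast
      then show "\<exists>as\<in>tuples U1 \<sigma>. \<forall>(\<phi>, \<tau>', e)\<in>q. as @ e \<in> ext U1 (\<sigma> @ \<tau>') \<phi>"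
        using star_tuples[OF x(1)] by blast
    qed
  qed
  then obtain c where c: "c \<in> tuples U1 \<sigma>" "\<forall>(\<phi>, \<tau>', e) \<in> ?C. c @ e \<in> ext U1 (\<sigma> @ \<tau>') \<phi>" by blast
  then have "c \<in> star \<sigma> X" by (simp add: ext_rf_U1)
  moreover have "c \<notin> star \<sigma> (tr' \<sigma> t)" if "honest \<sigma> X t" for t
  proof -
    have "?G t \<in> ?C" using that by blast
    with c(2) have "c \<in> ext U1 \<sigma> (Neg (rf \<sigma> (tr' \<sigma> t)))" by fastforce
    then show ?thesis by (simp add: ext_Neg ext_rf_U1)
  qed
  ultimately show ?thesis by blast
qed

text \<open>On the externally definable sets, \<open>c\<close> acts as an ultrafilter. The condition
  on \<open>W\<close> says that the trace of its \<open>b\<close>-instance belongs to this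
  ultrafilter, that is, that the instance belongs to the coheir determined by \<open>c\<close>; such
  \<open>W\<close> are closed under finite intersections.\<close>

lemma ex_small_DM:
  assumes b: "b \<in> tuples U1 \<beta>" and c: "c \<in> tuples U1 \<sigma>" and "finite Q"
    and "\<forall>W\<in>Q. DM (\<beta> @ \<sigma>) W \<and> c \<in> star \<sigma> (tr \<beta> \<sigma> b W)"
  shows "\<exists>W0. DM (\<beta> @ \<sigma>) W0 \<and> c \<in> star \<sigma> (tr \<beta> \<sigma> b W0) \<and> (\<forall>W\<in>Q. W0 \<subseteq> W)"
  using assms(3,4)
proof (induction Q rule: finite_induct)
  case empty
  have "{y \<in> tuples M \<beta>. y @ x \<in> tuples M (\<beta> @ \<sigma>)} = tuples M \<beta>" if "x \<in> tuples M \<sigma>" for x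
    using that by (auto simp: tuples_appendI)
  then have "tr \<beta> \<sigma> b (tuples M (\<beta> @ \<sigma>)) = tuples M \<sigma>" using b by (auto simp: tr_def star_all)
  then show ?case using ED_tuples[OF elemM] c star_all by (intro exI[of _ "tuples M (\<beta> @ \<sigma>)"]) simp
next
  case (insert W Q)
  then obtain W0 where W0: "DM (\<beta> @ \<sigma>) W0" "c \<in> star \<sigma> (tr \<beta> \<sigma> b W0)" "\<forall>W\<in>Q. W0 \<subseteq> W" by auto
  have W: "DM (\<beta> @ \<sigma>) W" "c \<in> star \<sigma> (tr \<beta> \<sigma> b W)" using insert.prems by auto
  have "c \<in> star \<sigma> (tr \<beta> \<sigma> b (W \<inter> W0))"
    unfolding tr_inter[OF W(1) W0(1)] star_inter[OF ED_tr[OF b W(1)] ED_tr[OF b W0(1)]] using W W0 by simp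
  then show ?case using ED_inter[OF elemM W(1) W0(1)] W0(3) by (intro exI[of _ "W \<inter> W0"]) auto
qed

lemma swapped_formula:
  assumes W: "ED (\<beta> @ \<sigma>) W"
  shows "\<exists>\<theta> \<in> fms L1 (\<sigma> @ \<beta>). \<forall>x \<in> tuples U1 \<sigma>. \<forall>b \<in> tuples U1 \<beta>. x @ b \<in> ext U1 (\<sigma> @ \<beta>) \<theta> \<longleftrightarrow> b @ x \<in> star (\<beta> @ \<sigma>) W"
proof -
  have "rf (\<beta> @ \<sigma>) W \<in> fms L1 (\<beta> @ \<sigma> @ [])" using fms_rf[OF W] by simp
  then obtain \<theta> where \<theta>: "\<theta> \<in> fms L1 (\<sigma> @ \<beta> @ [])"
    "\<And>(N :: ('s, unit, 's list \<times> 'a list set, 'v) struc) b c d. is_struc L1 N \<Longrightarrow> b \<in> tuples N \<beta> \<Longrightarrow> c \<in> tuples N \<sigma> \<Longrightarrow> d \<in> tuples N [] \<Longrightarrow>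
    c @ b @ d \<in> ext N (\<sigma> @ \<beta> @ []) \<theta> \<longleftrightarrow> b @ c @ d \<in> ext N (\<beta> @ \<sigma> @ []) (rf (\<beta> @ \<sigma>) W)"
    by (rule block_swap2[where 'a = 'v]) (rule that)
  show ?thesis
  proof (intro bexI[of _ \<theta>] ballI)
    show "\<theta> \<in> fms L1 (\<sigma> @ \<beta>)" using \<theta>(1) by simp
    show "x @ b \<in> ext U1 (\<sigma> @ \<beta>) \<theta> \<longleftrightarrow> b @ x \<in> star (\<beta> @ \<sigma>) W" if "x \<in> tuples U1 \<sigma>" "b \<in> tuples U1 \<beta>" for x b
      using \<theta>(2)[OF is_struc_U1 that(2,1), of "[]"] by (simp add: ext_rf_U1)
  qed
qed

text \<open>One more element of that Morley sequence.\<close>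

lemma extend_Morley:
  assumes X: "ED \<sigma> X" and c: "c \<in> star \<sigma> X" "\<And>t. honest \<sigma> X t \<Longrightarrow> c \<notin> star \<sigma> (tr' \<sigma> t)"
    and b: "b \<in> tuples U1 \<beta>"
  shows "\<exists>x \<in> tuples U1 \<sigma>. (\<forall>W. DM (\<beta> @ \<sigma>) W \<longrightarrow> (b @ x \<in> star (\<beta> @ \<sigma>) W \<longleftrightarrow> c \<in> star \<sigma> (tr \<beta> \<sigma> b W))) \<and>
    (x \<in> star \<sigma> X \<longleftrightarrow> t)"
proof -
  have ct: "c \<in> tuples U1 \<sigma>" by (rule star_tuples[OF c(1)])
  have "\<exists>\<theta>. DM (\<beta> @ \<sigma>) W \<longrightarrow> \<theta> \<in> fms L1 (\<sigma> @ \<beta>) \<and>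
    (\<forall>x \<in> tuples U1 \<sigma>. x @ b \<in> ext U1 (\<sigma> @ \<beta>) \<theta> \<longleftrightarrow> b @ x \<in> star (\<beta> @ \<sigma>) W)" for W
  proof (cases "DM (\<beta> @ \<sigma>) W")
    case True
    from swapped_formula[OF DM_ED[OF this]] show ?thesis using b by blast
  qed simp
  then obtain \<theta> where \<theta>: "\<And>W. DM (\<beta> @ \<sigma>) W \<Longrightarrow> \<theta> W \<in> fms L1 (\<sigma> @ \<beta>)"
    "\<And>W x. DM (\<beta> @ \<sigma>) W \<Longrightarrow> x \<in> tuples U1 \<sigma> \<Longrightarrow> x @ b \<in> ext U1 (\<sigma> @ \<beta>) (\<theta> W) \<longleftrightarrow> b @ x \<in> star (\<beta> @ \<sigma>) W"
    by metis
  define f where "f = (if t then rf \<sigma> X else Neg (rf \<sigma> X))"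
  have f: "f \<in> fms L1 \<sigma>" "\<And>x. x \<in> tuples U1 \<sigma> \<Longrightarrow> x \<in> ext U1 \<sigma> f \<longleftrightarrow> (x \<in> star \<sigma> X \<longleftrightarrow> t)"
    using fms_rf[OF X] fms_Neg[OF fms_rf[OF X]] by (auto simp: f_def ext_Neg ext_rf_U1)
  \<comment> \<open>The coheir of \<open>c\<close>, restricted to the parameters \<open>b\<close>
    and those from \<open>M\<close>, together with the prescribed answer about
    \<open>X\<close>.\<close>
  let ?c0 = "(f, [], []) :: ('s, unit, 's list \<times> 'a list set) fm \<times> 's list \<times> 'v list"
  let ?G = "\<lambda>W. (\<theta> W, \<beta>, b)" and ?H = "{W. DM (\<beta> @ \<sigma>) W \<and> c \<in> star \<sigma> (tr \<beta> \<sigma> b W)}"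
  let ?C = "insert ?c0 (?G ` ?H)"
  have "\<exists>as \<in> tuples U1 \<sigma>. \<forall>(\<phi>, \<tau>', e) \<in> ?C. as @ e \<in> ext U1 (\<sigma> @ \<tau>') \<phi>"
  proof (rule realize[OF monsterD(4,3,1,2)[OF monster_U1]])
    show "set b \<subseteq> univ U1" by (rule tuples_set[OF b])
    show "|set b| <o \<kappa>1" by (rule finite_ordLess_Card_order[OF monsterD(1,2)[OF monster_U1]]) simp
    show "?C \<subseteq> conds L1 U1 (set b) \<sigma>" using f(1) \<theta>(1) b by (auto simp: conds_def)
    show "fin_sat U1 \<sigma> ?C" unfolding fin_sat_def
    proof (intro allI impI)
      fix q assume q: "q \<subseteq> ?C" "finite q"
      then have "finite (q - {?c0})" "q - {?c0} \<subseteq> ?G ` ?H" by auto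
      from finite_subset_image[OF this] obtain Q where Q: "Q \<subseteq> ?H" "finite Q" "q - {?c0} = ?G ` Q" by blast
      have "\<forall>W\<in>Q. DM (\<beta> @ \<sigma>) W \<and> c \<in> star \<sigma> (tr \<beta> \<sigma> b W)" using Q(1) by blast
      from ex_small_DM[OF b ct Q(2) this] obtain W0 where W0: "DM (\<beta> @ \<sigma>) W0" "c \<in> star \<sigma> (tr \<beta> \<sigma> b W0)" "\<forall>W\<in>Q. W0 \<subseteq> W" by blast
      have "\<exists>x \<in> tuples U1 \<sigma>. b @ x \<in> star (\<beta> @ \<sigma>) W0 \<and> (x \<in> star \<sigma> X \<longleftrightarrow> t)"
      proof (cases t)
        case True
        \<comment> \<open>Both sets belong to the ultrafilter of \<open>c\<close>, so they have a
          common point in \<open>M\<close>.\<close>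
        have "c \<in> star \<sigma> (X \<inter> tr \<beta> \<sigma> b W0)" using star_inter[OF X ED_tr[OF b W0(1)]] c(1) W0(2) by simp
        then obtain x0 where x0: "x0 \<in> X" "x0 \<in> tr \<beta> \<sigma> b W0" using star_ne[OF ED_inter[OF elem X ED_tr[OF b W0(1)]]] by blast
        then have x0t: "x0 \<in> tuples M \<sigma>" and bx: "b \<in> star \<beta> {y \<in> tuples M \<beta>. y @ x0 \<in> W0}" by (auto simp: tr_def)
        have "\<exists>x \<in> star \<sigma> X. b @ x \<in> star (\<beta> @ \<sigma>) W0"
          by (rule star_witness[OF bx ED_slice'[OF W0(1) x0t] DM_ED[OF W0(1)] X]) (use x0 in auto)
        then show ?thesis using True star_tuples by blast
      next
        case False
        \<comment> \<open>If \<open>W0\<close> were honest, \<open>c\<close> would avoid its trace.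
          So some point of its \<open>b\<close>-instance lies outside the extension of
          \<open>X\<close>.\<close>
        have "\<not> honest \<sigma> X (\<beta>, b, W0)" using c(2)[of "(\<beta>, b, W0)"] W0(2) by auto
        then show ?thesis using False b W0(1) by (auto simp: honest_def)
      qed
      then obtain x where x: "x \<in> tuples U1 \<sigma>" "b @ x \<in> star (\<beta> @ \<sigma>) W0" "x \<in> star \<sigma> X \<longleftrightarrow> t" by blast
      have "b @ x \<in> star (\<beta> @ \<sigma>) W" if "W \<in> Q" for W
        using star_mono[OF DM_ED[OF W0(1)] DM_ED] W0(3) that Q(1) x(2) by blast
      then have "x @ e \<in> ext U1 (\<sigma> @ \<tau>') \<phi>" if "(\<phi>, \<tau>', e) \<in> q - {?c0}" for \<phi> \<tau>' e
        using that \<theta>(2)[OF _ x(1)] Q(1) unfolding Q(3) by auto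
      moreover have "x @ e \<in> ext U1 (\<sigma> @ \<tau>') \<phi>" if "(\<phi>, \<tau>', e) = ?c0" for \<phi> \<tau>' e
        using that x(3) f(2)[OF x(1)] by simp
      ultimately have "\<forall>(\<phi>, \<tau>', e)\<in>q. x @ e \<in> ext U1 (\<sigma> @ \<tau>') \<phi>" by blast
      then show "\<exists>as\<in>tuples U1 \<sigma>. \<forall>(\<phi>, \<tau>', e)\<in>q. as @ e \<in> ext U1 (\<sigma> @ \<tau>') \<phi>"
        using x(1) by blast
    qed
  qed
  then obtain x where x: "x \<in> tuples U1 \<sigma>" "\<forall>(\<phi>, \<tau>', e) \<in> ?C. x @ e \<in> ext U1 (\<sigma> @ \<tau>') \<phi>" by blast
  have pos: "b @ x \<in> star (\<beta> @ \<sigma>) W" if W: "DM (\<beta> @ \<sigma>) W" "c \<in> star \<sigma> (tr \<beta> \<sigma> b W)" for W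
  proof -
    have "?G W \<in> ?C" using W by blast
    with x(2) have "x @ b \<in> ext U1 (\<sigma> @ \<beta>) (\<theta> W)" by fastforce
    then show ?thesis using \<theta>(2)[OF W(1) x(1)] by simp
  qed
  have "c \<in> star \<sigma> (tr \<beta> \<sigma> b W)" if W: "DM (\<beta> @ \<sigma>) W" "b @ x \<in> star (\<beta> @ \<sigma>) W" for W
  proof (rule ccontr)
    assume "c \<notin> star \<sigma> (tr \<beta> \<sigma> b W)"
    then have "c \<in> star \<sigma> (tr \<beta> \<sigma> b (tuples M (\<beta> @ \<sigma>) - W))"
      unfolding tr_compl[OF W(1) b] star_compl[OF ED_tr[OF b W(1)]] using ct by simp
    from pos[OF ED_compl[OF elemM W(1)] this] show False using star_compl[OF DM_ED[OF W(1)]] W(2) by simp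
  qed
  with pos x(1) f(2)[OF x(1)] x(2) show ?thesis by (intro bexI[OF _ x(1)]) auto
qed

text \<open>Otherwise \<open>extend_Morley\<close> can be iterated with a free choice at each step.
  The type of the next term over the earlier ones depends only on their \<open>L\<close>-type over
  \<open>M\<close>, so all sequences of length \<open>n\<close> have the same type although
  membership in \<open>X\<close> follows any prescribed pattern; \<open>no_patterns\<close> excludes
  this.\<close>

lemma ex_honest:
  assumes X: "ED \<sigma> X"
  shows "\<exists>t. honest \<sigma> X t \<and> X \<subseteq> tr' \<sigma> t"
proof (rule ccontr)
  assume "\<not> ?thesis"
  then obtain c where c: "c \<in> star \<sigma> X" "\<And>t. honest \<sigma> X t \<Longrightarrow> c \<notin> star \<sigma> (tr' \<sigma> t)"
    using ex_coheir[OF X] by blast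
  define P where "P \<beta> b t x \<longleftrightarrow> x \<in> tuples U1 \<sigma> \<and>
    (\<forall>W. DM (\<beta> @ \<sigma>) W \<longrightarrow> (b @ x \<in> star (\<beta> @ \<sigma>) W \<longleftrightarrow> c \<in> star \<sigma> (tr \<beta> \<sigma> b W))) \<and> (x \<in> star \<sigma> X \<longleftrightarrow> t)"
    for \<beta> b t x
  define nx where "nx \<beta> b t = (SOME x. P \<beta> b t x)" for \<beta> b t
  have P: "P \<beta> b t (nx \<beta> b t)" if b: "b \<in> tuples U1 \<beta>" for \<beta> b t
  proof -
    have "\<exists>x. P \<beta> b t x" using extend_Morley[OF X c b, of t] unfolding P_def by blast
    then show ?thesis unfolding nx_def by (rule someI_ex)
  qed
  have nx: "nx \<beta> b t \<in> tuples U1 \<sigma>" "DM (\<beta> @ \<sigma>) W \<Longrightarrow> b @ nx \<beta> b t \<in> star (\<beta> @ \<sigma>) W \<longleftrightarrow> c \<in> star \<sigma> (tr \<beta> \<sigma> b W)"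
    "nx \<beta> b t \<in> star \<sigma> X \<longleftrightarrow> t" if "b \<in> tuples U1 \<beta>" for \<beta> b t W
    using P[OF that, of t] unfolding P_def by blast+
  \<comment> \<open>The concatenation of the first \<open>n\<close> terms of the sequence whose
    \<open>k\<close>-th term lies in the extension of \<open>X\<close> exactly if \<open>k\<close>
    is in \<open>A\<close>.\<close>
  define B where "B A n = rec_nat [] (\<lambda>n b. b @ nx (pow \<sigma> n) b (n \<in> A)) n" for A n
  have B0: "B A 0 = []" and BS: "B A (Suc n) = B A n @ nx (pow \<sigma> n) (B A n) (n \<in> A)" for A n
    by (simp_all add: B_def)
  have powS: "pow \<sigma> (Suc n) = pow \<sigma> n @ \<sigma>" for n using pow_add[of n 1 \<sigma>] by simp
  have Bt: "B A n \<in> tuples U1 (pow \<sigma> n)" for A n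
  proof (induction n)
    case (Suc n)
    show ?case unfolding BS powS by (rule tuples_appendI[OF Suc nx(1)[OF Suc]])
  qed (simp add: B0)
  have tp: "B A n \<in> star (pow \<sigma> n) W \<longleftrightarrow> B A' n \<in> star (pow \<sigma> n) W" if "DM (pow \<sigma> n) W" for A A' n W
    using that
  proof (induction n arbitrary: W)
    case (Suc n)
    have W: "DM (pow \<sigma> n @ \<sigma>) W" using Suc.prems by (simp only: powS)
    \<comment> \<open>The trace involves the earlier terms only through slices of \<open>W\<close>
      at points of \<open>M\<close>, and to these the induction hypothesis applies.\<close>
    have "tr (pow \<sigma> n) \<sigma> (B A n) W = tr (pow \<sigma> n) \<sigma> (B A' n) W"
      using Suc.IH[OF DM_slice[OF W]] by (auto simp: tr_def)
    then show ?case unfolding BS powS nx(2)[OF Bt W] by simp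
  qed (simp add: B0)
  from no_patterns[OF X] obtain n :: nat where n: "\<forall>\<tau> hs b. (\<forall>k<n. reidx \<sigma> \<tau> (hs k)) \<longrightarrow> (\<forall>A. b A \<in> tuples U1 \<tau>) \<longrightarrow>
    (\<forall>A. \<forall>\<alpha> \<in> fms L \<tau>. b A \<in> star \<tau> (ext M \<tau> \<alpha>) \<longrightarrow> b {} \<in> star \<tau> (ext M \<tau> \<alpha>)) \<longrightarrow>
    \<not> (\<forall>A. \<forall>k<n. pick (hs k) (b A) \<in> star \<sigma> X \<longleftrightarrow> k \<in> A)" by (elim exE)
  let ?w = "\<lambda>A k. nx (pow \<sigma> k) (B A k) (k \<in> A)"
  have Bc: "B A n = cat (?w A) [0..<n]" for A n by (induction n) (simp_all add: B0 BS)
  have "pick (cpick (length \<sigma>) [0..<n] [k]) (B A n) = ?w A k" if "k < n" for A k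
    unfolding Bc[of A n] using pick_cpick[of "[0..<n]" "?w A" "length \<sigma>" "[k]"] that tuples_length[OF nx(1)[OF Bt]] by simp
  then have "\<forall>A. \<forall>k<n. pick (cpick (length \<sigma>) [0..<n] [k]) (B A n) \<in> star \<sigma> X \<longleftrightarrow> k \<in> A"
    using nx(3)[OF Bt] by simp
  moreover have "\<forall>k<n. reidx \<sigma> (pow \<sigma> n) (cpick (length \<sigma>) [0..<n] [k])"
  proof (intro allI impI)
    show "reidx \<sigma> (pow \<sigma> n) (cpick (length \<sigma>) [0..<n] [k])" if "k < n" for k
      using reidx_cpick[of "[k]" "[0..<n]" \<sigma>] that by simp
  qed
  moreover have "\<forall>A. \<forall>\<alpha> \<in> fms L (pow \<sigma> n). B A n \<in> star (pow \<sigma> n) (ext M (pow \<sigma> n) \<alpha>) \<longrightarrow>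
      B {} n \<in> star (pow \<sigma> n) (ext M (pow \<sigma> n) \<alpha>)"
    using tp ED_ext[OF elemM] by blast
  moreover have "\<forall>A. B A n \<in> tuples U1 (pow \<sigma> n)" using Bt by blast
  ultimately show False
    using n[THEN spec[of _ "pow \<sigma> n"], THEN spec[of _ "\<lambda>k. cpick (length \<sigma>) [0..<n] [k]"], THEN spec[of _ "\<lambda>A. B A n"]]
    by blast
qed

text \<open>Shelah's theorem; with it, all definable sets of the Shelah expansion are externally definable.\<close>

lemma ED_proj:
  assumes X: "ED (\<tau> @ \<tau>') X"
  shows "ED \<tau> {u \<in> tuples M \<tau>. \<exists>v \<in> tuples M \<tau>'. u @ v \<in> X}"
proof -
  from ex_honest[OF X] obtain \<beta> b W where hon: "honest (\<tau> @ \<tau>') X (\<beta>, b, W)" and sub: "X \<subseteq> tr \<beta> (\<tau> @ \<tau>') b W" by auto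
  then have b: "b \<in> tuples U1 \<beta>" and W: "DM (\<beta> @ (\<tau> @ \<tau>')) W"
    and hx: "\<And>x. x \<in> tuples U1 (\<tau> @ \<tau>') \<Longrightarrow> b @ x \<in> star (\<beta> @ (\<tau> @ \<tau>')) W \<Longrightarrow> x \<in> star (\<tau> @ \<tau>') X"
    by (auto simp: honest_def)
  have Xtr: "X = tr \<beta> (\<tau> @ \<tau>') b W" using sub honest_sub[OF X hon] by blast
  from W obtain \<mu> \<chi> m where \<chi>: "\<chi> \<in> fms L (\<beta> @ (\<tau> @ \<tau>') @ \<mu>)" and m: "m \<in> tuples M \<mu>"
    and We: "W = {z \<in> tuples M (\<beta> @ (\<tau> @ \<tau>')). z @ m \<in> ext M (\<beta> @ (\<tau> @ \<tau>') @ \<mu>) \<chi>}" by (rule DM_formula)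
  from realize_in_M'[OF b] obtain b' where b': "b' \<in> tuples M' \<beta>"
    and e': "\<forall>\<mu>. \<forall>\<chi> \<in> fms L (\<beta> @ \<mu>). \<forall>m \<in> tuples M \<mu>.
      b' @ m \<in> ext M' (\<beta> @ \<mu>) \<chi> \<longleftrightarrow> b \<in> star \<beta> {y \<in> tuples M \<beta>. y @ m \<in> ext M (\<beta> @ \<mu>) \<chi>}" by (elim bexE)
  note e = e'[rule_format]
  have \<chi>0: "\<chi> \<in> fms L ((\<beta> @ \<tau>) @ \<tau>' @ \<mu> @ [])" using \<chi> by simp
  from block_swap[OF \<chi>0, where 'a = 'a] obtain \<chi>' where \<chi>': "\<chi>' \<in> fms L ((\<beta> @ \<tau>) @ \<mu> @ \<tau>' @ [])"
    and sw: "\<forall>N :: ('s, 'f, 'p, 'a) struc. is_struc L N \<longrightarrow>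
    (\<forall>a\<in>tuples N (\<beta> @ \<tau>). \<forall>b\<in>tuples N \<tau>'. \<forall>c\<in>tuples N \<mu>. \<forall>d\<in>tuples N [].
      a @ c @ b @ d \<in> ext N ((\<beta> @ \<tau>) @ \<mu> @ \<tau>' @ []) \<chi>' \<longleftrightarrow> a @ b @ c @ d \<in> ext N ((\<beta> @ \<tau>) @ \<tau>' @ \<mu> @ []) \<chi>)" by (elim bexE)
  have \<chi>'2: "\<chi>' \<in> fms L ((\<beta> @ (\<tau> @ \<mu>)) @ \<tau>')" using \<chi>' by simp
  \<comment> \<open>The projection is taken in \<open>L\<close>, so at the parameter
    \<open>b'\<close> its quantifier ranges over \<open>M'\<close>. Honesty is what makes a witness
    in \<open>M'\<close> imply one in \<open>M\<close>.\<close>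
  define \<psi> where "\<psi> = exs (\<beta> @ (\<tau> @ \<mu>)) \<tau>' \<chi>'"
  have \<psi>: "\<psi> \<in> fms L (\<beta> @ (\<tau> @ \<mu>))" unfolding \<psi>_def by (rule fms_exs[OF \<chi>'2])
  have ext\<psi>: "y @ (u @ n) \<in> ext N (\<beta> @ (\<tau> @ \<mu>)) \<psi> \<longleftrightarrow> (\<exists>v\<in>tuples N \<tau>'. y @ (u @ v) @ n \<in> ext N (\<beta> @ (\<tau> @ \<tau>') @ \<mu>) \<chi>)"
    if N: "is_struc L N" and y: "y \<in> tuples N \<beta>" and u: "u \<in> tuples N \<tau>" and n: "n \<in> tuples N \<mu>"
    for N :: "('s, 'f, 'p, 'a) struc" and y u n
  proof -
    have "y @ (u @ n) \<in> tuples N (\<beta> @ (\<tau> @ \<mu>))" by (intro tuples_appendI y u n)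
    moreover have "(y @ (u @ n)) @ v \<in> ext N ((\<beta> @ (\<tau> @ \<mu>)) @ \<tau>') \<chi>' \<longleftrightarrow> y @ (u @ v) @ n \<in> ext N (\<beta> @ (\<tau> @ \<tau>') @ \<mu>) \<chi>"
      if v: "v \<in> tuples N \<tau>'" for v
      using sw[rule_format, OF N tuples_appendI[OF y u] v n, of "[]"] by simp
    ultimately show ?thesis unfolding \<psi>_def ext_exs[OF \<chi>'2] by blast
  qed
  have "(\<exists>v \<in> tuples M \<tau>'. u @ v \<in> X) \<longleftrightarrow> b' @ (u @ m) \<in> ext M' (\<beta> @ (\<tau> @ \<mu>)) \<psi>" if u: "u \<in> tuples M \<tau>" for u
  proof
    assume "\<exists>v \<in> tuples M \<tau>'. u @ v \<in> X"
    then obtain v where v: "v \<in> tuples M \<tau>'" "u @ v \<in> tr \<beta> (\<tau> @ \<tau>') b W" using Xtr by blast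
    have uv: "u @ v \<in> tuples M (\<tau> @ \<tau>')" by (rule tuples_appendI[OF u v(1)])
    have "{y \<in> tuples M \<beta>. y @ (u @ v) \<in> W} = {y \<in> tuples M \<beta>. y @ ((u @ v) @ m) \<in> ext M (\<beta> @ ((\<tau> @ \<tau>') @ \<mu>)) \<chi>}"
      using tuples_appendI[OF _ uv] by (auto simp: We)
    then have "b \<in> star \<beta> {y \<in> tuples M \<beta>. y @ ((u @ v) @ m) \<in> ext M (\<beta> @ ((\<tau> @ \<tau>') @ \<mu>)) \<chi>}"
      using v(2) by (simp add: tr_def)
    then have "b' @ (u @ v) @ m \<in> ext M' (\<beta> @ (\<tau> @ \<tau>') @ \<mu>) \<chi>" using e[OF \<chi> tuples_appendI[OF uv m]] by blast
    then show "b' @ (u @ m) \<in> ext M' (\<beta> @ (\<tau> @ \<mu>)) \<psi>"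
      using ext\<psi>[OF is_struc_M' b' elem_sub_tuples[OF elem u] elem_sub_tuples[OF elem m]] elem_sub_tuples[OF elem v(1)] by blast
  next
    assume "b' @ (u @ m) \<in> ext M' (\<beta> @ (\<tau> @ \<mu>)) \<psi>"
    then have bs: "b \<in> star \<beta> {y \<in> tuples M \<beta>. y @ (u @ m) \<in> ext M (\<beta> @ (\<tau> @ \<mu>)) \<psi>}"
      using e[OF \<psi> tuples_appendI[OF u m]] by blast
    show "\<exists>v \<in> tuples M \<tau>'. u @ v \<in> X"
    proof (rule ccontr)
      assume no: "\<not> (\<exists>v \<in> tuples M \<tau>'. u @ v \<in> X)"
      \<comment> \<open>By transfer some point of the \<open>b\<close>-instance of \<open>W\<close>
        lies outside the extension of \<open>X\<close>, which honesty forbids. This point need not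
        have anything to do with \<open>u\<close>.\<close>
      have "\<exists>x \<in> star (\<tau> @ \<tau>') (tuples M (\<tau> @ \<tau>') - X). b @ x \<in> star (\<beta> @ (\<tau> @ \<tau>')) W"
      proof (rule star_witness[OF bs ED_formula[OF \<psi> tuples_appendI[OF u m]] DM_ED[OF W] ED_compl[OF elem X]])
        fix y assume "y \<in> {y \<in> tuples M \<beta>. y @ (u @ m) \<in> ext M (\<beta> @ (\<tau> @ \<mu>)) \<psi>}"
        then have y: "y \<in> tuples M \<beta>" and "y @ (u @ m) \<in> ext M (\<beta> @ (\<tau> @ \<mu>)) \<psi>" by auto
        then obtain v where v: "v\<in>tuples M \<tau>'" "y @ (u @ v) @ m \<in> ext M (\<beta> @ (\<tau> @ \<tau>') @ \<mu>) \<chi>"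
          using ext\<psi>[OF is_struc_M y u m] by blast
        have uv: "u @ v \<in> tuples M (\<tau> @ \<tau>')" by (rule tuples_appendI[OF u v(1)])
        have "y @ (u @ v) \<in> W" using v(2) tuples_appendI[OF y uv] by (simp add: We)
        then show "\<exists>x\<in>tuples M (\<tau> @ \<tau>') - X. y @ x \<in> W" using uv no v(1) by blast
      qed
      then show False using star_compl[OF X] hx by auto
    qed
  qed
  then have "{u \<in> tuples M \<tau>. \<exists>v \<in> tuples M \<tau>'. u @ v \<in> X} = {u \<in> tuples M \<tau>. b' @ (u @ m) \<in> ext M' (\<beta> @ (\<tau> @ \<mu>)) \<psi>}" by blast
  then show ?thesis using ED_param[OF elem \<psi> b' elem_sub_tuples[OF elem m]] by simp
qed

section \<open>Formulas of the Shelah expansion\<close>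

lemma has_sort_L1: "has_sort L1 t s \<Longrightarrow> \<exists>v. t = Var v \<and> fst v = s"
  by (induction rule: has_sort.induct) (auto simp: shelah_lang_def)

lemma list_has_sort_L1: "list_all2 (has_sort L1) ts \<sigma> \<Longrightarrow> \<exists>vs. ts = map Var vs \<and> map fst vs = \<sigma>"
proof (induction ts \<sigma> rule: list_all2_induct)
  case (Cons t ts s \<sigma>)
  then obtain v vs where "t = Var v" "fst v = s" "ts = map Var vs" "map fst vs = \<sigma>" using has_sort_L1 by blast
  then show ?case by (intro exI[of _ "v # vs"]) simp
qed simp

lemma pick_map_pos: "set xs \<subseteq> set bs \<Longrightarrow> pick (map (pos bs) xs) (map f bs) = map f xs"
  by (auto simp: pick_def subset_iff pos)

lemma reidx_map_pos: "set xs \<subseteq> set bs \<Longrightarrow> reidx (map f xs) (map f bs) (map (pos bs) xs)"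
  using pos[of _ bs] by (fastforce simp: reidx_def pick_map_pos)

lemma map_tuples: "(\<And>v. v \<in> set xs \<Longrightarrow> g v \<in> dom_of N (fst v)) \<Longrightarrow> map g xs \<in> tuples N (map fst xs)"
  by (simp add: tuples_iff)

text \<open>Induction on formulas, where the quantifier is the case that needs Shelah's theorem.
  Free variables are handled through a list \<open>xs\<close> rather than through
  \<open>fms\<close>, since subformulas of a formula on standard variables may have other free
  variables.\<close>

lemma ED_sat:
  assumes "wf_fm L1 \<phi>"
  shows "\<exists>xs Y. set xs \<subseteq> fv \<phi> \<and> ED (map fst xs) Y \<and>
    (\<forall>g. (\<forall>v \<in> fv \<phi>. g v \<in> dom_of M (fst v)) \<longrightarrow> (sat S g \<phi> \<longleftrightarrow> map g xs \<in> Y))"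
  using assms
proof (induction \<phi>)
  case (Eq t u)
  then obtain s v w where vw: "t = Var v" "u = Var w" "fst v = s" "fst w = s" using has_sort_L1 by fastforce
  define \<psi> :: "('s, 'f, 'p) fm" where "\<psi> = fm.Eq (Var (s, 0)) (Var (s, 1))"
  have "has_sort L (Var (s, k)) s" for k using has_sort.intros(1)[of L "(s, k)"] by simp
  then have \<psi>: "\<psi> \<in> fms L [s, s]" by (auto simp: \<psi>_def fms_def formulas_def in_std_vars)
  have "[g v, g w] \<in> ext M [s, s] \<psi> \<longleftrightarrow> g v = g w" if "g v \<in> dom_of M s" "g w \<in> dom_of M s" for g :: "'s var \<Rightarrow> 'a"
    using that by (simp add: ext_def \<psi>_def std_env_def tuples_def)
  then show ?case using vw ED_ext[OF elem \<psi>]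
    by (intro exI[of _ "[v, w]"] exI[of _ "ext M [s, s] \<psi>"]) auto
next
  case (Rel p ts)
  obtain \<sigma> Y where p: "p = (\<sigma>, Y)" by (cases p)
  with Rel have Y: "ED \<sigma> Y" and "list_all2 (has_sort L1) ts \<sigma>"
    by (auto simp: shelah_lang_def split: if_splits)
  then obtain vs where vs: "ts = map Var vs" "map fst vs = \<sigma>" using list_has_sort_L1 by blast
  have "map (eval S g) (map Var vs) = map g vs" for g by simp
  then have "sat S g (fm.Rel p ts) \<longleftrightarrow> map g vs \<in> Y" for g by (simp only: sat.simps p vs(1) rel_int_S)
  then show ?case using vs Y by (intro exI[of _ vs] exI[of _ Y]) auto
next
  case (Neg \<phi>)
  then obtain xs Y where xs: "set xs \<subseteq> fv \<phi>" "ED (map fst xs) Y"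
    "\<And>g. (\<forall>v \<in> fv \<phi>. g v \<in> dom_of M (fst v)) \<Longrightarrow> sat S g \<phi> \<longleftrightarrow> map g xs \<in> Y" by auto
  have "map g xs \<in> tuples M (map fst xs)" if "\<forall>v \<in> fv \<phi>. g v \<in> dom_of M (fst v)" for g
    by (rule map_tuples) (use xs(1) that in blast)
  then show ?case using xs ED_compl[OF elem xs(2)]
    by (intro exI[of _ xs] exI[of _ "tuples M (map fst xs) - Y"]) auto
next
  case (And \<phi> \<psi>)
  then obtain xs Y where xs: "set xs \<subseteq> fv \<phi>" "ED (map fst xs) Y"
    "\<And>g. (\<forall>v \<in> fv \<phi>. g v \<in> dom_of M (fst v)) \<Longrightarrow> sat S g \<phi> \<longleftrightarrow> map g xs \<in> Y" by auto
  from And obtain ys Z where ys: "set ys \<subseteq> fv \<psi>" "ED (map fst ys) Z"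
    "\<And>g. (\<forall>v \<in> fv \<psi>. g v \<in> dom_of M (fst v)) \<Longrightarrow> sat S g \<psi> \<longleftrightarrow> map g ys \<in> Z" by auto
  let ?bs = "xs @ ys"
  let ?Y = "{as \<in> tuples M (map fst ?bs). pick (map (pos ?bs) xs) as \<in> Y} \<inter> {as \<in> tuples M (map fst ?bs). pick (map (pos ?bs) ys) as \<in> Z}"
  have "ED (map fst ?bs) ?Y"
    by (intro ED_inter[OF elem] ED_reidx[OF elem reidx_map_pos xs(2)] ED_reidx[OF elem reidx_map_pos ys(2)]) auto
  moreover have "sat S g (fm.And \<phi> \<psi>) \<longleftrightarrow> map g ?bs \<in> ?Y" if g: "\<forall>v \<in> fv (fm.And \<phi> \<psi>). g v \<in> dom_of M (fst v)" for g
  proof -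
    have "map g ?bs \<in> tuples M (map fst ?bs)" by (rule map_tuples) (use xs(1) ys(1) g in auto)
    then show ?thesis using xs(3)[of g] ys(3)[of g] g pick_map_pos[of xs ?bs g] pick_map_pos[of ys ?bs g] by simp
  qed
  ultimately show ?case using xs(1) ys(1) by (intro exI[of _ ?bs] exI[of _ ?Y]) auto
next
  case (Ex v \<phi>)
  then obtain xs Y where xs: "set xs \<subseteq> fv \<phi>" "ED (map fst xs) Y"
    "\<And>g. (\<forall>v \<in> fv \<phi>. g v \<in> dom_of M (fst v)) \<Longrightarrow> sat S g \<phi> \<longleftrightarrow> map g xs \<in> Y" by auto
  \<comment> \<open>The quantified variable is moved to the end, where \<open>ED_proj\<close>
    expects it. It is appended even if it does not occur in \<open>xs\<close>.\<close>
  let ?ys = "removeAll v xs" let ?bs = "?ys @ [v]"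
  have sub: "set xs \<subseteq> set ?bs" by auto
  let ?Y = "{as \<in> tuples M (map fst ?bs). pick (map (pos ?bs) xs) as \<in> Y}"
  have Y: "ED (map fst ?bs) ?Y" by (rule ED_reidx[OF elem reidx_map_pos[OF sub] xs(2)])
  let ?Z = "{u \<in> tuples M (map fst ?ys). \<exists>a \<in> tuples M [fst v]. u @ a \<in> ?Y}"
  have "ED (map fst ?ys) ?Z" by (rule ED_proj) (use Y in simp)
  moreover have "sat S g (fm.Ex v \<phi>) \<longleftrightarrow> map g ?ys \<in> ?Z" if g: "\<forall>v \<in> fv (fm.Ex v \<phi>). g v \<in> dom_of M (fst v)" for g
  proof -
    have yt: "map g ?ys \<in> tuples M (map fst ?ys)" by (rule map_tuples) (use xs(1) g in auto)
    have "sat S (g(v := a)) \<phi> \<longleftrightarrow> map g ?ys @ [a] \<in> ?Y" if a: "a \<in> dom_of M (fst v)" for a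
    proof -
      have "map (g(v := a)) ?ys = map g ?ys" by auto
      then have eq: "map (g(v := a)) ?bs = map g ?ys @ [a]" by (simp only: map_append list.map fun_upd_same)
      have "map g ?ys @ [a] \<in> tuples M (map fst ?bs)" using tuples_appendI[OF yt, of "[a]" "[fst v]"] a by simp
      moreover have "pick (map (pos ?bs) xs) (map g ?ys @ [a]) = map (g(v := a)) xs"
        unfolding eq[symmetric] by (rule pick_map_pos[OF sub])
      ultimately show ?thesis using xs(3)[of "g(v := a)"] g a by auto
    qed
    then show ?thesis using yt by (auto simp: dom_of_S tuples_def list_all2_Cons2)
  qed
  ultimately show ?case using xs(1) by (intro exI[of _ ?ys] exI[of _ ?Z]) auto
qed

lemma ED_S:
  assumes "\<phi> \<in> fms L1 \<tau>"
  shows "ED \<tau> (ext S \<tau> \<phi>)"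
proof -
  from assms have "wf_fm L1 \<phi>" and fv: "fv \<phi> \<subseteq> set (std_vars \<tau>)" by (auto simp: fms_def formulas_def)
  from ED_sat[OF this(1)] obtain xs Y where xs: "set xs \<subseteq> fv \<phi>" "ED (map fst xs) Y"
    "\<And>g. (\<forall>v \<in> fv \<phi>. g v \<in> dom_of M (fst v)) \<Longrightarrow> sat S g \<phi> \<longleftrightarrow> map g xs \<in> Y" by blast
  have x: "snd v < length \<tau> \<and> fst v = \<tau> ! snd v" if "v \<in> fv \<phi>" for v using that fv in_std_vars by blast
  have r: "reidx (map fst xs) \<tau> (map snd xs)" using x xs(1) by (auto simp: reidx_def pick_def)
  have "sat S (std_env as) \<phi> \<longleftrightarrow> pick (map snd xs) as \<in> Y" if as: "as \<in> tuples M \<tau>" for as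
  proof -
    have "\<forall>v \<in> fv \<phi>. std_env as v \<in> dom_of M (fst v)" using x as by (auto simp: std_env_def tuples_iff)
    moreover have "map (std_env as) xs = pick (map snd xs) as" by (simp add: pick_def std_env_def)
    ultimately show ?thesis using xs(3)[of "std_env as"] by simp
  qed
  then have "ext S \<tau> \<phi> = {as \<in> tuples M \<tau>. pick (map snd xs) as \<in> Y}" by (auto simp: ext_def)
  then show ?thesis using ED_reidx[OF elem r xs(2)] by simp
qed

text \<open>In \<open>U1\<close> every formula of the expansion is thus equivalent to a predicate,
  which brings it within the scope of \<open>no_patterns\<close>.\<close>

lemma ext_U1_star: "\<phi> \<in> fms L1 \<tau> \<Longrightarrow> ext U1 \<tau> \<phi> = star \<tau> (ext S \<tau> \<phi>)"
  using transfer_eq[OF _ fms_rf[OF ED_S]] ext_rf_S[OF ED_S] ext_rf_U1 by metis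

end

section \<open>Copying \<open>L\<close>-types from \<open>U\<close> to \<open>U1\<close>\<close>

locale shelah_monster = shelah L M M' \<kappa>1 U1
  for L :: "('s, 'f, 'p) lang" and M M' :: "('s, 'f, 'p, 'a) struc"
    and \<kappa>1 :: "'k rel" and U1 :: "('s, unit, 's list \<times> 'a list set, 'v) struc" +
  fixes T :: "('s, 'f, 'p) fm set" and \<kappa> :: "'l rel" and U :: "('s, 'f, 'p, 'u) struc"
  assumes complete: "complete_theory L T"
    and models_M: "models L M T"
    and monster_U: "monster L T \<kappa> U"
begin

lemmas is_struc_U = monsterD(3)[OF monster_U]

lemma models_U: "models L U T"
  using monster_U by (simp add: monster_def)

lemmas transfer_U_M = complete_theory_transfer[OF complete models_U models_M]

text \<open>\<open>l\<close> has in \<open>U1\<close> the \<open>L\<close>-type that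
  \<open>u\<close> has in \<open>U\<close>. Since \<open>U1\<close> is not an
  \<open>L\<close>-structure, an \<open>L\<close>-formula is read there as the predicate naming its
  extension in \<open>M\<close>. One implication suffices because formulas can be negated.\<close>

definition sim :: "'s list \<Rightarrow> 'u list \<Rightarrow> 'v list \<Rightarrow> bool" where
  "sim \<tau> u l \<longleftrightarrow> u \<in> tuples U \<tau> \<and> l \<in> tuples U1 \<tau> \<and> (\<forall>\<alpha> \<in> fms L \<tau>. u \<in> ext U \<tau> \<alpha> \<longrightarrow> l \<in> star \<tau> (ext M \<tau> \<alpha>))"

lemma sim_iff:
  assumes s: "sim \<tau> u l" and \<alpha>: "\<alpha> \<in> fms L \<tau>"
  shows "u \<in> ext U \<tau> \<alpha> \<longleftrightarrow> l \<in> star \<tau> (ext M \<tau> \<alpha>)"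
proof
  show "l \<in> star \<tau> (ext M \<tau> \<alpha>)" if "u \<in> ext U \<tau> \<alpha>" using s \<alpha> that by (auto simp: sim_def)
  show "u \<in> ext U \<tau> \<alpha>" if l: "l \<in> star \<tau> (ext M \<tau> \<alpha>)"
  proof (rule ccontr)
    assume "u \<notin> ext U \<tau> \<alpha>"
    then have "u \<in> ext U \<tau> (Neg \<alpha>)" using s by (simp add: ext_Neg sim_def)
    then have "l \<in> star \<tau> (ext M \<tau> (Neg \<alpha>))" using s fms_Neg[OF \<alpha>] by (auto simp: sim_def)
    then show False using l star_compl[OF ED_ext[OF elem \<alpha>]] by (simp add: ext_Neg)
  qed
qed

text \<open>\<open>U\<close> and \<open>M\<close> are models of the same complete theory, and a
  sentence true in \<open>M\<close> has the set of all empty tuples as its extension.\<close>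

lemma sim_Nil: "sim [] [] []"
  unfolding sim_def
proof (intro conjI ballI impI)
  fix \<alpha> :: "('s, 'f, 'p) fm" assume \<alpha>: "\<alpha> \<in> fms L []" and "[] \<in> ext U [] \<alpha>"
  then have "ext M [] \<alpha> \<noteq> {}" using transfer_U_M[OF \<alpha>] by blast
  then have "ext M [] \<alpha> = tuples M []" using ext_tuples[of M "[]" \<alpha>] by auto
  then show "[] \<in> star [] (ext M [] \<alpha>)" using star_all[of "[]"] by simp
qed simp_all

lemma sim_pick:
  assumes s: "sim \<tau> u l" and h: "reidx \<tau>' \<tau> hs"
  shows "sim \<tau>' (pick hs u) (pick hs l)"
  unfolding sim_def
proof (intro conjI ballI impI)
  have ul: "u \<in> tuples U \<tau>" "l \<in> tuples U1 \<tau>" using s by (auto simp: sim_def)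
  show "pick hs u \<in> tuples U \<tau>'" "pick hs l \<in> tuples U1 \<tau>'" using pick_tuples[OF h] ul by auto
  fix \<alpha> assume \<alpha>: "\<alpha> \<in> fms L \<tau>'" and "pick hs u \<in> ext U \<tau>' \<alpha>"
  then have "u \<in> ext U \<tau> (reindex \<tau>' \<tau> hs \<alpha>)" using ul by (simp add: ext_reindex[OF h \<alpha> is_struc_U])
  then have "l \<in> star \<tau> (ext M \<tau> (reindex \<tau>' \<tau> hs \<alpha>))" using s fms_reindex[OF h \<alpha>] by (auto simp: sim_def)
  then show "pick hs l \<in> star \<tau>' (ext M \<tau>' \<alpha>)"
    unfolding ext_reindex[OF h \<alpha> is_struc_M] star_reidx[OF h ED_ext[OF elem \<alpha>]] by simp
qed

text \<open>The forth step of a back-and-forth argument. For finitely many formulas the existence of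
  the new tuple belongs to the \<open>L\<close>-type of \<open>u\<close>, hence holds at
  \<open>l\<close>; saturation of \<open>U1\<close> does the rest.\<close>

lemma sim_extend:
  assumes s: "sim \<tau> u l" and u': "u' \<in> tuples U \<tau>'"
  shows "\<exists>l' \<in> tuples U1 \<tau>'. sim (\<tau> @ \<tau>') (u @ u') (l @ l')"
proof -
  have u: "u \<in> tuples U \<tau>" and l: "l \<in> tuples U1 \<tau>" using s by (auto simp: sim_def)
  define \<theta> where "\<theta> W = (SOME \<theta>. \<theta> \<in> fms L1 (\<tau>' @ \<tau>) \<and>
    (\<forall>x \<in> tuples U1 \<tau>'. \<forall>b \<in> tuples U1 \<tau>. x @ b \<in> ext U1 (\<tau>' @ \<tau>) \<theta> \<longleftrightarrow> b @ x \<in> star (\<tau> @ \<tau>') W))" for W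
  have \<theta>: "\<theta> W \<in> fms L1 (\<tau>' @ \<tau>)"
    "x \<in> tuples U1 \<tau>' \<Longrightarrow> x @ l \<in> ext U1 (\<tau>' @ \<tau>) (\<theta> W) \<longleftrightarrow> l @ x \<in> star (\<tau> @ \<tau>') W"
    if "ED (\<tau> @ \<tau>') W" for W x
  proof -
    from swapped_formula[OF that] have "\<exists>\<theta>. \<theta> \<in> fms L1 (\<tau>' @ \<tau>) \<and>
      (\<forall>x \<in> tuples U1 \<tau>'. \<forall>b \<in> tuples U1 \<tau>. x @ b \<in> ext U1 (\<tau>' @ \<tau>) \<theta> \<longleftrightarrow> b @ x \<in> star (\<tau> @ \<tau>') W)" by blast
    from someI_ex[OF this, folded \<theta>_def] l
    show "\<theta> W \<in> fms L1 (\<tau>' @ \<tau>)"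
      "x \<in> tuples U1 \<tau>' \<Longrightarrow> x @ l \<in> ext U1 (\<tau>' @ \<tau>) (\<theta> W) \<longleftrightarrow> l @ x \<in> star (\<tau> @ \<tau>') W" by blast+
  qed
  let ?H = "{\<alpha> \<in> fms L (\<tau> @ \<tau>'). u @ u' \<in> ext U (\<tau> @ \<tau>') \<alpha>}"
  let ?G = "\<lambda>\<alpha>. (\<theta> (ext M (\<tau> @ \<tau>') \<alpha>), \<tau>, l)"
  have "\<exists>as \<in> tuples U1 \<tau>'. \<forall>(\<phi>, \<mu>, e) \<in> ?G ` ?H. as @ e \<in> ext U1 (\<tau>' @ \<mu>) \<phi>"
  proof (rule realize[OF monsterD(4,3,1,2)[OF monster_U1]])
    show "set l \<subseteq> univ U1" by (rule tuples_set[OF l])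
    show "|set l| <o \<kappa>1" by (rule finite_ordLess_Card_order[OF monsterD(1,2)[OF monster_U1]]) simp
    show "?G ` ?H \<subseteq> conds L1 U1 (set l) \<tau>'" using \<theta>(1)[OF ED_ext[OF elem]] l by (auto simp: conds_def)
    show "fin_sat U1 \<tau>' (?G ` ?H)" unfolding fin_sat_def
    proof (intro allI impI)
      fix q assume q: "q \<subseteq> ?G ` ?H" "finite q"
      from finite_subset_image[OF q(2,1)] obtain Q where Q: "Q \<subseteq> ?H" "finite Q" "q = ?G ` Q" by blast
      obtain as where as: "set as = Q" using finite_list[OF Q(2)] by (elim exE)
      have \<alpha>: "conj as \<in> fms L (\<tau> @ \<tau>')" by (rule fms_conj) (use as Q(1) in auto)
      have "u @ u' \<in> ext U (\<tau> @ \<tau>') (conj as)"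
        unfolding ext_conj[OF is_struc_U] using as Q(1) tuples_appendI[OF u u'] by auto
      then have "u \<in> ext U \<tau> (exs \<tau> \<tau>' (conj as))" unfolding ext_exs[OF \<alpha>] using u u' by blast
      then have "l \<in> star \<tau> (ext M \<tau> (exs \<tau> \<tau>' (conj as)))" using s fms_exs[OF \<alpha>] by (auto simp: sim_def)
      then have "\<exists>x \<in> tuples U1 \<tau>'. l @ x \<in> star (\<tau> @ \<tau>') (ext M (\<tau> @ \<tau>') (conj as))"
        by (rule star_ex[OF ED_ext[OF elem fms_exs[OF \<alpha>]] ED_ext[OF elem \<alpha>], rotated]) (auto simp: ext_exs[OF \<alpha>])
      then obtain x where x: "x \<in> tuples U1 \<tau>'" "l @ x \<in> star (\<tau> @ \<tau>') (ext M (\<tau> @ \<tau>') (conj as))" by blast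
      have "x @ l \<in> ext U1 (\<tau>' @ \<tau>) (\<theta> (ext M (\<tau> @ \<tau>') \<alpha>'))" if "\<alpha>' \<in> Q" for \<alpha>'
      proof -
        have \<alpha>': "\<alpha>' \<in> fms L (\<tau> @ \<tau>')" using that Q(1) by auto
        have "ext M (\<tau> @ \<tau>') (conj as) \<subseteq> ext M (\<tau> @ \<tau>') \<alpha>'"
          unfolding ext_conj[OF is_struc_M] using as that by auto
        then have "l @ x \<in> star (\<tau> @ \<tau>') (ext M (\<tau> @ \<tau>') \<alpha>')"
          using star_mono[OF ED_ext[OF elem \<alpha>] ED_ext[OF elem \<alpha>']] x(2) by blast
        then show ?thesis using \<theta>(2)[OF ED_ext[OF elem \<alpha>'] x(1)] by simp
      qed
      then show "\<exists>as\<in>tuples U1 \<tau>'. \<forall>(\<phi>, \<mu>, e)\<in>q. as @ e \<in> ext U1 (\<tau>' @ \<mu>) \<phi>"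
        using x(1) unfolding Q(3) by blast
    qed
  qed
  then obtain x where x: "x \<in> tuples U1 \<tau>'" "\<forall>(\<phi>, \<mu>, e) \<in> ?G ` ?H. x @ e \<in> ext U1 (\<tau>' @ \<mu>) \<phi>" by blast
  have "l @ x \<in> star (\<tau> @ \<tau>') (ext M (\<tau> @ \<tau>') \<alpha>)" if "\<alpha> \<in> fms L (\<tau> @ \<tau>')" "u @ u' \<in> ext U (\<tau> @ \<tau>') \<alpha>" for \<alpha>
  proof -
    have "?G \<alpha> \<in> ?G ` ?H" by (rule imageI) (use that in blast)
    with x(2) have "x @ l \<in> ext U1 (\<tau>' @ \<tau>) (\<theta> (ext M (\<tau> @ \<tau>') \<alpha>))" by blast
    then show ?thesis using \<theta>(2)[OF ED_ext[OF elem that(1)] x(1)] by simp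
  qed
  then have "sim (\<tau> @ \<tau>') (u @ u') (l @ x)" using u l u' x(1) by (simp add: sim_def tuples_appendI)
  with x(1) show ?thesis by blast
qed

lemma sim_family:
  assumes s: "sim (pow \<sigma> (length bs)) (cat a bs) (cat f bs)" and sub: "set ks \<subseteq> set bs"
    and a: "\<And>x. x \<in> set bs \<Longrightarrow> a x \<in> tuples U \<sigma>" and f: "\<And>x. x \<in> set bs \<Longrightarrow> f x \<in> tuples U1 \<sigma>"
  shows "sim (pow \<sigma> (length ks)) (cat a ks) (cat f ks)"
proof -
  have "pick (cpick (length \<sigma>) bs ks) (cat a bs) = cat a ks"
    by (rule pick_cpick[OF _ sub]) (use a tuples_length in blast)
  moreover have "pick (cpick (length \<sigma>) bs ks) (cat f bs) = cat f ks"
    by (rule pick_cpick[OF _ sub]) (use f tuples_length in blast)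
  ultimately show ?thesis using sim_pick[OF s reidx_cpick[OF sub]] by simp
qed

lemma copy_sequence:
  assumes a: "\<And>i :: nat. a i \<in> tuples U \<sigma>"
  shows "\<exists>h. (\<forall>i. h i \<in> tuples U1 \<sigma>) \<and> (\<forall>ks. sim (pow \<sigma> (length ks)) (cat a ks) (cat h ks))"
proof -
  have "\<exists>h. (\<forall>i. h i \<in> tuples U1 \<sigma>) \<and> sim (pow \<sigma> n) (cat a [0..<n]) (cat h [0..<n])" for n
  proof -
    have "cat a [0..<n] \<in> tuples U (pow \<sigma> n)" using cat_tuples[of "[0..<n]" a U \<sigma>] a by simp
    from sim_extend[OF sim_Nil this] obtain l where l: "l \<in> tuples U1 (pow \<sigma> n)" "sim (pow \<sigma> n) (cat a [0..<n]) l" by auto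
    obtain d where d: "d \<in> tuples U1 \<sigma>" using tuples_ne[OF is_struc_U1] by blast
    have "l \<in> tuples U1 (pow \<sigma> (length [0..<n]))" using l(1) by simp
    from ex_cat_eq[OF distinct_upt this, of "\<lambda>_. d"] d obtain h where "\<forall>i. h i \<in> tuples U1 \<sigma>" "cat h [0..<n] = l" by blast
    with l(2) show ?thesis by blast
  qed
  note ex = this
  \<comment> \<open>Initial segments suffice, since every list of indices is picked from one of them
    by \<open>sim_family\<close>.\<close>
  let ?C = "{([0..<n], rf (pow \<sigma> n) (ext M (pow \<sigma> n) \<alpha>)) | n \<alpha>. \<alpha> \<in> fms L (pow \<sigma> n) \<and> cat a [0..<n] \<in> ext U (pow \<sigma> n) \<alpha>}"
  have "\<exists>h. (\<forall>i. h i \<in> tuples U1 \<sigma>) \<and> (\<forall>c\<in>?C. famsat U1 \<sigma> [] [] h c)"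
  proof (rule realize_family[OF monsterD(4,3,1,2)[OF monster_U1]])
    show "\<forall>(is, \<phi>) \<in> ?C. \<phi> \<in> fms L1 (pow \<sigma> (length is) @ [])" using fms_rf[OF ED_ext[OF elem]] by auto
    show "\<forall>q. q \<subseteq> ?C \<longrightarrow> finite q \<longrightarrow> (\<exists>f. (\<forall>i. f i \<in> tuples U1 \<sigma>) \<and> (\<forall>c\<in>q. famsat U1 \<sigma> [] [] f c))"
    proof (intro allI impI)
      fix q assume q: "q \<subseteq> ?C" "finite q"
      define m where "m = Max (insert 0 (length ` fst ` q))"
      have m: "length (fst c) \<le> m" if "c \<in> q" for c unfolding m_def using q(2) that by (intro Max_ge) auto
      from ex[of m] obtain h where h: "\<forall>i. h i \<in> tuples U1 \<sigma>" "sim (pow \<sigma> m) (cat a [0..<m]) (cat h [0..<m])" by blast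
      have "famsat U1 \<sigma> [] [] h c" if c: "c \<in> q" for c
      proof -
        from c q(1) obtain n \<alpha> where n: "c = ([0..<n], rf (pow \<sigma> n) (ext M (pow \<sigma> n) \<alpha>))" "\<alpha> \<in> fms L (pow \<sigma> n)"
          "cat a [0..<n] \<in> ext U (pow \<sigma> n) \<alpha>" by blast
        have "set [0..<n] \<subseteq> set [0..<m]" using m[OF c] n(1) by auto
        from sim_family[OF _ this, of \<sigma> a h] h a have "sim (pow \<sigma> n) (cat a [0..<n]) (cat h [0..<n])" by simp
        then show ?thesis unfolding n(1) famsat_def using n(2,3) by (simp add: sim_def ext_rf_U1)
      qed
      with h(1) show "\<exists>f. (\<forall>i. f i \<in> tuples U1 \<sigma>) \<and> (\<forall>c\<in>q. famsat U1 \<sigma> [] [] f c)" by blast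
    qed
  qed simp
  then obtain h where h: "\<And>i. h i \<in> tuples U1 \<sigma>" "\<And>c. c \<in> ?C \<Longrightarrow> famsat U1 \<sigma> [] [] h c" by blast
  have s: "sim (pow \<sigma> n) (cat a [0..<n]) (cat h [0..<n])" for n
    unfolding sim_def
  proof (intro conjI ballI impI)
    show "cat a [0..<n] \<in> tuples U (pow \<sigma> n)" "cat h [0..<n] \<in> tuples U1 (pow \<sigma> n)"
      using cat_tuples[of "[0..<n]" a U \<sigma>] cat_tuples[of "[0..<n]" h U1 \<sigma>] a h(1) by simp_all
    fix \<alpha> assume "\<alpha> \<in> fms L (pow \<sigma> n)" "cat a [0..<n] \<in> ext U (pow \<sigma> n) \<alpha>"
    then have "famsat U1 \<sigma> [] [] h ([0..<n], rf (pow \<sigma> n) (ext M (pow \<sigma> n) \<alpha>))" by (intro h(2)) blast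
    then show "cat h [0..<n] \<in> star (pow \<sigma> n) (ext M (pow \<sigma> n) \<alpha>)" by (simp add: famsat_def ext_rf_U1)
  qed
  have "sim (pow \<sigma> (length ks)) (cat a ks) (cat h ks)" for ks
  proof -
    define n where "n = Suc (Max (insert 0 (set ks)))"
    have "x \<le> Max (insert 0 (set ks))" if "x \<in> set ks" for x using that by (intro Max_ge) auto
    then have "x < n" if "x \<in> set ks" for x using that unfolding n_def less_Suc_eq_le by blast
    then have "set ks \<subseteq> set [0..<n]" by auto
    from sim_family[OF _ this, of \<sigma> a h] s[of n] a h(1) show ?thesis by simp
  qed
  with h(1) show ?thesis by blast
qed

end

text \<open>Ramsey's theorem is applied once for each of the finitely many conditions, each time
  inside the infinite set obtained before. As both lists are arbitrary, the implication amounts to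
  an equivalence.\<close>

lemma Ramsey_family:
  fixes P :: "'c \<Rightarrow> nat list \<Rightarrow> bool" and k :: "'c \<Rightarrow> nat"
  assumes "finite C" "infinite (Z :: nat set)"
  shows "\<exists>Y \<subseteq> Z. infinite Y \<and> (\<forall>c\<in>C. \<forall>is js. sorted_wrt (<) is \<longrightarrow> sorted_wrt (<) js \<longrightarrow> set is \<subseteq> Y \<longrightarrow> set js \<subseteq> Y \<longrightarrow>
    length is = k c \<longrightarrow> length js = k c \<longrightarrow> P c is \<longrightarrow> P c js)"
  using assms
proof (induction C arbitrary: Z rule: finite_induct)
  case empty
  then show ?case by (intro exI[of _ Z]) simp
next
  case (insert c C)
  define f where "f X = (if P c (sorted_list_of_set X) then 0 else (1::nat))" for X
  have "\<forall>X. X \<subseteq> Z \<and> finite X \<and> card X = k c \<longrightarrow> f X < 2" by (simp add: f_def)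
  from Ramsey[OF insert.prems this] obtain Y t where Y: "Y \<subseteq> Z" "infinite Y"
    and "\<forall>X. X \<subseteq> Y \<and> finite X \<and> card X = k c \<longrightarrow> f X = t" by (elim exE conjE)
  then have Yt: "f X = t" if "X \<subseteq> Y" "finite X" "card X = k c" for X using that by simp
  from insert.IH[OF Y(2)] obtain Y' where Y': "Y' \<subseteq> Y" "infinite Y'"
    "\<forall>c\<in>C. \<forall>is js. sorted_wrt (<) is \<longrightarrow> sorted_wrt (<) js \<longrightarrow> set is \<subseteq> Y' \<longrightarrow> set js \<subseteq> Y' \<longrightarrow>
    length is = k c \<longrightarrow> length js = k c \<longrightarrow> P c is \<longrightarrow> P c js" by (elim exE conjE)
  have "P c js" if "sorted_wrt (<) is" "sorted_wrt (<) js" "set is \<subseteq> Y'" "set js \<subseteq> Y'"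
    "length is = k c" "length js = k c" "P c is" for "is" js
  proof -
    have d: "distinct is" "distinct js" using that(1,2) by (auto simp: strict_sorted_iff)
    have "sorted_list_of_set (set is) = is" "sorted_list_of_set (set js) = js"
      using that(1,2) by (simp_all add: strict_sorted_iff sorted_list_of_set.idem_if_sorted_distinct)
    moreover have "f (set ks) = t" if "set ks \<subseteq> Y'" "length ks = k c" "distinct ks" for ks
      by (rule Yt) (use that Y'(1) distinct_card[of ks] in auto)
    then have "f (set is) = t" "f (set js) = t" using that(3-6) d by blast+
    moreover note that(7)
    ultimately show ?thesis unfolding f_def by (metis zero_neq_one)
  qed
  then have c: "\<forall>is js. sorted_wrt (<) is \<longrightarrow> sorted_wrt (<) js \<longrightarrow> set is \<subseteq> Y' \<longrightarrow> set js \<subseteq> Y' \<longrightarrow>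
    length is = k c \<longrightarrow> length js = k c \<longrightarrow> P c is \<longrightarrow> P c js" by (intro allI impI) assumption
  have "\<forall>d\<in>insert c C. \<forall>is js. sorted_wrt (<) is \<longrightarrow> sorted_wrt (<) js \<longrightarrow> set is \<subseteq> Y' \<longrightarrow> set js \<subseteq> Y' \<longrightarrow>
    length is = k d \<longrightarrow> length js = k d \<longrightarrow> P d is \<longrightarrow> P d js"
    unfolding Set.ball_simps(7) by (intro conjI c Y'(3))
  moreover have "Y' \<subseteq> Z" using Y(1) Y'(1) by blast
  ultimately show ?case using Y'(2) by (intro exI[of _ Y']) (intro conjI)
qed

subsection \<open>Inserting one point at a time\<close>

abbreviation inc :: "'i :: linorder list \<Rightarrow> bool" where
  "inc \<equiv> sorted_wrt (<)"

text \<open>Indiscernibility over the empty set of the part of the family indexed by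
  \<open>A\<close>. The implication is an equivalence, being required for \<open>as\<close> and
  \<open>bs\<close> in both orders.\<close>

definition rind :: "('s, 'f, 'p) lang \<Rightarrow> ('s, 'f, 'p, 'u) struc \<Rightarrow> 's list \<Rightarrow> 'i :: linorder set \<Rightarrow> ('i \<Rightarrow> 'u list) \<Rightarrow> bool" where
  "rind L N \<sigma> A g \<longleftrightarrow> (\<forall>as bs \<alpha>. inc as \<and> inc bs \<and> set as \<subseteq> A \<and> set bs \<subseteq> A \<and> length as = length bs \<and>
     \<alpha> \<in> fms L (pow \<sigma> (length as)) \<longrightarrow> cat g as \<in> ext N (pow \<sigma> (length as)) \<alpha> \<longrightarrow> cat g bs \<in> ext N (pow \<sigma> (length as)) \<alpha>)"

lemma inc_map: "strict_mono_on A f \<Longrightarrow> set xs \<subseteq> A \<Longrightarrow> inc xs \<Longrightarrow> inc (map f xs)"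
  by (induction xs) (auto simp: strict_mono_on_def)

lemma inc_distinct: "inc xs \<Longrightarrow> distinct xs"
  by (simp add: strict_sorted_iff)

lemma pos_nth: "distinct zs \<Longrightarrow> i < length zs \<Longrightarrow> pos zs (zs ! i) = i"
  using pos[of "zs ! i" zs] nth_eq_iff_index_eq[of zs "pos zs (zs ! i)" i] by simp

lemma pos_less: "inc zs \<Longrightarrow> x \<in> set zs \<Longrightarrow> y \<in> set zs \<Longrightarrow> x < y \<Longrightarrow> pos zs x < pos zs y"
  using pos[of x zs] pos[of y zs]
  by (metis linorder_neqE_nat order_less_asym order_less_irrefl sorted_wrt_nth_less)

lemma ex_inc_list: "infinite A \<Longrightarrow> \<exists>xs. inc xs \<and> set xs \<subseteq> A \<and> length xs = n" for A :: "'i :: linorder set"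
proof -
  assume "infinite A"
  then obtain B where "finite B" "card B = n" "B \<subseteq> A" using infinite_arbitrarily_large by blast
  then show ?thesis by (intro exI[of _ "sorted_list_of_set B"]) auto
qed

context shelah
begin

text \<open>Indiscernibility for the formulas in \<open>\<Psi>\<close> only, each given with the
  number of tuples that it takes. For finite \<open>\<Psi>\<close> this is what Ramsey's theorem
  provides and what a single formula can express.\<close>

definition psi_ind :: "'s list \<Rightarrow> (nat \<times> ('s, unit, 's list \<times> 'a list set) fm) set \<Rightarrow> ('i :: linorder \<Rightarrow> 'v list) \<Rightarrow> 'i set \<Rightarrow> bool" where
  "psi_ind \<sigma> \<Psi> f Z \<longleftrightarrow> (\<forall>c \<in> \<Psi>. \<forall>ks ks'. inc ks \<longrightarrow> inc ks' \<longrightarrow> set ks \<subseteq> Z \<longrightarrow> set ks' \<subseteq> Z \<longrightarrow>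
     length ks = fst c \<longrightarrow> length ks' = fst c \<longrightarrow>
     cat f ks \<in> ext U1 (pow \<sigma> (fst c)) (snd c) \<longrightarrow> cat f ks' \<in> ext U1 (pow \<sigma> (fst c)) (snd c))"

lemma psi_ind_mono: "psi_ind \<sigma> \<Psi> f Z \<Longrightarrow> Y \<subseteq> Z \<Longrightarrow> psi_ind \<sigma> \<Psi> f Y"
  unfolding psi_ind_def by (meson subset_trans)

lemma psi_ind_map:
  assumes "psi_ind \<sigma> \<Psi> f (r ` Z)" "strict_mono_on Z r" "\<And>z. z \<in> Z \<Longrightarrow> f' z = f (r z)"
  shows "psi_ind \<sigma> \<Psi> f' Z"
  unfolding psi_ind_def
proof (intro ballI allI impI)
  fix c ks ks' assume c: "c \<in> \<Psi>" and k: "inc ks" "inc ks'" "set ks \<subseteq> Z" "set ks' \<subseteq> Z" "length ks = fst c" "length ks' = fst c"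
    and "cat f' ks \<in> ext U1 (pow \<sigma> (fst c)) (snd c)"
  have eq: "cat f' ls = cat f (map r ls)" if "set ls \<subseteq> Z" for ls
  proof -
    have "map f' ls = map f (map r ls)" using assms(3) that by auto
    then show ?thesis by (simp only:)
  qed
  have "inc (map r ks)" "inc (map r ks')" using inc_map[OF assms(2)] k by auto
  moreover have "set (map r ks) \<subseteq> r ` Z" "set (map r ks') \<subseteq> r ` Z" using k by auto
  moreover have "cat f (map r ks) \<in> ext U1 (pow \<sigma> (fst c)) (snd c)" using \<open>cat f' ks \<in> _\<close> eq[OF k(3)] by (simp only:)
  ultimately have "cat f (map r ks') \<in> ext U1 (pow \<sigma> (fst c)) (snd c)"
    using assms(1)[unfolded psi_ind_def, THEN bspec, OF c] k(5,6) by (metis length_map)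
  then show "cat f' ks' \<in> ext U1 (pow \<sigma> (fst c)) (snd c)" using eq[OF k(4)] by (simp only:)
qed

lemma psi_ind_cong: "(\<And>z. z \<in> Z \<Longrightarrow> f' z = f z) \<Longrightarrow> psi_ind \<sigma> \<Psi> f' Z \<longleftrightarrow> psi_ind \<sigma> \<Psi> f Z"
  using psi_ind_map[of \<sigma> \<Psi> f "\<lambda>z. z" Z f'] psi_ind_map[of \<sigma> \<Psi> f' "\<lambda>z. z" Z f] by (auto simp: strict_mono_on_def)

text \<open>On \<open>m\<close> points there are only finitely many instances, so the property is a
  finite conjunction of implications. It thereby becomes a definable, hence externally definable,
  condition on the concatenated tuple, to which \<open>no_patterns\<close> can be applied.\<close>

lemma psi_ind_formula:
  assumes "finite \<Psi>" and \<Psi>: "\<forall>c\<in>\<Psi>. snd c \<in> fms L1 (pow \<sigma> (fst c))"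
  shows "\<exists>\<gamma> \<in> fms L1 (pow \<sigma> m). \<forall>(f :: 'i :: linorder \<Rightarrow> 'v list) zs. (\<forall>x. f x \<in> tuples U1 \<sigma>) \<longrightarrow> inc zs \<longrightarrow> length zs = m \<longrightarrow>
    (cat f zs \<in> ext U1 (pow \<sigma> m) \<gamma> \<longleftrightarrow> psi_ind \<sigma> \<Psi> f (set zs))"
proof -
  \<comment> \<open>Lists of positions take the place of lists of indices, so that the formula does
    not depend on \<open>zs\<close>.\<close>
  define K where "K c = {ks. inc ks \<and> set ks \<subseteq> {..<m} \<and> length ks = fst c}" for c :: "nat \<times> ('s, unit, 's list \<times> 'a list set) fm"
  define H where "H = Sigma \<Psi> (\<lambda>c. K c \<times> K c)"
  have "finite (K c)" for c
    by (rule finite_subset[OF _ finite_lists_length_eq[of "{..<m}" "fst c"]]) (auto simp: K_def)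
  then have "finite H" unfolding H_def using assms(1) by blast
  from finite_list[OF this] obtain hs where hs: "set hs = H" by (elim exE)
  define F :: "(nat \<times> ('s, unit, 's list \<times> 'a list set) fm) \<times> nat list \<times> nat list \<Rightarrow> ('s, unit, 's list \<times> 'a list set) fm"
    where "F = (\<lambda>(c, ks, ks'). Neg (And (refam \<sigma> [] [0..<m] ks (snd c)) (Neg (refam \<sigma> [] [0..<m] ks' (snd c)))))"
  have rfm: "refam \<sigma> [] [0..<m] ks (snd c) \<in> fms L1 (pow \<sigma> m)" if "c \<in> \<Psi>" "ks \<in> K c" for c ks
    using fms_refam[of ks "[0..<m]" "snd c" L1 \<sigma> "[]"] that \<Psi> by (auto simp: K_def atLeast0LessThan)
  have Ff: "F t \<in> fms L1 (pow \<sigma> m)" if "t \<in> H" for t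
    using that rfm unfolding H_def F_def by (auto intro!: fms_Neg fms_And)
  have \<gamma>: "conj (map F hs) \<in> fms L1 (pow \<sigma> m)" by (rule fms_conj_map) (use Ff hs in blast)
  have "cat f zs \<in> ext U1 (pow \<sigma> m) (conj (map F hs)) \<longleftrightarrow> psi_ind \<sigma> \<Psi> f (set zs)"
    if f: "\<forall>x. f x \<in> tuples U1 \<sigma>" and zs: "inc zs" "length zs = m" for f :: "'i \<Rightarrow> 'v list" and zs
  proof -
    let ?f = "\<lambda>i. f (zs ! i)"
    have cz: "cat ?f [0..<m] = cat f zs"
    proof -
      have "map ?f [0..<m] = map f (map (nth zs) [0..<length zs])" using zs(2) by simp
      then show ?thesis unfolding map_nth by simp
    qed
    have ct: "cat f zs \<in> tuples U1 (pow \<sigma> m)" using cat_tuples[of zs f U1 \<sigma>] f zs(2) by simp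
    have r: "cat f zs \<in> ext U1 (pow \<sigma> m) (refam \<sigma> [] [0..<m] ks (snd c)) \<longleftrightarrow> cat ?f ks \<in> ext U1 (pow \<sigma> (fst c)) (snd c)"
      if "c \<in> \<Psi>" "ks \<in> K c" for c ks
      using ext_refam[of ks "[0..<m]" "snd c" L1 \<sigma> "[]" U1 ?f "[]"] that \<Psi> is_struc_U1 f cz by (auto simp: K_def atLeast0LessThan)
    have "cat f zs \<in> ext U1 (pow \<sigma> m) (F (c, ks, ks')) \<longleftrightarrow>
        (cat ?f ks \<in> ext U1 (pow \<sigma> (fst c)) (snd c) \<longrightarrow> cat ?f ks' \<in> ext U1 (pow \<sigma> (fst c)) (snd c))"
      if "(c, ks, ks') \<in> H" for c ks ks'
      using that r[of c ks] r[of c ks'] ct by (auto simp: F_def H_def ext_Neg ext_And)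
    then have 1: "cat f zs \<in> ext U1 (pow \<sigma> m) (conj (map F hs)) \<longleftrightarrow> (\<forall>c\<in>\<Psi>. \<forall>ks\<in>K c. \<forall>ks'\<in>K c.
        cat ?f ks \<in> ext U1 (pow \<sigma> (fst c)) (snd c) \<longrightarrow> cat ?f ks' \<in> ext U1 (pow \<sigma> (fst c)) (snd c))"
      unfolding ext_conj_map[OF is_struc_U1 ct] hs by (auto simp: H_def)
    have sm: "strict_mono_on {..<m} (nth zs)" using zs sorted_wrt_nth_less by (auto simp: strict_mono_on_def)
    have to: "\<exists>ls. inc ls \<and> set ls \<subseteq> set zs \<and> length ls = fst c \<and> cat f ls = cat ?f ks" if "ks \<in> K c" for c ks
    proof (intro exI conjI)
      show "inc (map (nth zs) ks)" using that inc_map[OF sm] by (auto simp: K_def)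
      show "set (map (nth zs) ks) \<subseteq> set zs" using that zs(2) by (auto simp: K_def)
    qed (use that in \<open>auto simp: K_def comp_def\<close>)
    have from_zs: "\<exists>ks\<in>K c. cat f ls = cat ?f ks" if "inc ls" "set ls \<subseteq> set zs" "length ls = fst c" for c ls
    proof (intro bexI)
      have "strict_mono_on (set zs) (pos zs)" using pos_less[OF zs(1)] by (auto simp: strict_mono_on_def)
      then have "inc (map (pos zs) ls)" using inc_map that by blast
      then show "map (pos zs) ls \<in> K c" using that pos[of _ zs] zs(2) by (auto simp: K_def)
      have "map f ls = map ?f (map (pos zs) ls)" using that(2) pos[of _ zs] by auto
      then show "cat f ls = cat ?f (map (pos zs) ls)" by (simp only:)
    qed
    show ?thesis unfolding 1 psi_ind_def
    proof (intro iffI ballI allI impI)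
      fix c ls ls' assume a: "\<forall>c\<in>\<Psi>. \<forall>ks\<in>K c. \<forall>ks'\<in>K c.
        cat ?f ks \<in> ext U1 (pow \<sigma> (fst c)) (snd c) \<longrightarrow> cat ?f ks' \<in> ext U1 (pow \<sigma> (fst c)) (snd c)"
        "c \<in> \<Psi>" "inc ls" "inc ls'" "set ls \<subseteq> set zs" "set ls' \<subseteq> set zs" "length ls = fst c" "length ls' = fst c"
        "cat f ls \<in> ext U1 (pow \<sigma> (fst c)) (snd c)"
      from from_zs[OF a(3,5,7)] obtain ks where ks: "ks \<in> K c" "cat f ls = cat ?f ks" by blast
      from from_zs[OF a(4,6,8)] obtain ks' where ks': "ks' \<in> K c" "cat f ls' = cat ?f ks'" by blast
      show "cat f ls' \<in> ext U1 (pow \<sigma> (fst c)) (snd c)"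
        using a(1)[THEN bspec, OF a(2), THEN bspec, OF ks(1), THEN bspec, OF ks'(1)] a(9) unfolding ks(2) ks'(2) by blast
    next
      fix c ks ks' assume a: "\<forall>c\<in>\<Psi>. \<forall>ks ks'. inc ks \<longrightarrow> inc ks' \<longrightarrow> set ks \<subseteq> set zs \<longrightarrow> set ks' \<subseteq> set zs \<longrightarrow>
        length ks = fst c \<longrightarrow> length ks' = fst c \<longrightarrow>
        cat f ks \<in> ext U1 (pow \<sigma> (fst c)) (snd c) \<longrightarrow> cat f ks' \<in> ext U1 (pow \<sigma> (fst c)) (snd c)"
        "c \<in> \<Psi>" "ks \<in> K c" "ks' \<in> K c" "cat ?f ks \<in> ext U1 (pow \<sigma> (fst c)) (snd c)"
      from to[OF a(3)] obtain ls where ls: "inc ls" "set ls \<subseteq> set zs" "length ls = fst c" "cat f ls = cat ?f ks" by blast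
      from to[OF a(4)] obtain ls' where ls': "inc ls'" "set ls' \<subseteq> set zs" "length ls' = fst c" "cat f ls' = cat ?f ks'" by blast
      have "cat f ls \<in> ext U1 (pow \<sigma> (fst c)) (snd c)" using a(5) unfolding ls(4) .
      then have "cat f ls' \<in> ext U1 (pow \<sigma> (fst c)) (snd c)"
        using a(1)[THEN bspec, OF a(2), rule_format, OF ls(1) ls'(1) ls(2) ls'(2) ls(3) ls'(3)] by blast
      then show "cat ?f ks' \<in> ext U1 (pow \<sigma> (fst c)) (snd c)" unfolding ls'(4) .
    qed
  qed
  with \<gamma> show ?thesis by (intro bexI[of _ "conj (map F hs)"]) auto
qed

end

text \<open>A counterexample to the starred statement of the overview. The tuple \<open>ns\<close>
  avoids both points and so can be compared with every increasing tuple that omits one of them;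
  \<open>\<alpha>\<close> tells \<open>ps\<close> apart from all of these.\<close>

locale broken_sequence = shelah_monster L M M' \<kappa>1 U1 T \<kappa> U
  for L :: "('s, 'f, 'p) lang" and M M' :: "('s, 'f, 'p, 'a) struc"
    and \<kappa>1 :: "'k rel" and U1 :: "('s, unit, 's list \<times> 'a list set, 'v) struc"
    and T :: "('s, 'f, 'p) fm set" and \<kappa> :: "'l rel" and U :: "('s, 'f, 'p, 'u) struc" +
  fixes g :: "rat \<Rightarrow> 'u list" and \<sigma> :: "'s list" and A :: "rat set" and p q :: rat
    and \<alpha> :: "('s, 'f, 'p) fm" and ps ns :: "rat list"
  assumes g: "g x \<in> tuples U \<sigma>"
    and cofinite_A: "finite (- A)" and pA: "p \<in> A" and qA: "q \<in> A" and pq: "p < q"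
    and ind_p: "rind L U \<sigma> (A - {p}) g" and ind_q: "rind L U \<sigma> (A - {q}) g"
    and \<alpha>: "\<alpha> \<in> fms L (pow \<sigma> (length ps))"
    and ps: "set ps \<subseteq> A" "inc ps" "cat g ps \<in> ext U (pow \<sigma> (length ps)) \<alpha>"
    and ns: "set ns \<subseteq> A - {p, q}" "inc ns" "length ns = length ps" "cat g ns \<notin> ext U (pow \<sigma> (length ps)) \<alpha>"
begin

definition okl :: "rat list \<Rightarrow> bool" where
  "okl as \<longleftrightarrow> inc as \<and> set as \<subseteq> A \<and> (p \<notin> set as \<or> q \<notin> set as)"

lemma infinite_Apq: "infinite (A - {p, q})"
proof
  assume "finite (A - {p, q})"
  then have "finite ((A - {p, q}) \<union> {p, q} \<union> - A)" using cofinite_A by blast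
  moreover have "(A - {p, q}) \<union> {p, q} \<union> - A = UNIV" by blast
  ultimately have "finite (UNIV :: rat set)" by (simp only:)
  then show False using infinite_UNIV_char_0 by blast
qed

lemma okl_step:
  assumes "inc as" "inc bs" "length as = length bs" "\<beta> \<in> fms L (pow \<sigma> (length as))"
    "set as \<subseteq> A - {r}" "set bs \<subseteq> A - {r}" "r = p \<or> r = q" "cat g as \<in> ext U (pow \<sigma> (length as)) \<beta>"
  shows "cat g bs \<in> ext U (pow \<sigma> (length as)) \<beta>"
  using assms ind_p ind_q unfolding rind_def by blast

text \<open>Both tuples are compared with a third one that avoids \<open>p\<close> and
  \<open>q\<close> and therefore lies in both indiscernible parts. They need not omit the same
  point.\<close>

lemma okl_eq:
  assumes as: "okl as" and bs: "okl bs" and l: "length as = length bs" and \<beta>: "\<beta> \<in> fms L (pow \<sigma> (length as))"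
    and t: "cat g as \<in> ext U (pow \<sigma> (length as)) \<beta>"
  shows "cat g bs \<in> ext U (pow \<sigma> (length as)) \<beta>"
proof -
  from ex_inc_list[OF infinite_Apq] obtain cs where cs: "inc cs" "set cs \<subseteq> A - {p, q}" "length cs = length as" by blast
  from as obtain r where r: "r = p \<or> r = q" "set as \<subseteq> A - {r}" by (auto simp: okl_def)
  have 1: "cat g cs \<in> ext U (pow \<sigma> (length as)) \<beta>"
    by (rule okl_step[of as cs \<beta> r]) (use as cs r \<beta> t in \<open>auto simp: okl_def\<close>)
  from bs obtain r' where r': "r' = p \<or> r' = q" "set bs \<subseteq> A - {r'}" by (auto simp: okl_def)
  have "cat g bs \<in> ext U (pow \<sigma> (length cs)) \<beta>"
    by (rule okl_step[of cs bs \<beta> r']) (use bs cs r' \<beta> 1 l in \<open>auto simp: okl_def\<close>)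
  then show ?thesis using cs(3) by simp
qed

text \<open>\<open>f\<close> is a copy in \<open>U1\<close>, indexed by \<open>B\<close>, of the sequence \<open>g\<close> with \<open>p\<close> or \<open>q\<close> omitted.\<close>

definition LI :: "rat set \<Rightarrow> (rat \<Rightarrow> 'v list) \<Rightarrow> bool" where
  "LI B f \<longleftrightarrow> (\<forall>\<eta>. strict_mono_on B \<eta> \<longrightarrow> \<eta> ` B \<subseteq> A \<longrightarrow> p \<notin> \<eta> ` B \<or> q \<notin> \<eta> ` B \<longrightarrow>
     (\<forall>ks. set ks \<subseteq> B \<longrightarrow> sim (pow \<sigma> (length ks)) (cat (\<lambda>x. g (\<eta> x)) ks) (cat f ks)))"

text \<open>By \<open>okl_eq\<close> all order embeddings that omit one of the points give tuples of
  the same \<open>L\<close>-type, so it is enough to check one embedding on one listing of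
  \<open>B\<close>.\<close>

lemma LI_I:
  assumes B: "finite B" and f: "\<And>x. f x \<in> tuples U1 \<sigma>" and \<eta>: "strict_mono_on B \<eta>" "\<eta> ` B \<subseteq> A" "p \<notin> \<eta> ` B \<or> q \<notin> \<eta> ` B"
    and s: "sim (pow \<sigma> (length (sorted_list_of_set B))) (cat (\<lambda>x. g (\<eta> x)) (sorted_list_of_set B)) (cat f (sorted_list_of_set B))"
  shows "LI B f"
  unfolding LI_def
proof (intro allI impI)
  fix \<eta>' ks assume \<eta>': "strict_mono_on B \<eta>'" "\<eta>' ` B \<subseteq> A" "p \<notin> \<eta>' ` B \<or> q \<notin> \<eta>' ` B" and ks: "set ks \<subseteq> B"
  let ?bl = "sorted_list_of_set B"
  have bl: "inc ?bl" "set ?bl = B" using B by auto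
  have ok: "okl (map \<eta>'' ?bl)" if "strict_mono_on B \<eta>''" "\<eta>'' ` B \<subseteq> A" "p \<notin> \<eta>'' ` B \<or> q \<notin> \<eta>'' ` B" for \<eta>''
    using that inc_map[of B \<eta>'' ?bl] bl by (auto simp: okl_def)
  have e: "cat (\<lambda>x. g (\<eta>'' x)) ?bl = cat g (map \<eta>'' ?bl)" for \<eta>'' by (simp add: comp_def)
  have "sim (pow \<sigma> (length ?bl)) (cat (\<lambda>x. g (\<eta>' x)) ?bl) (cat f ?bl)"
    unfolding sim_def
  proof (intro conjI ballI impI)
    show "cat (\<lambda>x. g (\<eta>' x)) ?bl \<in> tuples U (pow \<sigma> (length ?bl))" "cat f ?bl \<in> tuples U1 (pow \<sigma> (length ?bl))"
      by (intro cat_tuples g f)+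
    fix \<beta> assume \<beta>: "\<beta> \<in> fms L (pow \<sigma> (length ?bl))" and "cat (\<lambda>x. g (\<eta>' x)) ?bl \<in> ext U (pow \<sigma> (length ?bl)) \<beta>"
    then have "cat (\<lambda>x. g (\<eta> x)) ?bl \<in> ext U (pow \<sigma> (length ?bl)) \<beta>"
      using okl_eq[OF ok[OF \<eta>'] ok[OF \<eta>], of \<beta>] unfolding e by simp
    then show "cat f ?bl \<in> star (pow \<sigma> (length ?bl)) (ext M (pow \<sigma> (length ?bl)) \<beta>)" using s \<beta> by (auto simp: sim_def)
  qed
  then show "sim (pow \<sigma> (length ks)) (cat (\<lambda>x. g (\<eta>' x)) ks) (cat f ks)"
    by (rule sim_family) (use ks bl g f in auto)
qed

end

text \<open>For positive \<open>\<delta>\<close>, an increasing sequence of rationals between 0 and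
  \<open>\<delta>\<close>. Added to \<open>p\<close> or \<open>q\<close> it yields arbitrarily many
  indices immediately to the right.\<close>

definition off :: "rat \<Rightarrow> nat \<Rightarrow> rat" where
  "off \<delta> i = \<delta> * ((of_nat i + 1) / (of_nat i + 2))"

lemma off_bounds: "0 < \<delta> \<Longrightarrow> 0 < off \<delta> i \<and> off \<delta> i < \<delta>"
proof -
  assume "0 < \<delta>"
  moreover have "0 < (of_nat i + 1) / (of_nat i + 2 :: rat)" "(of_nat i + 1) / (of_nat i + 2 :: rat) < 1"
    by (simp_all add: add_pos_nonneg divide_simps)
  ultimately show ?thesis unfolding off_def using mult_strict_left_mono[of "(of_nat i + 1) / (of_nat i + 2)" 1 \<delta>] by simp
qed

lemma off_mono: "0 < \<delta> \<Longrightarrow> i < j \<Longrightarrow> off \<delta> i < off \<delta> j"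
proof -
  assume "0 < \<delta>" "i < j"
  then have "(of_nat i + 1) / (of_nat i + 2) < (of_nat j + 1) / (of_nat j + 2 :: rat)"
    by (simp add: divide_simps) (simp add: algebra_simps)
  then show ?thesis using \<open>0 < \<delta>\<close> unfolding off_def by (rule mult_strict_left_mono)
qed

lemma off_eq: "0 < \<delta> \<Longrightarrow> off \<delta> i = off \<delta> j \<longleftrightarrow> i = j"
  using off_mono[of \<delta> i j] off_mono[of \<delta> j i] by (metis linorder_neqE_nat less_irrefl)

section \<open>Shifting indices near \<open>p\<close> and \<open>q\<close>\<close>

context broken_sequence
begin

text \<open>Within this distance of \<open>p\<close> and \<open>q\<close>, points can be inserted
  and shifted without leaving \<open>A\<close> and without changing their order relative to
  \<open>F0\<close>.\<close>

definition sep :: "rat set \<Rightarrow> rat \<Rightarrow> bool" where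
  "sep F0 \<delta> \<longleftrightarrow> 0 < \<delta> \<and> p + \<delta> \<le> q - \<delta> \<and> (\<forall>z\<in>F0. \<delta> \<le> \<bar>z - p\<bar> \<and> \<delta> \<le> \<bar>z - q\<bar>) \<and>
     {p - \<delta> <..< p + \<delta>} \<subseteq> A \<and> {q - \<delta> <..< q + \<delta>} \<subseteq> A \<and> F0 \<subseteq> A - {p, q}"

lemma ex_sep:
  assumes "finite F0" "F0 \<subseteq> A - {p, q}"
  shows "\<exists>\<delta>. sep F0 \<delta>"
proof -
  define Z where "Z = F0 \<union> - A"
  have Z: "finite Z" "p \<notin> Z" "q \<notin> Z" using assms cofinite_A pA qA by (auto simp: Z_def)
  \<comment> \<open>Half the distance between \<open>p\<close> and \<open>q\<close> keeps the two
    intervals apart; the other entries keep them away from \<open>F0\<close> and from the gaps of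
    \<open>A\<close>.\<close>
  define W where "W = insert ((q - p) / 2) ((\<lambda>z. \<bar>z - p\<bar>) ` Z \<union> (\<lambda>z. \<bar>z - q\<bar>) ` Z)"
  have W: "finite W" "W \<noteq> {}" using Z by (auto simp: W_def)
  have pos: "0 < w" if "w \<in> W" for w using that Z pq by (auto simp: W_def)
  define \<delta> where "\<delta> = Min W"
  have \<delta>: "0 < \<delta>" using W pos by (simp add: \<delta>_def)
  have le: "\<delta> \<le> w" if "w \<in> W" for w using W that by (simp add: \<delta>_def)
  have Zp: "\<delta> \<le> \<bar>z - p\<bar>" "\<delta> \<le> \<bar>z - q\<bar>" if "z \<in> Z" for z using le that by (auto simp: W_def)
  have "\<delta> \<le> (q - p) / 2" by (rule le) (simp add: W_def)
  moreover have "x \<in> A" if "p - \<delta> < x" "x < p + \<delta>" for x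
  proof (rule ccontr)
    assume "x \<notin> A"
    then have "x \<in> Z" by (simp add: Z_def)
    from Zp(1)[OF this] that show False by linarith
  qed
  moreover have "x \<in> A" if "q - \<delta> < x" "x < q + \<delta>" for x
  proof (rule ccontr)
    assume "x \<notin> A"
    then have "x \<in> Z" by (simp add: Z_def)
    from Zp(2)[OF this] that show False by linarith
  qed
  ultimately have "sep F0 \<delta>" using \<delta> Zp assms(2) unfolding sep_def by (auto simp: Z_def field_simps)
  then show ?thesis ..
qed

definition Dm :: "rat set \<Rightarrow> rat \<Rightarrow> rat set" where
  "Dm F0 \<delta> = F0 \<union> {p <..< p + \<delta>} \<union> {q <..< q + \<delta>}"

text \<open>An embedding of \<open>Dm F0 \<delta>\<close> into \<open>A\<close>, for
  \<open>d\<close> between 0 and \<open>\<delta>\<close>: the points \<open>p + d\<close> and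
  \<open>q + d\<close> take the places of \<open>p\<close> and \<open>q\<close>, no other point is
  sent there, and \<open>F0\<close> stays fixed.\<close>

definition sh :: "rat \<Rightarrow> rat \<Rightarrow> rat \<Rightarrow> rat" where
  "sh \<delta> d x = (if p < x \<and> x < p + \<delta> \<or> q < x \<and> x < q + \<delta> then x - d else x)"

text \<open>A shifted point stays within distance \<open>\<delta>\<close> of its centre
  \<open>p\<close> or \<open>q\<close>, so it crosses neither \<open>F0\<close> nor the other
  interval.\<close>

lemma sh_mono:
  assumes s: "sep F0 \<delta>" and d: "0 < d" "d < \<delta>"
  shows "strict_mono_on (Dm F0 \<delta>) (sh \<delta> d)"
  unfolding strict_mono_on_def
proof (intro allI impI, elim conjE)
  fix x y assume x: "x \<in> Dm F0 \<delta>" and y: "y \<in> Dm F0 \<delta>" and xy: "x < y"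
  have sp: "p + \<delta> \<le> q - \<delta>" "0 < \<delta>" using s by (auto simp: sep_def)
  have out: "\<delta> \<le> \<bar>z - p\<bar>" "\<delta> \<le> \<bar>z - q\<bar>" if "z \<in> F0" for z using s that by (auto simp: sep_def)
  consider "x \<in> F0" | "p < x" "x < p + \<delta>" | "q < x" "x < q + \<delta>" using x by (auto simp: Dm_def)
  then show "sh \<delta> d x < sh \<delta> d y"
  proof cases
    case 1
    consider "y \<in> F0" | "p < y" "y < p + \<delta>" | "q < y" "y < q + \<delta>" using y by (auto simp: Dm_def)
    then show ?thesis
    proof cases
      case 1
      then show ?thesis using out[OF \<open>x \<in> F0\<close>] out[OF 1] xy d sp by (auto simp: sh_def)
    next
      case 2
      then show ?thesis using out[OF \<open>x \<in> F0\<close>] xy d sp by (auto simp: sh_def abs_if split: if_splits)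
    next
      case 3
      then show ?thesis using out[OF \<open>x \<in> F0\<close>] xy d sp by (auto simp: sh_def abs_if split: if_splits)
    qed
  next
    case 2
    consider "y \<in> F0" | "p < y" "y < p + \<delta>" | "q < y" "y < q + \<delta>" using y by (auto simp: Dm_def)
    then show ?thesis
    proof cases
      case 1
      then show ?thesis using 2 out[OF 1] xy d sp by (auto simp: sh_def abs_if split: if_splits)
    qed (use 2 xy d sp in \<open>auto simp: sh_def\<close>)
  next
    case 3
    consider "y \<in> F0" | "p < y" "y < p + \<delta>" | "q < y" "y < q + \<delta>" using y by (auto simp: Dm_def)
    then show ?thesis
    proof cases
      case 1
      then show ?thesis using 3 out[OF 1] xy d sp by (auto simp: sh_def abs_if split: if_splits)
    qed (use 3 xy d sp in \<open>auto simp: sh_def\<close>)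
  qed
qed

lemma sh_facts:
  assumes s: "sep F0 \<delta>" and d: "0 < d" "d < \<delta>"
  shows "x \<in> Dm F0 \<delta> \<Longrightarrow> sh \<delta> d x \<in> A" "x \<in> Dm F0 \<delta> \<Longrightarrow> sh \<delta> d x = p \<Longrightarrow> x = p + d"
    "x \<in> Dm F0 \<delta> \<Longrightarrow> sh \<delta> d x = q \<Longrightarrow> x = q + d" "sh \<delta> d (p + d) = p" "sh \<delta> d (q + d) = q" "x \<in> F0 \<Longrightarrow> sh \<delta> d x = x"
    "p + d \<in> Dm F0 \<delta>" "q + d \<in> Dm F0 \<delta>"
proof -
  have sp: "p + \<delta> \<le> q - \<delta>" "0 < \<delta>" and F0: "F0 \<subseteq> A - {p, q}"
    and A: "\<And>x. p - \<delta> < x \<Longrightarrow> x < p + \<delta> \<Longrightarrow> x \<in> A" "\<And>x. q - \<delta> < x \<Longrightarrow> x < q + \<delta> \<Longrightarrow> x \<in> A"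
    using s by (auto simp: sep_def)
  have out: "\<delta> \<le> \<bar>z - p\<bar>" "\<delta> \<le> \<bar>z - q\<bar>" if "z \<in> F0" for z using s that by (auto simp: sep_def)
  show "sh \<delta> d (p + d) = p" "sh \<delta> d (q + d) = q" "p + d \<in> Dm F0 \<delta>" "q + d \<in> Dm F0 \<delta>"
    using d by (auto simp: sh_def Dm_def)
  show f: "sh \<delta> d x = x" if "x \<in> F0" for x using out[OF that] sp by (auto simp: sh_def)
  assume x: "x \<in> Dm F0 \<delta>"
  show "sh \<delta> d x \<in> A"
  proof (cases "x \<in> F0")
    case True
    then show ?thesis using f[OF True] F0 by auto
  next
    case False
    then show ?thesis using x A(1)[of "x - d"] A(2)[of "x - d"] d by (auto simp: sh_def Dm_def)
  qed
  show "x = p + d" if "sh \<delta> d x = p"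
  proof (cases "x \<in> F0")
    case True
    then show ?thesis using f[OF True] F0 that by auto
  next
    case False
    then show ?thesis using x that d sp by (auto simp: sh_def Dm_def split: if_splits)
  qed
  show "x = q + d" if "sh \<delta> d x = q"
  proof (cases "x \<in> F0")
    case True
    then show ?thesis using f[OF True] F0 that by auto
  next
    case False
    then show ?thesis using x that d sp by (auto simp: sh_def Dm_def split: if_splits)
  qed
qed

text \<open>After the shift by \<open>d\<close>, the sequence \<open>f\<close> is a copy of a part
  of \<open>g\<close> that contains neither \<open>p\<close> nor \<open>q\<close>, and
  \<open>sim_extend\<close> adds copies of \<open>g p\<close> and \<open>g q\<close> at once. Their
  joint type preserves the distinction between \<open>ps\<close> and \<open>ns\<close>. Just because
  of this distinction, only the sequences with a single new point can be claimed to satisfy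
  \<open>LI\<close>.\<close>

lemma insert_points:
  assumes s: "sep F0 \<delta>" and d: "0 < d" "d < \<delta>" and B: "finite B" "B \<subseteq> Dm F0 \<delta>" "F0 \<subseteq> B" "p + d \<notin> B" "q + d \<notin> B"
    and f: "\<forall>x. f x \<in> tuples U1 \<sigma>" and LI: "LI B f" and ps_F: "set ps \<subseteq> insert p (insert q F0)" and ns_F: "set ns \<subseteq> F0"
  defines "\<rho> \<equiv> (\<lambda>x. x)(p := p + d, q := q + d)"
  shows "\<exists>f'. (\<forall>x. f' x \<in> tuples U1 \<sigma>) \<and> (\<forall>z\<in>B. f' z = f z) \<and> LI (insert (p + d) B) f' \<and> LI (insert (q + d) B) f' \<and>
    cat (\<lambda>z. f' (\<rho> z)) ps \<in> star (pow \<sigma> (length ps)) (ext M (pow \<sigma> (length ps)) \<alpha>) \<and>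
    cat (\<lambda>z. f' (\<rho> z)) ns \<notin> star (pow \<sigma> (length ps)) (ext M (pow \<sigma> (length ps)) \<alpha>)"
proof -
  note sf = sh_facts[OF s d]
  let ?bl = "sorted_list_of_set B" and ?sh = "sh \<delta> d"
  have bl: "set ?bl = B" using B(1) by simp
  have smB: "strict_mono_on B ?sh" using sh_mono[OF s d] B(2) unfolding strict_mono_on_def by blast
  have "?sh ` B \<subseteq> A" by (intro image_subsetI sf(1) subsetD[OF B(2)])
  moreover have "p \<notin> ?sh ` B"
  proof
    assume "p \<in> ?sh ` B"
    then obtain x where x: "x \<in> B" "?sh x = p" by auto
    with sf(2)[OF subsetD[OF B(2) x(1)] x(2)] B(4) show False by simp
  qed
  ultimately have "sim (pow \<sigma> (length ?bl)) (cat (\<lambda>x. g (?sh x)) ?bl) (cat f ?bl)"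
    using LI[unfolded LI_def, THEN spec[of _ ?sh]] smB equalityD1[OF bl] by blast
  from sim_extend[OF this tuples_appendI[OF g[of p] g[of q]]] obtain l where l: "l \<in> tuples U1 (\<sigma> @ \<sigma>)"
    "sim (pow \<sigma> (length ?bl) @ (\<sigma> @ \<sigma>)) (cat (\<lambda>x. g (?sh x)) ?bl @ (g p @ g q)) (cat f ?bl @ l)" by blast
  from l(1) obtain y z where yz: "l = y @ z" "y \<in> tuples U1 \<sigma>" "z \<in> tuples U1 \<sigma>" by (rule tuples_appendE)
  define f' where "f' = f(p + d := y, q + d := z)"
  have f't: "f' x \<in> tuples U1 \<sigma>" for x using f yz by (simp add: f'_def)
  have f'B: "f' z = f z" if "z \<in> B" for z using that B(4,5) by (auto simp: f'_def)
  let ?bs = "?bl @ [p + d, q + d]"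
  have "map f' ?bl = map f ?bl" using f'B bl by simp
  then have "cat f' ?bl = cat f ?bl" by (simp only:)
  then have "cat f' ?bs = cat f ?bl @ l" using pq by (simp add: yz f'_def)
  moreover have "cat (\<lambda>x. g (?sh x)) ?bs = cat (\<lambda>x. g (?sh x)) ?bl @ (g p @ g q)" using sf(4,5) by simp
  moreover have "pow \<sigma> (length ?bs) = pow \<sigma> (length ?bl) @ (\<sigma> @ \<sigma>)" using pow_add[of "length ?bl" 2 \<sigma>] by (simp add: numeral_2_eq_2)
  ultimately have sbs: "sim (pow \<sigma> (length ?bs)) (cat (\<lambda>x. g (?sh x)) ?bs) (cat f' ?bs)" using l(2) by simp
  have sks: "sim (pow \<sigma> (length ks)) (cat (\<lambda>x. g (?sh x)) ks) (cat f' ks)" if "set ks \<subseteq> insert (p + d) (insert (q + d) B)" for ks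
    by (rule sim_family[OF sbs]) (use that bl g f't in auto)
  have LIr: "LI (insert r B) f'" if r: "r = p + d \<or> r = q + d" for r
  proof (rule LI_I[of _ _ ?sh])
    have sub: "insert r B \<subseteq> Dm F0 \<delta>" using B(2) r sf(7,8) by auto
    show "strict_mono_on (insert r B) ?sh" using sh_mono[OF s d] sub unfolding strict_mono_on_def by blast
    show "?sh ` insert r B \<subseteq> A" using sub sf(1) by blast
    show "p \<notin> ?sh ` insert r B \<or> q \<notin> ?sh ` insert r B"
    proof (rule ccontr)
      assume "\<not> ?thesis"
      then obtain x y where x: "x \<in> insert r B" "?sh x = p" and y: "y \<in> insert r B" "?sh y = q"
        by (metis imageE)
      have "x = p + d" by (rule sf(2)[OF subsetD[OF sub x(1)] x(2)])
      moreover have "y = q + d" by (rule sf(3)[OF subsetD[OF sub y(1)] y(2)])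
      ultimately show False using x(1) y(1) r B(4,5) pq by auto
    qed
    show "sim (pow \<sigma> (length (sorted_list_of_set (insert r B)))) (cat (\<lambda>x. g (?sh x)) (sorted_list_of_set (insert r B)))
        (cat f' (sorted_list_of_set (insert r B)))"
    proof (rule sks)
      have "set (sorted_list_of_set (insert r B)) = insert r B" using B(1) by (intro set_sorted_list_of_set) simp
      then show "set (sorted_list_of_set (insert r B)) \<subseteq> insert (p + d) (insert (q + d) B)" using r by auto
    qed
  qed (use B(1) f't in auto)
  \<comment> \<open>Applying \<open>\<rho>\<close> and then the shift returns every index of
    \<open>ps\<close> and \<open>ns\<close> to itself, so \<open>\<alpha>\<close> is evaluated in
    \<open>U1\<close> at a copy of the original tuple.\<close>
  have sps: "sim (pow \<sigma> (length ks)) (cat g ks) (cat (\<lambda>z. f' (\<rho> z)) ks)" if ks: "set ks \<subseteq> insert p (insert q F0)" for ks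
  proof -
    have "set (map \<rho> ks) \<subseteq> insert (p + d) (insert (q + d) B)" using ks B(3) by (auto simp: \<rho>_def)
    from sks[OF this] have "sim (pow \<sigma> (length ks)) (cat (\<lambda>x. g (?sh (\<rho> x))) ks) (cat (\<lambda>x. f' (\<rho> x)) ks)"
      by (simp add: comp_def)
    moreover have "map (\<lambda>x. g (?sh (\<rho> x))) ks = map g ks" using ks sf(4,5,6) pq by (auto simp: \<rho>_def)
    then have "cat (\<lambda>x. g (?sh (\<rho> x))) ks = cat g ks" by (simp only:)
    ultimately show ?thesis by (simp only:)
  qed
  have "cat (\<lambda>z. f' (\<rho> z)) ps \<in> star (pow \<sigma> (length ps)) (ext M (pow \<sigma> (length ps)) \<alpha>)"
    using sim_iff[OF sps[OF ps_F] \<alpha>] ps(3) by blast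
  moreover have "cat (\<lambda>z. f' (\<rho> z)) ns \<notin> star (pow \<sigma> (length ps)) (ext M (pow \<sigma> (length ps)) \<alpha>)"
    using sim_iff[OF sps[of ns], of \<alpha>] ns_F \<alpha> ns(3,4) by auto
  ultimately show ?thesis using f't f'B LIr by blast
qed

text \<open>Ramsey's theorem is used on a sequence indexed by the natural numbers, so
  \<open>g\<close> is first copied along those naturals that lie in \<open>A\<close> and differ from
  \<open>p\<close> and \<open>q\<close>. A finite piece of the homogeneous subsequence is relabelled
  by \<open>B\<close>; as it contains no term at \<open>p\<close> or \<open>q\<close>, its
  \<open>L\<close>-type is the one that \<open>LI\<close> asks for.\<close>

lemma base_sequence:
  assumes \<Psi>: "finite \<Psi>" and B: "finite B"
  shows "\<exists>f. (\<forall>x. f x \<in> tuples U1 \<sigma>) \<and> psi_ind \<sigma> \<Psi> f B \<and> LI B f"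
proof -
  have "infinite {n :: nat. of_nat n \<in> A - {p, q}}"
  proof
    assume "finite {n :: nat. of_nat n \<in> A - {p, q}}"
    moreover have "finite {n :: nat. (of_nat n :: rat) \<in> - A \<union> {p, q}}"
      using finite_vimageI[of "- A \<union> {p, q}" "of_nat :: nat \<Rightarrow> rat"] cofinite_A by (simp add: vimage_def inj_on_def)
    ultimately have "finite ({n :: nat. of_nat n \<in> A - {p, q}} \<union> {n :: nat. (of_nat n :: rat) \<in> - A \<union> {p, q}})" by blast
    moreover have "{n :: nat. of_nat n \<in> A - {p, q}} \<union> {n :: nat. (of_nat n :: rat) \<in> - A \<union> {p, q}} = UNIV" by blast
    ultimately have "finite (UNIV :: nat set)" by (simp only:)
    then show False by simp
  qed
  note inf = this
  define e where "e = enumerate {n :: nat. of_nat n \<in> A - {p, q}}"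
  have e: "strict_mono e" "\<And>i. (of_nat (e i) :: rat) \<in> A - {p, q}"
    using strict_mono_enumerate[OF inf] enumerate_in_set[OF inf] by (auto simp: e_def)
  obtain h where h: "\<And>i. h i \<in> tuples U1 \<sigma>" "\<And>ks. sim (pow \<sigma> (length ks)) (cat (\<lambda>i. g (of_nat (e i))) ks) (cat h ks)"
    using copy_sequence[of "\<lambda>i. g (of_nat (e i))" \<sigma>] g by blast
  from Ramsey_family[OF \<Psi> infinite_UNIV_nat, where k = fst and P = "\<lambda>c ks. cat h ks \<in> ext U1 (pow \<sigma> (fst c)) (snd c)"]
  obtain Y where Y: "infinite Y" "\<forall>c\<in>\<Psi>. \<forall>is js. inc is \<longrightarrow> inc js \<longrightarrow> set is \<subseteq> Y \<longrightarrow> set js \<subseteq> Y \<longrightarrow>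
    length is = fst c \<longrightarrow> length js = fst c \<longrightarrow> cat h is \<in> ext U1 (pow \<sigma> (fst c)) (snd c) \<longrightarrow> cat h js \<in> ext U1 (pow \<sigma> (fst c)) (snd c)"
    by (elim exE conjE)
  have hY: "psi_ind \<sigma> \<Psi> h Y" unfolding psi_ind_def using Y(2) .
  define y where "y = enumerate Y"
  have y: "strict_mono y" "\<And>i. y i \<in> Y" using strict_mono_enumerate[OF Y(1)] enumerate_in_set[OF Y(1)] by (auto simp: y_def)
  let ?bl = "sorted_list_of_set B"
  have bl: "set ?bl = B" "inc ?bl" using B by auto
  define r where "r z = y (pos ?bl z)" for z
  have r: "strict_mono_on B r" unfolding strict_mono_on_def r_def
    using pos_less[OF bl(2)] bl(1) y(1) by (auto simp: strict_mono_def)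
  define f where "f = (\<lambda>z. h (r z))"
  have f: "f x \<in> tuples U1 \<sigma>" for x by (simp add: f_def h(1))
  have "r ` B \<subseteq> Y" using y(2) by (auto simp: r_def)
  then have "psi_ind \<sigma> \<Psi> f B" using psi_ind_map[OF psi_ind_mono[OF hY] r] by (simp add: f_def)
  moreover have "LI B f"
  proof (rule LI_I[OF B f, of "\<lambda>z. of_nat (e (r z))"])
    show "strict_mono_on B (\<lambda>z. (of_nat (e (r z)) :: rat))"
      using r e(1) by (auto simp: strict_mono_on_def strict_mono_def)
    have "(\<lambda>z. of_nat (e (r z))) ` B \<subseteq> A - {p, q}" by (intro image_subsetI e(2))
    then show "(\<lambda>z. of_nat (e (r z))) ` B \<subseteq> A" "p \<notin> (\<lambda>z. of_nat (e (r z))) ` B \<or> q \<notin> (\<lambda>z. of_nat (e (r z))) ` B"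
      by blast+
    show "sim (pow \<sigma> (length ?bl)) (cat (\<lambda>x. g (of_nat (e (r x)))) ?bl) (cat f ?bl)"
      using h(2)[of "map r ?bl"] unfolding f_def by (simp add: comp_def)
  qed
  ultimately show ?thesis using f by blast
qed

text \<open>If \<open>N\<close> points around \<open>r\<close> fit into \<open>F0\<close> with a \<open>\<Psi>\<close>-indiscernible result and \<open>N\<close> others, interleaved
  with them, do not, then all choices between neighbours have the same \<open>L\<close>-type: too many patterns.\<close>

lemma interleaved_patterns:
  fixes R :: "nat \<Rightarrow> rat" and J :: "nat set" and B :: "rat set"
  assumes F0: "finite F0" and \<Psi>: "finite \<Psi>" "\<forall>c\<in>\<Psi>. snd c \<in> fms L1 (pow \<sigma> (fst c))"
    and X: "X = ext S (pow \<sigma> m) \<gamma>" and \<gamma>: "\<gamma> \<in> fms L1 (pow \<sigma> m)" and m: "m = Suc (card F0)"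
    and \<gamma>_iff: "\<forall>(f :: rat \<Rightarrow> 'v list) zs. (\<forall>x. f x \<in> tuples U1 \<sigma>) \<longrightarrow> inc zs \<longrightarrow> length zs = m \<longrightarrow>
      (cat f zs \<in> ext U1 (pow \<sigma> m) \<gamma> \<longleftrightarrow> psi_ind \<sigma> \<Psi> f (set zs))"
    and N: "\<forall>\<tau> hs b. (\<forall>k<N :: nat. reidx (pow \<sigma> m) \<tau> (hs k)) \<longrightarrow> (\<forall>A. b A \<in> tuples U1 \<tau>) \<longrightarrow>
      (\<forall>A. \<forall>\<alpha> \<in> fms L \<tau>. b A \<in> star \<tau> (ext M \<tau> \<alpha>) \<longrightarrow> b {} \<in> star \<tau> (ext M \<tau> \<alpha>)) \<longrightarrow>
      \<not> (\<forall>A. \<forall>k<N. pick (hs k) (b A) \<in> star (pow \<sigma> m) X \<longleftrightarrow> k \<in> A)"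
    and f: "\<forall>x. f x \<in> tuples U1 \<sigma>" and LI: "LI B f" and B: "B \<subseteq> A - {p, q}" "F0 \<subseteq> B"
    and r: "r \<notin> F0" and R: "\<And>i j. i < j \<Longrightarrow> R i < R j" "\<And>i. r < R i" "\<And>z i. z \<in> F0 \<Longrightarrow> r < z \<Longrightarrow> R i < z"
    and J: "finite J" "card J = N" "\<And>j. j \<in> J \<Longrightarrow> R (2 * j) \<in> B \<and> R (2 * j + 1) \<in> B"
    and good: "\<And>j. j \<in> J \<Longrightarrow> psi_ind \<sigma> \<Psi> f (insert (R (2 * j)) F0)"
    and bad: "\<And>j. j \<in> J \<Longrightarrow> \<not> psi_ind \<sigma> \<Psi> f (insert (R (2 * j + 1)) F0)"
  shows False
proof -
  define jl where "jl = sorted_list_of_set J"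
  have jl: "inc jl" "set jl = J" "length jl = N" using J by (auto simp: jl_def)
  \<comment> \<open>From the \<open>k\<close>-th selected pair of neighbours the even, harmless
    point is taken if \<open>k\<close> is in \<open>A\<close>, and the odd, spoiling point
    otherwise.\<close>
  define x where "x A k = R (2 * (jl ! k) + (if k \<in> A then 0 else 1))" for A k
  have x_less: "x A k < x A k'" if "k < k'" "k' < N" for A k k'
  proof -
    have "jl ! k < jl ! k'" using that jl by (simp add: sorted_wrt_nth_less)
    then show ?thesis unfolding x_def by (intro R(1)) auto
  qed
  have xB: "x A k \<in> B" if "k < N" for A k using J(3)[of "jl ! k"] jl that by (auto simp: x_def)
  define F1 where "F1 = sorted_list_of_set {z \<in> F0. z < r}"
  define F2 where "F2 = sorted_list_of_set {z \<in> F0. r < z}"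
  have F1: "inc F1" "set F1 = {z \<in> F0. z < r}" and F2: "inc F2" "set F2 = {z \<in> F0. r < z}"
    using F0 by (auto simp: F1_def F2_def)
  have "z < r \<or> r < z" if "z \<in> F0" for z using that r linorder_less_linear by blast
  then have F12: "set F1 \<union> set F2 = F0" using F1(2) F2(2) by blast
  have inc1: "inc (F1 @ map (x A) ks @ F2)" if "inc ks" "set ks \<subseteq> {..<N}" for A ks
  proof -
    have "inc (map (x A) ks)" by (rule inc_map[of "{..<N}"]) (use that x_less in \<open>auto simp: strict_mono_on_def\<close>)
    moreover have "u < x A k" if "u \<in> set F1" for u k
      using that F1(2) R(2)[of "2 * (jl ! k) + (if k \<in> A then 0 else 1)"] unfolding x_def by simp
    moreover have "x A k < u" if "u \<in> set F2" for u k
      using that F2(2) R(3)[of u "2 * (jl ! k) + (if k \<in> A then 0 else 1)"] unfolding x_def by simp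
    moreover have "u < v" if "u \<in> set F1" "v \<in> set F2" for u v using that F1(2) F2(2) by auto
    ultimately show ?thesis using F1(1) F2(1) by (simp add: sorted_wrt_append ball_Un)
  qed
  define ls where "ls A = F1 @ map (x A) [0..<N] @ F2" for A
  have ls: "inc (ls A)" "set (ls A) \<subseteq> B" for A
    using inc1[of "[0..<N]"] xB F12 B(2) by (auto simp: ls_def atLeast0LessThan)
  define n1 n2 where "n1 = length F1" and "n2 = length F2"
  have n: "n1 + n2 = card F0"
  proof -
    have "card F0 = card (set F1) + card (set F2)" unfolding F12[symmetric]
      by (rule card_Un_disjoint) (auto simp: F1(2) F2(2) F0)
    then show ?thesis using F1(1) F2(1) by (simp add: n1_def n2_def distinct_card inc_distinct)
  qed
  define len where "len = n1 + N + n2"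
  have len: "length (ls A) = len" for A by (simp add: ls_def len_def n1_def n2_def)
  \<comment> \<open>The positions in \<open>ls A\<close> of the points of \<open>F0\<close> and of
    the \<open>k\<close>-th chosen point. The picked tuples share the entries from
    \<open>F0\<close>.\<close>
  define pp where "pp k = [0..<n1] @ [n1 + k] @ [n1 + N..<n1 + N + n2]" for k
  have pp: "set (pp k) \<subseteq> set [0..<len]" "length (pp k) = m" if "k < N" for k
    using that n by (auto simp: pp_def len_def m)
  have ppl: "map (nth (ls A)) (pp k) = F1 @ [x A k] @ F2" if "k < N" for A k
  proof -
    have 1: "map (nth (ls A)) [0..<n1] = F1"
      by (rule nth_equalityI) (auto simp: ls_def n1_def nth_append)
    have 2: "ls A ! (n1 + k) = x A k" using that by (simp add: ls_def n1_def nth_append)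
    have 3: "map (nth (ls A)) [n1 + N..<n1 + N + n2] = F2"
      by (rule nth_equalityI) (auto simp: ls_def n1_def n2_def nth_append)
    show ?thesis by (simp only: pp_def map_append 1 2 3 list.map)
  qed
  let ?\<tau> = "pow \<sigma> len"
  define b where "b A = cat f (ls A)" for A
  have bt: "b A \<in> tuples U1 ?\<tau>" for A using cat_tuples[of "ls A" f U1 \<sigma>] f by (simp add: b_def len)
  have "\<forall>k<N. reidx (pow \<sigma> m) ?\<tau> (cpick (length \<sigma>) [0..<len] (pp k))"
  proof (intro allI impI)
    fix k assume "k < N"
    from reidx_cpick[OF pp(1)[OF this], of \<sigma>] pp(2)[OF this]
    show "reidx (pow \<sigma> m) ?\<tau> (cpick (length \<sigma>) [0..<len] (pp k))" by simp
  qed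
  moreover have "\<forall>A. b A \<in> tuples U1 ?\<tau>" using bt by blast
  moreover have "\<forall>A. \<forall>\<beta> \<in> fms L ?\<tau>. b A \<in> star ?\<tau> (ext M ?\<tau> \<beta>) \<longrightarrow> b {} \<in> star ?\<tau> (ext M ?\<tau> \<beta>)"
  proof (intro allI ballI impI)
    fix A' \<beta> assume \<beta>: "\<beta> \<in> fms L ?\<tau>" and t: "b A' \<in> star ?\<tau> (ext M ?\<tau> \<beta>)"
    have "strict_mono_on B (\<lambda>x. x)" by (simp add: strict_mono_on_def)
    moreover have "(\<lambda>x. x) ` B \<subseteq> A" "p \<notin> (\<lambda>x. x) ` B \<or> q \<notin> (\<lambda>x. x) ` B" using B(1) by auto
    ultimately have "sim (pow \<sigma> (length ks)) (cat g ks) (cat f ks)" if "set ks \<subseteq> B" for ks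
      using LI[unfolded LI_def, THEN spec[of _ "\<lambda>x. x"]] that by simp
    then have s: "sim ?\<tau> (cat g (ls A)) (b A)" for A using ls(2)[of A] len[of A] by (metis b_def)
    \<comment> \<open>None of these lists contains \<open>p\<close> or \<open>q\<close>, whence they
      all have the same \<open>L\<close>-type.\<close>
    have ok: "okl (ls A)" for A using ls[of A] B(1) by (auto simp: okl_def)
    have "cat g (ls A') \<in> ext U ?\<tau> \<beta>" using sim_iff[OF s \<beta>] t by blast
    then have "cat g (ls {}) \<in> ext U ?\<tau> \<beta>" using okl_eq[OF ok[of A'] ok[of "{}"], of \<beta>] len \<beta> by simp
    then show "b {} \<in> star ?\<tau> (ext M ?\<tau> \<beta>)" using sim_iff[OF s \<beta>] by blast
  qed
  moreover have "\<forall>A. \<forall>k<N. pick (cpick (length \<sigma>) [0..<len] (pp k)) (b A) \<in> star (pow \<sigma> m) X \<longleftrightarrow> k \<in> A"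
  proof (intro allI impI)
    fix A k assume k: "k < N"
    let ?f = "\<lambda>i. f (ls A ! i)"
    have "map ?f [0..<len] = map f (map (nth (ls A)) [0..<length (ls A)])" by (simp add: len)
    then have "map ?f [0..<len] = map f (ls A)" unfolding map_nth .
    then have "b A = cat ?f [0..<len]" unfolding b_def by (simp only:)
    moreover have "pick (cpick (length \<sigma>) [0..<len] (pp k)) (cat ?f [0..<len]) = cat ?f (pp k)"
      by (rule pick_cpick[OF _ pp(1)[OF k]]) (use f tuples_length in blast)
    moreover have "map ?f (pp k) = map f (F1 @ [x A k] @ F2)" unfolding ppl[OF k, symmetric] by simp
    then have "cat ?f (pp k) = cat f (F1 @ [x A k] @ F2)" by (simp only:)
    ultimately have eq: "pick (cpick (length \<sigma>) [0..<len] (pp k)) (b A) = cat f (F1 @ [x A k] @ F2)" by simp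
    have i: "inc (F1 @ [x A k] @ F2)" using inc1[of "[k]" A] k by simp
    have l: "length (F1 @ [x A k] @ F2) = m" using n by (simp add: m n1_def n2_def)
    have st: "set (F1 @ [x A k] @ F2) = insert (x A k) F0" using F12 by auto
    have "cat f (F1 @ [x A k] @ F2) \<in> star (pow \<sigma> m) X \<longleftrightarrow> psi_ind \<sigma> \<Psi> f (insert (x A k) F0)"
      using \<gamma>_iff[rule_format, OF f[rule_format] i l] unfolding X st ext_U1_star[OF \<gamma>] .
    also have "\<dots> \<longleftrightarrow> k \<in> A" using good[of "jl ! k"] bad[of "jl ! k"] jl k by (auto simp: x_def)
    finally show "pick (cpick (length \<sigma>) [0..<len] (pp k)) (b A) \<in> star (pow \<sigma> m) X \<longleftrightarrow> k \<in> A" unfolding eq .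
  qed
  ultimately show False
    using N[THEN spec[of _ ?\<tau>], THEN spec[of _ "\<lambda>k. cpick (length \<sigma>) [0..<len] (pp k)"], THEN spec[of _ b]] by blast
qed

text \<open>If this fails, inserting copies of \<open>g p\<close> and \<open>g q\<close> always
  spoils the homogeneity at one of the two places. Repeating the insertion at odd points, between
  even points of the homogeneous sequence, collects arbitrarily many spoiling points near
  \<open>p\<close> or near \<open>q\<close>, and \<open>interleaved_patterns\<close> excludes
  that.\<close>

lemma finite_config:
  assumes F: "finite F" "F \<subseteq> A" "p \<in> F" "q \<in> F" "set ps \<subseteq> F" "set ns \<subseteq> F"
    and \<Psi>: "finite \<Psi>" "\<forall>c\<in>\<Psi>. snd c \<in> fms L1 (pow \<sigma> (fst c))"
  shows "\<exists>f. (\<forall>x. f x \<in> tuples U1 \<sigma>) \<and> psi_ind \<sigma> \<Psi> f (F - {p}) \<and> psi_ind \<sigma> \<Psi> f (F - {q}) \<and>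
    cat f ps \<in> star (pow \<sigma> (length ps)) (ext M (pow \<sigma> (length ps)) \<alpha>) \<and>
    cat f ns \<notin> star (pow \<sigma> (length ps)) (ext M (pow \<sigma> (length ps)) \<alpha>)"
proof (rule ccontr)
  assume no: "\<not> ?thesis"
  define F0 where "F0 = F - {p, q}"
  have F0: "finite F0" "F0 \<subseteq> A - {p, q}" "p \<notin> F0" "q \<notin> F0" using F by (auto simp: F0_def)
  from ex_sep[OF F0(1,2)] obtain \<delta> where s: "sep F0 \<delta>" ..
  have \<delta>: "0 < \<delta>" "p + \<delta> \<le> q - \<delta>" using s by (auto simp: sep_def)
  have out: "\<delta> \<le> \<bar>z - p\<bar>" "\<delta> \<le> \<bar>z - q\<bar>" if "z \<in> F0" for z using s that by (auto simp: sep_def)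
  have DmA: "Dm F0 \<delta> \<subseteq> A - {p, q}"
  proof -
    have "{p<..<p + \<delta>} \<subseteq> A" "{q<..<q + \<delta>} \<subseteq> A" using s \<delta>(1) by (force simp: sep_def)+
    then show ?thesis using F0(2) \<delta> by (auto simp: Dm_def)
  qed
  define R where "R r i = r + off \<delta> i" for r i
  have Rb: "r < R r i" "R r i < r + \<delta>" for r i using off_bounds[OF \<delta>(1)] by (auto simp: R_def)
  have Req: "R r i = R r' j \<longleftrightarrow> r = r' \<and> i = j" if "r \<in> {p, q}" "r' \<in> {p, q}" for r r' i j
    using that off_eq[OF \<delta>(1)] off_bounds[OF \<delta>(1), of i] off_bounds[OF \<delta>(1), of j] \<delta> by (auto simp: R_def)
  have RF0: "R r i \<notin> F0" if "r \<in> {p, q}" for r i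
    using that out[of "R r i"] Rb[of r i] by auto
  have RDm: "R r i \<in> Dm F0 \<delta>" if "r \<in> {p, q}" for r i using that Rb[of r i] by (auto simp: Dm_def)
  define m where "m = Suc (card F0)"
  from psi_ind_formula[OF \<Psi>, of m, where 'i = rat] obtain \<gamma> where \<gamma>: "\<gamma> \<in> fms L1 (pow \<sigma> m)"
    and \<gamma>_iff: "\<forall>(f :: rat \<Rightarrow> 'v list) zs. (\<forall>x. f x \<in> tuples U1 \<sigma>) \<longrightarrow> inc zs \<longrightarrow> length zs = m \<longrightarrow>
      (cat f zs \<in> ext U1 (pow \<sigma> m) \<gamma> \<longleftrightarrow> psi_ind \<sigma> \<Psi> f (set zs))" by (elim bexE)
  define X where "X = ext S (pow \<sigma> m) \<gamma>"
  have "ED (pow \<sigma> m) X" unfolding X_def by (rule ED_S[OF \<gamma>])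
  from no_patterns[OF this] obtain N :: nat where N: "\<forall>\<tau> hs b. (\<forall>k<N. reidx (pow \<sigma> m) \<tau> (hs k)) \<longrightarrow> (\<forall>A. b A \<in> tuples U1 \<tau>) \<longrightarrow>
      (\<forall>A. \<forall>\<alpha> \<in> fms L \<tau>. b A \<in> star \<tau> (ext M \<tau> \<alpha>) \<longrightarrow> b {} \<in> star \<tau> (ext M \<tau> \<alpha>)) \<longrightarrow>
      \<not> (\<forall>A. \<forall>k<N. pick (hs k) (b A) \<in> star (pow \<sigma> m) X \<longleftrightarrow> k \<in> A)" by (elim exE)
  \<comment> \<open>Even points are provided at both places, because it is not known in advance
    which of them will collect enough spoiling points. Of \<open>2 * N\<close> rounds at least
    \<open>N\<close> concern the same place.\<close>
  define B0 where "B0 = F0 \<union> (\<lambda>j. R p (2 * j)) ` {..<2 * N} \<union> (\<lambda>j. R q (2 * j)) ` {..<2 * N}"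
  have "F0 \<subseteq> Dm F0 \<delta>" by (auto simp: Dm_def)
  then have B0: "finite B0" "B0 \<subseteq> Dm F0 \<delta>" using F0(1) RDm[of p] RDm[of q] by (auto simp: B0_def)
  from base_sequence[OF \<Psi>(1) B0(1)] obtain k0 where k0: "\<forall>x. k0 x \<in> tuples U1 \<sigma>" "psi_ind \<sigma> \<Psi> k0 B0" "LI B0 k0" by blast
  \<comment> \<open>One spoiling point is kept from each round and the other inserted point is
    dropped: \<open>LI\<close> is guaranteed with either of them but not with both.\<close>
  define inv where "inv t f B \<longleftrightarrow> finite B \<and> B0 \<subseteq> B \<and>
    B \<subseteq> B0 \<union> (\<lambda>j. R p (2 * j + 1)) ` {..<t} \<union> (\<lambda>j. R q (2 * j + 1)) ` {..<t} \<and> (\<forall>x. f x \<in> tuples U1 \<sigma>) \<and>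
    (\<forall>z\<in>B0. f z = k0 z) \<and> LI B f \<and>
    (\<forall>j<t. \<exists>r\<in>{p, q}. R r (2 * j + 1) \<in> B \<and> \<not> psi_ind \<sigma> \<Psi> f (insert (R r (2 * j + 1)) F0))" for t f B
  have BDm: "B \<subseteq> Dm F0 \<delta>" if "inv t f B" for t f B
    using that B0(2) RDm unfolding inv_def by blast
  have "\<exists>f B. inv t f B" for t
  proof (induction t)
    case 0
    show ?case using B0(1) k0 by (intro exI[of _ k0] exI[of _ B0]) (simp add: inv_def)
  next
    case (Suc t)
    then obtain f B where fB: "inv t f B" by blast
    then have iv: "finite B" "B0 \<subseteq> B" "B \<subseteq> B0 \<union> (\<lambda>j. R p (2 * j + 1)) ` {..<t} \<union> (\<lambda>j. R q (2 * j + 1)) ` {..<t}"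
      "\<forall>x. f x \<in> tuples U1 \<sigma>" "\<forall>z\<in>B0. f z = k0 z" "LI B f"
      "\<And>j. j < t \<Longrightarrow> \<exists>r\<in>{p, q}. R r (2 * j + 1) \<in> B \<and> \<not> psi_ind \<sigma> \<Psi> f (insert (R r (2 * j + 1)) F0)"
      by (simp_all add: inv_def)
    define d where "d = off \<delta> (2 * t + 1)"
    have d: "0 < d" "d < \<delta>" using off_bounds[OF \<delta>(1)] by (auto simp: d_def)
    have Rd: "r + d = R r (2 * t + 1)" for r by (simp add: R_def d_def)
    have ev: "2 * t + 1 \<noteq> 2 * j" for j by presburger
    have new: "R r (2 * t + 1) \<notin> B" if r: "r \<in> {p, q}" for r
    proof
      assume "R r (2 * t + 1) \<in> B"
      with iv(3) have "R r (2 * t + 1) \<in> F0 \<or> (\<exists>j. R r (2 * t + 1) = R p (2 * j)) \<or> (\<exists>j. R r (2 * t + 1) = R q (2 * j)) \<or>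
        (\<exists>j<t. R r (2 * t + 1) = R p (2 * j + 1)) \<or> (\<exists>j<t. R r (2 * t + 1) = R q (2 * j + 1))"
        unfolding B0_def by blast
      then show False using RF0[OF r] Req[OF r] ev by auto
    qed
    have F0B: "F0 \<subseteq> B" using iv(2) by (auto simp: B0_def)
    define \<rho> where "\<rho> = (\<lambda>x. x)(p := p + d, q := q + d)"
    from insert_points[OF s d iv(1) BDm[OF fB] F0B new[of p, folded Rd] new[of q, folded Rd] iv(4,6)] F(5,6) ns(1)
    obtain f' where f': "\<forall>x. f' x \<in> tuples U1 \<sigma>" "\<forall>z\<in>B. f' z = f z" "LI (insert (p + d) B) f'" "LI (insert (q + d) B) f'"
      "cat (\<lambda>z. f' (\<rho> z)) ps \<in> star (pow \<sigma> (length ps)) (ext M (pow \<sigma> (length ps)) \<alpha>)"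
      "cat (\<lambda>z. f' (\<rho> z)) ns \<notin> star (pow \<sigma> (length ps)) (ext M (pow \<sigma> (length ps)) \<alpha>)"
      unfolding \<rho>_def by (force simp: F0_def)
    \<comment> \<open>If neither insertion spoiled the indiscernibility, \<open>f'\<close> read
      along \<open>\<rho>\<close> would be a configuration of the kind that \<open>no\<close>
      denies.\<close>
    have "\<exists>r\<in>{p, q}. \<not> psi_ind \<sigma> \<Psi> f' (insert (r + d) F0)"
    proof (rule ccontr)
      assume "\<not> ?thesis"
      then have g1: "psi_ind \<sigma> \<Psi> f' (insert (r + d) F0)" if "r \<in> {p, q}" for r using that by blast
      have g2: "psi_ind \<sigma> \<Psi> (\<lambda>z. f' (\<rho> z)) (insert r F0)" if r: "r \<in> {p, q}" for r
      proof (rule psi_ind_map[of _ _ f' \<rho>])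
        have "\<rho> ` insert r F0 = insert (r + d) F0" using r F0(3,4) by (auto simp: \<rho>_def)
        then show "psi_ind \<sigma> \<Psi> f' (\<rho> ` insert r F0)" using g1[OF r] by simp
        show "strict_mono_on (insert r F0) \<rho>"
          unfolding strict_mono_on_def
        proof (intro allI impI, elim conjE)
          fix x y assume xy: "x \<in> insert r F0" "y \<in> insert r F0" "x < y"
          have \<rho>F: "\<rho> z = z" if "z \<in> F0" for z using that F0(3,4) by (auto simp: \<rho>_def)
          have \<rho>r: "\<rho> r = r + d" using r by (auto simp: \<rho>_def)
          have far: "\<delta> \<le> \<bar>z - r\<bar>" if "z \<in> F0" for z using out[OF that] r by auto
          show "\<rho> x < \<rho> y"
          proof (cases "x = r")
            case True
            then have "y \<in> F0" using xy by auto
            then show ?thesis using True \<rho>r \<rho>F far[of y] xy(3) d by auto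
          next
            case False
            then have x: "x \<in> F0" using xy by auto
            show ?thesis
            proof (cases "y = r")
              case True
              then show ?thesis using x \<rho>F \<rho>r xy(3) d by auto
            next
              case False
              then show ?thesis using xy x \<rho>F by auto
            qed
          qed
        qed
      qed simp
      have "F - {p} = insert q F0" "F - {q} = insert p F0" using F pq by (auto simp: F0_def)
      then show False using no f'(1,5,6) g2[of p] g2[of q] by (auto intro!: exI[of _ "\<lambda>z. f' (\<rho> z)"])
    qed
    then obtain r where r: "r \<in> {p, q}" "\<not> psi_ind \<sigma> \<Psi> f' (insert (R r (2 * t + 1)) F0)" unfolding Rd by blast
    have "inv (Suc t) f' (insert (R r (2 * t + 1)) B)"
      unfolding inv_def
    proof (intro conjI allI impI)
      show "insert (R r (2 * t + 1)) B \<subseteq> B0 \<union> (\<lambda>j. R p (2 * j + 1)) ` {..<Suc t} \<union> (\<lambda>j. R q (2 * j + 1)) ` {..<Suc t}"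
        using iv(3) r(1) by (auto simp: lessThan_Suc)
      show "\<forall>z\<in>B0. f' z = k0 z" using f'(2) iv(2,5) by auto
      show "LI (insert (R r (2 * t + 1)) B) f'" using f'(3,4) r(1) unfolding Rd by auto
      fix j assume j: "j < Suc t"
      show "\<exists>r'\<in>{p, q}. R r' (2 * j + 1) \<in> insert (R r (2 * t + 1)) B \<and> \<not> psi_ind \<sigma> \<Psi> f' (insert (R r' (2 * j + 1)) F0)"
      proof (cases "j = t")
        case True
        then show ?thesis using r by (intro bexI[of _ r]) auto
      next
        case False
        then have "j < t" using j by simp
        from iv(7)[OF this] obtain r' where r': "r' \<in> {p, q}" "R r' (2 * j + 1) \<in> B"
          "\<not> psi_ind \<sigma> \<Psi> f (insert (R r' (2 * j + 1)) F0)" by blast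
        have "psi_ind \<sigma> \<Psi> f' (insert (R r' (2 * j + 1)) F0) \<longleftrightarrow> psi_ind \<sigma> \<Psi> f (insert (R r' (2 * j + 1)) F0)"
          by (rule psi_ind_cong) (use f'(2) r'(2) F0B in auto)
        with r' show ?thesis by (intro bexI[of _ r']) auto
      qed
    qed (use iv f'(1) in auto)
    then show ?case by blast
  qed
  then obtain f B where fB: "inv (2 * N) f B" by blast
  then have iv: "B0 \<subseteq> B" "\<forall>x. f x \<in> tuples U1 \<sigma>" "\<forall>z\<in>B0. f z = k0 z" "LI B f"
    "\<And>j. j < 2 * N \<Longrightarrow> \<exists>r\<in>{p, q}. R r (2 * j + 1) \<in> B \<and> \<not> psi_ind \<sigma> \<Psi> f (insert (R r (2 * j + 1)) F0)"
    by (simp_all add: inv_def)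
  define J where "J r = {j \<in> {..<2 * N}. R r (2 * j + 1) \<in> B \<and> \<not> psi_ind \<sigma> \<Psi> f (insert (R r (2 * j + 1)) F0)}" for r
  have "{..<2 * N} = J p \<union> J q" using iv(5) by (auto simp: J_def)
  then have "2 * N \<le> card (J p) + card (J q)" by (metis card_Un_le card_lessThan)
  then have "N \<le> card (J p) \<or> N \<le> card (J q)" by linarith
  then obtain r where r: "r \<in> {p, q}" "N \<le> card (J r)" by auto
  obtain J' where J': "J' \<subseteq> J r" "card J' = N" "finite J'" using obtain_subset_with_card_n[OF r(2)] by metis
  have F0B: "F0 \<subseteq> B" using iv(1) by (auto simp: B0_def)
  have ev: "R r (2 * j) \<in> B0" if "j \<in> J r" for j using that r(1) by (auto simp: B0_def J_def)
  show False
  proof (rule interleaved_patterns[OF F0(1) \<Psi> X_def \<gamma> m_def \<gamma>_iff N iv(2,4) _ F0B, of r "R r" J'])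
    show "B \<subseteq> A - {p, q}" using BDm[OF fB] DmA by blast
    show "r \<notin> F0" using r(1) F0 by auto
    show "R r i < R r j" if "i < j" for i j using off_mono[OF \<delta>(1) that] by (simp add: R_def)
    show "r < R r i" for i by (rule Rb)
    show "R r i < z" if "z \<in> F0" "r < z" for z i using out[OF that(1)] that(2) r(1) Rb(2)[of r i] by auto
    show "finite J'" "card J' = N" using J' by auto
    show "R r (2 * j) \<in> B \<and> R r (2 * j + 1) \<in> B" if "j \<in> J'" for j
      using ev[of j] that J'(1) iv(1) by (auto simp: J_def)
    show "psi_ind \<sigma> \<Psi> f (insert (R r (2 * j)) F0)" if "j \<in> J'" for j
    proof -
      \<comment> \<open>\<open>F0\<close> and the even points still carry the values of the
        homogeneous sequence \<open>k0\<close>.\<close>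
      have sub: "insert (R r (2 * j)) F0 \<subseteq> B0" using ev that J'(1) by (auto simp: B0_def)
      then have "psi_ind \<sigma> \<Psi> k0 (insert (R r (2 * j)) F0)" using psi_ind_mono[OF k0(2)] by blast
      moreover have "psi_ind \<sigma> \<Psi> f (insert (R r (2 * j)) F0) \<longleftrightarrow> psi_ind \<sigma> \<Psi> k0 (insert (R r (2 * j)) F0)"
        by (rule psi_ind_cong) (use sub iv(3) in auto)
      ultimately show ?thesis by blast
    qed
    show "\<not> psi_ind \<sigma> \<Psi> f (insert (R r (2 * j + 1)) F0)" if "j \<in> J'" for j using that J'(1) by (auto simp: J_def)
  qed
qed

end

subsection \<open>Indiscernible sequences indexed by rationals\<close>

text \<open>The transfer of \<open>\<phi>\<close> from \<open>is\<close> to \<open>js\<close> as one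
  condition for \<open>famsat\<close>. In this form indiscernibility can be part of the type handled
  by \<open>realize_family\<close>.\<close>

definition impc :: "'s list \<Rightarrow> 's list \<Rightarrow> ('s, 'f, 'p) fm \<Rightarrow> 'i list \<Rightarrow> 'i list \<Rightarrow> 'i list \<times> ('s, 'f, 'p) fm" where
  "impc \<sigma> \<epsilon> \<phi> is js = (is @ js, Neg (And (refam \<sigma> \<epsilon> (is @ js) is \<phi>) (Neg (refam \<sigma> \<epsilon> (is @ js) js \<phi>))))"

lemma
  assumes \<phi>: "\<phi> \<in> fms L (pow \<sigma> (length is) @ \<epsilon>)" and l: "length is = length js"
  shows fms_impc: "impc \<sigma> \<epsilon> \<phi> is js = (bs, \<psi>) \<Longrightarrow> \<psi> \<in> fms L (pow \<sigma> (length bs) @ \<epsilon>)"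
    and famsat_impc: "is_struc L N \<Longrightarrow> e \<in> tuples N \<epsilon> \<Longrightarrow> (\<And>i. f i \<in> tuples N \<sigma>) \<Longrightarrow> famsat N \<sigma> \<epsilon> e f (impc \<sigma> \<epsilon> \<phi> is js) \<longleftrightarrow>
      (cat f is @ e \<in> ext N (pow \<sigma> (length is) @ \<epsilon>) \<phi> \<longrightarrow> cat f js @ e \<in> ext N (pow \<sigma> (length js) @ \<epsilon>) \<phi>)"
proof -
  have 1: "set is \<subseteq> set (is @ js)" "set js \<subseteq> set (is @ js)" and \<phi>': "\<phi> \<in> fms L (pow \<sigma> (length js) @ \<epsilon>)"
    using \<phi> l by auto
  from fms_refam[OF 1(1) \<phi>] fms_refam[OF 1(2) \<phi>'] show "\<psi> \<in> fms L (pow \<sigma> (length bs) @ \<epsilon>)" if "impc \<sigma> \<epsilon> \<phi> is js = (bs, \<psi>)"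
    using that unfolding impc_def by (auto intro!: fms_Neg fms_And)
  assume N: "is_struc L N" and e: "e \<in> tuples N \<epsilon>" and f: "\<And>i. f i \<in> tuples N \<sigma>"
  have "cat f (is @ js) @ e \<in> tuples N (pow \<sigma> (length (is @ js)) @ \<epsilon>)" by (intro tuples_appendI cat_tuples f e)
  then show "famsat N \<sigma> \<epsilon> e f (impc \<sigma> \<epsilon> \<phi> is js) \<longleftrightarrow>
      (cat f is @ e \<in> ext N (pow \<sigma> (length is) @ \<epsilon>) \<phi> \<longrightarrow> cat f js @ e \<in> ext N (pow \<sigma> (length js) @ \<epsilon>) \<phi>)"
    using ext_refam[OF 1(1) \<phi> N, of f e] ext_refam[OF 1(2) \<phi>' N, of f e] f e
    by (simp only: famsat_def impc_def prod.case ext_Neg ext_And) blast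
qed

abbreviation le_rel :: "('i :: linorder \<times> 'i) set" where
  "le_rel \<equiv> {(x, y). x \<le> y}"

lemma increasing_le: "increasing le_rel = inc"
proof -
  have "(\<lambda>i j :: 'a. (i, j) \<in> le_rel \<and> i \<noteq> j) = (<)" by (auto simp: fun_eq_iff)
  then show ?thesis by (simp add: increasing_def fun_eq_iff)
qed

lemma indiscD:
  assumes "indisc L U D \<sigma> r K a" "\<phi> \<in> fms L (pow \<sigma> (length is) @ \<tau>)" "e \<in> tuples U \<tau>" "set e \<subseteq> D"
    "set is \<subseteq> K" "increasing r is" "set js \<subseteq> K" "increasing r js" "length js = length is"
  shows "cat a is @ e \<in> ext U (pow \<sigma> (length is) @ \<tau>) \<phi> \<longleftrightarrow> cat a js @ e \<in> ext U (pow \<sigma> (length is) @ \<tau>) \<phi>"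
  using assms unfolding indisc_def by blast

lemma indisc_subset:
  assumes i: "indisc L U D \<sigma> r K a" and sub: "K' \<subseteq> K"
  shows "indisc L U D \<sigma> r K' a"
  unfolding indisc_def
proof (intro conjI allI impI ballI, goal_cases)
  case (1 i)
  then show ?case using i sub by (auto simp: indisc_def)
next
  case (2 n \<tau> \<phi> e "is" js)
  then show ?case using indiscD[OF i, of \<phi> "is" \<tau> e js] sub by (elim conjE) (simp add: subset_trans[of _ K' K])
qed

lemma indiscD_left:
  fixes L :: "('s, 'f, 'p) lang" and U :: "('s, 'f, 'p, 'u) struc"
  assumes N: "is_struc L U" and i: "indisc L U D \<sigma> r K a" and \<phi>: "\<phi> \<in> fms L (\<tau> @ pow \<sigma> (length is))"
    and e: "e \<in> tuples U \<tau>" "set e \<subseteq> D"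
    and "is": "set is \<subseteq> K" "increasing r is" and js: "set js \<subseteq> K" "increasing r js" "length js = length is"
  shows "e @ cat a is \<in> ext U (\<tau> @ pow \<sigma> (length is)) \<phi> \<longleftrightarrow> e @ cat a js \<in> ext U (\<tau> @ pow \<sigma> (length is)) \<phi>"
proof -
  have "\<phi> \<in> fms L (\<tau> @ pow \<sigma> (length is) @ [])" using \<phi> by simp
  then obtain \<psi> where \<psi>: "\<psi> \<in> fms L (pow \<sigma> (length is) @ \<tau> @ [])" and
    eq: "\<And>b c d. b \<in> tuples U \<tau> \<Longrightarrow> c \<in> tuples U (pow \<sigma> (length is)) \<Longrightarrow> d \<in> tuples U [] \<Longrightarrow>
      c @ b @ d \<in> ext U (pow \<sigma> (length is) @ \<tau> @ []) \<psi> \<longleftrightarrow> b @ c @ d \<in> ext U (\<tau> @ pow \<sigma> (length is) @ []) \<phi>"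
    using block_swap2[where 'a = 'u] N by metis
  have a: "a i \<in> tuples U \<sigma>" if "i \<in> K" for i using i that by (auto simp: indisc_def)
  have t: "cat a is \<in> tuples U (pow \<sigma> (length is))" "cat a js \<in> tuples U (pow \<sigma> (length is))"
    using cat_tuples[of "is" a U \<sigma>] cat_tuples[of js a U \<sigma>] "is" js a by auto
  show ?thesis
    using indiscD[OF i _ e "is" js, of \<psi>] \<psi> eq[OF e(1) t(1), of "[]"] eq[OF e(1) t(2), of "[]"] by simp
qed

lemma rind_iff:
  assumes "rind L N \<sigma> A g" "inc as" "inc bs" "set as \<subseteq> A" "set bs \<subseteq> A" "length as = length bs"
    "\<alpha> \<in> fms L (pow \<sigma> (length as))"
  shows "cat g as \<in> ext N (pow \<sigma> (length as)) \<alpha> \<longleftrightarrow> cat g bs \<in> ext N (pow \<sigma> (length as)) \<alpha>"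
  using assms unfolding rind_def by (metis)

text \<open>Each entry of \<open>e\<close> is looked up in \<open>as\<close>. The sorts match
  automatically, since an element determines its sort.\<close>

lemma ex_pick:
  assumes "as \<in> tuples N \<tau>'" "e \<in> tuples N \<tau>" "set e \<subseteq> set as"
  shows "\<exists>hs. reidx \<tau> \<tau>' hs \<and> pick hs as = e"
proof (intro exI conjI)
  let ?hs = "map (pos as) e"
  have p: "pos as x < length as \<and> as ! pos as x = x" if "x \<in> set e" for x using pos[of x as] assms(3) that by blast
  show "pick ?hs as = e" by (auto simp: pick_def p intro: map_idI)
  have "\<tau>' ! pos as (e ! j) = \<tau> ! j" if "j < length \<tau>" for j
  proof -
    have j: "j < length e" using that assms(2) by (simp add: tuples_iff)
    have "e ! j \<in> dom_of N (\<tau> ! j)" using that assms(2) by (simp add: tuples_iff)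
    moreover have "pos as (e ! j) < length as" using p[of "e ! j"] j by simp
    then have "as ! pos as (e ! j) \<in> dom_of N (\<tau>' ! pos as (e ! j))" using assms(1) by (simp add: tuples_iff)
    ultimately show ?thesis using p[of "e ! j"] j by (simp add: dom_of_def)
  qed
  then show "reidx \<tau> \<tau>' ?hs" using p assms(1,2)
    by (auto simp: reidx_def pick_def tuples_iff intro!: nth_equalityI)
qed

text \<open>Parameters taken from earlier terms are coordinates of an increasing tuple that can be
  prepended to both lists. A formula with such parameters thus becomes one without.\<close>

lemma indisc_over_initial:
  fixes L :: "('s, 'f, 'p) lang" and U :: "('s, 'f, 'p, 'u) struc" and h :: "'i :: linorder \<Rightarrow> 'u list"
  assumes N: "is_struc L U" and h: "\<forall>x. h x \<in> tuples U \<sigma>" and r: "rind L U \<sigma> A h"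
    and K: "K \<subseteq> A" "Z \<subseteq> A" "\<forall>z\<in>Z. \<forall>x\<in>K. z < x"
  shows "indisc L U (\<Union>z\<in>Z. set (h z)) \<sigma> le_rel K h"
proof -
  have "cat h is @ e \<in> ext U (pow \<sigma> (length is) @ \<tau>) \<phi> \<longleftrightarrow> cat h js @ e \<in> ext U (pow \<sigma> (length is) @ \<tau>) \<phi>"
    if \<phi>: "\<phi> \<in> fms L (pow \<sigma> (length is) @ \<tau>)" and e: "e \<in> tuples U \<tau>" "set e \<subseteq> (\<Union>z\<in>Z. set (h z))"
      and i: "set is \<subseteq> K" "inc is" and j: "set js \<subseteq> K" "inc js" "length js = length is" for \<phi> \<tau> e "is" js
  proof -
    obtain Y where Y: "Y \<subseteq> Z" "finite Y" "set e \<subseteq> (\<Union>z\<in>Y. set (h z))"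
      using finite_subset_Union[of "set e" "(\<lambda>z. set (h z)) ` Z"] e(2) finite_subset_image
      by (metis List.finite_set)
    define ds where "ds = sorted_list_of_set Y"
    have ds: "inc ds" "set ds = Y" using Y(2) by (auto simp: ds_def)
    have "set e \<subseteq> set (cat h ds)" using Y(3) ds(2) by simp
    from ex_pick[OF cat_tuples e(1) this] h obtain hs where hs: "reidx \<tau> (pow \<sigma> (length ds)) hs" "pick hs (cat h ds) = e" by blast
    let ?n = "length is"
    obtain h1 where h1: "reidx (pow \<sigma> ?n) (pow \<sigma> (length ds) @ pow \<sigma> ?n @ []) h1"
      "\<forall>xs as ys. length xs = length (pow \<sigma> (length ds)) \<longrightarrow> length as = length (pow \<sigma> ?n) \<longrightarrow> pick h1 (xs @ as @ ys) = (as :: 'u list)"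
      using ex_reidx_append[of "pow \<sigma> ?n" "pow \<sigma> (length ds)" "[]"] by blast
    have H: "reidx (pow \<sigma> ?n @ \<tau>) (pow \<sigma> (length ds) @ pow \<sigma> ?n) (h1 @ hs)"
      using reidx_append[OF h1(1)[unfolded append_Nil2] reidx_mono[OF hs(1)]] .
    define \<psi> where "\<psi> = reindex (pow \<sigma> ?n @ \<tau>) (pow \<sigma> (length ds) @ pow \<sigma> ?n) (h1 @ hs) \<phi>"
    have \<psi>: "\<psi> \<in> fms L (pow \<sigma> (length (ds @ is)))" unfolding \<psi>_def using fms_reindex[OF H \<phi>] by (simp add: pow_add)
    have ct: "cat h ks \<in> tuples U (pow \<sigma> (length ks))" for ks by (rule cat_tuples) (use h in blast)
    have eq: "cat h (ds @ ks) \<in> ext U (pow \<sigma> (length (ds @ is))) \<psi> \<longleftrightarrow> cat h ks @ e \<in> ext U (pow \<sigma> ?n @ \<tau>) \<phi>"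
      if "length ks = ?n" for ks
    proof -
      have l: "length (cat h ds) = length (pow \<sigma> (length ds))" "length (cat h ks) = length (pow \<sigma> ?n)"
        using tuples_length[OF ct] that by metis+
      have "pick (h1 @ hs) (cat h ds @ cat h ks) = cat h ks @ e"
        unfolding pick_append using h1(2)[rule_format, OF l, of "[]"] pick_mono[OF hs(1) l(1)] hs(2) by simp
      moreover have "cat h ds @ cat h ks \<in> tuples U (pow \<sigma> (length ds) @ pow \<sigma> ?n)"
        using tuples_appendI[OF ct ct] that by metis
      ultimately show ?thesis unfolding \<psi>_def using ext_reindex[OF H \<phi> N] by (simp add: pow_add)
    qed
    have lt: "z < x" if "z \<in> Y" "x \<in> K" for z x using K(3) Y(1) that by blast
    have ks: "inc (ds @ ks) \<and> set (ds @ ks) \<subseteq> A" if "set ks \<subseteq> K" "inc ks" for ks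
      using that ds lt K Y(1) by (auto simp: sorted_wrt_append)
    have "cat h (ds @ is) \<in> ext U (pow \<sigma> (length (ds @ is))) \<psi> \<longleftrightarrow> cat h (ds @ js) \<in> ext U (pow \<sigma> (length (ds @ is))) \<psi>"
      by (rule rind_iff[OF r _ _ _ _ _ \<psi>]) (use ks[OF i] ks[OF j(1,2)] j(3) in auto)
    then show ?thesis using eq[OF refl] eq[OF j(3)] by simp
  qed
  then show ?thesis unfolding indisc_def increasing_le using h by blast
qed

lemma increasing_image:
  assumes "inj_on en K" "set zs \<subseteq> K"
  shows "increasing {(en x, en y) |x y. x \<in> K \<and> y \<in> K \<and> x \<le> y} (map en zs) \<longleftrightarrow> inc zs"
proof -
  let ?r = "{(en x, en y) |x y. x \<in> K \<and> y \<in> K \<and> x \<le> y}"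
  have "(en x, en y) \<in> ?r \<and> en x \<noteq> en y \<longleftrightarrow> x < y" if "x \<in> K" "y \<in> K" for x y
    using inj_onD[OF assms(1)] that by (auto simp: order_less_le)
  then show ?thesis unfolding increasing_def sorted_wrt_map using assms(2)
    by (induction zs) (simp_all add: subset_iff)
qed

lemma indisc_image:
  assumes "inj_on en K" "\<forall>x\<in>K. a (en x) = h x" "X \<subseteq> K"
  shows "indisc L U D \<sigma> {(en x, en y) |x y. x \<in> K \<and> y \<in> K \<and> x \<le> y} (en ` X) a \<longleftrightarrow> indisc L U D \<sigma> le_rel X h"
proof -
  let ?r = "{(en x, en y) |x y. x \<in> K \<and> y \<in> K \<and> x \<le> y}"
  have c: "cat a (map en zs) = cat h zs" if "set zs \<subseteq> X" for zs
  proof -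
    have "map a (map en zs) = map h zs" using that assms(2,3) by auto
    then show ?thesis by (simp only:)
  qed
  have i: "increasing ?r (map en zs) \<longleftrightarrow> inc zs" if "set zs \<subseteq> X" for zs
    using increasing_image[OF assms(1)] that assms(3) by blast
  have pull: "\<exists>zs. is = map en zs \<and> set zs \<subseteq> X" if "set is \<subseteq> en ` X" for "is"
proof (intro exI conjI)
    show "is = map en (map (inv_into X en) is)"
      using that by (auto simp: f_inv_into_f subset_iff intro!: map_idI[symmetric])
    show "set (map (inv_into X en) is) \<subseteq> X" using that by (auto intro!: inv_into_into)
  qed
  show ?thesis
  proof
    assume l: "indisc L U D \<sigma> ?r (en ` X) a"
    show "indisc L U D \<sigma> le_rel X h" unfolding indisc_def increasing_le
    proof (intro conjI allI impI ballI)
      show "h x \<in> tuples U \<sigma>" if "x \<in> X" for x using l that assms(2,3) unfolding indisc_def by fastforce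
      fix n \<tau> \<phi> e "is" js assume *: "\<phi> \<in> fms L (pow \<sigma> n @ \<tau>) \<and> e \<in> tuples U \<tau> \<and> set e \<subseteq> D \<and>
        set is \<subseteq> X \<and> inc is \<and> length is = n \<and> set js \<subseteq> X \<and> inc js \<and> length js = n"
      then have "set is \<subseteq> X" "set js \<subseteq> X" by auto
      note [simp] = i[OF this(1)] i[OF this(2)] and c' = c[OF this(1)] c[OF this(2)]
      show "cat h is @ e \<in> ext U (pow \<sigma> n @ \<tau>) \<phi> \<longleftrightarrow> cat h js @ e \<in> ext U (pow \<sigma> n @ \<tau>) \<phi>"
        using indiscD[OF l, of \<phi> "map en is" \<tau> e "map en js"] * unfolding c' by (auto simp: image_mono)
    qed
  next
    assume l: "indisc L U D \<sigma> le_rel X h"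
    show "indisc L U D \<sigma> ?r (en ` X) a" unfolding indisc_def
    proof (intro conjI allI impI ballI)
      show "a k \<in> tuples U \<sigma>" if "k \<in> en ` X" for k using l that assms(2,3) unfolding indisc_def by fastforce
      fix n \<tau> \<phi> e "is" js assume *: "\<phi> \<in> fms L (pow \<sigma> n @ \<tau>) \<and> e \<in> tuples U \<tau> \<and> set e \<subseteq> D \<and>
        set is \<subseteq> en ` X \<and> increasing ?r is \<and> length is = n \<and> set js \<subseteq> en ` X \<and> increasing ?r js \<and> length js = n"
      then obtain zs ws where zs: "is = map en zs" "set zs \<subseteq> X" and ws: "js = map en ws" "set ws \<subseteq> X" using pull by meson
      have "inc zs" "inc ws" using * i[OF zs(2)] i[OF ws(2)] unfolding zs(1) ws(1) by blast+
      then show "cat a is @ e \<in> ext U (pow \<sigma> n @ \<tau>) \<phi> \<longleftrightarrow> cat a js @ e \<in> ext U (pow \<sigma> n @ \<tau>) \<phi>"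
        using indiscD[OF l, of \<phi> zs \<tau> e ws] * zs(2) ws(2) unfolding zs(1) ws(1) c[OF zs(2)] c[OF ws(2)] increasing_le by auto
    qed
  qed
qed

lemma infinite_cofinite_Ioo: "finite (- A) \<Longrightarrow> x < y \<Longrightarrow> infinite (A \<inter> {x<..<y})" for A :: "rat set"
proof
  assume "finite (- A)" "x < y" "finite (A \<inter> {x<..<y})"
  then have "finite (- A \<union> A \<inter> {x<..<y})" by blast
  then have "finite {x<..<y}" by (rule rev_finite_subset) auto
  then show False using infinite_Ioo[OF \<open>x < y\<close>] by blast
qed

lemma ex_between_cofinite: "finite (- A) \<Longrightarrow> x < y \<Longrightarrow> \<exists>z\<in>A. x < z \<and> z < y" for A :: "rat set"
  using infinite_cofinite_Ioo[of A x y] by (metis IntE all_not_in_conv finite.emptyI greaterThanLessThan_iff)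

text \<open>Distality is formulated with indices from the type underlying \<open>\<kappa>\<close>,
  so the rational sequence is moved there by an injection \<open>en\<close>; countable sets are
  small because \<open>\<kappa>\<close> exceeds the number of formulas. As \<open>A\<close> is
  cofinite, the parts of \<open>K\<close> on either side of \<open>c\<close> are infinite and
  without endpoints.\<close>

lemma distal_rat:
  fixes \<kappa> :: "'k rel" and h :: "rat \<Rightarrow> 'u list" and L :: "('s, 'f, 'p) lang"
  assumes d: "distal L T \<kappa> U" and A: "finite (- A)" and K: "K = A \<inter> {p<..}" and c: "c \<in> K"
    and D: "D \<subseteq> univ U" "countable D"
    and i1: "indisc L U {} \<sigma> le_rel K h" and i2: "indisc L U D \<sigma> le_rel (K - {c}) h"
  shows "indisc L U D \<sigma> le_rel K h"
proof -
  have mon: "monster L T \<kappa> U" using d by (simp add: distal_def)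
  have "infinite (UNIV :: 'k set)" using monsterD(2)[OF mon] finite_subset[OF subset_UNIV] by blast
  then obtain en0 :: "nat \<Rightarrow> 'k" where en0: "inj en0" using infinite_countable_subset by blast
  define en :: "rat \<Rightarrow> 'k" where "en = en0 \<circ> to_nat"
  have en: "inj en" unfolding en_def by (intro inj_compose en0 inj_to_nat)
  have enK: "inj_on en X" for X using en inj_on_subset by blast
  define a where "a k = h (inv en k)" for k
  have a: "a (en x) = h x" for x by (simp add: a_def inv_f_f[OF en])
  define r where "r = {(en x, en y) |x y. x \<in> K \<and> y \<in> K \<and> x \<le> y}"
  define I where "I = en ` (A \<inter> {p<..<c})"
  define J where "J = en ` (A \<inter> {c<..})"
  have pc: "p < c" using c K by auto
  have K3: "K = A \<inter> {p<..<c} \<union> {c} \<union> A \<inter> {c<..}" using c pc unfolding K by auto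
  then have IJ: "I \<union> {en c} \<union> J = en ` K" by (auto simp: I_def J_def)
  have "K - {c} = A \<inter> {p<..<c} \<union> A \<inter> {c<..}" unfolding K3 by auto
  then have IJ': "I \<union> J = en ` (K - {c})" by (auto simp: I_def J_def)
  have rI: "(en x, en y) \<in> r \<longleftrightarrow> x \<in> K \<and> y \<in> K \<and> x \<le> y" for x y
    unfolding r_def using injD[OF en] by blast
  have ax: "\<forall>x\<in>K. a (en x) = h x" using a by simp
  note im = indisc_image[OF enK[of K] ax, folded r_def]
  have "indiscernible L U {} \<sigma> r (I \<union> {en c} \<union> J) a"
    unfolding indiscernible_iff IJ by (rule im[THEN iffD2, OF _ i1]) simp
  moreover have "indiscernible L U D \<sigma> r (I \<union> J) a"
    unfolding indiscernible_iff IJ' by (rule im[THEN iffD2, OF _ i2]) blast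
  moreover have "en c \<notin> I \<union> J" "I \<inter> J = {}"
    by (auto simp: I_def J_def inj_eq[OF en])
  moreover have "|I \<union> {en c} \<union> J| <o \<kappa>" "|D| <o \<kappa>"
    by (rule countable_ordLess[OF _ monsterD(5)[OF mon]], simp add: I_def J_def D(2))+
  moreover have "linear_order_on (I \<union> {en c} \<union> J) r"
    unfolding IJ order_on_defs
  proof (intro conjI)
    show "r \<subseteq> en ` K \<times> en ` K" by (auto simp: r_def)
    show "refl_on (en ` K) r" by (auto simp: refl_on_def rI)
    show "trans r"
    proof (rule transI)
      fix x y z assume "(x, y) \<in> r" "(y, z) \<in> r"
      then show "(x, z) \<in> r" by (auto simp: r_def inj_eq[OF en])
    qed
    show "antisym r" by (auto simp: antisym_def r_def inj_eq[OF en])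
    show "total_on (en ` K) r" by (auto simp: total_on_def rI)
  qed
  moreover have "\<forall>i\<in>I. (i, en c) \<in> r" "\<forall>j\<in>J. (en c, j) \<in> r"
    using c pc by (auto simp: I_def J_def rI K)
  moreover have "infinite I" "infinite J"
  proof -
    have "infinite (A \<inter> {p<..<c})" by (rule infinite_cofinite_Ioo[OF A pc])
    then show "infinite I" unfolding I_def using finite_imageD[OF _ enK] by blast
    have "infinite (A \<inter> {c<..<c + 1})" by (rule infinite_cofinite_Ioo[OF A]) simp
    then have "infinite (A \<inter> {c<..})" by (rule infinite_super[rotated]) auto
    then show "infinite J" unfolding J_def using finite_imageD[OF _ enK] by blast
  qed
  moreover have "without_endpoints r I"
    unfolding without_endpoints_def
  proof
    fix i assume "i \<in> I"
    then obtain x where x: "i = en x" "x \<in> A" "p < x" "x < c" by (auto simp: I_def)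
    from ex_between_cofinite[OF A x(3)] ex_between_cofinite[OF A x(4)] obtain y z where
      "y \<in> A" "p < y" "y < x" "z \<in> A" "x < z" "z < c" by blast
    then show "(\<exists>j\<in>I. j \<noteq> i \<and> (j, i) \<in> r) \<and> (\<exists>j\<in>I. j \<noteq> i \<and> (i, j) \<in> r)"
      unfolding x(1) I_def using x by (intro conjI bexI[of _ "en y"] bexI[of _ "en z"]) (auto simp: rI K inj_eq[OF en])
  qed
  moreover have "without_endpoints r J"
    unfolding without_endpoints_def
  proof
    fix i assume "i \<in> J"
    then obtain x where x: "i = en x" "x \<in> A" "c < x" by (auto simp: J_def)
    from ex_between_cofinite[OF A x(3)] ex_between_cofinite[OF A, of x "x + 1"] obtain y z where
      "y \<in> A" "c < y" "y < x" "z \<in> A" "x < z" by auto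
    then show "(\<exists>j\<in>J. j \<noteq> i \<and> (j, i) \<in> r) \<and> (\<exists>j\<in>J. j \<noteq> i \<and> (i, j) \<in> r)"
      unfolding x(1) J_def using x pc by (intro conjI bexI[of _ "en y"] bexI[of _ "en z"]) (auto simp: rI K inj_eq[OF en])
  qed
  ultimately have "indiscernible L U D \<sigma> r (I \<union> {en c} \<union> J) a"
    using d[unfolded distal_def, THEN conjunct2, THEN conjunct2, rule_format, of "en c" I J r D \<sigma> a] D(1) by blast
  then have "indisc L U D \<sigma> r (en ` K) a" unfolding indiscernible_iff IJ .
  then show ?thesis by (rule im[THEN iffD1, rotated]) simp
qed

section \<open>Refuting a broken sequence\<close>

context broken_sequence
begin

text \<open>If \<open>ps\<close> omitted one of the points, it would agree with \<open>ns\<close>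
  about \<open>\<alpha>\<close>.\<close>

lemma ps_not_okl: "p \<in> set ps" "q \<in> set ps"
proof -
  have "okl ns" using ns by (auto simp: okl_def)
  have "\<not> okl ps"
  proof
    assume "okl ps"
    from okl_eq[OF this \<open>okl ns\<close> ns(3)[symmetric] \<alpha> ps(3)] ns(4) show False by blast
  qed
  then show "p \<in> set ps" "q \<in> set ps" using ps by (auto simp: okl_def)
qed

text \<open>Compactness applied to \<open>finite_config\<close>: finitely many instances of
  indiscernibility involve finitely many formulas and indices, which serve as \<open>\<Psi>\<close>
  and as part of \<open>F\<close>.\<close>

lemma copy_in_U1:
  "\<exists>h. (\<forall>x. h x \<in> tuples U1 \<sigma>) \<and> rind L1 U1 \<sigma> (A - {p}) h \<and> rind L1 U1 \<sigma> (A - {q}) h \<and>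
    cat h ps \<in> star (pow \<sigma> (length ps)) (ext M (pow \<sigma> (length ps)) \<alpha>) \<and>
    cat h ns \<notin> star (pow \<sigma> (length ps)) (ext M (pow \<sigma> (length ps)) \<alpha>)"
proof -
  let ?Y = "ext M (pow \<sigma> (length ps)) \<alpha>"
  let ?\<rho> = "rf (pow \<sigma> (length ps)) ?Y"
  have Y: "ED (pow \<sigma> (length ps)) ?Y" by (rule ED_ext[OF elem \<alpha>])
  have \<rho>: "?\<rho> \<in> fms L1 (pow \<sigma> (length ps))" by (rule fms_rf[OF Y])
  \<comment> \<open>Both lists of an instance omit the same point; nothing is demanded of lists
    through both points.\<close>
  define Q where "Q = {(\<psi>, ks, ks'). \<psi> \<in> fms L1 (pow \<sigma> (length ks)) \<and> inc ks \<and> inc ks' \<and> length ks = length ks' \<and>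
    (\<exists>r\<in>{p, q}. set ks \<subseteq> A - {r} \<and> set ks' \<subseteq> A - {r})}"
  define im where "im = (\<lambda>(\<psi>, ks, ks'). impc \<sigma> [] \<psi> ks ks' :: rat list \<times> ('s, unit, 's list \<times> 'a list set) fm)"
  define C where "C = {(ps, ?\<rho>), (ns, Neg ?\<rho>)} \<union> im ` Q"
  have C: "\<forall>(is, \<phi>) \<in> C. \<phi> \<in> fms L1 (pow \<sigma> (length is) @ [])"
  proof clarify
    fix "is" \<phi> assume "(is, \<phi>) \<in> C"
    then consider "is = ps" "\<phi> = ?\<rho>" | "is = ns" "\<phi> = Neg ?\<rho>" | \<psi> ks ks' where "(\<psi>, ks, ks') \<in> Q" "impc \<sigma> [] \<psi> ks ks' = (is, \<phi>)"
      unfolding C_def im_def by force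
    then show "\<phi> \<in> fms L1 (pow \<sigma> (length is) @ [])"
    proof cases
      case 3
      then have "\<psi> \<in> fms L1 (pow \<sigma> (length ks) @ [])" "length ks = length ks'" by (auto simp: Q_def)
      from fms_impc[OF this 3(2)] show ?thesis .
    qed (use \<rho> ns(3) in \<open>simp_all add: fms_Neg\<close>)
  qed
  have f\<rho>: "famsat U1 \<sigma> [] [] f (ps, ?\<rho>) \<longleftrightarrow> cat f ps \<in> star (pow \<sigma> (length ps)) ?Y"
    "famsat U1 \<sigma> [] [] f (ns, Neg ?\<rho>) \<longleftrightarrow> cat f ns \<notin> star (pow \<sigma> (length ps)) ?Y"
    if f: "\<forall>x. f x \<in> tuples U1 \<sigma>" for f
  proof -
    have "cat f ns \<in> tuples U1 (pow \<sigma> (length ns))" by (rule cat_tuples) (use f in blast)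
    then show "famsat U1 \<sigma> [] [] f (ps, ?\<rho>) \<longleftrightarrow> cat f ps \<in> star (pow \<sigma> (length ps)) ?Y"
      "famsat U1 \<sigma> [] [] f (ns, Neg ?\<rho>) \<longleftrightarrow> cat f ns \<notin> star (pow \<sigma> (length ps)) ?Y"
      using ns(3) by (simp_all add: famsat_def ext_Neg ext_rf_U1)
  qed
  have fim: "famsat U1 \<sigma> [] [] f (im (\<psi>, ks, ks')) \<longleftrightarrow>
      (cat f ks \<in> ext U1 (pow \<sigma> (length ks)) \<psi> \<longrightarrow> cat f ks' \<in> ext U1 (pow \<sigma> (length ks)) \<psi>)"
    if "\<forall>x. f x \<in> tuples U1 \<sigma>" "(\<psi>, ks, ks') \<in> Q" for f \<psi> ks ks'
  proof -
    have q: "\<psi> \<in> fms L1 (pow \<sigma> (length ks) @ [])" "length ks = length ks'" using that(2) by (auto simp: Q_def)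
    show ?thesis using famsat_impc[OF q is_struc_U1, of "[]" f] that(1) q(2) by (simp add: im_def)
  qed
  have "\<exists>f. (\<forall>x. f x \<in> tuples U1 \<sigma>) \<and> (\<forall>c\<in>B. famsat U1 \<sigma> [] [] f c)" if B: "B \<subseteq> C" "finite B" for B
  proof -
    have "B - {(ps, ?\<rho>), (ns, Neg ?\<rho>)} \<subseteq> im ` Q" using B(1) by (auto simp: C_def)
    from finite_subset_image[OF finite_Diff[OF B(2)] this] obtain Q0 where Q0: "Q0 \<subseteq> Q" "finite Q0"
      "B - {(ps, ?\<rho>), (ns, Neg ?\<rho>)} = im ` Q0" by blast
    define \<Psi> where "\<Psi> = (\<lambda>(\<psi>, ks, ks'). (length ks, \<psi>)) ` Q0"
    define G where "G = (\<Union>(\<psi>, ks, ks')\<in>Q0. set ks \<union> set ks')"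
    have \<Psi>: "finite \<Psi>" "\<forall>c\<in>\<Psi>. snd c \<in> fms L1 (pow \<sigma> (fst c))" using Q0(1,2) by (auto simp: \<Psi>_def Q_def)
    have "finite G" using Q0(2) by (auto simp: G_def)
    moreover have "G \<subseteq> A" using Q0(1) unfolding G_def Q_def by blast
    moreover define F where "F = {p, q} \<union> set ps \<union> set ns \<union> G"
    ultimately have F: "finite F" "F \<subseteq> A" "p \<in> F" "q \<in> F" "set ps \<subseteq> F" "set ns \<subseteq> F" "G \<subseteq> F"
      using pA qA ps(1) ns(1) by auto
    from finite_config[OF F(1-6) \<Psi>] obtain f where f: "\<forall>x. f x \<in> tuples U1 \<sigma>" and
      fp: "psi_ind \<sigma> \<Psi> f (F - {p})" and fq: "psi_ind \<sigma> \<Psi> f (F - {q})" and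
      f\<alpha>: "cat f ps \<in> star (pow \<sigma> (length ps)) ?Y" "cat f ns \<notin> star (pow \<sigma> (length ps)) ?Y"
      by (elim exE conjE)
    have "famsat U1 \<sigma> [] [] f (im t)" if t: "t \<in> Q0" for t
    proof -
      obtain \<psi> ks ks' where t': "t = (\<psi>, ks, ks')" by (cases t)
      have tQ: "(\<psi>, ks, ks') \<in> Q" using t t' Q0(1) by blast
      have sub: "set ks \<subseteq> G" "set ks' \<subseteq> G" "(length ks, \<psi>) \<in> \<Psi>" using t unfolding t' G_def \<Psi>_def by force+
      from tQ obtain r where r: "r \<in> {p, q}" "set ks \<subseteq> A - {r}" "set ks' \<subseteq> A - {r}" and k: "inc ks" "inc ks'" "length ks = length ks'"
        by (auto simp: Q_def)
      have pr: "psi_ind \<sigma> \<Psi> f (F - {r})" using r(1) fp fq by blast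
      have "set ks \<subseteq> F - {r}" "set ks' \<subseteq> F - {r}"
        using r sub F(7) by blast+
      then have "cat f ks \<in> ext U1 (pow \<sigma> (length ks)) \<psi> \<longrightarrow> cat f ks' \<in> ext U1 (pow \<sigma> (length ks)) \<psi>"
        using pr[unfolded psi_ind_def, THEN bspec, OF sub(3), THEN spec[of _ ks], THEN spec[of _ ks']] k by simp
      then show ?thesis using fim[OF f tQ] unfolding t' by blast
    qed
    then have "\<forall>c\<in>im ` Q0. famsat U1 \<sigma> [] [] f c" by blast
    then have "\<forall>c\<in>B. famsat U1 \<sigma> [] [] f c" using f\<rho>[OF f] f\<alpha> unfolding Q0(3)[symmetric] by blast
    with f show ?thesis by blast
  qed
  then have "\<forall>B. B \<subseteq> C \<longrightarrow> finite B \<longrightarrow> (\<exists>f. (\<forall>x. f x \<in> tuples U1 \<sigma>) \<and> (\<forall>c\<in>B. famsat U1 \<sigma> [] [] f c))" by blast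
  from realize_family[OF monsterD(4)[OF monster_U1] is_struc_U1 monsterD(1,2)[OF monster_U1] _ C this]
  obtain h where h: "\<forall>x. h x \<in> tuples U1 \<sigma>" "\<forall>c\<in>C. famsat U1 \<sigma> [] [] h c" by auto
  have "rind L1 U1 \<sigma> (A - {r}) h" if "r \<in> {p, q}" for r
    unfolding rind_def
  proof (intro allI impI)
    fix as bs \<psi> assume *: "inc as \<and> inc bs \<and> set as \<subseteq> A - {r} \<and> set bs \<subseteq> A - {r} \<and> length as = length bs \<and> \<psi> \<in> fms L1 (pow \<sigma> (length as))"
      "cat h as \<in> ext U1 (pow \<sigma> (length as)) \<psi>"
    then have Q: "(\<psi>, as, bs) \<in> Q" using that by (auto simp: Q_def)
    then have "famsat U1 \<sigma> [] [] h (im (\<psi>, as, bs))" using h(2) unfolding C_def by blast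
    then show "cat h bs \<in> ext U1 (pow \<sigma> (length as)) \<psi>" using fim[OF h(1) Q] *(2) by blast
  qed
  moreover have "famsat U1 \<sigma> [] [] h (ps, ?\<rho>)" "famsat U1 \<sigma> [] [] h (ns, Neg ?\<rho>)" using h(2) unfolding C_def by blast+
  ultimately show ?thesis using h(1) f\<rho>[OF h(1)] by blast
qed

text \<open>Omitting \<open>p\<close> shows that the terms after \<open>p\<close> are indiscernible;
  omitting \<open>q\<close> shows that those other than \<open>q\<close> are so over the terms up to
  \<open>p\<close>. Distality then includes \<open>q\<close>, which can therefore be replaced in
  \<open>ps\<close> by a nearby index. The new tuple omits \<open>q\<close> and so must agree with
  \<open>ns\<close>.\<close>

lemma contradiction: False
proof -
  let ?Y = "ext M (pow \<sigma> (length ps)) \<alpha>"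
  let ?\<rho> = "rf (pow \<sigma> (length ps)) ?Y"
  have \<rho>: "?\<rho> \<in> fms L1 (pow \<sigma> (length ps))" by (rule fms_rf[OF ED_ext[OF elem \<alpha>]])
  obtain h where h: "\<forall>x. h x \<in> tuples U1 \<sigma>" and hp: "rind L1 U1 \<sigma> (A - {p}) h" and hq: "rind L1 U1 \<sigma> (A - {q}) h"
    and hps: "cat h ps \<in> ext U1 (pow \<sigma> (length ps)) ?\<rho>" and hns: "cat h ns \<notin> ext U1 (pow \<sigma> (length ps)) ?\<rho>"
    using copy_in_U1 unfolding ext_rf_U1 by blast
  define K where "K = A \<inter> {p<..}"
  define Z where "Z = A \<inter> {..p}"
  define D where "D = (\<Union>z\<in>Z. set (h z))"
  have qK: "q \<in> K" using qA pq by (simp add: K_def)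
  have "D \<subseteq> univ U1" using h unfolding D_def by (auto simp: tuples_iff dom_of_def in_set_conv_nth)
  moreover have "countable D" unfolding D_def by (rule countable_UN) (auto intro: countable_finite)
  ultimately have D: "D \<subseteq> univ U1" "countable D" .
  have "indisc L1 U1 (\<Union>z\<in>{}. set (h z)) \<sigma> le_rel K h"
    by (rule indisc_over_initial[OF is_struc_U1 h hp]) (auto simp: K_def)
  then have "indisc L1 U1 {} \<sigma> le_rel K h" by simp
  moreover have "indisc L1 U1 D \<sigma> le_rel (K - {q}) h" unfolding D_def
    by (rule indisc_over_initial[OF is_struc_U1 h hq]) (use pq in \<open>auto simp: K_def Z_def\<close>)
  ultimately have ind: "indisc L1 U1 D \<sigma> le_rel K h" by (rule distal_rat[OF dist cofinite_A K_def qK D])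
  from split_list[OF ps_not_okl(2)] obtain l l3 where l: "ps = l @ q # l3" by blast
  then have "p \<in> set l" using ps_not_okl(1) ps(2) pq by (auto simp: sorted_wrt_append)
  from split_list[OF this] obtain l1 l2 where l12: "l = l1 @ p # l2" by blast
  have ps_eq: "ps = (l1 @ [p]) @ (l2 @ q # l3)" unfolding l l12 by simp
  \<comment> \<open>The replacement for \<open>q\<close> has to lie above all earlier entries of
    \<open>ps\<close>. Inserting \<open>p\<close> covers the case of an empty \<open>l2\<close> and
    keeps the replacement above \<open>p\<close>.\<close>
  define m where "m = Max (insert p (set l2))"
  have m: "m < q" "p \<le> m" "\<forall>x\<in>set l2. x \<le> m"
    using ps(2) pq unfolding ps_eq m_def by (auto simp: sorted_wrt_append)
  from ex_between_cofinite[OF cofinite_A m(1)] obtain q' where q': "q' \<in> A" "m < q'" "q' < q" by blast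
  have l2q': "\<forall>x\<in>set l2. x < q'" "p < q'" using m q' by auto
  have i: "set (l2 @ q # l3) \<subseteq> K" "inc (l2 @ q # l3)" "set (l2 @ q' # l3) \<subseteq> K" "inc (l2 @ q' # l3)"
    "inc ((l1 @ [p]) @ (l2 @ q' # l3))" "set ((l1 @ [p]) @ (l2 @ q' # l3)) \<subseteq> A - {q}" "set (l1 @ [p]) \<subseteq> Z"
    using ps(1,2) l2q' q' pq unfolding ps_eq by (auto simp: sorted_wrt_append K_def Z_def)
  have e: "cat h (l1 @ [p]) \<in> tuples U1 (pow \<sigma> (length (l1 @ [p])))" by (rule cat_tuples) (use h in blast)
  have eD: "set (cat h (l1 @ [p])) \<subseteq> D" using i(7) unfolding D_def by auto
  have pw: "pow \<sigma> (length ps) = pow \<sigma> (length (l1 @ [p])) @ pow \<sigma> (length (l2 @ q # l3))"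
    unfolding ps_eq length_append[of "l1 @ [p]"] pow_add ..
  have c: "cat h ((l1 @ [p]) @ ks) = cat h (l1 @ [p]) @ cat h ks" for ks by simp
  have "cat h ps \<in> ext U1 (pow \<sigma> (length ps)) ?\<rho> \<longleftrightarrow> cat h ((l1 @ [p]) @ (l2 @ q' # l3)) \<in> ext U1 (pow \<sigma> (length ps)) ?\<rho>"
    using indiscD_left[OF is_struc_U1 ind \<rho>[unfolded pw] e eD i(1) _ i(3)] i(2,4) unfolding pw[symmetric] c[symmetric] ps_eq[symmetric]
      increasing_le by simp
  moreover have len: "length ((l1 @ [p]) @ (l2 @ q' # l3)) = length ps" unfolding ps_eq by simp
  have nsq: "set ns \<subseteq> A - {q}" using ns(1) by auto
  have "cat h ((l1 @ [p]) @ (l2 @ q' # l3)) \<in> ext U1 (pow \<sigma> (length ps)) ?\<rho> \<longleftrightarrow> cat h ns \<in> ext U1 (pow \<sigma> (length ps)) ?\<rho>"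
    by (rule rind_iff[OF hq i(5) ns(2) i(6) nsq, unfolded len, OF ns(3)[symmetric] \<rho>])
  ultimately show False using hps hns by blast
qed

end

context shelah_monster
begin

text \<open>The starred statement of the overview. A tuple with a type different from that of
  \<open>ns\<close> would give a broken sequence, for the distinguishing formula or for its
  negation.\<close>

lemma rind_union:
  fixes g :: "rat \<Rightarrow> 'u list"
  assumes g: "\<forall>x. g x \<in> tuples U \<sigma>" and A: "finite (- A)" "p \<in> A" "q \<in> A" "p < q"
    and r: "rind L U \<sigma> (A - {p}) g" "rind L U \<sigma> (A - {q}) g"
  shows "rind L U \<sigma> A g"
proof -
  have inf: "infinite (A - {p, q})"
  proof -
    have "A - {p, q} = - (- A \<union> {p, q})" by blast
    then show ?thesis using A(1) by (simp add: infinite_UNIV_char_0 Compl_eq_Diff_UNIV)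
  qed
  have same: "cat g as \<in> ext U (pow \<sigma> (length as)) \<alpha> \<longleftrightarrow> cat g ns \<in> ext U (pow \<sigma> (length as)) \<alpha>"
    if as: "inc as" "set as \<subseteq> A" and ns: "inc ns" "set ns \<subseteq> A - {p, q}" "length ns = length as"
      and \<alpha>: "\<alpha> \<in> fms L (pow \<sigma> (length as))" for as ns \<alpha>
  proof -
    have no: False if "\<beta> \<in> fms L (pow \<sigma> (length as))" "cat g as \<in> ext U (pow \<sigma> (length as)) \<beta>" "cat g ns \<notin> ext U (pow \<sigma> (length as)) \<beta>" for \<beta>
    proof -
      interpret broken_sequence L M M' \<kappa>1 U1 T \<kappa> U g \<sigma> A p q \<beta> as ns
        by unfold_locales (use g A r as ns that in auto)
      show False by (rule contradiction)
    qed
    have "cat g ks \<in> tuples U (pow \<sigma> (length ks))" for ks by (rule cat_tuples) (use g in blast)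
    from this[of as] this[of ns] show ?thesis using no[OF \<alpha>] no[OF fms_Neg[OF \<alpha>]] ns(3) by (auto simp: ext_Neg)
  qed
  show ?thesis unfolding rind_def
  proof (intro allI impI, elim conjE)
    fix as bs \<alpha> assume *: "inc as" "inc bs" "set as \<subseteq> A" "set bs \<subseteq> A" "length as = length bs" "\<alpha> \<in> fms L (pow \<sigma> (length as))"
      and t: "cat g as \<in> ext U (pow \<sigma> (length as)) \<alpha>"
    obtain ns where ns: "inc ns" "set ns \<subseteq> A - {p, q}" "length ns = length as" using ex_inc_list[OF inf] by blast
    have "cat g as \<in> ext U (pow \<sigma> (length as)) \<alpha> \<longleftrightarrow> cat g ns \<in> ext U (pow \<sigma> (length as)) \<alpha>"
      by (rule same) (use * ns in auto)
    moreover have "cat g bs \<in> ext U (pow \<sigma> (length bs)) \<alpha> \<longleftrightarrow> cat g ns \<in> ext U (pow \<sigma> (length bs)) \<alpha>"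
      by (rule same) (use * ns in auto)
    ultimately show "cat g bs \<in> ext U (pow \<sigma> (length as)) \<alpha>" using t *(5) by simp
  qed
qed

end

section \<open>Copies of the exceptional element in many cuts\<close>

lemma fms_append: "\<phi> \<in> fms L \<tau> \<Longrightarrow> \<phi> \<in> fms L (\<tau> @ \<tau>')"
  by (auto simp: fms_def in_std_vars nth_append subset_iff intro: trans_less_add1)

lemma ext_append:
  assumes "\<phi> \<in> fms L \<tau>" "as \<in> tuples N \<tau>" "e \<in> tuples N \<tau>'"
  shows "as @ e \<in> ext N (\<tau> @ \<tau>') \<phi> \<longleftrightarrow> as \<in> ext N \<tau> \<phi>"
proof -
  have "sat N (std_env (as @ e)) \<phi> = sat N (std_env as) \<phi>"
    by (rule sat_cong) (use assms in \<open>auto simp: fms_def in_std_vars std_env_def nth_append tuples_length subset_iff\<close>)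
  then show ?thesis using assms tuples_appendI[of as N \<tau> e \<tau>'] by (simp add: ext_def)
qed

text \<open>The forth step again, now between two tuples of the same saturated model.\<close>

lemma type_extend:
  fixes U :: "('s, 'f, 'p, 'u) struc" and L :: "('s, 'f, 'p) lang"
  assumes mon: "monster L T \<kappa> U" and u: "u \<in> tuples U \<tau>" "u' \<in> tuples U \<tau>" and b: "b \<in> tuples U \<sigma>"
    and eq: "\<forall>\<theta>\<in>fms L \<tau>. u \<in> ext U \<tau> \<theta> \<longrightarrow> u' \<in> ext U \<tau> \<theta>"
  shows "\<exists>b'\<in>tuples U \<sigma>. \<forall>\<theta>\<in>fms L (\<sigma> @ \<tau>). b @ u \<in> ext U (\<sigma> @ \<tau>) \<theta> \<longrightarrow> b' @ u' \<in> ext U (\<sigma> @ \<tau>) \<theta>"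
proof -
  note N = monsterD(3)[OF mon]
  let ?H = "{\<theta> \<in> fms L (\<sigma> @ \<tau>). b @ u \<in> ext U (\<sigma> @ \<tau>) \<theta>}"
  let ?G = "\<lambda>\<theta>. (\<theta>, \<tau>, u')"
  have "\<exists>as \<in> tuples U \<sigma>. \<forall>(\<phi>, \<mu>, e) \<in> ?G ` ?H. as @ e \<in> ext U (\<sigma> @ \<mu>) \<phi>"
  proof (rule realize[OF monsterD(4,3,1,2)[OF mon]])
    show "set u' \<subseteq> univ U" by (rule tuples_set[OF u(2)])
    show "|set u'| <o \<kappa>" by (rule finite_ordLess_Card_order[OF monsterD(1,2)[OF mon]]) simp
    show "?G ` ?H \<subseteq> conds L U (set u') \<sigma>" using u(2) by (auto simp: conds_def)
    show "fin_sat U \<sigma> (?G ` ?H)" unfolding fin_sat_def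
    proof (intro allI impI)
      fix q assume q: "q \<subseteq> ?G ` ?H" "finite q"
      from finite_subset_image[OF q(2,1)] obtain Q where Q: "Q \<subseteq> ?H" "finite Q" "q = ?G ` Q" by blast
      obtain as where as: "set as = Q" using finite_list[OF Q(2)] by (elim exE)
      have "conj as \<in> fms L (\<sigma> @ \<tau>)" by (rule fms_conj) (use as Q(1) in auto)
      then have "conj as \<in> fms L (\<sigma> @ \<tau> @ [])" by simp
      then obtain \<chi> where \<chi>: "\<chi> \<in> fms L (\<tau> @ \<sigma> @ [])" and
        sw: "\<And>x y z. x \<in> tuples U \<sigma> \<Longrightarrow> y \<in> tuples U \<tau> \<Longrightarrow> z \<in> tuples U [] \<Longrightarrow>
          y @ x @ z \<in> ext U (\<tau> @ \<sigma> @ []) \<chi> \<longleftrightarrow> x @ y @ z \<in> ext U (\<sigma> @ \<tau> @ []) (conj as)"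
        using block_swap2[where 'a = 'u] N by metis
      have \<chi>': "\<chi> \<in> fms L (\<tau> @ \<sigma>)" using \<chi> by simp
      have "b @ u \<in> ext U (\<sigma> @ \<tau>) (conj as)"
        unfolding ext_conj[OF N] using as Q(1) tuples_appendI[OF b u(1)] by auto
      then have "u @ b \<in> ext U (\<tau> @ \<sigma>) \<chi>" using sw[OF b u(1), of "[]"] by simp
      then have "u \<in> ext U \<tau> (exs \<tau> \<sigma> \<chi>)" unfolding ext_exs[OF \<chi>'] using u b by blast
      then have "u' \<in> ext U \<tau> (exs \<tau> \<sigma> \<chi>)" using eq fms_exs[OF \<chi>'] by blast
      then obtain x where x: "x \<in> tuples U \<sigma>" "u' @ x \<in> ext U (\<tau> @ \<sigma>) \<chi>" unfolding ext_exs[OF \<chi>'] by blast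
      then have "x @ u' \<in> ext U (\<sigma> @ \<tau>) (conj as)" using sw[OF x(1) u(2), of "[]"] by simp
      then have "\<forall>\<theta>\<in>Q. x @ u' \<in> ext U (\<sigma> @ \<tau>) \<theta>" unfolding ext_conj[OF N] as by blast
      then show "\<exists>as\<in>tuples U \<sigma>. \<forall>(\<phi>, \<mu>, e)\<in>q. as @ e \<in> ext U (\<sigma> @ \<mu>) \<phi>"
        using x(1) unfolding Q(3) by blast
    qed
  qed
  then obtain x where x: "x \<in> tuples U \<sigma>" "\<forall>(\<phi>, \<mu>, e) \<in> ?G ` ?H. x @ e \<in> ext U (\<sigma> @ \<mu>) \<phi>" by blast
  have "\<forall>\<theta>\<in>fms L (\<sigma> @ \<tau>). b @ u \<in> ext U (\<sigma> @ \<tau>) \<theta> \<longrightarrow> x @ u' \<in> ext U (\<sigma> @ \<tau>) \<theta>" using x(2) by fast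
  with x(1) show ?thesis by blast
qed

lemma increasing_map:
  assumes "\<forall>x\<in>X. \<forall>y\<in>X. x < y \<longrightarrow> (\<eta> x, \<eta> y) \<in> r \<and> \<eta> x \<noteq> \<eta> y" "set ks \<subseteq> X" "inc ks"
  shows "increasing r (map \<eta> ks)"
  using assms(2,3) unfolding increasing_def by (induction ks) (use assms(1) in auto)

lemma ex_emb:
  assumes "inc gl" "increasing r zs" "length zs = length gl"
  shows "\<exists>\<eta>. map \<eta> gl = zs \<and> (\<forall>x\<in>set gl. \<forall>y\<in>set gl. x < y \<longrightarrow> (\<eta> x, \<eta> y) \<in> r \<and> \<eta> x \<noteq> \<eta> y)"
proof (intro exI conjI ballI impI)
  let ?\<eta> = "\<lambda>x. zs ! pos gl x"
  show "map ?\<eta> gl = zs" using assms(3) pos_nth[OF inc_distinct[OF assms(1)]] by (auto intro: nth_equalityI)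
  fix x y assume x: "x \<in> set gl" and y: "y \<in> set gl" and "x < y"
  then have "pos gl x < pos gl y" by (rule pos_less[OF assms(1)])
  moreover have "pos gl y < length zs" using pos[OF y] assms(3) by simp
  ultimately show "(?\<eta> x, ?\<eta> y) \<in> r" "?\<eta> x \<noteq> ?\<eta> y"
    using assms(2) unfolding increasing_def by (auto dest: sorted_wrt_nth_less)
qed

text \<open>The sequence \<open>I + {c} + J\<close> is indiscernible, and \<open>I + J\<close> is so over \<open>e\<close>, but \<open>\<phi>(x, e)\<close> singles out \<open>c\<close>.
  Then \<open>\<phi>(x, e)\<close> can single out several elements of a finite sequence which is indiscernible if all but one of them are
  omitted.\<close>

locale split_sequence = shelah_monster L M M' \<kappa>1 U1 T \<kappa> U
  for L :: "('s, 'f, 'p) lang" and M M' :: "('s, 'f, 'p, 'a) struc"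
    and \<kappa>1 :: "'k rel" and U1 :: "('s, unit, 's list \<times> 'a list set, 'v) struc"
    and T :: "('s, 'f, 'p) fm set" and \<kappa> :: "'l rel" and U :: "('s, 'f, 'p, 'u) struc" +
  fixes I J :: "'i set" and c :: 'i and r :: "'i rel" and a :: "'i \<Rightarrow> 'u list" and \<sigma> \<epsilon> :: "'s list"
    and e :: "'u list" and \<phi> :: "('s, 'f, 'p) fm"
  assumes long_I: "\<exists>zs. set zs \<subseteq> I \<and> increasing r zs \<and> length zs = n"
    and long_J: "\<exists>zs. set zs \<subseteq> J \<and> increasing r zs \<and> length zs = n"
    and inc_IcJ: "set zs \<subseteq> I \<Longrightarrow> increasing r zs \<Longrightarrow> set ws \<subseteq> J \<Longrightarrow> increasing r ws \<Longrightarrow> increasing r (zs @ c # ws)"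
    and ind: "indisc L U {} \<sigma> r (I \<union> {c} \<union> J) a"
    and e: "e \<in> tuples U \<epsilon>"
    and ind_e: "set is \<subseteq> I \<union> J \<Longrightarrow> set js \<subseteq> I \<union> J \<Longrightarrow> increasing r is \<Longrightarrow> increasing r js \<Longrightarrow> length is = length js \<Longrightarrow>
      \<theta> \<in> fms L (pow \<sigma> (length is) @ \<epsilon>) \<Longrightarrow>
      cat a is @ e \<in> ext U (pow \<sigma> (length is) @ \<epsilon>) \<theta> \<Longrightarrow> cat a js @ e \<in> ext U (pow \<sigma> (length is) @ \<epsilon>) \<theta>"
    and \<phi>: "\<phi> \<in> fms L (\<sigma> @ \<epsilon>)" "i \<in> I \<union> J \<Longrightarrow> a i @ e \<in> ext U (\<sigma> @ \<epsilon>) \<phi>" "a c @ e \<notin> ext U (\<sigma> @ \<epsilon>) \<phi>"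
begin

lemma a: "i \<in> I \<union> {c} \<union> J \<Longrightarrow> a i \<in> tuples U \<sigma>"
  using ind by (auto simp: indisc_def)

text \<open>Over \<open>e\<close> all increasing tuples of \<open>I + J\<close> of a given length
  have the same type. For each \<open>s\<close> the part of \<open>F\<close> below \<open>s\<close>
  is placed in \<open>I\<close> and the part above it in \<open>J\<close>, with \<open>c\<close> in
  between; moving this tuple over \<open>e\<close> to a fixed tuple \<open>zs\<close> yields a copy
  of \<open>c\<close> in the cut of \<open>s\<close>. As \<open>zs\<close> does not depend on
  \<open>s\<close>, all these copies fit one family on \<open>F\<close>.\<close>

lemma finite_split:
  fixes F S0 :: "rat set"
  assumes F: "finite F" "F \<inter> S0 = {}"
  shows "\<exists>f. (\<forall>x. f x \<in> tuples U \<sigma>) \<and> (\<forall>x\<in>F. f x @ e \<in> ext U (\<sigma> @ \<epsilon>) \<phi>) \<and>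
    (\<forall>s\<in>S0. f s @ e \<notin> ext U (\<sigma> @ \<epsilon>) \<phi> \<and> rind L U \<sigma> (F \<union> {s}) f)"
proof -
  define fl where "fl = sorted_list_of_set F"
  have fl: "inc fl" "set fl = F" using F(1) by (auto simp: fl_def)
  define k where "k = length fl"
  obtain zs where zs: "set zs \<subseteq> I" "increasing r zs" "length zs = k" using long_I by blast
  define gl1 gl2 where "gl1 s = sorted_list_of_set {x \<in> F. x < s}" and "gl2 s = sorted_list_of_set {x \<in> F. s < x}" for s
  have gl: "inc (gl1 s @ s # gl2 s)" "gl1 s @ gl2 s = fl" if "s \<in> S0" for s
  proof -
    have 1: "inc (gl1 s)" "set (gl1 s) = {x \<in> F. x < s}" "inc (gl2 s)" "set (gl2 s) = {x \<in> F. s < x}"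
      using F(1) by (auto simp: gl1_def gl2_def)
    show "inc (gl1 s @ s # gl2 s)" using 1 by (auto simp: sorted_wrt_append)
    then have "inc (gl1 s @ gl2 s)" by (simp add: sorted_wrt_append)
    moreover have "set (gl1 s @ gl2 s) = set fl"
    proof -
      have "s \<notin> F" using that F(2) by blast
      then have "x < s \<or> s < x" if "x \<in> F" for x using that linorder_less_linear by blast
      then show ?thesis using 1 fl(2) by auto
    qed
    ultimately show "gl1 s @ gl2 s = fl" using fl(1) strict_sorted_equal by metis
  qed
  let ?\<tau> = "pow \<sigma> k @ \<epsilon>"
  have ct: "cat a xs \<in> tuples U (pow \<sigma> (length xs))" if "set xs \<subseteq> I \<union> {c} \<union> J" for xs
    by (rule cat_tuples) (use that a in blast)
  have zt: "cat a zs @ e \<in> tuples U ?\<tau>" using ct[of zs] zs e by (auto intro: tuples_appendI)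
  have "\<exists>b\<in>tuples U \<sigma>. \<exists>zw. length zw = k \<and> increasing r (take (length (gl1 s)) zw @ c # drop (length (gl1 s)) zw) \<and> set zw \<subseteq> I \<union> J \<and>
      (\<forall>\<theta>\<in>fms L (\<sigma> @ ?\<tau>). a c @ (cat a zw @ e) \<in> ext U (\<sigma> @ ?\<tau>) \<theta> \<longrightarrow> b @ (cat a zs @ e) \<in> ext U (\<sigma> @ ?\<tau>) \<theta>)"
    if s: "s \<in> S0" for s
  proof -
    obtain z1 where z1: "set z1 \<subseteq> I" "increasing r z1" "length z1 = length (gl1 s)" using long_I by blast
    obtain w where w: "set w \<subseteq> J" "increasing r w" "length w = length (gl2 s)" using long_J by blast
    have i: "increasing r (z1 @ c # w)" by (rule inc_IcJ[OF z1(1,2) w(1,2)])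
    then have i': "increasing r (z1 @ w)" by (simp add: increasing_def sorted_wrt_append)
    have l: "length (z1 @ w) = k" using z1(3) w(3) gl(2)[OF s] by (metis k_def length_append)
    have sub: "set (z1 @ w) \<subseteq> I \<union> J" using z1 w by auto
    have "cat a (z1 @ w) \<in> tuples U (pow \<sigma> k)" using ct[of "z1 @ w"] sub unfolding l by blast
    then have t: "cat a (z1 @ w) @ e \<in> tuples U ?\<tau>" by (rule tuples_appendI[OF _ e])
    have "\<forall>\<theta>\<in>fms L ?\<tau>. cat a (z1 @ w) @ e \<in> ext U ?\<tau> \<theta> \<longrightarrow> cat a zs @ e \<in> ext U ?\<tau> \<theta>"
    proof -
      have "set zs \<subseteq> I \<union> J" "length (z1 @ w) = length zs" using zs l by auto
      from ind_e[OF sub this(1) i' zs(2) this(2)] show ?thesis unfolding l by blast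
    qed
    from type_extend[OF monster_U t zt a[of c] this] obtain b where b: "b \<in> tuples U \<sigma>"
      "\<forall>\<theta>\<in>fms L (\<sigma> @ ?\<tau>). a c @ (cat a (z1 @ w) @ e) \<in> ext U (\<sigma> @ ?\<tau>) \<theta> \<longrightarrow> b @ (cat a zs @ e) \<in> ext U (\<sigma> @ ?\<tau>) \<theta>" by blast
    have "take (length (gl1 s)) (z1 @ w) = z1" "drop (length (gl1 s)) (z1 @ w) = w" using z1(3) by auto
    then show ?thesis using b l i sub by (intro bexI[OF _ b(1)] exI[of _ "z1 @ w"]) simp
  qed
  then obtain b where b: "\<forall>s\<in>S0. b s \<in> tuples U \<sigma> \<and> (\<exists>zw. length zw = k \<and> increasing r (take (length (gl1 s)) zw @ c # drop (length (gl1 s)) zw) \<and> set zw \<subseteq> I \<union> J \<and>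
      (\<forall>\<theta>\<in>fms L (\<sigma> @ ?\<tau>). a c @ (cat a zw @ e) \<in> ext U (\<sigma> @ ?\<tau>) \<theta> \<longrightarrow> b s @ (cat a zs @ e) \<in> ext U (\<sigma> @ ?\<tau>) \<theta>))" by metis
  \<comment> \<open>The last case is a default value of the right sorts for the indices outside
    \<open>F\<close> and \<open>S0\<close>.\<close>
  define f where "f x = (if x \<in> F then a (zs ! pos fl x) else if x \<in> S0 then b x else a c)" for x
  have zI: "zs ! pos fl x \<in> I" if "x \<in> F" for x using pos[of x fl] that fl(2) zs by (auto simp: k_def subset_iff)
  have f: "f x \<in> tuples U \<sigma>" for x using zI a b by (auto simp: f_def)
  have fF: "f x @ e \<in> ext U (\<sigma> @ \<epsilon>) \<phi>" if "x \<in> F" for x using \<phi>(2)[of "zs ! pos fl x"] zI that by (simp add: f_def)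
  have cf: "cat f fl = cat a zs"
  proof -
    have "map f fl = map a zs" using zs(3) fl(2) pos_nth[OF inc_distinct[OF fl(1)]] by (auto simp: f_def k_def intro!: nth_equalityI)
    then show ?thesis by (simp only:)
  qed
  have main: "f s @ e \<notin> ext U (\<sigma> @ \<epsilon>) \<phi> \<and> rind L U \<sigma> (F \<union> {s}) f" if s: "s \<in> S0" for s
  proof -
    from b s obtain zw where zw: "length zw = k" "increasing r (take (length (gl1 s)) zw @ c # drop (length (gl1 s)) zw)" "set zw \<subseteq> I \<union> J"
      and tp: "\<forall>\<theta>\<in>fms L (\<sigma> @ ?\<tau>). a c @ (cat a zw @ e) \<in> ext U (\<sigma> @ ?\<tau>) \<theta> \<longrightarrow> b s @ (cat a zs @ e) \<in> ext U (\<sigma> @ ?\<tau>) \<theta>" by blast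
    have lk: "length (gl1 s) + length (gl2 s) = k" using gl(2)[OF s] by (metis k_def length_append)
    then have "length (take (length (gl1 s)) zw @ c # drop (length (gl1 s)) zw) = length (gl1 s @ s # gl2 s)" using zw(1) by simp
    \<comment> \<open>\<open>\<eta>\<close> leads from \<open>F\<close> and \<open>s\<close> back to
      a tuple through \<open>c\<close> in the original sequence with the same type over
      \<open>e\<close>, so the indiscernibility of \<open>f\<close> is inherited from that of
      \<open>a\<close>.\<close>
    from ex_emb[OF gl(1)[OF s] zw(2) this] obtain \<eta> where
      \<eta>: "map \<eta> (gl1 s @ s # gl2 s) = take (length (gl1 s)) zw @ c # drop (length (gl1 s)) zw" and
      mono: "\<forall>x\<in>set (gl1 s @ s # gl2 s). \<forall>y\<in>set (gl1 s @ s # gl2 s). x < y \<longrightarrow> (\<eta> x, \<eta> y) \<in> r \<and> \<eta> x \<noteq> \<eta> y" by blast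
    have "map \<eta> (gl1 s) = take (length (gl1 s)) zw" "\<eta> s = c" "map \<eta> (gl2 s) = drop (length (gl1 s)) zw"
      using \<eta> zw(1) lk by (auto simp: append_eq_append_conv)
    then have mfl: "map \<eta> fl = zw" and \<eta>s: "\<eta> s = c" unfolding gl(2)[OF s, symmetric] map_append by auto
    have sets: "set (gl1 s @ s # gl2 s) = F \<union> {s}" "set (s # fl) = F \<union> {s}"
      unfolding fl(2)[symmetric] gl(2)[OF s, symmetric] by auto
    have \<eta>K: "\<eta> x \<in> I \<union> {c} \<union> J" if "x \<in> F \<union> {s}" for x
    proof (cases "x \<in> F")
      case True
      then have "\<eta> x \<in> set zw" unfolding mfl[symmetric] using fl(2) by simp
      then show ?thesis using zw(3) by blast
    qed (use that \<eta>s in auto)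
    have sF: "s \<notin> F" using s F(2) by blast
    have c1: "cat (\<lambda>x. a (\<eta> x)) (s # fl) @ e = a c @ (cat a zw @ e)"
      unfolding mfl[symmetric] by (simp add: \<eta>s comp_def)
    have c2: "cat f (s # fl) @ e = b s @ (cat a zs @ e)" using cf sF s by (simp add: f_def)
    have pw: "pow \<sigma> (length (s # fl)) @ \<epsilon> = \<sigma> @ ?\<tau>" by (simp add: k_def)
    have key: "cat f ks @ e \<in> ext U (pow \<sigma> (length ks) @ \<epsilon>) \<psi>"
      if ks: "set ks \<subseteq> F \<union> {s}" and \<psi>: "\<psi> \<in> fms L (pow \<sigma> (length ks) @ \<epsilon>)"
        and t: "cat (\<lambda>x. a (\<eta> x)) ks @ e \<in> ext U (pow \<sigma> (length ks) @ \<epsilon>) \<psi>" for ks \<psi>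
    proof -
      have ks': "set ks \<subseteq> set (s # fl)" using ks sets(2) by blast
      have "a (\<eta> x) \<in> tuples U \<sigma>" if "x \<in> set (s # fl)" for x using \<eta>K a that sets(2) by blast
      then have "cat (\<lambda>x. a (\<eta> x)) (s # fl) @ e \<in> ext U (pow \<sigma> (length (s # fl)) @ \<epsilon>) (refam \<sigma> \<epsilon> (s # fl) ks \<psi>)"
        using ext_refam[OF ks' \<psi> is_struc_U, of "\<lambda>x. a (\<eta> x)" e] e t by blast
      then have "cat f (s # fl) @ e \<in> ext U (pow \<sigma> (length (s # fl)) @ \<epsilon>) (refam \<sigma> \<epsilon> (s # fl) ks \<psi>)"
        using tp fms_refam[OF ks' \<psi>] unfolding c1 c2 pw by blast
      then show ?thesis using ext_refam[OF ks' \<psi> is_struc_U, of f e] e f by blast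
    qed
    have cft: "cat f ks \<in> tuples U (pow \<sigma> (length ks))" for ks by (rule cat_tuples) (rule f)
    have cat: "cat (\<lambda>x. a (\<eta> x)) ks \<in> tuples U (pow \<sigma> (length ks))" if "set ks \<subseteq> F \<union> {s}" for ks
      by (rule cat_tuples) (use \<eta>K a that in blast)
    have "f s @ e \<in> ext U (\<sigma> @ \<epsilon>) (Neg \<phi>)"
      using key[of "[s]" "Neg \<phi>"] fms_Neg[OF \<phi>(1)] \<phi>(3) tuples_appendI[OF a[of c] e] by (simp add: \<eta>s ext_Neg)
    then have 1: "f s @ e \<notin> ext U (\<sigma> @ \<epsilon>) \<phi>" by (simp add: ext_Neg)
    have key': "cat f ks \<in> ext U (pow \<sigma> (length ks)) \<psi>"
      if ks: "set ks \<subseteq> F \<union> {s}" and \<psi>: "\<psi> \<in> fms L (pow \<sigma> (length ks))"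
        and t: "cat a (map \<eta> ks) \<in> ext U (pow \<sigma> (length ks)) \<psi>" for ks \<psi>
    proof -
      have "cat (\<lambda>x. a (\<eta> x)) ks \<in> ext U (pow \<sigma> (length ks)) \<psi>" using t by (simp add: comp_def)
      then have "cat (\<lambda>x. a (\<eta> x)) ks @ e \<in> ext U (pow \<sigma> (length ks) @ \<epsilon>) \<psi>" using ext_append[OF \<psi> cat[OF ks] e] by blast
      from key[OF ks fms_append[OF \<psi>] this] show ?thesis using ext_append[OF \<psi> cft e] by blast
    qed
    have "rind L U \<sigma> (F \<union> {s}) f" unfolding rind_def
    proof (intro allI impI, elim conjE)
      fix as bs \<alpha> assume as: "inc as" "set as \<subseteq> F \<union> {s}" and bs: "inc bs" "set bs \<subseteq> F \<union> {s}" and l: "length as = length bs"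
        and \<alpha>: "\<alpha> \<in> fms L (pow \<sigma> (length as))" and t: "cat f as \<in> ext U (pow \<sigma> (length as)) \<alpha>"
      have i: "increasing r (map \<eta> ks) \<and> set (map \<eta> ks) \<subseteq> I \<union> {c} \<union> J" if "inc ks" "set ks \<subseteq> F \<union> {s}" for ks
        using increasing_map[OF mono[unfolded sets(1)] that(2,1)] \<eta>K that(2) by auto
      have "cat a (map \<eta> as) @ [] \<in> ext U (pow \<sigma> (length (map \<eta> as)) @ []) \<alpha> \<longleftrightarrow> cat a (map \<eta> bs) @ [] \<in> ext U (pow \<sigma> (length (map \<eta> as)) @ []) \<alpha>"
        by (rule indiscD[OF ind]) (use i[OF as] i[OF bs] l \<alpha> in auto)
      then have eq: "cat a (map \<eta> as) \<in> ext U (pow \<sigma> (length as)) \<alpha> \<longleftrightarrow> cat a (map \<eta> bs) \<in> ext U (pow \<sigma> (length as)) \<alpha>" by simp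
      have "cat a (map \<eta> as) \<in> ext U (pow \<sigma> (length as)) \<alpha>"
      proof (rule ccontr)
        assume "cat a (map \<eta> as) \<notin> ext U (pow \<sigma> (length as)) \<alpha>"
        then have "cat a (map \<eta> as) \<in> ext U (pow \<sigma> (length as)) (Neg \<alpha>)" using cat[OF as(2)] by (simp add: ext_Neg comp_def)
        from key'[OF as(2) fms_Neg[OF \<alpha>] this] t show False by (simp add: ext_Neg)
      qed
      then show "cat f bs \<in> ext U (pow \<sigma> (length as)) \<alpha>" using key'[OF bs(2), of \<alpha>] \<alpha> eq l by simp
    qed
    with 1 show ?thesis by blast
  qed
  show ?thesis using f fF main by blast
qed

end

text \<open>Shattering of a fixed size is a matter of sentences, so the bound found in
  \<open>M\<close> holds in \<open>U\<close>.\<close>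

lemma (in shelah_monster) shatter_bound_U:
  assumes \<phi>: "\<phi> \<in> fms L (\<sigma> @ \<epsilon>)"
  shows "\<exists>n. \<not> shatters U \<sigma> \<epsilon> \<phi> n"
proof -
  from shatter_bound[OF \<phi>] obtain n where n: "\<not> shatters M \<sigma> \<epsilon> \<phi> n" by blast
  have "\<not> shatters U \<sigma> \<epsilon> \<phi> n"
  proof
    assume "shatters U \<sigma> \<epsilon> \<phi> n"
    then obtain w where w: "\<forall>k. w k \<in> tuples U \<sigma>" "\<forall>c \<in> (\<lambda>S. ([0..<n], spatt \<sigma> \<epsilon> n S \<phi>)) ` Pow {..<n}. famsat U \<sigma> [] [] w c"
      unfolding shatters_iff[OF \<phi> is_struc_U] by blast
    have "\<exists>g. (\<forall>i. g i \<in> tuples M \<sigma>) \<and> (\<forall>c \<in> (\<lambda>S. ([0..<n], spatt \<sigma> \<epsilon> n S \<phi>)) ` Pow {..<n}. famsat M \<sigma> [] [] g c)"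
      by (rule family_transfer[OF is_struc_U is_struc_M transfer_U_M _ _ w]) (auto simp: fms_spatt[OF \<phi>])
    with n show False unfolding shatters_iff[OF \<phi> is_struc_M] by blast
  qed
  then show ?thesis by blast
qed

context split_sequence
begin

text \<open>Compactness: finitely many conditions mention finitely many indices outside
  \<open>S0\<close>, and these form the set \<open>F\<close> of \<open>finite_split\<close>. Each
  instance of indiscernibility involves at most one point of \<open>S0\<close>, so the joint type of
  several of them is not prescribed.\<close>

lemma many_splits:
  fixes S0 :: "rat set"
  shows "\<exists>g. (\<forall>x. g x \<in> tuples U \<sigma>) \<and> (\<forall>x. g x @ e \<in> ext U (\<sigma> @ \<epsilon>) \<phi> \<longleftrightarrow> x \<notin> S0) \<and>
    (\<forall>s\<in>S0. rind L U \<sigma> (- S0 \<union> {s}) g)"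
proof -
  define Q where "Q = {(\<psi>, ks, ks'). \<psi> \<in> fms L (pow \<sigma> (length ks)) \<and> inc ks \<and> inc ks' \<and> length ks = length ks' \<and>
    (\<exists>s\<in>S0. set ks \<subseteq> - S0 \<union> {s} \<and> set ks' \<subseteq> - S0 \<union> {s})}"
  define im where "im = (\<lambda>(\<psi>, ks, ks'). impc \<sigma> \<epsilon> \<psi> ks ks' :: rat list \<times> ('s, 'f, 'p) fm)"
  define C where "C = (\<lambda>x. ([x], if x \<in> S0 then Neg \<phi> else \<phi>)) ` UNIV \<union> im ` Q"
  have C_cases: "(\<exists>x. c = ([x], if x \<in> S0 then Neg \<phi> else \<phi>)) \<or> (\<exists>\<psi> ks ks'. (\<psi>, ks, ks') \<in> Q \<and> c = impc \<sigma> \<epsilon> \<psi> ks ks')" if "c \<in> C" for c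
    using that unfolding C_def im_def by force
  have C: "\<forall>(is, \<theta>) \<in> C. \<theta> \<in> fms L (pow \<sigma> (length is) @ \<epsilon>)"
  proof clarify
    fix "is" \<theta> assume "(is, \<theta>) \<in> C"
    from C_cases[OF this] consider x where "(is, \<theta>) = ([x], if x \<in> S0 then Neg \<phi> else \<phi>)"
      | \<psi> ks ks' where "(\<psi>, ks, ks') \<in> Q" "(is, \<theta>) = impc \<sigma> \<epsilon> \<psi> ks ks'" by blast
    then show "\<theta> \<in> fms L (pow \<sigma> (length is) @ \<epsilon>)"
    proof cases
      case 1
      then show ?thesis using \<phi>(1) fms_Neg[OF \<phi>(1)] by (simp split: if_splits)
    next
      case 2
      then have q: "\<psi> \<in> fms L (pow \<sigma> (length ks))" "length ks = length ks'" by (auto simp: Q_def)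
      show ?thesis by (rule fms_impc[OF fms_append[OF q(1)] q(2) 2(2)[symmetric]])
    qed
  qed
  have f1: "famsat U \<sigma> \<epsilon> e f ([x], if x \<in> S0 then Neg \<phi> else \<phi>) \<longleftrightarrow> (f x @ e \<in> ext U (\<sigma> @ \<epsilon>) \<phi> \<longleftrightarrow> x \<notin> S0)"
    if "\<forall>x. f x \<in> tuples U \<sigma>" for f x
    using that tuples_appendI[OF _ e, of "f x" \<sigma>] by (auto simp: famsat_def ext_Neg)
  have f2: "famsat U \<sigma> \<epsilon> e f (impc \<sigma> \<epsilon> \<psi> ks ks') \<longleftrightarrow>
      (cat f ks \<in> ext U (pow \<sigma> (length ks)) \<psi> \<longrightarrow> cat f ks' \<in> ext U (pow \<sigma> (length ks)) \<psi>)"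
    if f: "\<forall>x. f x \<in> tuples U \<sigma>" and Q: "(\<psi>, ks, ks') \<in> Q" for f \<psi> ks ks'
  proof -
    have q: "\<psi> \<in> fms L (pow \<sigma> (length ks))" "length ks = length ks'" "\<psi> \<in> fms L (pow \<sigma> (length ks'))"
      using Q by (auto simp: Q_def)
    have t: "cat f ls \<in> tuples U (pow \<sigma> (length ls))" for ls by (rule cat_tuples) (use f in blast)
    show ?thesis using famsat_impc[OF fms_append[OF q(1)] q(2) is_struc_U e, of f] f ext_append[OF q(1) t e] ext_append[OF q(3) t e]
      unfolding q(2) by blast
  qed
  have "\<exists>f. (\<forall>x. f x \<in> tuples U \<sigma>) \<and> (\<forall>c\<in>B. famsat U \<sigma> \<epsilon> e f c)" if B: "B \<subseteq> C" "finite B" for B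
  proof -
    define F where "F = (\<Union>c\<in>B. set (fst c)) - S0"
    have F: "finite F" "F \<inter> S0 = {}" using B(2) by (auto simp: F_def)
    from finite_split[OF F] obtain f where f: "\<forall>x. f x \<in> tuples U \<sigma>" "\<forall>x\<in>F. f x @ e \<in> ext U (\<sigma> @ \<epsilon>) \<phi>"
      "\<forall>s\<in>S0. f s @ e \<notin> ext U (\<sigma> @ \<epsilon>) \<phi> \<and> rind L U \<sigma> (F \<union> {s}) f" by (elim exE conjE)
    have "famsat U \<sigma> \<epsilon> e f c" if c: "c \<in> B" for c
    proof -
      from C_cases[of c] c B(1) consider x where "c = ([x], if x \<in> S0 then Neg \<phi> else \<phi>)"
        | \<psi> ks ks' where "(\<psi>, ks, ks') \<in> Q" "c = impc \<sigma> \<epsilon> \<psi> ks ks'" by blast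
      then show ?thesis
      proof cases
        case 1
        have "x \<in> F" if "x \<notin> S0" using c that unfolding F_def 1 by force
        then show ?thesis unfolding 1 f1[OF f(1)] using f(2,3) by blast
      next
        case 2
        then obtain s where s: "s \<in> S0" "set ks \<subseteq> - S0 \<union> {s}" "set ks' \<subseteq> - S0 \<union> {s}" by (auto simp: Q_def)
        have "set ks \<union> set ks' = set (fst c)" by (simp add: 2 impc_def)
        then have "set ks \<subseteq> F \<union> {s}" "set ks' \<subseteq> F \<union> {s}" using s c unfolding F_def by blast+
        moreover have "rind L U \<sigma> (F \<union> {s}) f" using f(3) s(1) by blast
        ultimately show ?thesis unfolding 2(2) f2[OF f(1) 2(1)] using 2(1) unfolding rind_def Q_def by blast
      qed
    qed
    with f(1) show ?thesis by blast
  qed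
  then have "\<forall>B. B \<subseteq> C \<longrightarrow> finite B \<longrightarrow> (\<exists>f. (\<forall>x. f x \<in> tuples U \<sigma>) \<and> (\<forall>c\<in>B. famsat U \<sigma> \<epsilon> e f c))" by blast
  from realize_family[OF monsterD(4)[OF monster_U] is_struc_U monsterD(1,2)[OF monster_U] e C this]
  obtain g where g: "\<forall>x. g x \<in> tuples U \<sigma>" "\<forall>c\<in>C. famsat U \<sigma> \<epsilon> e g c" by (elim exE conjE)
  have "g x @ e \<in> ext U (\<sigma> @ \<epsilon>) \<phi> \<longleftrightarrow> x \<notin> S0" for x
    using g(2) f1[OF g(1), of x] unfolding C_def by blast
  moreover have "rind L U \<sigma> (- S0 \<union> {s}) g" if "s \<in> S0" for s
    unfolding rind_def
  proof (intro allI impI)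
    fix as bs \<psi> assume *: "inc as \<and> inc bs \<and> set as \<subseteq> - S0 \<union> {s} \<and> set bs \<subseteq> - S0 \<union> {s} \<and> length as = length bs \<and> \<psi> \<in> fms L (pow \<sigma> (length as))"
      "cat g as \<in> ext U (pow \<sigma> (length as)) \<psi>"
    then have Q: "(\<psi>, as, bs) \<in> Q" using that by (auto simp: Q_def)
    then have "impc \<sigma> \<epsilon> \<psi> as bs \<in> C" unfolding C_def im_def by force
    then have "famsat U \<sigma> \<epsilon> e g (impc \<sigma> \<epsilon> \<psi> as bs)" using g(2) by blast
    then show "cat g bs \<in> ext U (pow \<sigma> (length as)) \<psi>" using f2[OF g(1) Q] *(2) by blast
  qed
  ultimately show ?thesis using g(1) by blast
qed

text \<open>The points of \<open>S0\<close> are restored one by one, each step being an instance of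
  \<open>rind_union\<close> with two of them as \<open>p\<close> and \<open>q\<close>. In the
  resulting indiscernible sequence \<open>\<phi>\<close> at \<open>e\<close> still fails exactly on
  \<open>S0\<close>, and moving points of \<open>S0\<close> slightly aside produces every
  pattern.\<close>

lemma contradiction: False
proof -
  from shatter_bound_U[OF \<phi>(1)] obtain N where N: "\<not> shatters U \<sigma> \<epsilon> \<phi> N" by blast
  \<comment> \<open>The bound \<open>N\<close> is included so that \<open>S0\<close> is nonempty
    even for \<open>N = 0\<close>; the induction below starts with one restored point.\<close>
  define S0 :: "rat set" where "S0 = of_nat ` {..N}"
  have S0: "finite S0" "S0 \<noteq> {}" by (auto simp: S0_def)
  from many_splits[of S0] obtain g where g: "\<forall>x. g x \<in> tuples U \<sigma>" "\<forall>x. g x @ e \<in> ext U (\<sigma> @ \<epsilon>) \<phi> \<longleftrightarrow> x \<notin> S0"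
    "\<forall>s\<in>S0. rind L U \<sigma> (- S0 \<union> {s}) g" by (elim exE conjE)
  have all: "rind L U \<sigma> (- S0 \<union> V) g" if "V \<subseteq> S0" "card V = Suc n" for V n
    using that
  proof (induction n arbitrary: V)
    case 0
    then obtain s where "V = {s}" by (auto simp: card_1_singleton_iff)
    then show ?case using g(3) 0 by simp
  next
    case (Suc n)
    obtain p V1 where p: "V = insert p V1" "p \<notin> V1" "card V1 = Suc n" using card_Suc_eq[THEN iffD1, OF Suc.prems(2)] by blast
    obtain q V2 where q: "V1 = insert q V2" "q \<notin> V2" using card_Suc_eq[THEN iffD1, OF p(3)] by blast
    have minus: "- S0 \<union> V - {x} = - S0 \<union> (V - {x})" if "x \<in> V" for x using that Suc.prems(1) by blast
    have d: "rind L U \<sigma> (- S0 \<union> V - {x}) g" if "x \<in> V" for x unfolding minus[OF that]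
      by (rule Suc.IH) (use Suc.prems that in auto)
    have fin: "finite (- (- S0 \<union> V))" using S0(1) by simp
    have "rind L U \<sigma> (- S0 \<union> V) g" if "x \<in> V" "y \<in> V" "x < y" for x y
      by (rule rind_union[OF g(1) fin _ _ that(3) d d]) (use that in auto)
    moreover have "p \<noteq> q" "p \<in> V" "q \<in> V" using p q by auto
    ultimately show ?case using linorder_less_linear by blast
  qed
  have "card S0 = Suc (card S0 - 1)" using S0 by (simp add: card_gt_0_iff)
  from all[OF subset_refl this] have R: "rind L U \<sigma> UNIV g" by (simp add: Compl_partition2)
  \<comment> \<open>Half-integers are not in \<open>S0\<close>, so \<open>\<phi>\<close> at
    \<open>e\<close> holds at the \<open>k\<close>-th entry exactly if \<open>k\<close> is in
    \<open>P\<close>.\<close>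
  define xs where "xs P = map (\<lambda>k. (of_nat k :: rat) + (if k \<in> P then 1 / 2 else 0)) [0..<N]" for P
  have xs: "inc (xs P)" "length (xs P) = N" for P
  proof -
    have "inc (map (\<lambda>k. (of_nat k :: rat) + (if k \<in> P then 1 / 2 else 0)) [0..<N])"
    proof (rule inc_map[of UNIV])
      have "(of_nat k :: rat) + (if k \<in> P then 1 / 2 else 0) < of_nat l + (if l \<in> P then 1 / 2 else 0)" if "k < l" for k l
      proof -
        have "(of_nat (Suc k) :: rat) \<le> of_nat l" using that by (intro of_nat_mono) simp
        then show ?thesis by simp
      qed
      then show "strict_mono_on UNIV (\<lambda>k. (of_nat k :: rat) + (if k \<in> P then 1 / 2 else 0))" by (simp add: strict_mono_on_def)
    qed (auto simp: strict_sorted_iff)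
    then show "inc (xs P)" "length (xs P) = N" by (simp_all add: xs_def)
  qed
  have half: "(of_nat k :: rat) + 1 / 2 \<notin> S0" for k
  proof
    assume "(of_nat k :: rat) + 1 / 2 \<in> S0"
    then obtain m :: nat where "(of_nat k :: rat) + 1 / 2 = of_nat m" by (auto simp: S0_def)
    then have "(of_nat (2 * k + 1) :: rat) = of_nat (2 * m)" by simp
    then have "2 * k + 1 = 2 * m" using of_nat_eq_iff by blast
    then show False by presburger
  qed
  have g': "\<And>P k. g (of_nat k + (if k \<in> P then 1 / 2 else 0)) \<in> tuples U \<sigma>" using g(1) by blast
  have c: "cat (\<lambda>k. g (of_nat k + (if k \<in> P then 1 / 2 else 0))) [0..<N] = cat g (xs P)" for P
    by (simp add: xs_def comp_def)
  have "\<exists>z\<in>tuples U \<epsilon>. \<forall>k<N. g (of_nat k) @ z \<in> ext U (\<sigma> @ \<epsilon>) \<phi> \<longleftrightarrow> k \<in> P" if P: "P \<subseteq> {..<N}" for P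
  proof -
    have "g (of_nat k + (if k \<in> P then 1 / 2 else 0)) @ e \<in> ext U (\<sigma> @ \<epsilon>) \<phi> \<longleftrightarrow> k \<in> P" if "k < N" for k
      using g(2) half[of k] that by (auto simp: S0_def)
    then have "cat g (xs P) \<in> ext U (pow \<sigma> N) (spatt \<sigma> \<epsilon> N P \<phi>)"
      using ext_spatt[OF \<phi>(1) is_struc_U, of "\<lambda>k. g (of_nat k + (if k \<in> P then 1 / 2 else 0))" N P, OF g'] e unfolding c by blast
    \<comment> \<open>That pattern \<open>P\<close> has a witness is a property of the tuple without
      parameters, so it passes from \<open>xs P\<close> to the unmoved tuple
      \<open>xs {}\<close>.\<close>
    then have "cat g (xs {}) \<in> ext U (pow \<sigma> N) (spatt \<sigma> \<epsilon> N P \<phi>)"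
      using rind_iff[OF R xs(1) xs(1), of P "{}"] xs(2) fms_spatt[OF \<phi>(1)] by simp
    then have "\<exists>z\<in>tuples U \<epsilon>. \<forall>k<N. g (of_nat k + (if k \<in> {} then 1 / 2 else 0)) @ z \<in> ext U (\<sigma> @ \<epsilon>) \<phi> \<longleftrightarrow> k \<in> P"
      using ext_spatt[OF \<phi>(1) is_struc_U, of "\<lambda>k. g (of_nat k + (if k \<in> {} then 1 / 2 else 0))" N P, OF g'] unfolding c by blast
    then show ?thesis by simp
  qed
  then have "shatters U \<sigma> \<epsilon> \<phi> N" unfolding shatters_def using g(1) by (intro exI[of _ "\<lambda>k. g (of_nat k)"]) blast
  with N show False ..
qed

end

subsection \<open>Distality of the reduct\<close>

lemma ex_increasing:
  assumes "trans r" "antisym r" "X \<noteq> {}" "\<forall>x\<in>X. \<exists>y\<in>X. (x, y) \<in> r \<and> x \<noteq> y"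
  shows "\<exists>zs. set zs \<subseteq> X \<and> increasing r zs \<and> length zs = n"
proof -
  have "\<exists>zs z. set (zs @ [z]) \<subseteq> X \<and> increasing r (zs @ [z]) \<and> length zs = n"
  proof (induction n)
    case 0
    then show ?case using assms(3) by (auto simp: increasing_def)
  next
    case (Suc n)
    then obtain zs z where z: "set (zs @ [z]) \<subseteq> X" "increasing r (zs @ [z])" "length zs = n" by blast
    from assms(4) z(1) obtain y where y: "y \<in> X" "(z, y) \<in> r" "z \<noteq> y" by auto
    have "(x, y) \<in> r \<and> x \<noteq> y" if "x \<in> set (zs @ [z])" for x
    proof (cases "x = z")
      case False
      then have "(x, z) \<in> r" using that z(2) by (auto simp: increasing_def sorted_wrt_append)
      then show ?thesis using y transD[OF assms(1)] antisymD[OF assms(2)] by metis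
    qed (use y in auto)
    then have "increasing r ((zs @ [z]) @ [y])"
      using z(2) unfolding increasing_def by (auto simp: sorted_wrt_append)
    then show ?case using z y(1) by (intro exI[of _ "zs @ [z]"] exI[of _ y]) auto
  qed
  then obtain zs z where "set (zs @ [z]) \<subseteq> X" "increasing r (zs @ [z])" "length zs = n" by blast
  then show ?thesis by (intro exI[of _ zs]) (auto simp: increasing_def sorted_wrt_append)
qed

lemma increasing_rev: "increasing r (rev zs) \<longleftrightarrow> increasing (r\<inverse>) zs"
  unfolding increasing_def sorted_wrt_rev by (rule arg_cong[where f = "\<lambda>P. sorted_wrt P zs"]) auto

lemma ex_increasing_down:
  assumes "trans r" "antisym r" "X \<noteq> {}" "\<forall>x\<in>X. \<exists>y\<in>X. (y, x) \<in> r \<and> y \<noteq> x"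
  shows "\<exists>zs. set zs \<subseteq> X \<and> increasing r zs \<and> length zs = n"
proof -
  have "\<exists>zs. set zs \<subseteq> X \<and> increasing (r\<inverse>) zs \<and> length zs = n"
    by (rule ex_increasing) (use assms in \<open>auto simp: antisym_def\<close>)
  then obtain zs where "set zs \<subseteq> X" "increasing (r\<inverse>) zs" "length zs = n" by blast
  then show ?thesis by (intro exI[of _ "rev zs"]) (simp add: increasing_rev)
qed

text \<open>A failure of indiscernibility over \<open>D\<close> gives a formula that is constant on
  increasing tuples of \<open>I + J\<close> but changes at some tuple through \<open>c\<close>. The
  other entries of this tuple become parameters, and \<open>I\<close> and \<open>J\<close> are cut
  down to the parts that lie nearer to \<open>c\<close> than those entries; this is a
  \<open>split_sequence\<close>.\<close>

lemma (in shelah_monster) distal_U: "distal L T \<kappa> U"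
  unfolding distal_def
proof (intro conjI allI impI monster_U NIP_if_bound, rule shatter_bound_U, assumption, elim conjE, rule ccontr)
  fix I J :: "'l set" and c r \<sigma> a D
  let ?K = "I \<union> {c} \<union> J"
  assume cIJ: "c \<notin> I \<union> J" "I \<inter> J = {}" and lin: "linear_order_on ?K r"
    and Ic: "\<forall>i\<in>I. (i, c) \<in> r" and cJ: "\<forall>j\<in>J. (c, j) \<in> r"
    and inf: "infinite I" "infinite J" and we: "without_endpoints r I" "without_endpoints r J"
    and "indiscernible L U {} \<sigma> r ?K a" "indiscernible L U D \<sigma> r (I \<union> J) a" "\<not> indiscernible L U D \<sigma> r ?K a"
  then have ind: "indisc L U {} \<sigma> r ?K a" and indD: "indisc L U D \<sigma> r (I \<union> J) a" and no: "\<not> indisc L U D \<sigma> r ?K a"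
    by (simp_all only: indiscernible_iff not_False_eq_True)
  define lt where "lt x y \<longleftrightarrow> (x, y) \<in> r \<and> x \<noteq> y" for x y
  have inc_lt: "increasing r xs \<longleftrightarrow> sorted_wrt lt xs" for xs by (simp add: increasing_def lt_def[abs_def])
  have tr: "trans r" and as: "antisym r" using lin by (auto simp: order_on_defs)
  have lt_trans: "lt x z" if "lt x y" "lt y z" for x y z
    using that transD[OF tr] antisymD[OF as] unfolding lt_def by metis
  have ltI: "lt i c" if "i \<in> I" for i using Ic cIJ that by (auto simp: lt_def)
  have ltJ: "lt c j" if "j \<in> J" for j using cJ cIJ that by (auto simp: lt_def)
  have ltIJ: "lt i j" if "i \<in> I" "j \<in> J" for i j using lt_trans[OF ltI ltJ] that by blast
  have nlt: "\<not> lt y x" if "lt x y" for x y using that antisymD[OF as] unfolding lt_def by blast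
  have I_up: "\<forall>x\<in>I. \<exists>y\<in>I. (x, y) \<in> r \<and> x \<noteq> y" and J_down: "\<forall>x\<in>J. \<exists>y\<in>J. (y, x) \<in> r \<and> y \<noteq> x"
    using we unfolding without_endpoints_def by metis+
  have a: "a i \<in> tuples U \<sigma>" if "i \<in> ?K" for i using ind that by (auto simp: indisc_def)
  from no obtain n \<tau> \<phi> e "is" js where \<phi>: "\<phi> \<in> fms L (pow \<sigma> n @ \<tau>)" and e: "e \<in> tuples U \<tau>" "set e \<subseteq> D"
    and "is": "set is \<subseteq> ?K" "increasing r is" "length is = n" and js: "set js \<subseteq> ?K" "increasing r js" "length js = n"
    and ne: "(cat a is @ e \<in> ext U (pow \<sigma> n @ \<tau>) \<phi>) \<noteq> (cat a js @ e \<in> ext U (pow \<sigma> n @ \<tau>) \<phi>)"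
    using a unfolding indisc_def by metis
  have "I \<noteq> {}" "J \<noteq> {}" using inf by auto
  from ex_increasing[OF tr as this(1) I_up] obtain ks where ks: "set ks \<subseteq> I" "increasing r ks" "length ks = n" by blast
  \<comment> \<open>At least one of the two differing tuples disagrees with the reference tuple
    \<open>ks\<close> in \<open>I\<close>; that one must contain \<open>c\<close>.\<close>
  obtain ls where ls: "set ls \<subseteq> ?K" "increasing r ls" "length ls = n"
    and ne: "(cat a ls @ e \<in> ext U (pow \<sigma> n @ \<tau>) \<phi>) \<noteq> (cat a ks @ e \<in> ext U (pow \<sigma> n @ \<tau>) \<phi>)"
    using ne "is" js by metis
  have same: "cat a xs @ e \<in> ext U (pow \<sigma> n @ \<tau>) \<phi> \<longleftrightarrow> cat a ks @ e \<in> ext U (pow \<sigma> n @ \<tau>) \<phi>"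
    if "set xs \<subseteq> I \<union> J" "increasing r xs" "length xs = n" for xs
    using indiscD[OF indD, of \<phi> ks \<tau> e xs] \<phi> e ks that by blast
  have "c \<in> set ls"
  proof (rule ccontr)
    assume "c \<notin> set ls"
    then have "set ls \<subseteq> I \<union> J" using ls(1) by blast
    from same[OF this ls(2,3)] ne show False by blast
  qed
  from split_list[OF this] obtain l m where l_m: "ls = l @ c # m" by blast
  have srt: "sorted_wrt lt l" "sorted_wrt lt m" "\<forall>x\<in>set l. lt x c" "\<forall>x\<in>set m. lt c x" "\<forall>x\<in>set l. \<forall>y\<in>set m. lt x y"
    using ls(2) unfolding inc_lt l_m by (auto simp: sorted_wrt_append)
  have nc: "\<not> lt c c" by (simp add: lt_def)
  have lI: "set l \<subseteq> I"
  proof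
    fix x assume "x \<in> set l"
    then have "x \<in> ?K" "lt x c" using ls(1) srt(3) unfolding l_m by auto
    then show "x \<in> I" using ltJ nlt nc by blast
  qed
  have mJ: "set m \<subseteq> J"
  proof
    fix x assume "x \<in> set m"
    then have "x \<in> ?K" "lt c x" using ls(1) srt(4) unfolding l_m by auto
    then show "x \<in> J" using ltI nlt nc by blast
  qed
  define I' where "I' = {i \<in> I. \<forall>x\<in>set l. lt x i}"
  define J' where "J' = {j \<in> J. \<forall>x\<in>set m. lt j x}"
  have "I' \<noteq> {}"
  proof (cases l rule: rev_cases)
    case Nil
    then show ?thesis using \<open>I \<noteq> {}\<close> by (auto simp: I'_def)
  next
    case (snoc l' x)
    with I_up lI obtain i where i: "i \<in> I" "lt x i" by (auto simp: lt_def)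
    then have "\<forall>y\<in>set l. lt y i" using srt(1) lt_trans unfolding snoc by (auto simp: sorted_wrt_append)
    then show ?thesis using i(1) by (auto simp: I'_def)
  qed
  moreover have "\<forall>x\<in>I'. \<exists>y\<in>I'. (x, y) \<in> r \<and> x \<noteq> y"
  proof
    fix x assume x: "x \<in> I'"
    with I_up obtain y where y: "y \<in> I" "lt x y" by (auto simp: I'_def lt_def)
    then have "y \<in> I'" using x lt_trans unfolding I'_def by blast
    then show "\<exists>y\<in>I'. (x, y) \<in> r \<and> x \<noteq> y" using y(2) by (auto simp: lt_def)
  qed
  ultimately have long_I: "\<exists>zs. set zs \<subseteq> I' \<and> increasing r zs \<and> length zs = k" for k by (rule ex_increasing[OF tr as])
  have "J' \<noteq> {}"
  proof (cases m)
    case Nil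
    then show ?thesis using \<open>J \<noteq> {}\<close> by (auto simp: J'_def)
  next
    case (Cons x m')
    with J_down mJ obtain j where j: "j \<in> J" "lt j x" by (auto simp: lt_def)
    then have "\<forall>y\<in>set m. lt j y" using srt(2) lt_trans unfolding Cons by auto
    then show ?thesis using j(1) by (auto simp: J'_def)
  qed
  moreover have "\<forall>x\<in>J'. \<exists>y\<in>J'. (y, x) \<in> r \<and> y \<noteq> x"
  proof
    fix x assume x: "x \<in> J'"
    with J_down obtain y where y: "y \<in> J" "lt y x" by (auto simp: J'_def lt_def)
    then have "y \<in> J'" using x lt_trans unfolding J'_def by blast
    then show "\<exists>y\<in>J'. (y, x) \<in> r \<and> y \<noteq> x" using y(2) by (auto simp: lt_def)
  qed
  ultimately have long_J: "\<exists>zs. set zs \<subseteq> J' \<and> increasing r zs \<and> length zs = k" for k by (rule ex_increasing_down[OF tr as])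
  \<comment> \<open>The sign is chosen so that \<open>\<phi>1\<close> holds on all increasing tuples
    of \<open>I + J\<close> and fails at \<open>ls\<close>.\<close>
  define \<phi>1 where "\<phi>1 = (if cat a ks @ e \<in> ext U (pow \<sigma> n @ \<tau>) \<phi> then \<phi> else Neg \<phi>)"
  have \<phi>1: "\<phi>1 \<in> fms L (pow \<sigma> n @ \<tau>)" using \<phi> fms_Neg[OF \<phi>] by (simp add: \<phi>1_def)
  have t: "cat a xs \<in> tuples U (pow \<sigma> (length xs))" if "set xs \<subseteq> ?K" for xs by (rule cat_tuples) (use that a in blast)
  have te: "cat a xs @ e \<in> tuples U (pow \<sigma> n @ \<tau>)" if "set xs \<subseteq> ?K" "length xs = n" for xs
    using tuples_appendI[OF t[OF that(1)] e(1)] that(2) by simp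
  have ls1: "cat a ls @ e \<notin> ext U (pow \<sigma> n @ \<tau>) \<phi>1" using ne by (auto simp: \<phi>1_def ext_Neg)
  have same1: "cat a xs @ e \<in> ext U (pow \<sigma> n @ \<tau>) \<phi>1" if "set xs \<subseteq> I \<union> J" "increasing r xs" "length xs = n" for xs
    using same[OF that] te[of xs] that by (auto simp: \<phi>1_def ext_Neg)
  let ?L = "pow \<sigma> (length l)" and ?R = "pow \<sigma> (length m) @ \<tau>" and ?e = "cat a l @ cat a m @ e"
  have tl: "cat a l \<in> tuples U ?L" and tm: "cat a m \<in> tuples U (pow \<sigma> (length m))" using t[of l] t[of m] lI mJ by auto
  have tR: "cat a m @ e \<in> tuples U ?R" by (rule tuples_appendI[OF tm e(1)])
  have n: "n = length l + (1 + length m)" using ls(3) by (simp add: l_m)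
  have mid: "increasing r (l @ xs @ m)" "set (l @ xs @ m) \<subseteq> I \<union> J" if "set xs \<subseteq> I' \<union> J'" "increasing r xs" for xs
  proof -
    have "lt x y" if "x \<in> set l" "y \<in> I' \<union> J'" for x y using that lI ltIJ by (auto simp: I'_def J'_def)
    moreover have "lt x y" if "x \<in> I' \<union> J'" "y \<in> set m" for x y using that mJ ltIJ by (auto simp: I'_def J'_def)
    ultimately show "increasing r (l @ xs @ m)" using srt that unfolding inc_lt by (auto simp: sorted_wrt_append)
    show "set (l @ xs @ m) \<subseteq> I \<union> J" using that lI mJ by (auto simp: I'_def J'_def)
  qed
  have pw1: "pow \<sigma> n @ \<tau> = ?L @ \<sigma> @ ?R" unfolding n pow_add by simp
  have "\<phi>1 \<in> fms L (?L @ \<sigma> @ ?R)" using \<phi>1 unfolding pw1 .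
  then obtain \<phi>' where \<phi>': "\<phi>' \<in> fms L (\<sigma> @ ?L @ ?R)" and sw: "\<And>x y z. x \<in> tuples U ?L \<Longrightarrow> y \<in> tuples U \<sigma> \<Longrightarrow> z \<in> tuples U ?R \<Longrightarrow>
      y @ x @ z \<in> ext U (\<sigma> @ ?L @ ?R) \<phi>' \<longleftrightarrow> x @ y @ z \<in> ext U (?L @ \<sigma> @ ?R) \<phi>1"
    using block_swap2[where 'a = 'u] is_struc_U by metis
  have sw': "a i @ ?e \<in> ext U (\<sigma> @ ?L @ ?R) \<phi>' \<longleftrightarrow> cat a (l @ i # m) @ e \<in> ext U (pow \<sigma> n @ \<tau>) \<phi>1" if "i \<in> ?K" for i
    using sw[OF tl a[OF that] tR] unfolding pw1 by simp
  interpret split_sequence L M M' \<kappa>1 U1 T \<kappa> U I' J' c r a \<sigma> "?L @ ?R" ?e \<phi>'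
  proof unfold_locales
    show "\<exists>zs. set zs \<subseteq> I' \<and> increasing r zs \<and> length zs = k" "\<exists>zs. set zs \<subseteq> J' \<and> increasing r zs \<and> length zs = k" for k
      by (fact long_I, fact long_J)
    show "increasing r (zs @ c # ws)" if "set zs \<subseteq> I'" "increasing r zs" "set ws \<subseteq> J'" "increasing r ws" for zs ws
    proof -
      have "set zs \<subseteq> I" "set ws \<subseteq> J" using that by (auto simp: I'_def J'_def)
      then show ?thesis using that ltI ltJ ltIJ unfolding inc_lt by (auto simp: sorted_wrt_append subset_iff)
    qed
    show "indisc L U {} \<sigma> r (I' \<union> {c} \<union> J') a" by (rule indisc_subset[OF ind]) (auto simp: I'_def J'_def)
    show "?e \<in> tuples U (?L @ ?R)" by (intro tuples_appendI tl tR)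
    show "\<phi>' \<in> fms L (\<sigma> @ ?L @ ?R)" by (fact \<phi>')
    show "a c @ ?e \<notin> ext U (\<sigma> @ ?L @ ?R) \<phi>'" using sw'[of c] ls1 unfolding l_m by simp
    show "a i @ ?e \<in> ext U (\<sigma> @ ?L @ ?R) \<phi>'" if "i \<in> I' \<union> J'" for i
    proof -
      have "increasing r [i]" by (simp add: increasing_def)
      then have "cat a (l @ [i] @ m) @ e \<in> ext U (pow \<sigma> n @ \<tau>) \<phi>1"
        using same1[OF mid(2,1)[of "[i]"]] that by (simp add: n)
      then show ?thesis using sw'[of i] that by (auto simp: I'_def J'_def)
    qed
    show "cat a js @ ?e \<in> ext U (pow \<sigma> (length is) @ ?L @ ?R) \<theta>"
      if "is": "set is \<subseteq> I' \<union> J'" and js: "set js \<subseteq> I' \<union> J'" and inc: "increasing r is" "increasing r js" and l: "length is = length js"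
        and \<theta>: "\<theta> \<in> fms L (pow \<sigma> (length is) @ ?L @ ?R)" and h: "cat a is @ ?e \<in> ext U (pow \<sigma> (length is) @ ?L @ ?R) \<theta>"
      for "is" js \<theta>
    proof -
      let ?k = "length is"
      \<comment> \<open>In the order \<open>l\<close> precedes \<open>is\<close>, but as a parameter
        it comes after it. Exchanging the two blocks makes the whole tuple increasing, so that
        indiscernibility over \<open>D\<close> applies.\<close>
      from \<theta> obtain \<theta>' where \<theta>': "\<theta>' \<in> fms L (?L @ pow \<sigma> ?k @ ?R)" and sw: "\<And>x y z. x \<in> tuples U (pow \<sigma> ?k) \<Longrightarrow>
          y \<in> tuples U ?L \<Longrightarrow> z \<in> tuples U ?R \<Longrightarrow>
          y @ x @ z \<in> ext U (?L @ pow \<sigma> ?k @ ?R) \<theta>' \<longleftrightarrow> x @ y @ z \<in> ext U (pow \<sigma> ?k @ ?L @ ?R) \<theta>"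
        using block_swap2[where 'a = 'u] is_struc_U by metis
      have K: "set is \<subseteq> ?K" "set js \<subseteq> ?K" using "is" js by (auto simp: I'_def J'_def)
      have tt: "cat a is \<in> tuples U (pow \<sigma> ?k)" "cat a js \<in> tuples U (pow \<sigma> ?k)" using t[OF K(1)] t[OF K(2)] l by simp_all
      have "cat a (l @ is @ m) @ e \<in> ext U (pow \<sigma> (length (l @ is @ m)) @ \<tau>) \<theta>' \<longleftrightarrow>
          cat a (l @ js @ m) @ e \<in> ext U (pow \<sigma> (length (l @ is @ m)) @ \<tau>) \<theta>'"
        by (rule indiscD[OF indD _ e mid(2)[OF "is" inc(1)] mid(1)[OF "is" inc(1)] mid(2)[OF js inc(2)] mid(1)[OF js inc(2)]])
          (use \<theta>' l in \<open>simp_all add: pow_add\<close>)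
      then show ?thesis using sw[OF tt(1) tl tR] sw[OF tt(2) tl tR] h by (simp add: pow_add)
    qed
  qed
  show False by (rule contradiction)
qed

theorem theorem1p1:
  fixes L :: "('s, 'f, 'p) lang"
    and T :: "('s, 'f, 'p) fm set"
    and M M' :: "('s, 'f, 'p, 'a) struc"
    and \<kappa>\<^sub>1 :: "'k rel" and U\<^sub>1 :: "('s, unit, 's list \<times> 'a list set, 'v) struc"
    and \<kappa> :: "'l rel" and U :: "('s, 'f, 'p, 'u) struc"
  assumes "complete_theory L T"
    and "models L M T"
    and "elem_sub L M M'"
    and "saturated L (cardSuc ( |univ M| +c |formulas L| )) M'"
    and "distal (shelah_lang L M M') (Th (shelah_lang L M M') (shelah_expansion M)) \<kappa>\<^sub>1 U\<^sub>1"
    and "monster L T \<kappa> U"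
  shows "distal L T \<kappa> U"
proof -
  interpret shelah_monster L M M' \<kappa>\<^sub>1 U\<^sub>1 T \<kappa> U by unfold_locales (fact assms)+
  show ?thesis by (rule distal_U)
qed

end
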